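(* Let $Q=\mathbb{Q}(\sqrt{a},\sqrt{b})$ be a biquadratic field such that $\mathscr{F}_4(Q)\neq\emptyset$. For every sufficiently small $0<\varepsilon<\tfrac14$ and every integer $\ell\ge1$ there is a constant $B_1=B_1(\ell,\varepsilon)$ (with $Q$ fixed) such that for every $X\ge1$, all fields $K\in\mathscr{F}_4(Q;X)$ except at most $B_1X^{\varepsilon}$ of them satisfy $$|\mathrm{Cl}_K[\ell]|\ll_{\ell,\varepsilon} D_K^{\frac12-\frac{1}{6\ell}+\varepsilon}.$$
   Context: Fix an algebraic closure $\overline{\mathbb{Q}}$; all number fields lie in it, and $\widetilde{K}$ denotes the Galois closure of $K$ over $\mathbb{Q}$. $D_K=|\mathrm{disc}(K/\mathbb{Q})|$. A $D_4$-quartic field is a degree-4 field $K$ with $\mathrm{Gal}(\widetilde K/\mathbb{Q})\cong D_4$ (dihedral of order 8). $a,b$ are distinct squarefree integers, not $0$ or $1$, and $Q=\mathbb{Q}(\sqrt a,\sqrt b)$ is biquadratic. $\mathscr{F}_4(Q)$ is the set of $D_4$-quartic fields $K$ with $Q\subseteq\widetilde K$, and $\mathscr{F}_4(Q;X)=\{K\in\mathscr{F}_4(Q):D_K\le X\}$. $\mathrm{Cl}_K[\ell]=\{[\mathfrak a]\in\mathrm{Cl}_K:[\mathfrak a]^\ell=1\}$ is the $\ell$-torsion of the ideal class group. *)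

theory Defs
  imports Complex_Main "HOL-Algebra.Group" "HOL-Computational_Algebra.Polynomial"
    "HOL-Computational_Algebra.Squarefree" "Jordan_Normal_Form.Determinant"
begin

text \<open>All number fields are subfields of the complex numbers (which contain an
algebraic closure of the rationals).\<close>

definition subfield_C :: "complex set \<Rightarrow> bool" where
  "subfield_C F \<longleftrightarrow> 0 \<in> F \<and> 1 \<in> F \<and>
     (\<forall>x\<in>F. \<forall>y\<in>F. x + y \<in> F \<and> x * y \<in> F) \<and> (\<forall>x\<in>F. - x \<in> F) \<and>
     (\<forall>x\<in>F. x \<noteq> 0 \<longrightarrow> inverse x \<in> F)"

definition is_Q_basis :: "complex set \<Rightarrow> nat \<Rightarrow> (nat \<Rightarrow> complex) \<Rightarrow> bool" where
  "is_Q_basis K n \<omega> \<longleftrightarrow> (\<forall>i<n. \<omega> i \<in> K) \<and>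
     (\<forall>x\<in>K. \<exists>c :: nat \<Rightarrow> rat. x = (\<Sum>i<n. of_rat (c i) * \<omega> i)) \<and>
     (\<forall>c :: nat \<Rightarrow> rat. (\<Sum>i<n. of_rat (c i) * \<omega> i) = 0 \<longrightarrow> (\<forall>i<n. c i = 0))"

definition number_field :: "complex set \<Rightarrow> bool" where
  "number_field K \<longleftrightarrow> subfield_C K \<and> (\<exists>n \<omega>. is_Q_basis K n \<omega>)"

definition field_degree :: "complex set \<Rightarrow> nat" where
  "field_degree K = (THE n. \<exists>\<omega>. is_Q_basis K n \<omega>)"

definition embeddings :: "complex set \<Rightarrow> (complex \<Rightarrow> complex) set" where
  "embeddings K = {\<sigma>. (\<forall>x\<in>K. \<forall>y\<in>K. \<sigma> (x + y) = \<sigma> x + \<sigma> y \<and> \<sigma> (x * y) = \<sigma> x * \<sigma> y)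
      \<and> \<sigma> 1 = 1 \<and> (\<forall>x. x \<notin> K \<longrightarrow> \<sigma> x = 0)}"

definition galois_closure :: "complex set \<Rightarrow> complex set" where
  "galois_closure K = \<Inter>{F. subfield_C F \<and> (\<forall>\<sigma>\<in>embeddings K. \<sigma> ` K \<subseteq> F)}"

definition aut_group :: "complex set \<Rightarrow> (complex \<Rightarrow> complex) monoid" where
  "aut_group L = \<lparr>carrier = {\<sigma>. bij_betw \<sigma> L L \<and>
       (\<forall>x\<in>L. \<forall>y\<in>L. \<sigma> (x + y) = \<sigma> x + \<sigma> y \<and> \<sigma> (x * y) = \<sigma> x * \<sigma> y) \<and>
       (\<forall>x. x \<notin> L \<longrightarrow> \<sigma> x = x)},
     mult = (\<lambda>\<sigma> \<tau>. \<sigma> \<circ> \<tau>), one = id\<rparr>"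

text \<open>The dihedral group of order 8: symmetries of a square with vertices 0,1,2,3
in cyclic order, i.e. permutations of {0,1,2,3} preserving adjacency.\<close>
definition sq_adj :: "nat \<Rightarrow> nat \<Rightarrow> bool" where
  "sq_adj i j \<longleftrightarrow> j = (i + 1) mod 4 \<or> i = (j + 1) mod 4"

definition D4_group :: "(nat \<Rightarrow> nat) monoid" where
  "D4_group = \<lparr>carrier = {p. bij_betw p {..<4} {..<4} \<and> (\<forall>i. i \<ge> 4 \<longrightarrow> p i = i) \<and>
       (\<forall>i<4. \<forall>j<4. sq_adj i j \<longrightarrow> sq_adj (p i) (p j))},
     mult = (\<lambda>p q. p \<circ> q), one = id\<rparr>"

definition D4_quartic :: "complex set \<Rightarrow> bool" where
  "D4_quartic K \<longleftrightarrow> number_field K \<and> field_degree K = 4 \<and>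
     aut_group (galois_closure K) \<cong> D4_group"

definition algebraic_integer :: "complex \<Rightarrow> bool" where
  "algebraic_integer x \<longleftrightarrow> (\<exists>p :: int poly. lead_coeff p = 1 \<and> poly (map_poly of_int p) x = 0)"

definition ring_of_integers :: "complex set \<Rightarrow> complex set" where
  "ring_of_integers K = {x\<in>K. algebraic_integer x}"

definition is_integral_basis :: "complex set \<Rightarrow> nat \<Rightarrow> (nat \<Rightarrow> complex) \<Rightarrow> bool" where
  "is_integral_basis K n \<omega> \<longleftrightarrow> (\<forall>i<n. \<omega> i \<in> ring_of_integers K) \<and>
     (\<forall>x\<in>ring_of_integers K. \<exists>c :: nat \<Rightarrow> int. x = (\<Sum>i<n. of_int (c i) * \<omega> i)) \<and>
     (\<forall>c :: nat \<Rightarrow> int. (\<Sum>i<n. of_int (c i) * \<omega> i) = 0 \<longrightarrow> (\<forall>i<n. c i = 0))"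

definition field_trace :: "complex set \<Rightarrow> complex \<Rightarrow> complex" where
  "field_trace K x = (\<Sum>\<sigma>\<in>embeddings K. \<sigma> x)"

definition field_disc :: "complex set \<Rightarrow> complex" where
  "field_disc K = (let n = field_degree K; \<omega> = (SOME \<omega>. is_integral_basis K n \<omega>)
     in det (mat n n (\<lambda>(i, j). field_trace K (\<omega> i * \<omega> j))))"

definition abs_disc :: "complex set \<Rightarrow> real" where
  "abs_disc K = cmod (field_disc K)"

definition is_ideal :: "complex set \<Rightarrow> complex set \<Rightarrow> bool" where
  "is_ideal R I \<longleftrightarrow> I \<subseteq> R \<and> 0 \<in> I \<and> (\<forall>x\<in>I. \<forall>y\<in>I. x + y \<in> I) \<and> (\<forall>x\<in>I. - x \<in> I) \<and>
     (\<forall>r\<in>R. \<forall>x\<in>I. r * x \<in> I)"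

definition nonzero_ideals :: "complex set \<Rightarrow> complex set set" where
  "nonzero_ideals R = {I. is_ideal R I \<and> I \<noteq> {0}}"

definition ideal_prod :: "complex set \<Rightarrow> complex set \<Rightarrow> complex set \<Rightarrow> complex set" where
  "ideal_prod R I J = \<Inter>{H. is_ideal R H \<and> (\<forall>x\<in>I. \<forall>y\<in>J. x * y \<in> H)}"

definition ideal_equiv :: "complex set \<Rightarrow> (complex set \<times> complex set) set" where
  "ideal_equiv R = {(I, J). I \<in> nonzero_ideals R \<and> J \<in> nonzero_ideals R \<and>
     (\<exists>\<alpha>\<in>R - {0}. \<exists>\<beta>\<in>R - {0}. (\<lambda>x. \<alpha> * x) ` I = (\<lambda>x. \<beta> * x) ` J)}"

definition class_group :: "complex set \<Rightarrow> complex set set monoid" where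
  "class_group K = (let R = ring_of_integers K in
     \<lparr>carrier = nonzero_ideals R // ideal_equiv R,
      mult = (\<lambda>C D. ideal_equiv R `` {ideal_prod R (SOME I. I \<in> C) (SOME J. J \<in> D)}),
      one = ideal_equiv R `` {R}\<rparr>)"

definition class_torsion :: "complex set \<Rightarrow> nat \<Rightarrow> complex set set set" where
  "class_torsion K l = {c \<in> carrier (class_group K).
      c [^]\<^bsub>class_group K\<^esub> l = \<one>\<^bsub>class_group K\<^esub>}"

definition biquad :: "int \<Rightarrow> int \<Rightarrow> complex set" where
  "biquad a b = \<Inter>{F. subfield_C F \<and> csqrt (of_int a) \<in> F \<and> csqrt (of_int b) \<in> F}"

definition F4 :: "complex set \<Rightarrow> complex set set" where
  "F4 Q = {K. D4_quartic K \<and> Q \<subseteq> galois_closure K}"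

definition F4_le :: "complex set \<Rightarrow> real \<Rightarrow> complex set set" where
  "F4_le Q X = {K \<in> F4 Q. abs_disc K \<le> X}"

end

(* The exceptional set can be taken empty. A quartic D4-field K whose Galois closure contains
Q(sqrt a, sqrt b) is k(sqrt(t (u + v sqrt d))) with k = Q(sqrt d), where d, u, v range over a finite
list depending on a, b only and t is a squarefree integer; this is a Hilbert 90 argument, as the
norm u^2 - d v^2 has one of finitely many square classes. If d is a square modulo p and
u^2 - d v^2 is not, then p (not dividing t v) has exactly two prime ideals of degree one in K,
interchanged by sqrt(t (u + v sqrt d)) |-> - sqrt(t (u + v sqrt d)). Mertens' theorem for the real
characters attached to d, u^2 - d v^2 and their product gives at least y^(1 - eta) / 2 such
primes up to y, uniformly in t up to the few divisors of t. So every K has the small degree one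
primes required by the argument of Ellenberg and Venkatesh, with y = D^(1/(6 l)) up to a constant
and an arbitrarily small power of D = |disc K|. *)

theory Submission
 imports Defs "HOL-Analysis.Analysis" "HOL-Number_Theory.Number_Theory" "Jordan_Normal_Form.Char_Poly"
  "HOL-Real_Asymp.Real_Asymp"
begin

section \<open>Algebraic integers and number fields\<close>

text \<open>The condition on \<open>p\<close> is shaped so that it does not see \<open>t\<close>. If
  \<open>c^2 = d\<close> modulo \<open>p\<close>, the values \<open>t*(u + v*c)\<close> and
  \<open>t*(u - v*c)\<close> have product \<open>t^2\<close> times \<open>u^2 - d*v^2\<close>; when
  that norm is a nonresidue, one of the two values is a square whatever \<open>t\<close> is.
  Complete splitting would bring in a symbol that depends on \<open>t\<close>, and uniformity in
  \<open>t\<close> would be lost. The obstacle in the discriminant argument is a ratio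
  \<open>gam\<close> of \<open>l\<close>-th powers of two such primes that lies in a proper
  subfield, since then \<open>1\<close>, \<open>gam\<close>, \<open>gam^2\<close>,
  \<open>gam^3\<close> are dependent and bound nothing. An element with two equal conjugates lies in
  Q(sqrt d) and is fixed by the involution, which moves the primes; comparing norms excludes this.
  For the remaining ratios a Vandermonde determinant bounds D by a constant times
  \<open>y^(6*l)\<close>: clearing the denominators of three powers costs \<open>3*l\<close>, and
  the discriminant is the square of a determinant. This is where the 6 comes from.\<close>

lemma algebraic_integer_iff: "algebraic_integer x \<longleftrightarrow> algebraic_int x"
 by (auto simp: algebraic_integer_def algebraic_int_altdef_ipoly)

definition zspan :: "'i set => ('i => complex) => complex set" where
 "zspan I v = {x. EX c :: 'i => int. x = (SUM i:I. of_int (c i) * v i)}"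

lemma zspanI: "x = (SUM i:I. of_int (c i) * v i) ==> x:zspan I v"
 unfolding zspan_def mem_Collect_eq by (rule exI[of _ c])

lemma zspan_add: "x:zspan I v ==> y:zspan I v ==> x + y:zspan I v"
proof -
 assume "x:zspan I v" "y:zspan I v"
 then obtain c d where "x = (SUM i:I. of_int (c i) * v i)" "y = (SUM i:I. of_int (d i) * v i)"
  by (auto simp: zspan_def)
 hence "x + y = (SUM i:I. of_int (c i + d i) * v i)"
  by (simp add: sum.distrib distrib_right)
 thus ?thesis by (auto simp only: zspan_def mem_Collect_eq)
qed

lemma zspan_smult: "x:zspan I v ==> of_int k*x:zspan I v"
proof -
 assume "x:zspan I v"
 then obtain c where "x = (SUM i:I. of_int (c i) * v i)" by (auto simp: zspan_def)
 hence "of_int k*x = (SUM i:I. of_int (k*c i) * v i)"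
  by (simp add: sum_distrib_left mult.assoc)
 thus ?thesis by (auto simp only: zspan_def mem_Collect_eq)
qed

lemma zspan_0 [simp]: "0:zspan I v"
 by (auto simp: zspan_def intro!: exI[of _ "%_. 0"])

lemma zspan_sum: "(!!j. j:J ==> f j:zspan I v) ==> (SUM j:J. f j):zspan I v"
 by (induction J rule: infinite_finite_induct) (auto intro: zspan_add)

lemma zspan_gen: "finite I ==> i:I ==> v i:zspan I v"
proof -
 assume "finite I" "i:I"
 hence "v i = (SUM j:I. of_int (if j = i then 1 else 0) * v j)"
  by (subst sum.remove[of I i]) auto
 thus ?thesis unfolding zspan_def mem_Collect_eq
  by (rule exI[of _ "%j. if j = i then 1 else 0"])
qed

text \<open>The determinant trick. Multiplication by \<open>x\<close> acts on the family through an
  integer matrix, and the vector of the \<open>v i\<close>, nonzero because of \<open>i0\<close>, is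
  an eigenvector for \<open>x\<close>; so \<open>x\<close> is a root of a monic integral
  characteristic polynomial.\<close>

lemma algebraic_int_if_zspan_stable:
 fixes v :: "'i => complex"
 assumes fin: "finite I" and nz: "i0:I" "v i0~=0"
  and st: "!!i. i:I ==> x * v i:zspan I v"
 shows "algebraic_int x"
proof -
 obtain f where f: "bij_betw f {..<card I} I"
  using ex_bij_betw_nat_finite[OF fin] atLeast0LessThan by metis
 define n where "n = card I"
 have "ALL i:I. EX c :: 'i => int. x * v i = (SUM j:I. of_int (c j) * v j)"
  using st by (auto simp: zspan_def)
 then obtain c :: "'i => 'i => int" where c: "!!i. i:I ==> x * v i = (SUM j:I. of_int (c i j) * v j)"
  by metis
 define A :: "int Matrix.mat" where "A = Matrix.mat n n (%(i,j). c (f i) (f j))"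
 define w where "w = Matrix.vec n (%i. v (f i))"
 let ?A = "map_mat (of_int :: int => complex) A"
 have Ac: "A:carrier_mat n n" "?A:carrier_mat n n" by (auto simp: A_def)
 have fi: "f i:I" if "i < n" for i using f that by (auto simp: bij_betw_def n_def)
 obtain k where k: "k < n" "f k = i0" using f nz(1) by (metis bij_betw_imp_surj_on imageE lessThan_iff n_def)
 have w0: "w~=0\<^sub>v n"
 proof
  assume "w = 0\<^sub>v n"
  hence "vec_index w k = vec_index (0\<^sub>v n) k" by simp
  with k nz show False by (simp add: w_def)
 qed
 have "?A *\<^sub>v w = x \<cdot>\<^sub>v w"
 proof (rule eq_vecI)
  fix i assume "i < dim_vec (x \<cdot>\<^sub>v w)"
  hence i: "i < n" by (simp add: w_def)
  have "vec_index (?A *\<^sub>v w) i = (SUM j<n. of_int (c (f i) (f j)) * v (f j))"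
   using i by (simp add: scalar_prod_def A_def w_def atLeast0LessThan)
  also have "... = (SUM j:I. of_int (c (f i) j) * v j)"
   using sum.reindex_bij_betw[OF f, of "%j. of_int (c (f i) j) * v j"] by (simp add: n_def)
  also have "... = x * v (f i)" using c[OF fi[OF i]] by simp
  finally show "vec_index (?A *\<^sub>v w) i = vec_index (x \<cdot>\<^sub>v w) i" using i by (simp add: w_def)
 qed (auto simp: A_def w_def)
 hence "eigenvalue ?A x"
  using w0 by (auto simp: eigenvalue_def eigenvector_def w_def A_def intro!: exI[of _ w])
 hence "poly (char_poly ?A) x = 0" using eigenvalue_root_char_poly[OF Ac(2)] by simp
 moreover have "char_poly ?A = map_poly of_int (char_poly A)"
  using of_int_hom.char_poly_hom[OF Ac(1)] by simp
 ultimately show ?thesis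
  using degree_monic_char_poly[OF Ac(1)] by (auto simp: algebraic_int_altdef_ipoly)
qed

lemma algebraic_int_power_zspan:
 assumes "algebraic_int (x :: complex)"
 obtains n where "n > 0" "x^n:zspan {..<n} (%i. x^i)"
proof -
 obtain p :: "int poly" where p: "poly (map_poly of_int p) x = 0" "lead_coeff p = 1"
  using assms by (auto simp: algebraic_int_altdef_ipoly)
 define n where "n = degree p"
 have n: "n > 0"
 proof (rule ccontr)
  assume "~ n > 0"
  then obtain a where "p = [:a:]" using degree_eq_zeroE[of p] by (auto simp: n_def)
  with p show False by simp
 qed
 have "(SUM i<=n. of_int (Polynomial.coeff p i)*x^i) = 0"
  using p(1) by (simp add: poly_altdef n_def coeff_map_poly degree_map_poly)
 hence "x^n = (SUM i<n. of_int (- Polynomial.coeff p i)*x^i)"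
  using p(2) by (simp add: lessThan_Suc_atMost[symmetric] n_def sum_negf eq_neg_iff_add_eq_0 add.commute)
 hence "x^n:zspan {..<n} (%i. x^i)" unfolding zspan_def by (auto simp del: of_int_minus)
 with n that show ?thesis by blast
qed

lemma zspan_mult_left:
 assumes "!!i. i:I ==> a * v i:zspan J w" "x:zspan I v"
 shows "a*x:zspan J w"
proof -
 obtain c where c: "x = (SUM i:I. of_int (c i) * v i)" using assms(2) by (auto simp: zspan_def)
 have "a*x = (SUM i:I. of_int (c i)*(a * v i))"
  unfolding c by (simp add: sum_distrib_left mult_ac)
 also have "...:zspan J w" by (intro zspan_sum zspan_smult assms(1))
 finally show ?thesis .
qed

text \<open>\<open>x\<close> and \<open>y\<close> both stabilise the module spanned by the monomials
  \<open>x^i*y^j\<close> with \<open>i < n\<close> and \<open>j < m\<close>, hence so do their sum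
  and their product.\<close>

lemma algebraic_int_add_mult:
 assumes "algebraic_int (x :: complex)" "algebraic_int y"
 shows "algebraic_int (x + y)" "algebraic_int (x*y)"
proof -
 obtain n where n: "n > 0" "x^n:zspan {..<n} (%i. x^i)"
  using algebraic_int_power_zspan[OF assms(1)] .
 obtain m where m: "m > 0" "y^m:zspan {..<m} (%i. y^i)"
  using algebraic_int_power_zspan[OF assms(2)] .
 let ?I = "{..<n} \<times> {..<m}" and ?v = "%(i,j). x^i*y^j"
 have fin: "finite ?I" by simp
 have xx: "x * ?v ij:zspan ?I ?v" if ij: "ij:?I" for ij
 proof (cases ij)
  case (Pair i j)
  hence b: "i < n" "j < m" using ij by auto
  show ?thesis
  proof (cases "Suc i < n")
   case True
   hence "?v (Suc i, j):zspan ?I ?v" using b by (intro zspan_gen) auto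
   thus ?thesis using Pair by (simp add: mult_ac)
  next
   \<comment> \<open>The exponent leaves the range; the monic relation for \<open>x^n\<close> brings
     it back.\<close>
   case False
   hence i: "n = Suc i" using b by simp
   have "y^j*x^n:zspan ?I ?v"
    by (rule zspan_mult_left[OF _ n(2)])
      (use b zspan_gen[OF fin, of "(_, j)" ?v] in \<open>auto simp: mult_ac\<close>)
   thus ?thesis using Pair i by (simp add: mult_ac)
  qed
 qed
 have yy: "y * ?v ij:zspan ?I ?v" if ij: "ij:?I" for ij
 proof (cases ij)
  case (Pair i j)
  hence b: "i < n" "j < m" using ij by auto
  show ?thesis
  proof (cases "Suc j < m")
   case True
   hence "?v (i, Suc j):zspan ?I ?v" using b by (intro zspan_gen) auto
   thus ?thesis using Pair by (simp add: mult_ac)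
  next
   case False
   hence i: "m = Suc j" using b by simp
   have "x^i*y^m:zspan ?I ?v"
    by (rule zspan_mult_left[OF _ m(2)])
      (use b zspan_gen[OF fin, of "(i, _)" ?v] in \<open>auto simp: mult_ac\<close>)
   thus ?thesis using Pair i by (simp add: mult_ac)
  qed
 qed
 show "algebraic_int (x + y)"
  by (rule algebraic_int_if_zspan_stable[OF fin, of "(0,0)" ?v])
    (use n m xx yy in \<open>auto simp: distrib_right intro!: zspan_add\<close>)
 show "algebraic_int (x*y)"
 proof (rule algebraic_int_if_zspan_stable[OF fin, of "(0,0)" ?v])
  fix ij assume "ij:?I"
  thus "x*y * ?v ij:zspan ?I ?v"
   using zspan_mult_left[OF xx yy, of ij] by (simp add: mult.assoc)
 qed (use n m in auto)
qed

lemma algebraic_int_sum: "(!!i. i:A ==> algebraic_int (f i :: complex)) ==> algebraic_int (sum f A)"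
 by (induction A rule: infinite_finite_induct) (simp_all add: algebraic_int_add_mult)

lemma algebraic_int_prod: "(!!i. i:A ==> algebraic_int (f i :: complex)) ==> algebraic_int (prod f A)"
 by (induction A rule: infinite_finite_induct) (simp_all add: algebraic_int_add_mult)

lemma algebraic_int_if_power:
 assumes "algebraic_int ((x :: complex)^n)" "n > 0"
 shows "algebraic_int x"
 by (rule algebraic_int_root[OF assms(1), where p = "Polynomial.monom 1 n"])
   (use assms(2) in \<open>auto simp: poly_monom coeff_monom degree_monom_eq\<close>)

section \<open>Determinants over types and over index ranges\<close>

no_notation Matrix.vec_index (infixl "$" 100)

text \<open>Two determinants meet here. \<open>field_disc\<close> is defined with the one for
  matrices over index ranges; Cramer's rule, invertibility and volumes of linear images are taken
  for type-indexed matrices. \<open>det_mat_eq_hdet\<close> connects the two.\<close>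

abbreviation hdet :: "'a::comm_ring_1^'n^'n => 'a" where "hdet \<equiv> Determinants.det"

text \<open>Relabelling by \<open>h\<close> turns a transposition into a transposition, so induction
  over products of transpositions preserves the sign.\<close>

lemma sign_conjugate:
 fixes h :: "'a::finite => nat"
 assumes h: "bij_betw h UNIV {0..<n}" and p: "p permutes (UNIV :: 'a set)"
 shows "sign (%x. if x:{0..<n} then h (p (inv_into UNIV h x)) else x) = sign p"
 using p finite_class.finite_UNIV
proof (induction rule: permutes_induct)
 case id
 have "(%x. if x:{0..<n} then h (id (inv_into UNIV h x)) else x) = id"
  using h by (auto simp: fun_eq_iff bij_betw_inv_into_right)
 thus ?case by (simp add: sign_id)
next
 case (swap a b p)
 let ?c = "%p x. if x:{0..<n} then h (p (inv_into UNIV h x)) else x"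
 have inj: "h x = h y \<longleftrightarrow> x = y" for x y using h by (auto simp: bij_betw_def inj_on_def)
 have rng: "h x < n" for x using h by (auto simp: bij_betw_def)
 have eq: "?c (Transposition.transpose a b o p) = Transposition.transpose (h a) (h b) o ?c p"
 proof
  fix x show "?c (Transposition.transpose a b o p) x = (Transposition.transpose (h a) (h b) o ?c p) x"
  proof (cases "x < n")
   case True
   thus ?thesis by (auto simp: Transposition.transpose_def inj)
  next
   case False
   hence "x~=h a" "x~=h b" using rng by metis+
   thus ?thesis using False by (auto simp: Transposition.transpose_def)
  qed
 qed
 have "?c p permutes {0..<n}"
  using bij_betw_permutations[OF h] swap by (auto simp: bij_betw_def)
 hence perm: "permutation (?c p)" by (auto simp: permutation_permutes)
 show ?case unfolding eq using swap perm
  by (subst sign_compose) (auto simp: sign_swap_id permutation_swap_id inj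
    sign_compose[OF permutation_swap_id] permutes_imp_permutation[of UNIV])
qed

lemma det_mat_eq_hdet:
 fixes h :: "'n::finite => nat" and f :: "nat => nat => 'a::comm_ring_1"
 assumes h: "bij_betw h UNIV {0..<n}"
 shows "Determinant.det (Matrix.mat n n (%(i,j). f i j)) = hdet ((\<chi> i j. f (h i) (h j)) :: 'a^'n^'n)"
proof -
 let ?c = "%p x. if x:{0..<n} then h (p (inv_into UNIV h x)) else x"
 have rng: "h x < n" for x using h by (auto simp: bij_betw_def)
 have "Determinant.det (Matrix.mat n n (%(i,j). f i j)) =
  (SUM q | q permutes {0..<n}. of_int (sign q)*(PROD i=0..<n. f i (q i)))"
  by (subst det_def'[of _ n]) (auto intro!: sum.cong prod.cong dest: permutes_in_image[where x = x for x])
 also have "... = (SUM p | p permutes (UNIV :: 'n set). of_int (sign (?c p))*(PROD i=0..<n. f i (?c p i)))"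
  using sum.reindex_bij_betw[OF bij_betw_permutations[OF h],
   of "%q. of_int (sign q)*(PROD i=0..<n. f i (q i))"] by simp
 also have "... = (SUM p | p permutes (UNIV :: 'n set). of_int (sign p)*(PROD i:UNIV. f (h i) (h (p i))))"
 proof (rule sum.cong, simp)
  fix p assume "p:{p. p permutes (UNIV :: 'n set)}"
  hence p: "p permutes UNIV" by simp
  have "(PROD i=0..<n. f i (?c p i)) = (PROD i:UNIV. f (h i) (?c p (h i)))"
   using prod.reindex_bij_betw[OF h, of "%i. f i (?c p i)"] by simp
  also have "... = (PROD i:UNIV. f (h i) (h (p i)))"
   using h rng by (intro prod.cong) (auto simp: bij_betw_def)
  finally show "of_int (sign (?c p))*(PROD i=0..<n. f i (?c p i)) = of_int (sign p)*(PROD i:UNIV. f (h i) (h (p i)))"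
   using sign_conjugate[OF h p] by simp
 qed
 also have "... = hdet (\<chi> i j. f (h i) (h j))" by (simp add: Determinants.det_def)
 finally show ?thesis .
qed

text \<open>The Leibniz formula only adds and multiplies entries and signs. It is applied with the
  rationals and the integers as \<open>S\<close>.\<close>

lemma hdet_closed:
 fixes A :: "'a::comm_ring_1^'n^'n"
 assumes "!!x y. x:S ==> y:S ==> x + y:S" "!!x y. x:S ==> y:S ==> x*y:S"
  "0:S" "1:S" "-1:S" "!!i j. A $ i $ j:S"
 shows "hdet A:S"
proof -
 have s: "sum f T:S" if "!!x. x:T ==> f x:S" for f and T :: "('n => 'n) set"
  using that by (induction T rule: infinite_finite_induct) (auto intro: assms)
 have p: "prod f T:S" if "!!x. x:T ==> f x:S" for f and T :: "'n set"
  using that by (induction T rule: infinite_finite_induct) (auto intro: assms)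
 show ?thesis unfolding Determinants.det_def
  by (intro s assms(2) p assms(6)) (auto simp: sign_def assms)
qed

lemma hdet_hom:
 fixes A :: "'a::comm_ring_1^'n^'n" and g :: "'a => 'b::comm_ring_1"
 assumes "!!x y. g (x + y) = g x + g y" "!!x y. g (x*y) = g x*g y" "g 0 = 0" "g 1 = 1"
 shows "hdet (\<chi> i j. g (A $ i $ j)) = g (hdet A)"
proof -
 have s: "g (sum f T) = (SUM x:T. g (f x))" for f and T :: "('n => 'n) set"
  by (induction T rule: infinite_finite_induct) (auto simp: assms)
 have p: "g (prod f T) = (PROD x:T. g (f x))" for f and T :: "'n set"
  by (induction T rule: infinite_finite_induct) (auto simp: assms)
 have "g (-1) + g 1 = g (-1 + 1)" by (simp only: assms(1))
 hence m: "g (-1) = -1" using assms by (simp add: eq_neg_iff_add_eq_0)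
 have i: "g (of_int (sign q)) = of_int (sign q)" for q :: "'n => 'n"
  using m by (simp add: sign_def assms)
 show ?thesis unfolding Determinants.det_def by (simp add: s p i assms(2))
qed

lemma hdet_nonzero_iff:
 fixes A :: "'a::field^'n^'n"
 shows "hdet A~=0 \<longleftrightarrow> (ALL x. A *v x = 0 --> x = 0)"
 by (metis invertible_det_nz invertible_left_inverse matrix_left_invertible_ker)

section \<open>Subfields of the complex numbers and their embeddings\<close>

locale number_subfield =
 fixes K :: "complex set"
 assumes subfield: "subfield_C K"
begin

lemma K_0 [simp]: "0:K" and K_1 [simp]: "1:K"
 and K_add: "x:K ==> y:K ==> x + y:K" and K_mult: "x:K ==> y:K ==> x*y:K"
 and K_uminus: "x:K ==> - x:K"
 using subfield by (auto simp: subfield_C_def)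

lemma K_inverse: "x:K ==> inverse x:K"
 using subfield by (cases "x = 0") (auto simp: subfield_C_def)

lemma K_diff: "x:K ==> y:K ==> x - y:K"
 using K_add[of x "- y"] K_uminus by simp

lemma K_divide: "x:K ==> y:K ==> x/y:K"
 using K_mult[of x "inverse y"] K_inverse by (simp add: divide_inverse)

lemma K_of_nat [simp]: "of_nat n:K"
 by (induction n) (auto intro: K_add)

lemma K_of_int [simp]: "of_int n:K"
 by (cases n rule: int_cases2) (auto intro: K_uminus)

lemma K_numeral [simp]: "numeral n:K"
 using K_of_nat[of "numeral n"] by simp

lemma K_of_rat [simp]: "of_rat q:K"
 by (cases q) (auto simp: of_rat_rat intro!: K_divide)

lemma K_Rats: "x:\<rat> ==> x:K"
 by (auto elim!: Rats_cases)

lemma K_power: "x:K ==> x^n:K"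
 by (induction n) (auto intro: K_mult)

lemma K_sum: "(!!i. i:A ==> f i:K) ==> sum f A:K"
 by (induction A rule: infinite_finite_induct) (auto intro: K_add)

lemma K_prod: "(!!i. i:A ==> f i:K) ==> prod f A:K"
 by (induction A rule: infinite_finite_induct) (auto intro: K_mult)

lemmas K_closed = K_add K_mult K_uminus K_inverse K_diff K_divide K_power K_sum K_prod

context
 fixes sig assumes sig: "sig:embeddings K"
begin

lemma emb_add: "x:K ==> y:K ==> sig (x + y) = sig x + sig y"
 and emb_mult: "x:K ==> y:K ==> sig (x*y) = sig x * sig y"
 and emb_1: "sig 1 = 1" and emb_outside: "x~:K ==> sig x = 0"
 using sig by (auto simp: embeddings_def)

lemma emb_0: "sig 0 = 0"
 using emb_add[of 0 0] by simp

lemma emb_uminus: "x:K ==> sig (- x) = - sig x"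
 using emb_add[of x "-x"] emb_0 K_uminus by (simp add: eq_neg_iff_add_eq_0 add.commute)

lemma emb_diff: "x:K ==> y:K ==> sig (x - y) = sig x - sig y"
 using emb_add[of x "-y"] emb_uminus[of y] K_uminus by simp

lemma emb_eq_0_iff: "x:K ==> sig x = 0 \<longleftrightarrow> x = 0"
 using emb_mult[of x "inverse x"] emb_1 emb_0 K_inverse by (cases "x = 0") auto

lemma emb_inverse: "x:K ==> sig (inverse x) = inverse (sig x)"
 using emb_mult[of x "inverse x"] emb_1 emb_0 K_inverse
 by (cases "x = 0") (auto simp: inverse_unique)

lemma emb_divide: "x:K ==> y:K ==> sig (x/y) = sig x/sig y"
 using emb_mult[of x "inverse y"] emb_inverse K_inverse by (simp add: divide_inverse)

lemma emb_of_nat: "sig (of_nat n) = of_nat n"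
 by (induction n) (auto simp: emb_0 emb_1 emb_add)

lemma emb_of_int: "sig (of_int n) = of_int n"
 by (cases n rule: int_cases2) (auto simp: emb_of_nat emb_uminus)

lemma emb_of_rat: "sig (of_rat q) = of_rat q"
 by (cases q) (auto simp: of_rat_rat emb_divide emb_of_int)

lemma emb_Rats: "x:\<rat> ==> sig x = x"
 by (auto elim!: Rats_cases simp: emb_of_rat)

lemma emb_power: "x:K ==> sig (x^n) = sig x^n"
 by (induction n) (auto simp: emb_1 emb_mult K_power)

lemma emb_sum: "(!!i. i:A ==> f i:K) ==> sig (sum f A) = (SUM i:A. sig (f i))"
 by (induction A rule: infinite_finite_induct) (auto simp: emb_0 emb_add K_sum)

lemma emb_inj: "x:K ==> y:K ==> sig x = sig y \<longleftrightarrow> x = y"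
 using emb_diff[of x y] emb_eq_0_iff[of "x - y"] K_diff by auto

lemma emb_algebraic_int: "x:K ==> algebraic_int x ==> algebraic_int (sig x)"
proof -
 assume x: "x:K" "algebraic_int x"
 then obtain p :: "int poly" where p: "poly (map_poly of_int p) x = 0" "lead_coeff p = 1"
  by (auto simp: algebraic_int_altdef_ipoly)
 have "poly (map_poly of_int p) (sig x) = sig (poly (map_poly of_int p) x)"
  using x by (simp add: poly_altdef coeff_map_poly degree_map_poly emb_sum emb_mult emb_power
    emb_of_int K_mult K_power)
 thus ?thesis using p emb_0 by (auto simp: algebraic_int_altdef_ipoly)
qed

end

lemma emb_eqI: "sig:embeddings K ==> tau:embeddings K ==> (!!x. x:K ==> sig x = tau x) ==> sig = tau"
 using emb_outside by (metis ext)

lemma embeddings_independent: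
 assumes "finite A" "A<=embeddings K" "!!x. x:K ==> (SUM sig:A. c sig * sig x) = 0" "sig:A"
 shows "c sig = 0"
 using assms
proof (induction A arbitrary: c sig rule: finite_induct)
 case (insert tau A)
 have tau: "tau:embeddings K" using insert by auto
 have A0: "c rho = 0" if rho: "rho:A" for rho
 proof -
  have rhoK: "rho:embeddings K" using insert rho by auto
  have "rho~=tau" using insert rho by auto
  then obtain y where y: "y:K" "rho y~=tau y" using emb_eqI[OF rhoK tau] by auto
  have "c rho*(rho y - tau y) = 0"
  proof (rule insert.IH[of "%rho. c rho*(rho y - tau y)"])
   fix x assume x: "x:K"
   have "(SUM sig:insert tau A. c sig * sig (y*x)) = 0" using insert.prems(2) x y K_mult by blast
   moreover have "(SUM sig:insert tau A. c sig * sig x) = 0" using insert.prems(2) x by blast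
   moreover have "sig (y*x) = sig y * sig x" if "sig:insert tau A" for sig
    using emb_mult[of sig] that insert.prems x y by auto
   ultimately have e: "c tau*tau y*tau x + (SUM sig:A. c sig * sig y * sig x) = 0" "c tau*tau x + (SUM sig:A. c sig * sig x) = 0"
    using insert.hyps by (auto simp: mult.assoc)
   have "(SUM sig:A. c sig*(sig y - tau y) * sig x) = (SUM sig:A. c sig * sig y * sig x) - tau y*(SUM sig:A. c sig * sig x)"
    by (simp add: sum_distrib_left sum_subtractf[symmetric] algebra_simps)
   also have "... = - (c tau*tau y*tau x) + tau y*(c tau*tau x)"
   proof -
    have "(SUM sig:A. c sig * sig x) = - (c tau*tau x)" using e(2) by (simp add: eq_neg_iff_add_eq_0 add.commute)
    moreover have "(SUM sig:A. c sig * sig y * sig x) = - (c tau*tau y*tau x)" using e(1) by (simp add: eq_neg_iff_add_eq_0 add.commute)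
    ultimately show ?thesis by simp
   qed
   finally show "(SUM sig:A. c sig*(sig y - tau y) * sig x) = 0" by simp
  qed (use insert rho in auto)
  thus ?thesis using y by simp
 qed
 have "(SUM sig:insert tau A. c sig * sig 1) = 0" using insert.prems(2) by simp
 hence "c tau = 0" using insert.hyps A0 emb_1[OF tau] by simp
 thus ?case using A0 insert.prems(3) by (metis insertE)
qed simp

end

lemma Ints_imp_ex: "x:\<int> ==> EX z. x = of_int z"
 by (auto elim: Ints_cases)

lemma cmod_of_rat: "cmod (of_rat q) = \<bar>real_of_rat q\<bar>"
 by (cases q) (simp add: of_rat_rat norm_divide)

lemma rat_common_denominator:
 assumes "finite (S :: rat set)"
 shows "EX m::int. m > 0 & (ALL q:S. of_int m*q:\<int>)"
 using assms
proof (induction S rule: finite_induct)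
 case empty
 thus ?case by (auto intro!: exI[of _ 1])
next
 case (insert q S)
 then obtain m where m: "m > 0" "ALL q:S. of_int m*q:\<int>" by auto
 obtain a d where q: "q = Rat.Fract a d" "d > 0" by (cases q) auto
 have "of_int (m*d)*r:\<int>" if "r:insert q S" for r
 proof (cases "r = q")
  case True
  have "of_int (m*d)*r = (of_int (m*a) :: rat)"
   using q True by (simp add: Fract_of_int_quotient)
  thus ?thesis by (metis Ints_of_int)
 next
  case False
  hence "of_int d*(of_int m*r):\<int>" using that m(2) by (intro Ints_mult[of "of_int d"]) auto
  thus ?thesis by (simp add: mult_ac)
 qed
 thus ?case using m(1) q(2) by (intro exI[of _ "m*d"]) auto
qed

text \<open>The square of its determinant is the discriminant of the family
  \<open>w\<close>.\<close>

definition embmat :: "('n::finite => complex => complex) => ('n => complex) => complex^'n^'n" where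
 "embmat e w = (\<chi> i j. e i (w j))"

section \<open>Norm, trace and integral bases\<close>

locale number_field_emb = number_subfield K for K +
 fixes e :: "4 => complex => complex"
 assumes e_bij: "bij_betw e UNIV (embeddings K)"
begin

lemma e_emb [simp]: "e i:embeddings K"
 using e_bij by (auto simp: bij_betw_def)

lemma e_eq_iff: "e i = e j \<longleftrightarrow> i = j"
 using e_bij by (auto simp: bij_betw_def inj_on_def)

lemmas e_add = emb_add[OF e_emb] and e_mult = emb_mult[OF e_emb] and e_0 [simp] = emb_0[OF e_emb]
 and e_1 [simp] = emb_1[OF e_emb] and e_uminus = emb_uminus[OF e_emb] and e_diff = emb_diff[OF e_emb]
 and e_eq_0_iff = emb_eq_0_iff[OF e_emb] and e_divide = emb_divide[OF e_emb]
 and e_inverse = emb_inverse[OF e_emb] and e_of_int [simp] = emb_of_int[OF e_emb]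
 and e_of_nat [simp] = emb_of_nat[OF e_emb] and e_of_rat [simp] = emb_of_rat[OF e_emb]
 and e_power = emb_power[OF e_emb] and e_sum = emb_sum[OF e_emb] and e_inj = emb_inj[OF e_emb]
 and e_algebraic_int = emb_algebraic_int[OF e_emb]

lemma id_index: "EX i. ALL x:K. e i x = x"
proof -
 have "(%x. if x:K then x else 0):embeddings K"
  by (auto simp: embeddings_def K_add K_mult)
 then obtain i where "e i = (%x. if x:K then x else 0)"
  using e_bij unfolding bij_betw_def by (metis (no_types, lifting) imageE)
 thus ?thesis by (intro exI[of _ i]) simp
qed

definition nrm :: "complex => complex" where "nrm x = (PROD i:UNIV. e i x)"

lemma nrm_1 [simp]: "nrm 1 = 1" by (simp add: nrm_def)

lemma nrm_mult: "x:K ==> y:K ==> nrm (x*y) = nrm x*nrm y"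
 by (simp add: nrm_def e_mult prod.distrib)

lemma nrm_power: "x:K ==> nrm (x^k) = nrm x^k"
 by (induction k) (auto simp: nrm_mult K_power)

lemma nrm_eq_0_iff: "x:K ==> nrm x = 0 \<longleftrightarrow> x = 0"
 by (simp add: nrm_def e_eq_0_iff)

lemma nrm_of_int: "nrm (of_int m) = of_int m^4"
 by (simp add: nrm_def)

lemma field_trace_eq: "field_trace K x = (SUM i:UNIV. e i x)"
 unfolding field_trace_def using sum.reindex_bij_betw[OF e_bij, of "%sig. sig x"] by simp

abbreviation R where "R \<equiv> ring_of_integers K"

lemma R_iff: "x:R \<longleftrightarrow> x:K & algebraic_int x"
 by (simp add: ring_of_integers_def algebraic_integer_iff)

lemma R_K: "x:R ==> x:K" by (simp add: R_iff)

lemma R_0 [simp]: "0:R" and R_1 [simp]: "1:R" and R_of_int [simp]: "of_int m:R"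
 and R_of_nat [simp]: "of_nat n:R"
 by (auto simp: R_iff)

lemma R_add: "x:R ==> y:R ==> x + y:R"
 and R_mult: "x:R ==> y:R ==> x*y:R"
 and R_uminus: "x:R ==> - x:R"
 by (auto simp: R_iff K_closed algebraic_int_add_mult)

lemma R_diff: "x:R ==> y:R ==> x - y:R"
 using R_add[of x "-y"] R_uminus by simp

lemma R_sum: "(!!i. i:A ==> f i:R) ==> sum f A:R"
 by (induction A rule: infinite_finite_induct) (auto intro: R_add)

lemma R_prod: "(!!i. i:A ==> f i:R) ==> prod f A:R"
 by (induction A rule: infinite_finite_induct) (auto intro: R_mult)

lemma R_power: "x:R ==> x^n:R"
 by (induction n) (auto intro: R_mult)

text \<open>Embeddings fix rational coefficients, so a change of family multiplies the embedding
  matrix on the right.\<close>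

lemma cmod_embmat_eqI:
 assumes "!!i. i:UNIV ==> w i:K" and "!!j. v j = (SUM k:UNIV. of_rat (C $ k $ j)*w k)"
 shows "embmat e v = embmat e w ** (\<chi> k j. of_rat (C $ k $ j))"
 using assms by (simp add: embmat_def matrix_matrix_mult_def vec_eq_iff e_sum e_mult K_mult mult.commute)

end

locale number_field_basis = number_field_emb K e for K and e :: "4 => complex => complex" +
 fixes b :: "4 => complex"
 assumes b_K: "b i:K"
  and b_span: "x:K ==> EX c. x = (SUM i:UNIV. of_rat (c i)*b i)"
begin

text \<open>A vector killed by the transpose is a linear relation between the embeddings on
  \<open>b\<close>, hence on all of \<open>K\<close>, against their independence.\<close>

lemma det_embmat: "hdet (embmat e b)~=0"
proof
 assume "hdet (embmat e b) = 0"
 hence "hdet (transpose (embmat e b)) = 0" by simp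
 then obtain c where c: "c~=0" "transpose (embmat e b) *v c = 0"
  using hdet_nonzero_iff by metis
 have cj: "(SUM i:UNIV. c $ i*e i (b j)) = 0" for j
 proof -
  have "(transpose (embmat e b) *v c) $ j = 0" using c by simp
  thus ?thesis by (simp add: matrix_vector_mult_def embmat_def transpose_def mult.commute)
 qed
 define g where "g = the_inv_into UNIV e"
 have g: "g (e i) = i" for i unfolding g_def
  using e_bij by (auto simp: bij_betw_def intro!: the_inv_into_f_f)
 have z: "(SUM i:UNIV. c $ i*e i x) = 0" if "x:K" for x
 proof -
  obtain q where q: "x = (SUM j:UNIV. of_rat (q j)*b j)" using b_span \<open>x : K\<close> by blast
  have "(SUM i:UNIV. c $ i*e i x) = (SUM i:UNIV. SUM j:UNIV. of_rat (q j)*(c $ i*e i (b j)))"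
   unfolding q using b_K by (simp add: e_sum e_mult K_mult sum_distrib_left mult_ac)
  also have "... = (SUM j:UNIV. of_rat (q j)*(SUM i:UNIV. c $ i*e i (b j)))"
   by (subst sum.swap) (simp add: sum_distrib_left)
  finally show ?thesis by (simp add: cj)
 qed
 have "c $ g sig = 0" if "sig:embeddings K" for sig
 proof (rule embeddings_independent[of "embeddings K" "%sig. c $ g sig"])
  show "finite (embeddings K)" using bij_betw_finite[OF e_bij] by simp
  fix x assume "x:K"
  thus "(SUM sig:embeddings K. c $ g sig * sig x) = 0"
   using sum.reindex_bij_betw[OF e_bij, of "%sig. c $ g sig * sig x"] z by (simp add: g)
 qed (use that in auto)
 hence "c $ i = 0" for i using g[of i] e_emb[of i] by metis
 thus False using c by (simp add: vec_eq_iff)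
qed

text \<open>\<open>A\<close> is the matrix of multiplication by \<open>x\<close> in \<open>b\<close>
  and has rational entries. \<open>embmat e b\<close> conjugates it to the diagonal matrix of the
  conjugates of \<open>x\<close>, so both have the same determinant and trace.\<close>

lemma nrm_trace_Rats:
 assumes x: "x:K"
 shows "nrm x:\<rat>" "(SUM i:UNIV. e i x):\<rat>"
proof -
 have "EX c. x*b j = (SUM i:UNIV. of_rat (c i)*b i)" for j
  using b_span[of "x*b j"] b_K x K_mult by blast
 then obtain c where c: "!!j. x*b j = (SUM i:UNIV. of_rat (c j i)*b i)" by metis
 define A :: "complex^4^4" where "A = (\<chi> i j. of_rat (c j i))"
 define M where "M = embmat e b"
 define D :: "complex^4^4" where "D = (\<chi> i j. if i = j then e i x else 0)"
 have MA: "M ** A = D ** M"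
 proof -
  have "(M ** A) $ i $ j = (D ** M) $ i $ j" for i j
  proof -
   have "(M ** A) $ i $ j = e i (x*b j)"
    unfolding c using b_K
    by (simp add: M_def A_def embmat_def matrix_matrix_mult_def e_sum e_mult K_mult mult.commute)
   also have "... = (D ** M) $ i $ j"
    using b_K x by (simp add: M_def D_def embmat_def matrix_matrix_mult_def e_mult
      if_distrib[of "%z. z * _"] cong: if_cong)
   finally show ?thesis .
  qed
  thus ?thesis by (simp add: vec_eq_iff)
 qed
 have "hdet D = nrm x" unfolding nrm_def
  by (subst Determinants.det_diagonal) (auto simp: D_def)
 moreover have "hdet M*hdet A = hdet D*hdet M"
  using arg_cong[OF MA, of hdet] by (simp add: Determinants.det_mul)
 ultimately have "nrm x = hdet A" using det_embmat by (simp add: M_def)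
 moreover have "hdet A:\<rat>" by (rule hdet_closed) (auto simp: A_def)
 ultimately show "nrm x:\<rat>" by simp
 obtain M' where M': "M' ** M = mat 1" "M ** M' = mat 1"
  using det_embmat invertible_det_nz[of M] by (auto simp: M_def invertible_def)
 have "D = D ** (M ** M')" using M' by (simp add: matrix_mul_rid)
 also have "... = M ** A ** M'" by (simp add: matrix_mul_assoc MA)
 finally have "Determinants.trace D = Determinants.trace (M ** A ** M')" by simp
 also have "... = Determinants.trace (M' ** (M ** A))" by (rule trace_mul_sym)
 also have "M' ** (M ** A) = A" by (simp add: matrix_mul_assoc M')
 finally have "(SUM i:UNIV. e i x) = (SUM i:UNIV. of_rat (c i i))"
  by (simp add: Determinants.trace_def D_def A_def)
 also have "... = of_rat (SUM i:UNIV. c i i)" by (simp add: of_rat_sum)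
 finally show "(SUM i:UNIV. e i x):\<rat>" by simp
qed

lemma nrm_Ints: "x:R ==> nrm x:\<int>"
proof (rule rational_algebraic_int_is_int)
 assume "x:R"
 thus "algebraic_int (nrm x)" "nrm x:\<rat>" unfolding nrm_def[of x]
  by (auto intro!: algebraic_int_prod e_algebraic_int nrm_trace_Rats[unfolded nrm_def] simp: R_iff)
qed

lemma trace_Ints: "x:R ==> (SUM i:UNIV. e i x):\<int>"
 by (rule rational_algebraic_int_is_int)
   (auto simp: R_iff nrm_trace_Rats intro!: algebraic_int_sum e_algebraic_int)

lemma nrm_ge_1: "x:R ==> x~=0 ==> cmod (nrm x) >= 1"
 using nrm_Ints[of x] nrm_eq_0_iff[of x] R_K[of x] by (auto elim!: Ints_cases)

text \<open>The inclusion is one of the embeddings; dropping its factor from the norm leaves a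
  product of conjugates, which is an algebraic integer.\<close>

lemma cofactor_R: "x:R ==> x~=0 ==> nrm x/x:R"
proof -
 assume x: "x:R" "x~=0"
 obtain i where i: "ALL y:K. e i y = y" using id_index by blast
 have "nrm x = x*(PROD j:UNIV - {i}. e j x)"
  unfolding nrm_def using i x R_K by (subst prod.remove[of _ i]) auto
 hence "nrm x/x = (PROD j:UNIV - {i}. e j x)" using x by simp
 moreover have "algebraic_int (PROD j:UNIV - {i}. e j x)"
  using x by (intro algebraic_int_prod e_algebraic_int) (auto simp: R_iff)
 moreover have "nrm x/x:K" using x R_K by (intro K_divide K_Rats[OF nrm_trace_Rats(1)])
 ultimately show ?thesis by (simp add: R_iff)
qed

lemma disc_Ints:
 assumes "!!i. w i:R"
 shows "(hdet (embmat e w))^2:\<int>"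
proof -
 have "(hdet (embmat e w))^2 = hdet (transpose (embmat e w) ** embmat e w)"
  by (simp add: Determinants.det_mul power2_eq_square)
 also have "...:\<int>"
 proof (rule hdet_closed)
  fix i j
  have "(transpose (embmat e w) ** embmat e w) $ i $ j = (SUM k:UNIV. e k (w i*w j))"
   using assms R_K by (simp add: matrix_matrix_mult_def transpose_def embmat_def e_mult)
  thus "(transpose (embmat e w) ** embmat e w) $ i $ j:\<int>"
   using trace_Ints[of "w i*w j"] assms R_mult by simp
 qed auto
 finally show ?thesis .
qed

text \<open>If \<open>m\<close> clears the denominators of the structure constants, the elements
  \<open>of_int m*b k\<close> span a module stable under multiplication by each of them.\<close>

lemma scaled_basis_R: "EX m::int. m > 0 & (ALL i. of_int m*b i:R)"
proof -
 have "EX c. b i*b j = (SUM k:UNIV. of_rat (c k)*b k)" for i j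
  using b_span b_K K_mult by blast
 then obtain c where c: "!!i j. b i*b j = (SUM k:UNIV. of_rat (c i j k)*b k)" by metis
 have "finite (range (%(i,j,k). c i j k))" by simp
 from rat_common_denominator[OF this] obtain m :: int where
  m: "m > 0" and m': "ALL q:range (%(i,j,k). c i j k). of_int m*q:\<int>" by blast
 have "of_int m*c i j k:\<int>" for i j k
  using m' by (metis (mono_tags, lifting) case_prod_conv rangeI)
 hence "EX z. of_int m*c i j k = of_int z" for i j k by (rule Ints_imp_ex)
 then obtain z where z: "!!i j k. of_int m*c i j k = of_int (z i j k)" by metis
 obtain i0 where i0: "b i0~=0"
 proof (rule ccontr)
  assume "~ thesis"
  hence "b i = 0" for i using that by auto
  thus False using b_span[of 1] by simp
 qed
 have "of_int m*b i:R" for i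
 proof -
  have "algebraic_int (of_int m*b i)"
  proof (rule algebraic_int_if_zspan_stable[of UNIV i0 "%k. of_int m*b k"])
   fix j
   have zc: "of_int m * of_rat (c i j k) = (of_int (z i j k) :: complex)" for k
    using arg_cong[OF z[of i j k], of "of_rat :: rat => complex"] by (simp add: of_rat_mult)
   have "of_int m*b i*(of_int m*b j) = of_int m * of_int m*(b i*b j)" by (simp add: mult_ac)
   also have "... = (SUM k:UNIV. of_int m * of_rat (c i j k)*(of_int m*b k))"
    unfolding c by (simp add: sum_distrib_left mult_ac)
   also have "... = (SUM k:UNIV. of_int (z i j k)*(of_int m*b k))" by (simp add: zc)
   finally show "of_int m*b i*(of_int m*b j):zspan UNIV (%k. of_int m*b k)"
    by (rule zspanI)
  qed (use i0 m in auto)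
  thus ?thesis using b_K by (simp add: R_iff K_mult)
 qed
 thus ?thesis using m by blast
qed

text \<open>Among the integral families of nonzero discriminant take one with the least. A
  non-integral coordinate \<open>q k\<close> of an integral \<open>x\<close> would allow replacing
  \<open>w k\<close> by \<open>x\<close> minus the integral part of \<open>q k\<close> times
  \<open>w k\<close>, which multiplies the determinant by the fractional part of
  \<open>q k\<close>.\<close>

lemma integral_basis_exists:
 "EX w :: 4 => complex. (ALL i. w i:R) & R = zspan UNIV w &
   (ALL x:K. EX c. x = (SUM i:UNIV. of_rat (c i)*w i))"
proof -
 \<comment> \<open>The discriminant of an integral family is an integer, so its absolute value can
   be minimised over the naturals.\<close>
 define P where "P n \<longleftrightarrow> (EX w. (ALL i. w i:R) & hdet (embmat e w)~=0 & (cmod (hdet (embmat e w)))^2 = real n)" for n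
 have Pn: "EX n. (cmod (hdet (embmat e w)))^2 = real n" if w: "!!i. w i:R" for w :: "4 => complex"
 proof -
  obtain z where "(hdet (embmat e w))^2 = of_int z" using disc_Ints[of w] w by (auto elim: Ints_cases)
  hence "cmod ((hdet (embmat e w))^2) = real (nat \<bar>z\<bar>)" by simp
  thus ?thesis unfolding norm_power by blast
 qed
 have "EX n. P n"
 proof -
  obtain m :: int where m: "m > 0" "!!i. of_int m*b i:R" using scaled_basis_R by blast
  define w where "w i = of_int m*b i" for i
  have "embmat e w = embmat e b ** (\<chi> k j. of_rat ((if k = j then of_int m else 0)))"
   using b_K by (simp add: embmat_def matrix_matrix_mult_def vec_eq_iff e_mult w_def
      if_distrib[of "%z. _*z"] if_distrib[of of_rat] cong: if_cong)
  moreover have "hdet ((\<chi> k j. of_rat ((if k = j then of_int m else 0)))::complex^4^4)~=0"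
   by (subst Determinants.det_diagonal) (use m in auto)
  ultimately have "hdet (embmat e w)~=0" using det_embmat by (simp add: Determinants.det_mul)
  moreover have wR: "!!i. w i:R" using m by (simp add: w_def)
  ultimately show ?thesis using Pn[of w] by (auto simp: P_def)
 qed
 hence PL: "P (Least P)" by (rule LeastI_ex)
 then obtain w where w: "!!i. w i:R" "hdet (embmat e w)~=0" "(cmod (hdet (embmat e w)))^2 = real (Least P)"
  by (auto simp: P_def)
 have "EX c. w j = (SUM i:UNIV. of_rat (c i)*b i)" for j using b_span w(1) R_K by blast
 then obtain c where c: "!!j. w j = (SUM i:UNIV. of_rat (c j i)*b i)" by metis
 define C :: "rat^4^4" where "C = (\<chi> i j. c j i)"
 have wC: "embmat e w = embmat e b ** (\<chi> k j. of_rat (C $ k $ j))"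
  by (rule cmod_embmat_eqI) (use b_K c in \<open>auto simp: C_def\<close>)
 have "hdet ((\<chi> k j. of_rat (C $ k $ j)) :: complex^4^4) = of_rat (hdet C)"
  by (rule hdet_hom) (auto simp: of_rat_add of_rat_mult)
 hence "hdet C~=0" using w(2) wC by (auto simp: Determinants.det_mul)
 hence "invertible C" by (simp add: invertible_det_nz)
 then obtain C' where C': "C ** C' = mat 1" by (auto simp: invertible_def)
 have bw: "b j = (SUM k:UNIV. of_rat (C' $ k $ j)*w k)" for j
 proof -
  have "(SUM k:UNIV. of_rat (C' $ k $ j)*w k) = (SUM k:UNIV. SUM i:UNIV. of_rat (C $ i $ k*C' $ k $ j)*b i)"
   unfolding c by (simp add: C_def sum_distrib_left of_rat_mult mult_ac)
  also have "... = (SUM i:UNIV. of_rat ((C ** C') $ i $ j)*b i)"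
   by (subst sum.swap) (simp add: matrix_matrix_mult_def of_rat_sum sum_distrib_right)
  also have "... = b j" by (simp add: C' mat_def if_distrib[of of_rat] if_distrib[of "%z. z * _"] cong: if_cong)
  finally show ?thesis by simp
 qed
 have span: "EX q. x = (SUM k:UNIV. of_rat (q k)*w k)" if x: "x:K" for x
 proof -
  obtain a where "x = (SUM i:UNIV. of_rat (a i)*b i)" using b_span x by blast
  also have "... = (SUM i:UNIV. SUM k:UNIV. of_rat (C' $ k $ i*a i)*w k)"
   by (subst bw) (simp add: sum_distrib_left of_rat_mult mult_ac)
  also have "... = (SUM k:UNIV. of_rat (SUM i:UNIV. C' $ k $ i*a i)*w k)"
   by (subst sum.swap) (simp add: of_rat_sum sum_distrib_right)
  finally show ?thesis by (intro exI[of _ "%k. SUM i:UNIV. C' $ k $ i*a i"])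
 qed
 have "x:zspan UNIV w" if x: "x:R" for x
 proof -
  obtain q where q: "x = (SUM k:UNIV. of_rat (q k)*w k)" using span R_K x by blast
  have "q k:\<int>" for k
  proof (rule ccontr)
   assume nk: "q k~:\<int>"
   define f where "f = frac (q k)"
   have f: "0 < f" "f < 1" using nk by (auto simp: f_def frac_gt_0_iff frac_lt_1)
   define y where "y = x - of_int \<lfloor>q k\<rfloor> * w k"
   have y: "y:R" using x w by (auto simp: y_def intro!: R_diff R_mult)
   define w' where "w' = w(k := y)"
   define v :: "complex^4" where "v = (\<chi> j. if j = k then of_rat f else of_rat (q j))"
   have y2: "y = (SUM j:UNIV. v $ j*w j)"
   proof -
    have "(SUM j:UNIV. v $ j*w j) = of_rat f*w k + (SUM j:UNIV-{k}. of_rat (q j)*w j)"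
     by (subst sum.remove[of _ k]) (auto simp: v_def intro!: sum.cong)
    moreover have "x = of_rat (q k)*w k + (SUM j:UNIV-{k}. of_rat (q j)*w j)"
     unfolding q by (subst sum.remove[of _ k]) auto
    moreover have "of_rat f = (of_rat (q k) - of_int \<lfloor>q k\<rfloor> :: complex)"
     by (simp add: f_def frac_def of_rat_diff)
    ultimately show ?thesis by (simp add: y_def algebra_simps)
   qed
   have vK: "v $ j:K" "e i (v $ j) = v $ j" for i j by (auto simp: v_def)
   \<comment> \<open>Only column \<open>k\<close> changes, and the new column is the image of
     \<open>v\<close>; Cramer's rule evaluates the determinant.\<close>
   have "embmat e w' = (\<chi> i j. if j = k then (embmat e w *v v) $ i else embmat e w $ i $ j)"
   proof -
    have "e i y = (SUM j:UNIV. e i (w j) * v $ j)" for i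
     unfolding y2 using w R_K by (simp add: e_sum e_mult vK K_mult mult.commute)
    thus ?thesis by (simp add: embmat_def w'_def vec_eq_iff matrix_vector_mult_def)
   qed
   hence "hdet (embmat e w') = v $ k*hdet (embmat e w)" by (simp add: cramer_lemma)
   hence d: "hdet (embmat e w') = of_rat f*hdet (embmat e w)" by (simp add: v_def)
   have w'R: "!!i. w' i:R" using w y by (simp add: w'_def)
   then obtain n where n: "(cmod (hdet (embmat e w')))^2 = real n" using Pn by blast
   have "hdet (embmat e w')~=0" using d w f by simp
   hence "P n" using w'R n by (auto simp: P_def)
   hence "Least P<=n" by (rule Least_le)
   moreover have cmod_rat: "cmod (of_rat f) = real_of_rat f"
    using f by (simp add: cmod_of_rat)
   moreover have "real n = (real_of_rat f)^2*real (Least P)"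
    using n w(3) d f by (simp add: norm_mult power_mult_distrib cmod_rat)
   moreover have "(real_of_rat f)^2 < 1" using f by (simp add: power_less_one_iff of_rat_less_1_iff)
   moreover have "real (Least P) > 0" using w by (metis norm_eq_zero zero_less_power2)
   ultimately show False
    using mult_strict_right_mono[of "(real_of_rat f)^2" 1 "real (Least P)"] by linarith
  qed
  hence "q k = of_int \<lfloor>q k\<rfloor>" for k by simp
  hence "of_rat (q k) = (of_int \<lfloor>q k\<rfloor> :: complex)" for k by (metis of_rat_of_int_eq)
  hence "x = (SUM k:UNIV. of_int \<lfloor>q k\<rfloor> * w k)" using q by simp
  thus ?thesis by (rule zspanI)
 qed
 moreover have "x:R" if "x:zspan UNIV w" for x
  using that w by (auto simp: zspan_def intro!: R_sum R_mult)
 ultimately have Rz: "R = zspan UNIV w" by (intro equalityI subsetI) auto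
 show ?thesis
 proof (intro exI[of _ w] conjI allI ballI)
  show "R = zspan UNIV w" by (rule Rz)
 qed (use w(1) span in blast)+
qed

end

section \<open>Lattices, ideals and the Minkowski bound\<close>

definition add_subgroup :: "complex set => bool" where
 "add_subgroup A \<longleftrightarrow> 0:A & (ALL x:A. ALL y:A. x + y:A) & (ALL x:A. - x:A)"

lemma add_subgroupD:
 assumes "add_subgroup A"
 shows "0:A" "x:A ==> y:A ==> x + y:A" "x:A ==> - x:A" "x:A ==> y:A ==> x - y:A"
proof -
 show "x:A ==> y:A ==> x - y:A"
  using assms unfolding add_subgroup_def by (metis diff_conv_add_uminus)
qed (use assms in \<open>auto simp: add_subgroup_def\<close>)

definition coset_of :: "complex set => complex => complex set" where
 "coset_of B x = (+) x`B"

lemma mem_coset_of: "y:coset_of B x \<longleftrightarrow> y - x:B"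
 unfolding coset_of_def by (auto simp: image_iff) (metis add.commute diff_add_cancel)

lemma coset_of_eq_iff: "add_subgroup B ==> coset_of B x = coset_of B y \<longleftrightarrow> x - y:B"
proof
 assume B: "add_subgroup B" and "coset_of B x = coset_of B y"
 thus "x - y:B" using add_subgroupD(1)[OF B] mem_coset_of[of x B x] mem_coset_of[of x B y] by simp
next
 assume B: "add_subgroup B" and xy: "x - y:B"
 show "coset_of B x = coset_of B y"
 proof (intro Set.set_eqI)
  fix t
  have "t - x:B \<longleftrightarrow> t - y:B"
   using add_subgroupD(2)[OF B _ xy, of "t - x"] add_subgroupD(4)[OF B _ xy, of "t - y"] by auto
  thus "t:coset_of B x \<longleftrightarrow> t:coset_of B y" by (simp add: mem_coset_of)
 qed
qed

definition index_in :: "complex set => complex set => nat" where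
 "index_in A B = card (coset_of B`A)"

text \<open>\<open>index_in\<close> is 0 when there are infinitely many cosets, so finiteness is
  kept as a separate predicate.\<close>

definition fin_index :: "complex set => complex set => bool" where
 "fin_index A B \<longleftrightarrow> finite (coset_of B`A)"

text \<open>With a representative \<open>rho X\<close> for each coset of \<open>B\<close>, sending
  \<open>(X, Y)\<close> to \<open>rho X + Y\<close> matches pairs of cosets with cosets of
  \<open>C\<close>.\<close>

lemma index_tower:
 assumes A: "add_subgroup A" and B: "add_subgroup B" and C: "add_subgroup C" and "C<=B" "B<=A"
 shows "index_in A C = index_in A B*index_in B C"
  and "fin_index A C \<longleftrightarrow> fin_index A B & fin_index B C"
proof -
 define rho where "rho X = (SOME a. a:A & coset_of B a = X)" for X
 have rho: "rho X:A" "coset_of B (rho X) = X" if "X:coset_of B`A" for X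
 proof -
  have "EX a. a:A & coset_of B a = X" using that by auto
  from someI_ex[OF this] show "rho X:A" "coset_of B (rho X) = X" by (auto simp: rho_def)
 qed
 let ?f = "%(X,Y). (+) (rho X)`Y"
 have f: "?f (X, coset_of C y) = coset_of C (rho X + y)" for X y
  by (auto simp: coset_of_def image_image add.assoc)
 have bij: "bij_betw ?f (coset_of B`A \<times> coset_of C`B) (coset_of C`A)"
  unfolding bij_betw_def
 proof (intro conjI inj_onI Set.set_eqI iffI)
  fix p q assume p: "p:coset_of B`A \<times> coset_of C`B" and q: "q:coset_of B`A \<times> coset_of C`B"
   and e: "?f p = ?f q"
  obtain X y where py: "p = (X, coset_of C y)" "X:coset_of B`A" "y:B" using p by auto
  obtain X' y' where qy: "q = (X', coset_of C y')" "X':coset_of B`A" "y':B" using q by auto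
  have e1: "rho X + y - (rho X' + y'):C" using e unfolding py qy f coset_of_eq_iff[OF C] .
  hence "rho X + y - (rho X' + y'):B" using \<open>C <= B\<close> by blast
  hence "rho X + y - (rho X' + y') - (y - y'):B" using add_subgroupD(4)[OF B] py qy by blast
  hence "rho X - rho X':B" by (simp add: algebra_simps)
  hence "coset_of B (rho X) = coset_of B (rho X')" using coset_of_eq_iff[OF B] by simp
  hence XX: "X = X'" using rho(2) py(2) qy(2) by simp
  hence "y - y':C" using e1 by simp
  hence yy: "coset_of C y = coset_of C y'" by (rule iffD2[OF coset_of_eq_iff[OF C]])
  show "p = q" unfolding py(1) qy(1) XX yy by (rule refl)
 next
  fix Z assume "Z:?f`(coset_of B`A \<times> coset_of C`B)"
  then obtain X y where X: "X:coset_of B`A" and y: "y:B" and Z: "Z = ?f (X, coset_of C y)" by auto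
  have "rho X + y:A" using rho(1)[OF X] y \<open>B <= A\<close> by (intro add_subgroupD(2)[OF A]) auto
  thus "Z:coset_of C`A" unfolding Z f by (rule imageI)
 next
  fix Z assume "Z:coset_of C`A"
  then obtain a where a: "a:A" "Z = coset_of C a" by auto
  let ?X = "coset_of B a"
  have X: "?X:coset_of B`A" using a by simp
  have "a - rho ?X:B" using rho(2)[OF X] coset_of_eq_iff[OF B] by metis
  moreover have "Z = ?f (?X, coset_of C (a - rho ?X))" unfolding f using a by simp
  ultimately show "Z:?f`(coset_of B`A \<times> coset_of C`B)" using X by blast
 qed
 show "index_in A C = index_in A B*index_in B C"
  using bij_betw_same_card[OF bij] by (simp add: index_in_def card_cartesian_product)
 have "0:A" "0:B" using A B by (auto simp: add_subgroup_def)
 thus "fin_index A C \<longleftrightarrow> fin_index A B & fin_index B C"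
  using bij_betw_finite[OF bij] unfolding fin_index_def by (auto simp: finite_cartesian_product_iff)
qed

lemma index_scale:
 assumes "alf~=0"
 shows "index_in ((*) alf`A) ((*) alf`B) = index_in A B"
  and "fin_index ((*) alf`A) ((*) alf`B) = fin_index A B"
proof -
 have c: "coset_of ((*) alf`B) (alf*x) = (*) alf`coset_of B x" for x
  by (auto simp: coset_of_def image_image distrib_left)
 have "coset_of ((*) alf`B)`(*) alf`A = (`) ((*) alf)`(coset_of B`A)"
  by (simp add: image_image c)
 moreover have "inj_on ((`) ((*) alf)) (coset_of B`A)"
  using assms by (intro inj_onI) (metis inj_image_eq_iff inj_on_def mult_cancel_left)
 ultimately show "index_in ((*) alf`A) ((*) alf`B) = index_in A B"
  "fin_index ((*) alf`A) ((*) alf`B) = fin_index A B"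
  by (auto simp: index_in_def fin_index_def card_image finite_image_iff)
qed

lemma index_pos: "add_subgroup A ==> fin_index A B ==> index_in A B > 0"
 by (auto simp: index_in_def fin_index_def add_subgroup_def card_gt_0_iff)

lemma index_eq_1D: "add_subgroup A ==> add_subgroup B ==> index_in A B = 1 ==> A<=B"
proof
 fix x assume A: "add_subgroup A" and B: "add_subgroup B" and "index_in A B = 1" "x:A"
 then obtain X where X: "coset_of B`A = {X}" by (auto simp: index_in_def card_1_singleton_iff)
 hence "coset_of B x = coset_of B 0" using \<open>x : A\<close> add_subgroupD(1)[OF A] by blast
 thus "x:B" using coset_of_eq_iff[OF B] by simp
qed

text \<open>Pigeonhole: of the multiples of \<open>x\<close> by 0 up to \<open>index_in A B\<close>
  two lie in one coset, and their difference is a multiple in \<open>B\<close>.\<close>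

lemma index_multiple:
 assumes A: "add_subgroup A" and B: "add_subgroup B" and f: "fin_index A B" and x: "x:A"
 shows "EX k:{1..index_in A B}. of_nat k*x:B"
proof -
 have m: "of_nat k*x:A" for k by (induction k) (use add_subgroupD[OF A] x in \<open>auto simp: distrib_right\<close>)
 have "card ((%k. coset_of B (of_nat k*x))`{0..index_in A B})<=index_in A B"
  unfolding index_in_def using f m by (intro card_mono) (auto simp: fin_index_def)
 hence "~ inj_on (%k. coset_of B (of_nat k*x)) {0..index_in A B}"
  using card_image by fastforce
 then obtain i j where ij: "i < j" "j<=index_in A B" "coset_of B (of_nat j*x) = coset_of B (of_nat i*x)"
  unfolding inj_on_def by (metis atLeastAtMost_iff linorder_neqE_nat)
 hence "of_nat (j - i)*x:B" using coset_of_eq_iff[OF B] by (simp add: of_nat_diff left_diff_distrib)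
 thus ?thesis using ij by (intro bexI[of _ "j - i"]) auto
qed

text \<open>Taking k-th roots lets the constant tend to 1. Together with multiplicativity this turns
  a bound up to a constant into an exact one.\<close>

lemma le_of_power_le:
 fixes a b C :: real
 assumes "a >= 0" "b > 0" "!!k. a^k<=C*b^k"
 shows "a<=b"
proof (rule ccontr)
 assume "~ a<=b"
 hence "a/b > 1" using assms by simp
 then obtain k where "C < (a/b)^k" using real_arch_pow by blast
 hence "C*b^k < a^k" using assms by (simp add: power_divide field_simps)
 with assms(3)[of k] show False by simp
qed

locale number_ring = number_field_basis K e w for K and e :: "4 => complex => complex" and w +
 assumes w_R: "w i:R" and R_zspan: "R = zspan UNIV w"
begin

abbreviation principal :: "complex => complex set" where "principal alf \<equiv> (*) alf`R"

lemma add_subgroup_R: "add_subgroup R"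
 by (auto simp: add_subgroup_def R_add R_uminus)

lemma add_subgroup_scale:
 assumes A: "add_subgroup A"
 shows "add_subgroup ((*) alf`A)"
 unfolding add_subgroup_def
proof (intro conjI ballI)
 show "0:(*) alf`A" using add_subgroupD(1)[OF A] by (intro image_eqI[of _ _ 0]) auto
next
 fix x y assume "x:(*) alf`A" "y:(*) alf`A"
 then obtain a b where "a:A" "b:A" "x = alf*a" "y = alf*b" by blast
 thus "x + y:(*) alf`A" using add_subgroupD(2)[OF A]
  by (intro image_eqI[of _ _ "a + b"]) (auto simp: distrib_left)
next
 fix x assume "x:(*) alf`A"
 then obtain a where "a:A" "x = alf*a" by blast
 thus "- x:(*) alf`A" using add_subgroupD(3)[OF A]
  by (intro image_eqI[of _ _ "- a"]) auto
qed

definition w_bound :: real where "w_bound = (SUM i:UNIV. SUM j:UNIV. cmod (e i (w j)))"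

lemma w_bound_nonneg: "w_bound >= 0" by (auto simp: w_bound_def intro!: sum_nonneg)

lemma e_span_le:
 assumes "!!j. \<bar>real_of_rat (q j)\<bar><=t"
 shows "cmod (e i (SUM j:UNIV. of_rat (q j)*w j))<=w_bound*t"
proof -
 have t: "t >= 0" using assms[of undefined] by linarith
 have "cmod (e i (SUM j:UNIV. of_rat (q j)*w j)) = cmod (SUM j:UNIV. of_rat (q j)*e i (w j))"
  using b_K by (simp add: e_sum e_mult K_mult)
 also have "...<=(SUM j:UNIV. cmod (of_rat (q j)*e i (w j)))" by (rule norm_sum)
 also have "...<=(SUM j:UNIV. t*cmod (e i (w j)))"
  using assms by (intro sum_mono) (auto simp: norm_mult cmod_of_rat intro!: mult_right_mono)
 also have "... = t*(SUM j:UNIV. cmod (e i (w j)))" by (simp add: sum_distrib_left)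
 also have "...<=t*w_bound" unfolding w_bound_def
  using t by (intro mult_left_mono member_le_sum[of i UNIV "%i. SUM j:UNIV. cmod (e i (w j))"]) (auto intro: sum_nonneg)
 finally show ?thesis by (simp add: mult.commute)
qed

text \<open>Every coset has a representative \<open>alf*z\<close> where the coordinates of
  \<open>z\<close> are at least 0 and less than 1. Cut that unit cube into \<open>s^4\<close> small
  ones: two representatives from the same one differ by an element of norm less than 1, that is by
  0.\<close>

lemma index_principal_le_cubes:
 assumes alf: "alf:R" "alf~=0" and s: "s > 0" and small: "cmod (nrm alf)*(w_bound/real s)^4 < 1"
 shows "fin_index R (principal alf)" "index_in R (principal alf)<=s^4"
proof -
 have ag: "add_subgroup (principal alf)" by (intro add_subgroup_scale add_subgroup_R)
 define Q where "Q X x q \<longleftrightarrow> x:R & coset_of (principal alf) x = X &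
   x = alf*(SUM j:UNIV. of_rat (q j)*w j) & (ALL j. 0<=q j & q j < 1)" for X x and q :: "4 => rat"
 have rep: "EX x q. Q X x q"
  if "X:coset_of (principal alf)`R" for X
 proof -
  obtain x where x: "x:R" "X = coset_of (principal alf) x" using \<open>X : _\<close> by auto
  have "x/alf:K" using x alf R_K K_divide by blast
  then obtain q where q: "x/alf = (SUM j:UNIV. of_rat (q j)*w j)" using b_span by blast
  define y where "y = (SUM j:UNIV. of_int \<lfloor>q j\<rfloor> * w j)"
  have y: "y:R" unfolding y_def by (intro R_sum R_mult w_R) auto
  have "x - alf*y = alf*(SUM j:UNIV. of_rat (frac (q j))*w j)"
   using q alf by (simp add: y_def frac_def of_rat_diff left_diff_distrib sum_subtractf field_simps)
  moreover have "coset_of (principal alf) (x - alf*y) = X"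
   unfolding x coset_of_eq_iff[OF ag] using y R_uminus[OF y] by (auto simp: image_iff intro!: bexI[of _ "-y"])
  moreover have "x - alf*y:R" using x alf y by (intro R_diff R_mult)
  ultimately show ?thesis by (intro exI[of _ "x - alf*y"] exI[of _ "%j. frac (q j)"]) (auto simp: Q_def frac_lt_1)
 qed
 then obtain xx qq where "!!X. X:coset_of (principal alf)`R ==> Q X (xx X) (qq X)" by metis
 hence xq: "!!X. X:coset_of (principal alf)`R ==> xx X:R & coset_of (principal alf) (xx X) = X &
   xx X = alf*(SUM j:UNIV. of_rat (qq X j)*w j) & (ALL j. 0<=qq X j & qq X j < 1)" unfolding Q_def .
 let ?F = "%X j. nat \<lfloor>of_nat s*qq X j\<rfloor>"
 have inj: "inj_on ?F (coset_of (principal alf)`R)"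
 proof (rule inj_onI)
  fix X Y assume XY: "X:coset_of (principal alf)`R" "Y:coset_of (principal alf)`R" and eq: "?F X = ?F Y"
  note X = xq[OF XY(1)] and Y = xq[OF XY(2)]
  define d where "d j = qq X j - qq Y j" for j
  have db: "\<bar>real_of_rat (d j)\<bar><=1/real s" for j
  proof -
   have "nat \<lfloor>of_nat s*qq X j\<rfloor> = nat \<lfloor>of_nat s*qq Y j\<rfloor>" using fun_cong[OF eq, of j] .
   moreover have "\<lfloor>of_nat s*qq X j\<rfloor> >= 0" "\<lfloor>of_nat s*qq Y j\<rfloor> >= 0" using X Y by auto
   ultimately have "\<lfloor>of_nat s*qq X j\<rfloor> = \<lfloor>of_nat s*qq Y j\<rfloor>" using eq_nat_nat_iff by blast
   hence "\<bar>of_nat s*qq X j - of_nat s*qq Y j\<bar><=1" by linarith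
   hence "\<bar>d j\<bar> * of_nat s<=1" by (simp add: d_def right_diff_distrib[symmetric] abs_mult mult.commute)
   hence "real_of_rat (\<bar>d j\<bar> * of_nat s)<=real_of_rat 1" using of_rat_less_eq by blast
   hence "\<bar>real_of_rat (d j)\<bar> * real s<=1" by (simp add: of_rat_mult abs_if of_rat_minus split: if_splits)
   thus ?thesis using s by (simp add: field_simps)
  qed
  have xy: "xx X - xx Y = alf*(SUM j:UNIV. of_rat (d j)*w j)"
   using X Y by (simp add: d_def of_rat_diff left_diff_distrib sum_subtractf right_diff_distrib)
  let ?z = "SUM j:UNIV. of_rat (d j)*w j"
  have zK: "?z:K" by (intro K_sum K_mult b_K) auto
  have "cmod (nrm ?z) = (PROD i:UNIV. cmod (e i ?z))" by (simp add: nrm_def prod_norm)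
  also have "...<=(PROD i:(UNIV::4 set). w_bound*(1/real s))"
   by (intro prod_mono conjI norm_ge_zero e_span_le db)
  finally have "cmod (nrm ?z)<=(w_bound/real s)^4" by simp
  hence "cmod (nrm (xx X - xx Y)) < 1"
   unfolding xy using alf R_K zK small
   by (simp add: nrm_mult norm_mult) (metis (no_types, lifting) mult_left_mono norm_ge_zero order_le_less_trans)
  hence "xx X - xx Y = 0" using nrm_ge_1[of "xx X - xx Y"] X Y R_diff by force
  thus "X = Y" using X Y by auto
 qed
 have im: "?F`(coset_of (principal alf)`R)<=PiE UNIV (%_. {..<s})"
 proof
  fix f assume "f:?F`(coset_of (principal alf)`R)"
  then obtain X where X: "X:coset_of (principal alf)`R" "f = ?F X" by auto
  have "f j < s" for j
  proof -
   have "of_nat s*qq X j < of_nat s" "qq X j >= 0" using xq[OF X(1)] s by auto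
   hence "\<lfloor>of_nat s*qq X j\<rfloor> < int s" by linarith
   thus ?thesis using X s by (simp add: nat_less_iff)
  qed
  thus "f:PiE UNIV (%_. {..<s})" by auto
 qed
 have fin: "finite (PiE (UNIV :: 4 set) (%_. {..<s}))" by (intro finite_PiE) auto
 show "fin_index R (principal alf)" unfolding fin_index_def
  using finite_imageD[OF finite_subset[OF im fin] inj] .
 have "index_in R (principal alf) = card (?F`(coset_of (principal alf)`R))"
  unfolding index_in_def using card_image[OF inj] by simp
 also have "...<=card (PiE (UNIV :: 4 set) (%_. {..<s}))" by (rule card_mono[OF fin im])
 finally show "index_in R (principal alf)<=s^4" by (simp add: card_PiE)
qed

lemma index_principal_le_const:
 assumes alf: "alf:R" "alf~=0"
 shows "fin_index R (principal alf)"
  "real (index_in R (principal alf))<=(w_bound + 2)^4*cmod (nrm alf)"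
proof -
 define t where "t = root 4 (cmod (nrm alf))"
 have tn: "t^4 = cmod (nrm alf)" unfolding t_def by (intro real_root_pow_pos2) auto
 have t1: "t >= 1" using nrm_ge_1[OF alf] unfolding t_def by simp
 \<comment> \<open>Just above \<open>w_bound*t\<close>, so that the norm condition is strict;
   \<open>t >= 1\<close> keeps \<open>s\<close> at most \<open>(w_bound + 2)*t\<close>.\<close>
 define s where "s = nat \<lceil>w_bound*t\<rceil> + 1"
 have s: "real s > w_bound*t" "real s<=w_bound*t + 2" "s > 0"
  using w_bound_nonneg t1 unfolding s_def by (auto, linarith+)
 have "cmod (nrm alf)*(w_bound/real s)^4 = (w_bound*t/real s)^4"
  unfolding tn[symmetric] by (simp add: power_mult_distrib power_divide)
 also have "... < 1^4"
  using s w_bound_nonneg t1 by (intro power_strict_mono) auto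
 finally have sm: "cmod (nrm alf)*(w_bound/real s)^4 < 1" by simp
 show "fin_index R (principal alf)" using index_principal_le_cubes(1)[OF alf s(3) sm] .
 have "real (index_in R (principal alf))<=real s^4"
  using index_principal_le_cubes(2)[OF alf s(3) sm] by (metis of_nat_le_iff of_nat_power)
 also have "...<=((w_bound + 2)*t)^4"
  using s t1 by (intro power_mono) (auto simp: distrib_right)
 also have "... = (w_bound + 2)^4*cmod (nrm alf)" by (simp add: power_mult_distrib tn)
 finally show "real (index_in R (principal alf))<=(w_bound + 2)^4*cmod (nrm alf)" .
qed

lemma index_principal_mult:
 assumes "alf:R" "alf~=0" "bet:R" "bet~=0"
 shows "index_in R (principal (alf*bet)) = index_in R (principal alf)*index_in R (principal bet)"
proof -
 have e: "principal (alf*bet) = (*) alf`principal bet" by (simp add: image_image mult.assoc)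
 have "index_in R (principal (alf*bet)) = index_in R (principal alf)*index_in (principal alf) (principal (alf*bet))"
  using assms by (intro index_tower add_subgroup_scale add_subgroup_R) (auto simp: e intro!: R_mult)
 thus ?thesis unfolding e using index_scale(1)[of alf R "principal bet"] assms by simp
qed

lemma index_principal_power:
 assumes "alf:R" "alf~=0"
 shows "index_in R (principal (alf^k)) = index_in R (principal alf)^k"
proof (induction k)
 case 0
 have "coset_of R x = coset_of R 0" if "x:R" for x
  using that coset_of_eq_iff[OF add_subgroup_R, of x 0] by simp
 hence "coset_of R`R = {coset_of R 0}" using R_0 by blast
 thus ?case by (simp add: index_in_def)
next
 case (Suc k)
 thus ?case using index_principal_mult[of alf "alf^k"] assms R_power by simp
qed

text \<open>Index and norm are multiplicative, so the constant of
  \<open>index_principal_le_const\<close> disappears along the powers of \<open>alf\<close>.\<close>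

lemma index_principal_le:
 assumes "alf:R" "alf~=0"
 shows "real (index_in R (principal alf))<=cmod (nrm alf)"
proof (rule le_of_power_le[where C = "(w_bound + 2)^4"])
 fix k
 show "real (index_in R (principal alf))^k<=(w_bound + 2)^4*cmod (nrm alf)^k"
  using index_principal_le_const(2)[of "alf^k"] index_principal_power[OF assms, of k] assms R_power R_K
  by (simp add: nrm_power norm_power)
qed (use nrm_ge_1[OF assms] in auto)

text \<open>The upper bound is applied to \<open>alf\<close> and to its cofactor \<open>bet\<close>,
  where \<open>alf*bet\<close> is the integer \<open>m = nrm alf\<close>. The two bounds multiply to
  \<open>m^4\<close>, and the index of \<open>m\<close> is at least that, so both are
  equalities.\<close>

lemma index_principal:
 assumes alf: "alf:R" "alf~=0"
 shows "real (index_in R (principal alf)) = cmod (nrm alf)"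
proof -
 define bet where "bet = nrm alf/alf"
 have nz: "nrm alf~=0" using nrm_eq_0_iff R_K alf by blast
 have bet: "bet:R" "bet~=0" using cofactor_R alf nz by (auto simp: bet_def)
 have ab: "alf*bet = nrm alf" using alf by (simp add: bet_def)
 obtain m where m: "nrm alf = of_int m" using nrm_Ints alf by (auto elim: Ints_cases)
 have mz: "m~=0" using nz m by auto
 have int_ge: "real (index_in R (principal (of_int m))) >= \<bar>of_int m\<bar>^4"
 proof -
  define M where "M = nat \<bar>m\<bar>"
  let ?g = "%c::4 => nat. coset_of (principal (of_int m)) (SUM j:UNIV. of_nat (c j)*w j)"
  \<comment> \<open>Combinations of the basis with coefficients below \<open>M\<close> are pairwise
    incongruent modulo \<open>m\<close>, by uniqueness of coordinates.\<close>
  have "inj_on ?g (PiE UNIV (%_. {..<M}))"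
  proof (rule inj_onI)
   fix c d assume c: "c:PiE UNIV (%_. {..<M})" and d: "d:PiE UNIV (%_. {..<M})" and "?g c = ?g d"
   hence "(SUM j:UNIV. of_nat (c j)*w j) - (SUM j:UNIV. of_nat (d j)*w j):principal (of_int m)"
    by (simp add: coset_of_eq_iff add_subgroup_scale add_subgroup_R)
   then obtain y where y: "y:R" "(SUM j:UNIV. of_nat (c j)*w j) - (SUM j:UNIV. of_nat (d j)*w j) = of_int m*y" by auto
   obtain z where z: "y = (SUM j:UNIV. of_int (z j)*w j)" using y(1) unfolding R_zspan zspan_def by auto
   define v :: "complex^4" where "v = (\<chi> j. of_nat (c j) - of_nat (d j) - of_int m * of_int (z j))"
   have v0: "(SUM j:UNIV. (v $ j)*w j) = 0"
    using y(2) unfolding z v_def by (simp add: left_diff_distrib sum_subtractf sum_distrib_left mult.assoc)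
   have vj: "v $ j = of_int (int (c j) - int (d j) - m*z j)" for j by (simp add: v_def)
   have "embmat e w *v v = 0"
   proof -
    have "(SUM j:UNIV. e i (w j) * v $ j) = e i (SUM j:UNIV. (v $ j)*w j)" for i
     unfolding vj using b_K by (subst e_sum) (auto simp: e_mult K_mult mult.commute simp del: of_int_diff of_int_mult)
    thus ?thesis using v0 by (simp add: vec_eq_iff matrix_vector_mult_def embmat_def)
   qed
   hence "v = 0" using det_embmat hdet_nonzero_iff by blast
   hence vz: "int (c j) - int (d j) = m*z j" for j using vj[of j] by (metis eq_iff_diff_eq_0 of_int_eq_0_iff zero_index)
   have "c j = d j" for j
   proof -
    have "c j < M" "d j < M" using c d by (auto simp: PiE_def Pi_def)
    hence "\<bar>int (c j) - int (d j)\<bar> < \<bar>m\<bar>" by (auto simp: M_def)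
    moreover have "m dvd int (c j) - int (d j)" using vz by simp
    ultimately have "int (c j) - int (d j) = 0"
     using dvd_imp_le_int[of "int (c j) - int (d j)" m] by linarith
    thus ?thesis by simp
   qed
   thus "c = d" by (rule ext)
  qed
  hence "card (PiE (UNIV::4 set) (%_. {..<M})) = card (?g`(PiE UNIV (%_. {..<M})))" by (simp add: card_image)
  also have "...<=index_in R (principal (of_int m))"
   unfolding index_in_def using index_principal_le_const(1)[of "of_int m"] mz
   by (intro card_mono) (auto simp: fin_index_def intro!: R_sum R_mult w_R imageI)
  finally have "M^4<=index_in R (principal (of_int m))" by (simp add: card_PiE)
  hence "real M^4<=real (index_in R (principal (of_int m)))" by (metis of_nat_le_iff of_nat_power)
  thus ?thesis by (simp add: M_def)
 qed
 have "cmod (nrm (of_int m)) = \<bar>of_int m\<bar>^4" by (simp add: nrm_of_int norm_power)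
 hence "cmod (nrm alf)*cmod (nrm bet)<=real (index_in R (principal alf))*real (index_in R (principal bet))"
  using int_ge index_principal_mult[OF alf bet] nrm_mult[of alf bet] alf bet R_K ab m
  by (metis norm_mult of_nat_mult)
 moreover have "real (index_in R (principal alf))<=cmod (nrm alf)" "real (index_in R (principal bet))<=cmod (nrm bet)"
  using index_principal_le alf bet by blast+
 moreover have "cmod (nrm bet) > 0" using nrm_ge_1[OF bet] by linarith
 ultimately have le: "real (index_in R (principal alf))*cmod (nrm bet) >= cmod (nrm alf)*cmod (nrm bet)"
  by (meson mult_left_mono of_nat_0_le_iff order_trans)
 moreover have "cmod (nrm bet) > 0" using nrm_ge_1[OF bet] by linarith
 ultimately have "real (index_in R (principal alf)) >= cmod (nrm alf)" by (simp only: mult_le_cancel_right_pos)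
 thus ?thesis using index_principal_le[OF alf] by (rule antisym[rotated])
qed

end

section \<open>Lattice points and Minkowski's bound\<close>

lemma Im_eq_0_if_cnj_eq: "cnj z = z ==> Im z = 0"
 by (simp add: complex_eq_iff)

lemma Im_Ints: "z:\<int> ==> Im z = 0"
 by (auto elim!: Ints_cases)

text \<open>Blichfeldt's principle. The preimage \<open>S\<close> of the box under \<open>B\<close>
  has volume greater than \<open>N\<close>; folded into the unit cube it must cover some point more
  than \<open>N\<close> times. The translations involved are \<open>N + 1\<close> integer points
  whose differences are sent into the symmetric box.\<close>

lemma lattice_points_congruent_box:
 fixes B :: "real^4^4" and a :: "4 => real"
 assumes B: "hdet B~=0" and a: "!!i. a i > 0" and N: "real N * \<bar>hdet B\<bar> < (PROD i:UNIV. a i)"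
 shows "EX Z. finite Z & card Z = N + 1 & (ALL z:Z. ALL i. z $ i:\<int>) &
   (ALL z:Z. ALL z':Z. ALL i. \<bar>(B *v (z - z')) $ i\<bar><=a i)"
proof (rule ccontr)
 assume neg: "~ ?thesis"
 define T where "T = cbox 0 (\<chi> i. a i)"
 obtain B' where B': "B ** B' = mat 1" "B' ** B = mat 1"
  using B invertible_det_nz[of B] by (auto simp: invertible_def)
 define S where "S = (*v) B'`T"
 have lin: "linear ((*v) B')" by (rule matrix_vector_mul_linear)
 have BS: "B *v x:T" if xS: "x:S" for x
 proof -
  obtain t where "t:T" "x = B' *v t" using xS unfolding S_def by blast
  thus ?thesis using B' by (simp add: matrix_vector_mul_assoc)
 qed
 have Tm: "T:lmeasurable" unfolding T_def by (rule lmeasurable_cbox)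
 have Sm: "S:lmeasurable" unfolding S_def by (rule measurable_linear_image[OF lin Tm])
 have "hdet B*hdet B' = hdet (B ** B')" by (simp add: Determinants.det_mul)
 hence dd: "hdet B*hdet B' = 1" using B' by simp
 have mT: "measure lebesgue T = (PROD i:UNIV. a i)"
 proof -
  have "measure lebesgue T = measure lborel (cbox 0 (\<chi> i. a i))" by (simp add: T_def)
  also have "... = (PROD i:UNIV. a i)"
   using a by (subst content_cbox_cart) (auto simp: interval_ne_empty_cart less_imp_le)
  finally show ?thesis .
 qed
 have "measure lebesgue S = \<bar>hdet B'\<bar> * (PROD i:UNIV. a i)"
  unfolding S_def using measure_linear_image[OF lin Tm] mT by simp
 moreover have "\<bar>hdet B'\<bar> = 1 / \<bar>hdet B\<bar>" using dd B by (simp add: field_simps abs_mult[symmetric])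
 ultimately have "measure lebesgue S = (PROD i:UNIV. a i) / \<bar>hdet B\<bar>" by simp
 hence mS: "measure lebesgue S > real N" using N B by (simp add: pos_less_divide_eq)
 have "bounded S" unfolding S_def T_def by (intro bounded_linear_image bounded_cbox linear_linear lin linear_conv_bounded_linear[THEN iffD1])
 then obtain b where b: "!!x. x:S ==> norm x<=b" by (auto simp: bounded_iff)
 define m where "m = nat \<lceil>b\<rceil> + 1"
 define Z where "Z = (%f::4=>int. (\<chi> i. of_int (f i)) :: real^4)`PiE UNIV (%_. {- int m..int m})"
 have finZ: "finite Z" unfolding Z_def by (intro finite_imageI finite_PiE) auto
 have Zint: "z $ i:\<int>" if "z:Z" for z i using that by (auto simp: Z_def)
 define C where "C = cbox (0::real^4) (\<chi> i. 1)"
 \<comment> \<open>\<open>P z\<close> is the part of \<open>S\<close> in the unit cell at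
   \<open>z\<close>; its translate by \<open>- z\<close> lies in the cube \<open>C\<close>.\<close>
 define P where "P z = {x:S. ALL i. \<lfloor>x $ i\<rfloor> = \<lfloor>z $ i\<rfloor>}" for z :: "real^4"
 have Pm: "P z:lmeasurable" for z
 proof -
  have "P z = S \<inter> (INT i:UNIV. {x. of_int \<lfloor>z $ i\<rfloor><=x $ i} \<inter> {x. x $ i < of_int \<lfloor>z $ i\<rfloor> + 1})"
   by (auto simp: P_def floor_eq_iff)
  moreover have "(INT i:UNIV. {x::real^4. of_int \<lfloor>z $ i\<rfloor><=x $ i} \<inter> {x. x $ i < of_int \<lfloor>z $ i\<rfloor> + 1}):sets lebesgue"
   by (intro sets.finite_INT sets.Int) (auto intro!: lebesgue_closedin borel_closed borel_open
     sets_completionI_sets[where M = lborel] closed_halfspace_component_ge_cart open_halfspace_component_lt_cart)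
  ultimately show ?thesis using Sm by (simp add: fmeasurable_Int_fmeasurable)
 qed
 have SP: "S = (UN z:Z. P z)"
 proof (intro equalityI subsetI)
  fix x assume x: "x:S"
  have bi: "\<bar>\<lfloor>x $ i\<rfloor>\<bar><=int m" for i
  proof -
   have "\<bar>x $ i\<bar><=b" using b[OF x] component_le_norm_cart[of x i] by linarith
   thus ?thesis unfolding m_def by linarith
  qed
  define z :: "real^4" where "z = (\<chi> i. of_int \<lfloor>x $ i\<rfloor>)"
  have "z:Z" unfolding Z_def z_def using bi
   by (intro image_eqI[of _ _ "%i. \<lfloor>x $ i\<rfloor>"]) (auto simp: abs_le_iff minus_le_iff)
  moreover have "x:P z" using x by (simp add: P_def z_def)
  ultimately show "x:(UN z:Z. P z)" by blast
 qed (auto simp: P_def)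
 have dis: "disjoint_family_on P Z"
 proof (unfold disjoint_family_on_def, intro ballI impI)
  fix y z assume "y:Z" "z:Z" "y~=z"
  then obtain i where "y $ i~=z $ i" by (auto simp: vec_eq_iff)
  moreover obtain p q where "y $ i = of_int p" "z $ i = of_int q"
   using Zint[OF \<open>y : Z\<close>, of i] Zint[OF \<open>z : Z\<close>, of i] by (auto elim!: Ints_cases)
  ultimately have "\<lfloor>y $ i\<rfloor>~=\<lfloor>z $ i\<rfloor>" by simp
  thus "P y \<inter> P z = {}" by (auto simp: P_def)
 qed
 let ?U = "%z. (+) (- z)`P z"
 have Um: "?U z:lmeasurable" for z using measurable_translation[OF Pm] .
 have UC: "?U z<=C" if "z:Z" for z
 proof
  fix y assume "y:?U z"
  then obtain x where x: "x:P z" "y = x - z" by auto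
  have "0<=y $ i & y $ i<=1" for i
  proof -
   obtain p where p: "z $ i = of_int p" using Zint[OF \<open>z : Z\<close>, of i] by (auto elim!: Ints_cases)
   have "\<lfloor>x $ i\<rfloor> = p" using x p by (simp add: P_def)
   thus ?thesis using x p by (simp add: floor_eq_iff)
  qed
  thus "y:C" by (simp add: C_def mem_box_cart)
 qed
 \<comment> \<open>Here the negated claim enters: a point covered by \<open>N + 1\<close> translates
   would give the family \<open>W\<close>.\<close>
 have mult: "card {z:Z. u:?U z}<=N" for u
 proof (rule ccontr)
  assume "~ card {z:Z. u:?U z}<=N"
  hence "N + 1<=card {z:Z. u:?U z}" by simp
  then obtain W where W: "W<={z:Z. u:?U z}" "card W = N + 1" "finite W"
   using obtain_subset_with_card_n by blast
  have Wx: "u + z:S" if "z:W" for z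
  proof -
   have "u:?U z" using W that by blast
   then obtain x where "x:P z" "u = - z + x" by blast
   thus ?thesis by (simp add: P_def)
  qed
  have "\<bar>(B *v (z - z')) $ i\<bar><=a i" if "z:W" "z':W" for z z' i
  proof -
   have "B *v (z - z') = B *v (u + z) - B *v (u + z')"
    by (simp add: matrix_vector_mult_diff_distrib[symmetric])
   moreover have "0<=(B *v (u + z)) $ i & (B *v (u + z)) $ i<=a i" "0<=(B *v (u + z')) $ i & (B *v (u + z')) $ i<=a i"
    using BS[OF Wx] that by (auto simp: T_def mem_box_cart)
   ultimately show ?thesis by (simp add: abs_le_iff)
  qed
  thus False using neg W Zint by blast
 qed
 have mC: "measure lebesgue C = 1"
 proof -
  have "measure lebesgue C = measure lborel (cbox (0::real^4) (\<chi> i. 1))" by (simp add: C_def)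
  also have "... = 1" by (subst content_cbox_cart) (auto simp: interval_ne_empty_cart)
  finally show ?thesis .
 qed
 have Cm: "C:lmeasurable" unfolding C_def by (rule lmeasurable_cbox)
 have Ui: "integrable lebesgue (indicat_real (?U z))" for z
  by (intro integrable_real_indicator fmeasurableD Um) (metis Um fmeasurableD2 infinity_ennreal_def top.not_eq_extremum)
 have "measure lebesgue S = (SUM z:Z. measure lebesgue (P z))"
  unfolding SP
 proof (rule measure_finite_Union[OF finZ _ dis])
  show "P`Z<=sets lebesgue" using fmeasurableD[OF Pm] by blast
  show "emeasure lebesgue (P z)~=\<infinity>" for z
   unfolding infinity_ennreal_def by (rule fmeasurableD2[OF Pm])
 qed
 also have "... = (SUM z:Z. measure lebesgue (?U z))" by (simp add: measure_translation measure_translation_subtract)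
 also have "... = (SUM z:Z. integral\<^sup>L lebesgue (indicat_real (?U z)))"
  using Um by (intro sum.cong) (auto simp: fmeasurable_def)
 also have "... = integral\<^sup>L lebesgue (%u. SUM z:Z. indicat_real (?U z) u)"
  by (rule Bochner_Integration.integral_sum[symmetric]) (rule Ui)
 also have "...<=integral\<^sup>L lebesgue (%u. real N*indicat_real C u)"
 proof (rule integral_mono)
  show "integrable lebesgue (%u. SUM z:Z. indicat_real (?U z) u)"
   by (intro Bochner_Integration.integrable_sum Ui)
  show "integrable lebesgue (%u. real N*indicat_real C u)"
   by (intro integrable_mult_right integrable_real_indicator fmeasurableD Cm) (metis Cm fmeasurableD2 infinity_ennreal_def top.not_eq_extremum)
  fix u :: "real^4"
  have "(SUM z:Z. indicat_real (?U z) u) = real (card {z:Z. u:?U z})"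
   using finZ by (simp add: indicator_def sum.If_cases Int_def conj_commute)
  also have "...<=real N*indicat_real C u"
  proof (cases "u:C")
   case True
   thus ?thesis using mult[of u] by simp
  next
   case False
   hence "{z:Z. u:?U z} = {}" using UC by blast
   thus ?thesis by (simp only: card.empty) simp
  qed
  finally show "(SUM z:Z. indicat_real (?U z) u)<=real N*indicat_real C u" .
 qed
 also have "... = real N" using mC Cm by (simp add: fmeasurable_def)
 finally show False using mS by linarith
qed

context number_field_emb
begin

lemma conj_index: "EX piv. ALL i x. e (piv i) x = cnj (e i x)"
proof -
 have "EX j. e j = (%x. cnj (e i x))" for i
 proof -
  have "(%x. cnj (e i x)):embeddings K"
   unfolding embeddings_def by (auto simp: e_add e_mult emb_outside[OF e_emb])
  thus ?thesis using e_bij unfolding bij_betw_def by (metis (no_types, lifting) imageE)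
 qed
 then obtain piv where "!!i. e (piv i) = (%x. cnj (e i x))" by metis
 thus ?thesis by (intro exI[of _ piv]) simp
qed

definition cj :: "4 => 4" where "cj = (SOME piv. ALL i x. e (piv i) x = cnj (e i x))"

lemma e_cj: "e (cj i) x = cnj (e i x)"
 using someI_ex[OF conj_index] unfolding cj_def by blast

text \<open>Hartley-type real coordinates: unlike the usual pairs of real and imaginary parts they need no
case distinction by signature.\<close>

definition hart :: "4 => complex => real" where "hart i x = Re (e i x) + Im (e i x)"

text \<open>With \<open>p\<close> and \<open>q\<close> the real and imaginary parts, the two
  coordinates are \<open>p + q\<close> and \<open>p - q\<close>, and their squares add up to twice
  the squared modulus.\<close>

lemma cmod_e_le_hart:
 assumes "\<bar>hart i x\<bar><=t" "\<bar>hart (cj i) x\<bar><=t"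
 shows "cmod (e i x)<=t"
proof -
 define p q where "p = Re (e i x)" and "q = Im (e i x)"
 have h: "\<bar>p + q\<bar><=t" "\<bar>p - q\<bar><=t" using assms by (auto simp: hart_def e_cj p_def q_def)
 have "(p + q)^2<=t^2" "(p - q)^2<=t^2" using h by (auto simp: abs_le_square_iff[symmetric])
 moreover have "(p + q)^2 + (p - q)^2 = 2*(p^2 + q^2)" by (simp add: power2_eq_square algebra_simps)
 ultimately have "2*(p^2 + q^2)<=t^2 + t^2" by (metis add_mono)
 hence "p^2 + q^2<=t^2" by simp
 hence "(cmod (e i x))^2<=t^2" by (simp add: cmod_power2 p_def q_def)
 moreover have "t >= 0" using h by linarith
 ultimately show ?thesis by (simp add: power2_le_iff_abs_le)
qed

end

context number_ring
begin

definition disc :: real where "disc = (cmod (hdet (embmat e w)))^2"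

definition hmat :: "real^4^4" where "hmat = (\<chi> i j. hart i (w j))"

lemma disc_Nats: "EX n::nat. n > 0 & disc = real n"
proof -
 obtain z where z: "(hdet (embmat e w))^2 = of_int z" using disc_Ints[of w] w_R by (auto elim: Ints_cases)
 hence "disc = real (nat \<bar>z\<bar>)" unfolding disc_def norm_power[symmetric] by simp
 moreover have "disc~=0" using det_embmat by (simp add: disc_def)
 ultimately show ?thesis by (intro exI[of _ "nat \<bar>z\<bar>"]) auto
qed

lemma disc_ge_1: "disc >= 1"
 using disc_Nats by auto

text \<open>The product of the coordinates of \<open>x\<close> and \<open>y\<close> is the real part
  of \<open>cnj x*y\<close> plus the imaginary part of \<open>x*y\<close>, at each embedding. Summed
  over the embeddings the second part belongs to a trace and vanishes, and the first sum is
  invariant under conjugation, hence real. So \<open>hmat\<close> has the same Gram matrix as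
  \<open>embmat e w\<close> with its Hermitian product.\<close>

lemma hmat_det: "(hdet hmat)^2 = disc"
proof -
 let ?M = "embmat e w"
 let ?H = "(\<chi> i j. of_real (hmat $ i $ j)) :: complex^4^4"
 let ?C = "(\<chi> i j. cnj (?M $ i $ j)) :: complex^4^4"
 have "transpose ?H ** ?H = transpose ?C ** ?M"
 proof -
  have "(transpose ?H ** ?H) $ a $ b = (transpose ?C ** ?M) $ a $ b" for a b
  proof -
   let ?s = "SUM i:UNIV. cnj (e i (w a))*e i (w b)"
   let ?t = "SUM i:UNIV. e i (w a)*e i (w b)"
   have "inj cj"
   proof (rule injI)
    fix i j assume "cj i = cj j"
    hence "cnj (e i x) = cnj (e j x)" for x using e_cj by metis
    hence "e i = e j" by auto
    thus "i = j" using e_eq_iff by blast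
   qed
   hence bij: "bij cj" by (simp add: bij_def finite_UNIV_inj_surj)
   have "cnj ?s = (SUM i:UNIV. cnj (e (cj i) (w a))*e (cj i) (w b))" by (simp add: e_cj)
   also have "... = ?s" using sum.reindex_bij_betw[OF bij, of "%i. cnj (e i (w a))*e i (w b)"] by simp
   finally have s: "Im ?s = 0" by (rule Im_eq_0_if_cnj_eq)
   have "?t = (SUM i:UNIV. e i (w a*w b))" using b_K by (simp add: e_mult)
   hence "?t:\<int>" using trace_Ints[of "w a*w b"] w_R R_mult by simp
   hence t: "Im ?t = 0" by (rule Im_Ints)
   have "(transpose ?H ** ?H) $ a $ b = of_real (SUM i:UNIV. hart i (w a)*hart i (w b))"
    by (simp add: matrix_matrix_mult_def transpose_def hmat_def)
   also have "(SUM i:UNIV. hart i (w a)*hart i (w b)) = Re ?s + Im ?t"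
    by (simp add: hart_def sum.distrib[symmetric] algebra_simps)
   also have "of_real (Re ?s + Im ?t) = ?s" using s t by (simp add: complex_eq_iff)
   finally show ?thesis by (simp add: matrix_matrix_mult_def transpose_def embmat_def)
  qed
  thus ?thesis by (simp add: vec_eq_iff)
 qed
 hence "hdet (transpose ?H ** ?H) = hdet (transpose ?C ** ?M)" by (rule arg_cong)
 hence HC: "hdet ?H*hdet ?H = hdet ?C*hdet ?M"
  by (simp only: Determinants.det_mul Determinants.det_transpose)
 have H: "hdet ?H = of_real (hdet hmat)" by (rule hdet_hom) auto
 have C: "hdet ?C = cnj (hdet ?M)" by (rule hdet_hom) auto
 have "of_real ((hdet hmat)^2) = hdet ?H*hdet ?H" unfolding H by (simp add: power2_eq_square)
 also have "... = cnj (hdet ?M)*hdet ?M" unfolding HC C by (rule refl)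
 also have "... = of_real disc" unfolding disc_def complex_norm_square by (rule mult.commute)
 finally show ?thesis by (simp only: of_real_eq_iff)
qed

text \<open>The lattice point lemma is applied to \<open>R\<close> with \<open>N\<close> the index
  of \<open>I\<close>: among \<open>N + 1\<close> elements with small differences two are congruent
  modulo \<open>I\<close>. This works without a basis of \<open>I\<close>. The sides are symmetric
  under \<open>cj\<close> because a modulus is controlled by the two coordinates at \<open>i\<close>
  and \<open>cj i\<close>.\<close>

lemma minkowski_ideal:
 assumes I: "add_subgroup I" "I<=R" "fin_index R I"
  and t: "!!i. t i > 0" "!!i. t (cj i) = t i" and vol: "real (index_in R I) * sqrt disc < (PROD i:UNIV. t i)"
 shows "EX alf:I. alf~=0 & (ALL i. cmod (e i alf)<=t i)"
proof -
 have hd: "\<bar>hdet hmat\<bar> = sqrt disc" by (simp add: hmat_det[symmetric])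
 hence "hdet hmat~=0" using disc_ge_1 by auto
 from lattice_points_congruent_box[where B = hmat and a = t and N = "index_in R I", OF this t(1)] vol hd
 obtain Z where Z: "finite Z" "card Z = index_in R I + 1" "!!z i. z:Z ==> z $ i:\<int>"
   "!!z z' i. z:Z ==> z':Z ==> \<bar>(hmat *v (z - z')) $ i\<bar><=t i" by auto
 define g where "g z = (SUM j:UNIV. of_real (z $ j)*w j)" for z :: "real^4"
 have gR: "g z:R" if "z:Z" for z
 proof -
  have "of_real (z $ j):R" for j using Z(3)[OF that, of j] by (auto elim!: Ints_cases)
  thus ?thesis unfolding g_def by (intro R_sum R_mult w_R)
 qed
 have "card ((%z. coset_of I (g z))`Z)<=index_in R I"
  unfolding index_in_def using I(3) gR by (intro card_mono) (auto simp: fin_index_def)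
 hence "~ inj_on (%z. coset_of I (g z)) Z" using Z(2) card_image by fastforce
 then obtain z z' where zz: "z:Z" "z':Z" "z~=z'" "coset_of I (g z) = coset_of I (g z')"
  by (auto simp: inj_on_def)
 define alf where "alf = g z - g z'"
 have "alf:I" using zz(4) coset_of_eq_iff[OF I(1)] by (simp add: alf_def)
 have "ALL j. EX q. (z - z') $ j = real_of_int q"
  using Z(3)[OF zz(1)] Z(3)[OF zz(2)] by (metis Ints_cases Ints_diff vector_minus_component)
 then obtain q where q: "!!j. (z - z') $ j = real_of_int (q j)" by metis
 have alfq: "alf = (SUM j:UNIV. of_int (q j)*w j)"
 proof -
  have "alf = (SUM j:UNIV. of_real ((z - z') $ j)*w j)"
   by (simp add: alf_def g_def sum_subtractf[symmetric] left_diff_distrib)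
  thus ?thesis unfolding q by simp
 qed
 have eq: "e i alf = (SUM j:UNIV. of_int (q j)*e i (w j))" for i
  unfolding alfq using b_K by (simp add: e_sum e_mult K_mult)
 have hq: "(hmat *v (z - z')) $ i = hart i alf" for i
 proof -
  have "(hmat *v (z - z')) $ i = (SUM j:UNIV. hart i (w j)*real_of_int (q j))"
   unfolding q[symmetric] by (simp add: matrix_vector_mult_def hmat_def)
  thus ?thesis by (simp add: hart_def eq sum.distrib[symmetric] algebra_simps)
 qed
 have "alf~=0"
 proof
  assume "alf = 0"
  have "embmat e w *v (\<chi> j. of_int (q j)) = 0"
   using eq \<open>alf = 0\<close> by (simp add: vec_eq_iff matrix_vector_mult_def embmat_def mult.commute)
  hence "(\<chi> j. of_int (q j)) = (0 :: complex^4)" using det_embmat hdet_nonzero_iff by blast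
  hence "q j = 0" for j by (simp add: vec_eq_iff)
  hence "z - z' = 0" using q by (simp add: vec_eq_iff)
  thus False using zz by simp
 qed
 moreover have "cmod (e i alf)<=t i" for i
  using cmod_e_le_hart[of i alf "t i"] Z(4)[OF zz(1,2), of i] Z(4)[OF zz(1,2), of "cj i"] t(2)[of i]
  unfolding hq by simp
 ultimately show ?thesis using \<open>alf : I\<close> by blast
qed

end

section \<open>Ideals, products and Nakayama's lemma\<close>

context number_ring
begin

abbreviation ideal :: "complex set => bool" where "ideal I \<equiv> is_ideal R I"
abbreviation nzideal :: "complex set => bool" where "nzideal I \<equiv> I:nonzero_ideals R"
abbreviation ip :: "complex set => complex set => complex set" (infixl "\<star>" 70) where "I \<star> J \<equiv> ideal_prod R I J"
abbreviation inorm :: "complex set => nat" where "inorm I \<equiv> index_in R I"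

lemma nzideal_iff: "nzideal I \<longleftrightarrow> ideal I & (EX x:I. x~=0)"
 by (auto simp: nonzero_ideals_def is_ideal_def)

lemma nz_ideal: "nzideal I ==> ideal I" by (simp add: nzideal_iff)

lemma idealD:
 assumes "ideal I"
 shows "I<=R" "0:I" "x:I ==> y:I ==> x + y:I" "x:I ==> - x:I"
  "r:R ==> x:I ==> r*x:I" "r:R ==> x:I ==> x*r:I" "x:I ==> x:R"
 using assms by (auto simp: is_ideal_def mult.commute)

lemma idealI:
 assumes "I<=R" "0:I" "!!x y. x:I ==> y:I ==> x + y:I" "!!r x. r:R ==> x:I ==> r*x:I"
 shows "ideal I"
proof -
 have "- x:I" if "x:I" for x using assms(4)[of "-1" x] that R_uminus[OF R_1] by simp
 thus ?thesis using assms by (auto simp: is_ideal_def)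
qed

lemma ideal_add_subgroup: "ideal I ==> add_subgroup I"
 by (simp add: is_ideal_def add_subgroup_def)

lemma ideal_R: "ideal R" by (rule idealI) (auto intro: R_add R_mult)

lemma nzideal_R: "nzideal R" using ideal_R R_1 by (auto simp: nzideal_iff)

lemma ideal_colon:
 assumes H: "ideal H"
 shows "ideal {z:R. ALL k:A. z*k:H}"
proof (rule idealI)
 fix x y assume "x:{z:R. ALL k:A. z*k:H}" "y:{z:R. ALL k:A. z*k:H}"
 thus "x + y:{z:R. ALL k:A. z*k:H}"
  using idealD(3)[OF H] by (simp add: distrib_right R_add)
next
 fix r x assume "r:R" "x:{z:R. ALL k:A. z*k:H}"
 thus "r*x:{z:R. ALL k:A. z*k:H}"
  using idealD(5)[OF H] by (simp add: mult.assoc R_mult)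
qed (use idealD(2)[OF H] in auto)

lemma ideal_prod_ideal: "ideal I ==> ideal J ==> ideal (I \<star> J)"
proof (rule idealI)
 assume I: "ideal I" and J: "ideal J"
 have "R:{H. ideal H & (ALL x:I. ALL y:J. x*y:H)}"
  using ideal_R idealD(7)[OF I] idealD(7)[OF J] by (simp add: R_mult)
 thus "I \<star> J<=R" unfolding ideal_prod_def by (rule Inter_lower)
 show "0:I \<star> J" unfolding ideal_prod_def by (rule InterI) (simp add: idealD)
 show "x + y:I \<star> J" if "x:I \<star> J" "y:I \<star> J" for x y
  using that unfolding ideal_prod_def Inter_iff mem_Collect_eq by (simp add: idealD)
 show "r*x:I \<star> J" if "r:R" "x:I \<star> J" for r x
  using that unfolding ideal_prod_def Inter_iff mem_Collect_eq by (simp add: idealD)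
qed

lemma ideal_prod_mem: "x:I ==> y:J ==> x*y:I \<star> J"
 by (auto simp: ideal_prod_def)

lemma ideal_prod_least: "ideal H ==> (!!x y. x:I ==> y:J ==> x*y:H) ==> I \<star> J<=H"
 unfolding ideal_prod_def by (rule Inter_lower) auto

lemma ideal_prod_comm: "I \<star> J = J \<star> I"
proof -
 have "(ALL x:A. ALL y:B. x*y:H) ==> (ALL x:B. ALL y:A. x*y:H)" for A B H :: "complex set"
  by (intro ballI) (subst mult.commute, blast)
 hence "(ALL x:I. ALL y:J. x*y:H) = (ALL x:J. ALL y:I. x*y:H)" for H by blast
 thus ?thesis unfolding ideal_prod_def by simp
qed

lemma ideal_prod_mono: "ideal I' ==> ideal J' ==> I<=I' ==> J<=J' ==> I \<star> J<=I' \<star> J'"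
 by (rule ideal_prod_least) (auto intro: ideal_prod_ideal ideal_prod_mem)

lemma ideal_prod_sub: "ideal I ==> ideal J ==> I \<star> J<=I" "ideal I ==> ideal J ==> I \<star> J<=J"
 by (rule ideal_prod_least; simp add: idealD)+

text \<open>The product is only known as a least ideal, so inclusions are checked on products of
  elements. For the outer factor this uses the ideal of all \<open>z\<close> with \<open>z*k\<close>
  in the target for every \<open>k\<close> in \<open>L\<close>.\<close>

lemma ideal_prod_assoc:
 assumes "ideal I" "ideal J" "ideal L"
 shows "(I \<star> J) \<star> L = I \<star> (J \<star> L)"
proof -
 have le: "(I \<star> J) \<star> L<=I \<star> (J \<star> L)" if "ideal I" "ideal J" "ideal L" for I J L
 proof (rule ideal_prod_least)
  let ?H = "I \<star> (J \<star> L)"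
  show H: "ideal ?H" by (intro ideal_prod_ideal that)
  fix x l assume x: "x:I \<star> J" and l: "l:L"
  have "I \<star> J<={z:R. ALL k:L. z*k:?H}"
  proof (rule ideal_prod_least[OF ideal_colon[OF H]])
   fix x y assume "x:I" "y:J"
   thus "x*y:{z:R. ALL k:L. z*k:?H}"
    using idealD(7)[OF that(1)] idealD(7)[OF that(2)] by (auto simp: mult.assoc intro!: R_mult ideal_prod_mem)
  qed
  thus "x*l:?H" using x l by blast
 qed
 have "I \<star> (J \<star> L) = (L \<star> J) \<star> I" by (metis ideal_prod_comm)
 also have "...<=L \<star> (J \<star> I)" by (rule le) (use assms in auto)
 also have "... = (I \<star> J) \<star> L" by (metis ideal_prod_comm)
 finally show ?thesis using le[OF assms] by blast
qed

lemma ideal_prod_R: "ideal I ==> I \<star> R = I" "ideal I ==> R \<star> I = I"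
proof -
 assume I: "ideal I"
 have "I<=I \<star> R" using ideal_prod_mem[of _ I 1 R] by auto
 thus *: "I \<star> R = I" using ideal_prod_sub(1)[OF I ideal_R] by blast
 thus "R \<star> I = I" using ideal_prod_comm by metis
qed

lemma ideal_scale: "alf:R ==> ideal I ==> ideal ((*) alf`I)"
proof (rule idealI)
 assume a: "alf:R" and I: "ideal I"
 show "(*) alf`I<=R" using a idealD(7)[OF I] by (auto intro: R_mult)
 show "0:(*) alf`I" using idealD(2)[OF I] by force
 show "x + y:(*) alf`I" if "x:(*) alf`I" "y:(*) alf`I" for x y
  using that idealD(3)[OF I] by (auto simp flip: distrib_left)
 show "r*x:(*) alf`I" if "r:R" "x:(*) alf`I" for r x
  using that idealD(5)[OF I] by (auto simp: mult.left_commute)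
qed

lemma nzideal_scale: "alf:R ==> alf~=0 ==> nzideal I ==> nzideal ((*) alf`I)"
 using ideal_scale by (auto simp: nzideal_iff)

lemma ideal_prod_scale:
 assumes I: "ideal I" and J: "ideal J" and aI: "ideal ((*) alf`I)"
 shows "((*) alf`I) \<star> J = (*) alf`(I \<star> J)"
proof
 have H: "ideal {z:R. alf*z:((*) alf`I) \<star> J}"
  by (rule idealI) (auto simp: distrib_left mult.left_commute idealD[OF ideal_prod_ideal[OF aI J]] intro: R_add R_mult)
 have "I \<star> J<={z:R. alf*z:((*) alf`I) \<star> J}"
 proof (rule ideal_prod_least[OF H])
  fix x y assume "x:I" "y:J"
  hence "alf*x*y:((*) alf`I) \<star> J" "x*y:R"
   using idealD(7)[OF I] idealD(7)[OF J] by (auto intro!: ideal_prod_mem R_mult)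
  thus "x*y:{z:R. alf*z:((*) alf`I) \<star> J}" by (simp add: mult.assoc)
 qed
 thus sub: "(*) alf`(I \<star> J)<=((*) alf`I) \<star> J" by auto
 have "ideal ((*) alf`(I \<star> J))"
 proof (rule idealI)
  show "(*) alf`(I \<star> J)<=R" using sub idealD(1)[OF ideal_prod_ideal[OF aI J]] by blast
  show "0:(*) alf`(I \<star> J)" using idealD(2)[OF ideal_prod_ideal[OF I J]] by force
 qed (use idealD(3,5)[OF ideal_prod_ideal[OF I J]] in \<open>auto simp: mult.left_commute simp flip: distrib_left\<close>)
 thus "((*) alf`I) \<star> J<=(*) alf`(I \<star> J)"
  by (rule ideal_prod_least) (auto simp: mult.assoc intro!: imageI ideal_prod_mem)
qed

lemma nzideal_prod: "nzideal I ==> nzideal J ==> nzideal (I \<star> J)"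
 unfolding nzideal_iff using ideal_prod_ideal ideal_prod_mem by (meson mult_eq_0_iff)

lemma principal_ideal: "alf:R ==> ideal (principal alf)"
 using ideal_scale ideal_R by blast

lemma principal_nzideal: "alf:R ==> alf~=0 ==> nzideal (principal alf)"
 using nzideal_scale nzideal_R by blast

lemma principal_prod: "alf:R ==> ideal J ==> principal alf \<star> J = (*) alf`J"
 using ideal_prod_scale[OF ideal_R, of J alf] principal_ideal ideal_prod_R(2) by simp

lemma principal_sub: "ideal I ==> alf:I ==> principal alf<=I"
 using idealD(6) by blast

lemma mem_principal: "alf:principal alf"
 by (rule image_eqI[of _ _ 1]) auto

lemma ideal_eq_R_iff: "ideal I ==> I = R \<longleftrightarrow> 1:I"
 using idealD(1,5)[of I] R_1 by (metis mult.right_neutral subsetI subset_antisym)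

lemma fin_index_ideal: "nzideal I ==> fin_index R I"
proof -
 assume I: "nzideal I"
 then obtain x where x: "x:I" "x~=0" by (auto simp: nzideal_iff)
 have xR: "x:R" using idealD(7) nz_ideal[OF I] x by blast
 have "fin_index R (principal x) \<longleftrightarrow> fin_index R I & fin_index I (principal x)"
  using principal_sub[OF nz_ideal[OF I] x(1)] idealD(1)[OF nz_ideal[OF I]]
  by (intro index_tower add_subgroup_R add_subgroup_scale ideal_add_subgroup nz_ideal[OF I]) auto
 thus ?thesis using index_principal_le_const(1)[OF xR x(2)] by blast
qed

lemma inorm_pos: "nzideal I ==> inorm I > 0"
 using index_pos[OF add_subgroup_R fin_index_ideal] .

lemma inorm_tower: "nzideal I ==> nzideal J ==> I<=J ==> inorm I = inorm J*index_in J I"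
 by (intro index_tower add_subgroup_R ideal_add_subgroup nz_ideal) (auto dest: nz_ideal idealD(1))

lemma inorm_R: "inorm R = 1"
proof -
 have "principal 1 = R" by simp
 thus ?thesis using index_principal[of 1] by simp
qed

lemma inorm_1D: "nzideal I ==> inorm I = 1 ==> I = R"
 using index_eq_1D[OF add_subgroup_R ideal_add_subgroup[OF nz_ideal]] idealD(1)[OF nz_ideal] by blast

lemma inorm_mono: "nzideal I ==> nzideal J ==> I<=J ==> inorm J<=inorm I"
 using inorm_tower[of I J] inorm_pos[of I] by (metis dvd_imp_le dvd_triv_left)

lemma inorm_eqD: "nzideal I ==> nzideal J ==> I<=J ==> inorm J = inorm I ==> I = J"
proof -
 assume I: "nzideal I" and J: "nzideal J" and s: "I<=J" and e: "inorm J = inorm I"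
 hence "index_in J I = 1" using inorm_tower[OF I J s] inorm_pos[OF I] by simp
 thus ?thesis using index_eq_1D[of J I] ideal_add_subgroup nz_ideal I J s by blast
qed

lemma inorm_scale:
 assumes "alf:R" "alf~=0" "nzideal I"
 shows "inorm ((*) alf`I) = inorm (principal alf)*inorm I"
proof -
 have "inorm ((*) alf`I) = inorm (principal alf)*index_in (principal alf) ((*) alf`I)"
  using assms idealD(1)[OF nz_ideal[OF assms(3)]]
  by (intro inorm_tower nzideal_scale principal_nzideal) auto
 thus ?thesis using index_scale(1)[of alf R I] assms by simp
qed

text \<open>\<open>J\<close> has finitely many cosets modulo the multiples of a nonzero
  \<open>x\<close> in \<open>J\<close>; representatives together with the \<open>x*w i\<close>
  generate it.\<close>

lemma ideal_zspan: "nzideal J ==> EX V. finite V & V<=J & J<=zspan V (%v. v)"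
proof -
 assume J: "nzideal J"
 have ag: "add_subgroup J" "add_subgroup R" using ideal_add_subgroup nz_ideal J add_subgroup_R by blast+
 obtain x where x: "x:J" "x~=0" using J by (auto simp: nzideal_iff)
 have xR: "x:R" using idealD(7) nz_ideal[OF J] x by blast
 have xJ: "principal x<=J" by (rule principal_sub[OF nz_ideal[OF J] x(1)])
 have "fin_index R (principal x) \<longleftrightarrow> fin_index R J & fin_index J (principal x)"
  using xJ idealD(1)[OF nz_ideal[OF J]] by (intro index_tower ag add_subgroup_scale) auto
 hence fin: "finite (coset_of (principal x)`J)"
  using index_principal_le_const(1)[OF xR x(2)] by (simp add: fin_index_def)
 obtain V where V: "finite V" "V<=J" "coset_of (principal x)`J = coset_of (principal x)`V"
  using finite_subset_image[OF fin subset_refl] by (metis finite_subset_image fin subset_refl)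
 define W where "W = V \<union> range (%i. x*w i)"
 have "x*w i:J" for i using xJ w_R by blast
 hence W: "finite W" "W<=J" using V(1,2) by (auto simp: W_def)
 have "y:zspan W (%v. v)" if y: "y:J" for y
 proof -
  have "coset_of (principal x) y:coset_of (principal x)`V" using V(3) y by blast
  then obtain v where v: "v:V" "coset_of (principal x) y = coset_of (principal x) v" by blast
  hence "y - v:principal x" using coset_of_eq_iff[OF add_subgroup_scale[OF ag(2)]] by blast
  then obtain r where r: "r:zspan UNIV w" "y - v = x*r" using R_zspan by blast
  have "x*r:zspan W (%v. v)"
   by (rule zspan_mult_left[OF _ r(1)]) (use W(1) zspan_gen[of W "x*w _" "%v. v"] in \<open>auto simp: W_def\<close>)
  moreover have "v:zspan W (%v. v)" using zspan_gen[of W v "%v. v"] v W(1) by (auto simp: W_def)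
  ultimately have "x*r + v:zspan W (%v. v)" by (rule zspan_add)
  thus ?thesis using r(2) by (simp add: algebra_simps)
 qed
 thus ?thesis using W by blast
qed

lemma integral_if_stabilizes:
 assumes J: "nzideal J" and om: "omg:K" "!!x. x:J ==> omg*x:J"
 shows "omg:R"
proof -
 obtain V where V: "finite V" "V<=J" "J<=zspan V (%v. v)" using ideal_zspan[OF J] by blast
 have "EX v:V. v~=0"
 proof (rule ccontr)
  assume "~ ?thesis"
  hence "y = 0" if "y:zspan V (%v. v)" for y using that by (auto simp: zspan_def intro!: sum.neutral)
  thus False using V(3) J by (auto simp: nzideal_iff)
 qed
 then obtain v where v: "v:V" "v~=0" by blast
 have "algebraic_int omg"
  by (rule algebraic_int_if_zspan_stable[of V v "%v. v"])
    (use V om v in blast)+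
 thus ?thesis using om by (simp add: R_iff)
qed

text \<open>For a matrix \<open>C\<close> over \<open>B\<close> fixing generators of \<open>J\<close>, the determinant of \<open>1 - C\<close> kills \<open>J\<close> and is
congruent to \<open>1\<close> modulo \<open>B\<close>.\<close>

lemma nakayama:
 assumes J: "nzideal J" and B: "ideal B" and eq: "J<=J \<star> B"
 shows "1:B"
proof -
 obtain V where V: "finite V" "V<=J" "J<=zspan V (%v. v)" using ideal_zspan[OF J] by blast
 define n where "n = card V"
 obtain f where f: "bij_betw f {0..<n} V" using ex_bij_betw_nat_finite[OF V(1)] n_def by blast
 let ?S = "{SUM v:V. c v * v |c. ALL v:V. c v:B}"
 have VR: "v:R" if "v:V" for v using that V(2) idealD(7)[OF nz_ideal[OF J]] by blast
 have S: "ideal ?S"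
 proof (rule idealI)
  show "?S<=R" using VR idealD(7)[OF B] by (auto intro!: R_sum R_mult)
  show "0:?S" using idealD(2)[OF B] by (auto intro!: exI[of _ "%_. 0"])
  fix x y assume "x:?S" "y:?S"
  then obtain c d where "x = (SUM v:V. c v * v)" "y = (SUM v:V. d v * v)" "ALL v:V. c v:B" "ALL v:V. d v:B" by blast
  thus "x + y:?S" using idealD(3)[OF B]
   by (intro CollectI exI[of _ "%v. c v + d v"]) (simp add: sum.distrib distrib_right)
 next
  fix r x assume "r:R" "x:?S"
  then obtain c where "x = (SUM v:V. c v * v)" "ALL v:V. c v:B" by blast
  thus "r*x:?S" using idealD(5)[OF B \<open>r : R\<close>]
   by (intro CollectI exI[of _ "%v. r*c v"]) (simp add: sum_distrib_left mult.assoc)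
 qed
 have "J \<star> B<=?S"
 proof (rule ideal_prod_least[OF S])
  fix x y assume x: "x:J" and y: "y:B"
  obtain c where xc: "x = (SUM v:V. of_int (c v) * v)" using V(3) x by (auto simp: zspan_def)
  have "x*y = (SUM v:V. (of_int (c v)*y) * v)"
   unfolding xc sum_distrib_right by (intro sum.cong refl) (simp add: mult_ac)
  moreover have "ALL v:V. of_int (c v)*y:B" using idealD(5)[OF B R_of_int y] by blast
  ultimately show "x*y:?S" by (intro CollectI exI[of _ "%v. of_int (c v)*y"]) simp
 qed
 hence "EX c. u = (SUM v:V. c v * v) & (ALL v:V. c v:B)" if "u:V" for u
  using V(2) eq that by blast
 then obtain c where c: "!!u. u:V ==> u = (SUM v:V. c u v * v)" "!!u v. u:V ==> v:V ==> c u v:B"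
  by metis
 define A where "A = Matrix.mat n n (%(i,j). c (f i) (f j))"
 have fV: "f i:V" if "i < n" for i using f that by (auto simp: bij_betw_def)
 have Ac: "A:carrier_mat n n" by (simp add: A_def)
 define u where "u = Matrix.vec n f"
 have Au: "A *\<^sub>v u = 1 \<cdot>\<^sub>v u"
 proof (rule eq_vecI)
  fix i assume "i < dim_vec (1 \<cdot>\<^sub>v u)"
  hence i: "i < n" by (simp add: u_def)
  have "vec_index (A *\<^sub>v u) i = (SUM j:{0..<n}. c (f i) (f j)*f j)"
   using i by (simp add: scalar_prod_def A_def u_def)
  also have "... = (SUM v:V. c (f i) v * v)"
   by (rule sum.reindex_bij_betw[OF f, of "%v. c (f i) v * v"])
  also have "... = f i" using c(1)[OF fV[OF i]] by simp
  finally show "vec_index (A *\<^sub>v u) i = vec_index (1 \<cdot>\<^sub>v u) i" using i by (simp add: u_def)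
 qed (auto simp: A_def u_def)
 have "u~=0\<^sub>v n"
 proof
  assume u0: "u = 0\<^sub>v n"
  have "v = 0" if vV: "v:V" for v
  proof -
   obtain i where "i < n" "f i = v" using f vV by (auto simp: bij_betw_def)
   thus ?thesis using arg_cong[OF u0, of "%u. vec_index u i"] by (simp add: u_def)
  qed
  hence "y = 0" if "y:zspan V (%v. v)" for y using that by (auto simp: zspan_def intro!: sum.neutral)
  thus False using V(3) J by (auto simp: nzideal_iff)
 qed
 \<comment> \<open>The generators form an eigenvector for the eigenvalue 1, so the determinant of
   \<open>A\<close> minus the identity vanishes; it is expanded by the Leibniz formula.\<close>
 hence "eigenvalue A 1"
  using Au unfolding eigenvalue_def eigenvector_def by (intro exI[of _ u]) (simp add: u_def A_def)
 hence "Determinant.det (char_matrix A 1) = 0" using eigenvalue_det[OF Ac] by simp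
 moreover have "char_matrix A 1 = Matrix.mat n n (%(i,j). c (f i) (f j) - (if i = j then 1 else 0))"
  by (rule eq_matI) (auto simp: char_matrix_def A_def)
 moreover have "Determinant.det (Matrix.mat n n (%(i,j). c (f i) (f j) - (if i = j then 1 else 0))) =
   (SUM p | p permutes {0..<n}. of_int (sign p)*(PROD i=0..<n. c (f i) (f (p i)) - (if i = p i then 1 else 0)))"
  by (subst det_def'[of _ n]) (auto intro!: sum.cong prod.cong dest: permutes_in_image[where x = x for x])
 ultimately have d0: "(SUM p | p permutes {0..<n}. of_int (sign p)*(PROD i=0..<n. c (f i) (f (p i)) - (if i = p i then 1 else 0))) = 0"
  by simp
 define m where "m i j = c (f i) (f j) - (if i = j then 1 else 0)" for i j
 have mR: "m i j:R" if "i < n" "j < n" for i j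
  using c(2)[OF fV fV] that idealD(7)[OF B] by (auto simp: m_def intro!: R_diff)
 \<comment> \<open>A permutation other than the identity moves some \<open>i\<close>; the entry
   there has no diagonal term, so the whole product lies in \<open>B\<close>.\<close>
 have t: "of_int (sign p)*(PROD i=0..<n. m i (p i)):B" if p: "p permutes {0..<n}" "p~=id" for p
 proof -
  have "EX i<n. p i~=i"
  proof (rule ccontr)
   assume "~ ?thesis"
   hence "p i = i" for i using permutes_not_in[OF p(1), of i] by (cases "i < n") auto
   thus False using p(2) by (auto simp: fun_eq_iff)
  qed
  then obtain i where i: "i < n" "p i~=i" by blast
  have pl: "p j < n" if "j < n" for j using permutes_in_image[OF p(1), of j] that by simp
  have "m i (p i):B" using c(2)[OF fV[OF i(1)] fV[OF pl[OF i(1)]]] i by (simp add: m_def)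
  moreover have "(PROD j:{0..<n}-{i}. m j (p j)):R" by (rule R_prod) (auto intro: mR pl)
  moreover have "(PROD j=0..<n. m j (p j)) = m i (p i)*(PROD j:{0..<n}-{i}. m j (p j))"
   using i by (subst prod.remove[of _ i]) auto
  ultimately show ?thesis using idealD(5,6)[OF B] R_of_int by simp
 qed
 \<comment> \<open>Modulo \<open>B\<close> every diagonal entry is \<open>-1\<close>, so the product
   is congruent to a sign \<open>s\<close>.\<close>
 have d1: "EX s:{1,-1}. (PROD i=0..<k. m i i) - s:B" if "k<=n" for k
  using that
 proof (induction k)
  case 0
  thus ?case using idealD(2)[OF B] by auto
 next
  case (Suc k)
  hence "EX s:{1,-1}. (PROD i=0..<k. m i i) - s:B" by simp
  then obtain s where s: "s:{1,-1}" "(PROD i=0..<k. m i i) - s:B" by blast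
  have k: "k < n" using Suc.prems by simp
  have b: "c (f k) (f k):B" using c(2)[OF fV[OF k] fV[OF k]] .
  have "(PROD i=0..<Suc k. m i i) - (- s) = ((PROD i=0..<k. m i i) - s)*m k k + s*c (f k) (f k)"
   by (simp add: m_def algebra_simps)
  moreover have "((PROD i=0..<k. m i i) - s)*m k k:B" using idealD(6)[OF B mR[OF k k] s(2)] .
  moreover have "s*c (f k) (f k):B" using s(1) b idealD(4)[OF B] by auto
  ultimately show ?case using s(1) idealD(3)[OF B] by (intro bexI[of _ "- s"]) auto
 qed
 obtain s where s: "s:{1,-1}" "(PROD i=0..<n. m i i) - s:B" using d1[OF order_refl] by blast
 have Bsum: "sum g T:B" if "!!x. x:T ==> g x:B" for g and T :: "(nat => nat) set"
  using that by (induction T rule: infinite_finite_induct) (auto intro: idealD[OF B])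
 have fp: "finite {p. p permutes {0..<n}}" by (rule finite_permutations) simp
 have "0 = (PROD i=0..<n. m i i) + (SUM p:{p. p permutes {0..<n}} - {id}. of_int (sign p)*(PROD i=0..<n. m i (p i)))"
  using d0 fp unfolding m_def[symmetric] by (subst (asm) sum.remove[of _ id]) (auto simp: permutes_id sign_id)
 hence "(PROD i=0..<n. m i i) = - (SUM p:{p. p permutes {0..<n}} - {id}. of_int (sign p)*(PROD i=0..<n. m i (p i)))"
  by (simp add: eq_neg_iff_add_eq_0)
 moreover have "...:B" by (intro idealD(4)[OF B] Bsum) (use t in auto)
 ultimately have "(PROD i=0..<n. m i i):B" by simp
 hence "(PROD i=0..<n. m i i) + - ((PROD i=0..<n. m i i) - s):B" by (intro idealD(3,4)[OF B] s(2))
 hence "s:B" by simp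
 thus ?thesis using s(1) idealD(4)[OF B, of s] by auto
qed

end

section \<open>Finiteness of classes, invertibility and prime ideals\<close>

context number_ring
begin

definition ipow :: "complex set => nat => complex set" where
 "ipow I k = ((\<star>) I ^^ k) R"

lemma ipow_0 [simp]: "ipow I 0 = R" and ipow_Suc: "ipow I (Suc k) = I \<star> ipow I k"
 by (simp_all add: ipow_def)

lemma ipow_nz: "nzideal I ==> nzideal (ipow I k)"
 by (induction k) (simp_all add: ipow_Suc nzideal_R nzideal_prod)

lemma ipow_add: "nzideal I ==> ipow I (m + k) = ipow I m \<star> ipow I k"
 by (induction m) (simp_all add: ipow_Suc ideal_prod_R ideal_prod_assoc ipow_nz nz_ideal)

lemma ideal_prod_left_commute:
 assumes "ideal A" "ideal B" "ideal C"
 shows "A \<star> (B \<star> C) = B \<star> (A \<star> C)"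
 using ideal_prod_assoc[OF assms] ideal_prod_assoc[OF assms(2,1,3)] ideal_prod_comm[of A B] by simp

lemma ipow_prod: "nzideal I ==> nzideal J ==> ipow (I \<star> J) k = ipow I k \<star> ipow J k"
proof (induction k)
 case (Suc k)
 note id = nz_ideal[OF Suc.prems(1)] nz_ideal[OF Suc.prems(2)] nz_ideal[OF ipow_nz[OF Suc.prems(1), of k]]
  nz_ideal[OF ipow_nz[OF Suc.prems(2), of k]]
 have "ipow (I \<star> J) (Suc k) = I \<star> (J \<star> (ipow I k \<star> ipow J k))"
  using Suc by (simp add: ipow_Suc ideal_prod_assoc id ideal_prod_ideal)
 also have "... = I \<star> (ipow I k \<star> (J \<star> ipow J k))"
  by (subst ideal_prod_left_commute) (simp_all add: id)
 also have "... = ipow I (Suc k) \<star> ipow J (Suc k)"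
  by (simp add: ipow_Suc ideal_prod_assoc id ideal_prod_ideal)
 finally show ?case .
qed (simp add: ideal_prod_R ideal_R)

lemma principal_mult: "alf:R ==> bet:R ==> principal alf \<star> principal bet = principal (alf*bet)"
 by (simp add: principal_prod principal_ideal image_image mult.assoc)

lemma ipow_principal: "alf:R ==> ipow (principal alf) k = principal (alf^k)"
 by (induction k) (simp_all add: ipow_Suc principal_mult R_power)

lemma scale_inj: "alf~=0 ==> (*) alf`A = (*) alf`B \<longleftrightarrow> A = (B :: complex set)"
 by (rule inj_image_eq_iff) (auto simp: inj_on_def)

lemma scale_scale: "(*) alf`((*) bet`A) = (*) (alf*bet)`(A :: complex set)"
 by (simp add: image_image mult.assoc)

text \<open>An ideal containing \<open>m\<close> is determined by its image in the finite quotient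
  by \<open>m\<close>.\<close>

lemma finite_ideals_containing:
 assumes m: "m:R" "m~=0"
 shows "finite {B. ideal B & m:B}"
proof -
 let ?c = "coset_of (principal m)"
 have ag: "add_subgroup (principal m)" by (rule add_subgroup_scale[OF add_subgroup_R])
 have fin: "finite (?c`R)" using index_principal_le_const(1)[OF m] by (simp add: fin_index_def)
 have "inj_on (%B. ?c`B) {B. ideal B & m:B}"
 proof (rule inj_onI)
  have sub: "B<=B'" if B: "ideal B" "ideal B'" "m:B'" "?c`B = ?c`B'" for B B'
  proof
   fix x assume "x:B"
   hence "?c x:?c`B'" using B(4) by blast
   then obtain y where y: "y:B'" "?c x = ?c y" by blast
   hence "x - y:principal m" using coset_of_eq_iff[OF ag] by blast
   hence "x - y:B'" using principal_sub[OF B(2,3)] by blast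
   hence "x - y + y:B'" using idealD(3)[OF B(2)] y(1) by blast
   thus "x:B'" by simp
  qed
  fix B B' assume "B:{B. ideal B & m:B}" "B':{B. ideal B & m:B}" "?c`B = ?c`B'"
  thus "B = B'" using sub[of B B'] sub[of B' B] by blast
 qed
 moreover have "(%B. ?c`B)`{B. ideal B & m:B}<=Pow (?c`R)"
  using idealD(1) by blast
 ultimately show ?thesis using fin by (meson finite_Pow_iff finite_imageD finite_subset)
qed

lemma small_element:
 assumes I: "nzideal I"
 shows "EX alf:I. alf~=0 & real (index_in I (principal alf))<=2 * sqrt disc"
proof -
 \<comment> \<open>The factor 2 makes the volume condition strict.\<close>
 define t where "t = root 4 (2 * sqrt disc*real (inorm I))"
 have N: "real (inorm I) > 0" using inorm_pos[OF I] by simp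
 have d: "sqrt disc > 0" using disc_ge_1 by simp
 have t4: "t^4 = 2 * sqrt disc*real (inorm I)"
  unfolding t_def using N d by (intro real_root_pow_pos2) auto
 have t0: "t > 0" unfolding t_def using N d by simp
 have vol: "real (inorm I) * sqrt disc < (PROD i:(UNIV::4 set). t)" using N d by (simp add: t4)
 obtain alf where alf: "alf:I" "alf~=0" "!!i. cmod (e i alf)<=t"
  using minkowski_ideal[OF ideal_add_subgroup[OF nz_ideal[OF I]] idealD(1)[OF nz_ideal[OF I]] fin_index_ideal[OF I], of "%_. t"] t0 vol
  by blast
 have aR: "alf:R" using idealD(7)[OF nz_ideal[OF I] alf(1)] .
 have "cmod (nrm alf)<=(PROD i:(UNIV::4 set). t)"
  unfolding nrm_def prod_norm[symmetric] by (rule prod_mono) (simp add: alf)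
 hence "cmod (nrm alf)<=2 * sqrt disc*real (inorm I)" by (simp add: t4)
 moreover have "real (inorm (principal alf)) = real (inorm I)*real (index_in I (principal alf))"
  using inorm_tower[OF principal_nzideal[OF aR alf(2)] I principal_sub[OF nz_ideal[OF I] alf(1)]] by simp
 ultimately have "real (inorm I)*real (index_in I (principal alf))<=real (inorm I)*(2 * sqrt disc)"
  using index_principal[OF aR alf(2)] by (simp add: mult_ac)
 hence "real (index_in I (principal alf))<=2 * sqrt disc" using N by simp
 thus ?thesis using alf by blast
qed

text \<open>Finiteness of the class number in a usable form: up to scaling every ideal is one of the
  finitely many that contain a fixed \<open>m\<close>. Every \<open>I\<close> contains an
  \<open>alf\<close> whose multiples have index at most \<open>M\<close> in \<open>I\<close>, and
  \<open>m = fact M\<close> kills that quotient.\<close>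

lemma class_representative:
 "EX m:R. m~=0 & (ALL I. nzideal I --> (EX alf:R - {0}. EX B. ideal B & m:B & (*) alf`B = (*) m`I))"
proof -
 define M where "M = nat \<lfloor>2 * sqrt disc\<rfloor>"
 define m :: complex where "m = of_nat (fact M)"
 have m: "m:R" "m~=0" by (simp_all add: m_def del: of_nat_fact)
 have "EX alf:R - {0}. EX B. ideal B & m:B & (*) alf`B = (*) m`I" if I: "nzideal I" for I
 proof -
  note id = nz_ideal[OF I]
  obtain alf where a: "alf:I" "alf~=0" "real (index_in I (principal alf))<=2 * sqrt disc"
   using small_element[OF I] by blast
  have aR: "alf:R" using idealD(7)[OF id a(1)] .
  have le: "index_in I (principal alf)<=M" unfolding M_def using a(3) by (simp add: le_nat_floor)
  have fi: "fin_index I (principal alf)"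
   using index_tower(2)[OF add_subgroup_R ideal_add_subgroup[OF id] add_subgroup_scale[OF add_subgroup_R] principal_sub[OF id a(1)] idealD(1)[OF id]]
    index_principal_le_const(1)[OF aR a(2)] by blast
  have mI: "m*x:principal alf" if x: "x:I" for x
  proof -
   obtain k where k: "k:{1..index_in I (principal alf)}" "of_nat k*x:principal alf"
    using index_multiple[OF ideal_add_subgroup[OF id] add_subgroup_scale[OF add_subgroup_R] fi x] by blast
   have "k dvd fact M" using k(1) le by (intro dvd_fact) auto
   then obtain j where "fact M = k*j" by (auto elim: dvdE)
   hence "m*x = of_nat j*(of_nat k*x)" by (simp add: m_def del: of_nat_fact)
   thus ?thesis using idealD(5)[OF principal_ideal[OF aR] R_of_nat k(2), of j] by (simp only:)
  qed
  define B where "B = {r:R. alf*r:(*) m`I}"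
  have sI: "ideal ((*) m`I)" by (rule ideal_scale[OF m(1) id])
  have B: "ideal B" unfolding B_def
   by (rule idealI) (auto simp: distrib_left mult.left_commute[of alf] intro: R_add R_mult idealD(3,5)[OF sI] simp: idealD(2)[OF sI])
  have "m:B" using m(1) a(1) by (auto simp: B_def mult.commute)
  moreover have "(*) alf`B = (*) m`I"
  proof
   show "(*) alf`B<=(*) m`I" by (auto simp: B_def)
   show "(*) m`I<=(*) alf`B"
   proof
    fix y assume y: "y:(*) m`I"
    then obtain x where "x:I" "y = m*x" by blast
    then obtain r where "r:R" "y = alf*r" using mI by blast
    thus "y:(*) alf`B" using y by (auto simp: B_def)
   qed
  qed
  ultimately show ?thesis using aR a(2) B by blast
 qed
 thus ?thesis using m by blast
qed

text \<open>\<open>omg\<close> and each \<open>x/omg\<close> with \<open>x\<close> in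
  \<open>A\<close> stabilise \<open>J\<close>, hence are integral. So \<open>A\<close> is
  \<open>omg\<close> times an ideal \<open>B\<close> with \<open>J \<star> B = J\<close>, and
  \<open>nakayama\<close> gives \<open>B = R\<close>.\<close>

lemma stabilizer_principal:
 assumes J: "nzideal J" and A: "nzideal A" and om: "omg:K" "omg~=0" and eq: "(*) omg`J = J \<star> A"
 shows "omg:R" "A = principal omg"
proof -
 have sub: "J \<star> A<=J" by (rule ideal_prod_sub(1)[OF nz_ideal[OF J] nz_ideal[OF A]])
 show oR: "omg:R"
 proof (rule integral_if_stabilizes[OF J om(1)])
  fix x assume "x:J" thus "omg*x:J" using eq sub by blast
 qed
 have div: "x/omg:R" if x: "x:A" for x
 proof (rule integral_if_stabilizes[OF J])
  show "x/omg:K" using R_K idealD(7)[OF nz_ideal[OF A] x] om K_divide by blast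
  fix y assume "y:J"
  hence "y*x:(*) omg`J" unfolding eq by (rule ideal_prod_mem[OF _ x])
  then obtain z where "z:J" "y*x = omg*z" by blast
  moreover from this have "x/omg*y = z" using om(2) by (simp add: field_simps)
  ultimately show "x/omg*y:J" by simp
 qed
 define B where "B = {r:R. omg*r:A}"
 have B: "ideal B" unfolding B_def
  by (rule idealI) (auto simp: distrib_left mult.left_commute[of omg] intro: R_add R_mult idealD(3,5)[OF nz_ideal[OF A]] simp: idealD(2)[OF nz_ideal[OF A]])
 have AB: "A = (*) omg`B"
 proof
  show "(*) omg`B<=A" by (auto simp: B_def)
  show "A<=(*) omg`B"
  proof
   fix x assume x: "x:A"
   have "x/omg:B" using div[OF x] x om(2) by (simp add: B_def)
   thus "x:(*) omg`B" using om(2) by (intro image_eqI[of _ _ "x/omg"]) auto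
  qed
 qed
 have "J \<star> A = (*) omg`(J \<star> B)"
  using ideal_prod_scale[OF B nz_ideal[OF J], of omg] nz_ideal[OF A] AB ideal_prod_comm by metis
 hence "J = J \<star> B" using eq scale_inj[OF om(2)] by metis
 hence "1:B" by (intro nakayama[OF J B]) blast
 hence "B = R" using ideal_eq_R_iff[OF B] by blast
 thus "A = principal omg" using AB by blast
qed

lemma power_principal:
 assumes I: "nzideal I"
 shows "EX k>0. EX omg:R. omg~=0 & ipow I k = principal omg"
proof -
 obtain m where m: "m:R" "m~=0"
  "!!I. nzideal I ==> EX alf:R - {0}. EX B. ideal B & m:B & (*) alf`B = (*) m`I"
  using class_representative by blast
 have "EX alf B. alf:R & alf~=0 & ideal B & m:B & (*) alf`B = (*) m`(ipow I k)" for k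
  using m(3)[OF ipow_nz[OF I, of k]] by blast
 then obtain alf B where aB: "!!k. alf k:R" "!!k. alf k~=0" "!!k. ideal (B k)" "!!k. m:B k"
  "!!k. (*) (alf k)`(B k) = (*) m`(ipow I k)" by metis
 have "finite (range B)" by (rule finite_subset[OF _ finite_ideals_containing[OF m(1,2)]]) (use aB in auto)
 hence "~ inj B" using finite_imageD infinite_UNIV_nat by blast
 then obtain i j where ij: "i < j" "B i = B j" unfolding inj_def by (metis linorder_neq_iff)
 define k where "k = j - i"
 have "(*) (alf j)`((*) (alf i)`(B i)) = (*) (alf i)`((*) (alf j)`(B j))"
  by (simp only: scale_scale ij(2) mult.commute[of "alf j"])
 hence "(*) m`((*) (alf j)`ipow I i) = (*) m`((*) (alf i)`ipow I j)"
  unfolding aB(5) by (simp only: scale_scale mult.commute[of m])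
 hence "(*) (alf j)`ipow I i = (*) (alf i)`ipow I j" by (simp only: scale_inj[OF m(2)])
 hence "(*) (inverse (alf i))`((*) (alf j)`ipow I i) = (*) (inverse (alf i))`((*) (alf i)`ipow I j)" by simp
 hence "(*) (inverse (alf i)*alf j)`ipow I i = ipow I j"
  using aB(2)[of i] by (simp add: scale_scale)
 moreover have "ipow I j = ipow I i \<star> ipow I k" using ij(1) ipow_add[OF I, of i k] by (simp add: k_def)
 ultimately have eq: "(*) (inverse (alf i)*alf j)`ipow I i = ipow I i \<star> ipow I k" by simp
 have "inverse (alf i)*alf j:K" "inverse (alf i)*alf j~=0" using aB(1,2) R_K K_closed by auto
 hence "inverse (alf i)*alf j:R" "inverse (alf i)*alf j~=0"
  "ipow I k = principal (inverse (alf i)*alf j)"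
  using stabilizer_principal[OF ipow_nz[OF I] ipow_nz[OF I] _ _ eq] by blast+
 moreover have "k > 0" using ij(1) by (simp add: k_def)
 ultimately show ?thesis by blast
qed

lemma ideal_invertible:
 assumes I: "nzideal I"
 shows "EX I' omg. nzideal I' & omg:R & omg~=0 & I \<star> I' = principal omg"
proof -
 obtain k omg where k: "k > 0" "omg:R" "omg~=0" "ipow I k = principal omg" using power_principal[OF I] by blast
 hence "I \<star> ipow I (k - 1) = principal omg" by (simp flip: ipow_Suc)
 thus ?thesis using k ipow_nz[OF I] by blast
qed

lemma ideal_cancel:
 assumes I: "nzideal I" and A: "ideal A" and B: "ideal B" and eq: "I \<star> A = I \<star> B"
 shows "A = B"
proof -
 obtain I' omg where i: "nzideal I'" "omg:R" "omg~=0" "I \<star> I' = principal omg" using ideal_invertible[OF I] by blast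
 have *: "(*) omg`X = I' \<star> (I \<star> X)" if X: "ideal X" for X
  using principal_prod[OF i(2) X] ideal_prod_assoc[OF nz_ideal[OF i(1)] nz_ideal[OF I] X] i(4) ideal_prod_comm[of I I'] by simp
 have "(*) omg`A = (*) omg`B" using *[OF A] *[OF B] eq by simp
 thus ?thesis using scale_inj[OF i(3)] by blast
qed

text \<open>Dividing by \<open>I\<close> means multiplying by its complement \<open>I'\<close> and
  then removing the generator \<open>omg\<close>.\<close>

lemma ideal_divides:
 assumes I: "nzideal I" and A: "nzideal A" and sub: "A<=I"
 shows "EX C. nzideal C & A = I \<star> C"
proof -
 note id = nz_ideal[OF I] nz_ideal[OF A]
 obtain I' omg where i: "nzideal I'" "omg:R" "omg~=0" "I \<star> I' = principal omg" using ideal_invertible[OF I] by blast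
 define C where "C = {r:R. omg*r:A \<star> I'}"
 have AI: "ideal (A \<star> I')" by (intro ideal_prod_ideal id nz_ideal[OF i(1)])
 have C: "ideal C" unfolding C_def
  by (rule idealI) (auto simp: distrib_left mult.left_commute[of omg] intro: R_add R_mult idealD(3,5)[OF AI] simp: idealD(2)[OF AI])
 have "A \<star> I'<=principal omg"
  unfolding i(4)[symmetric] by (intro ideal_prod_mono id nz_ideal[OF i(1)] sub subset_refl)
 hence wC: "(*) omg`C = A \<star> I'" by (auto simp: C_def)
 have "(*) omg`A = I \<star> (A \<star> I')"
  using principal_prod[OF i(2) id(2)] i(4) ideal_prod_assoc[OF id(1) nz_ideal[OF i(1)] id(2)] ideal_prod_comm[of A I'] by simp
 also have "... = (*) omg`(I \<star> C)"
  using ideal_prod_scale[OF C id(1), of omg] AI wC ideal_prod_comm by metis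
 finally have eq: "A = I \<star> C" using scale_inj[OF i(3)] by blast
 have "C~={0}"
 proof
  assume "C = {0}"
  hence "I \<star> C<={0}" using C by (intro ideal_prod_least) (auto simp: is_ideal_def)
  thus False using eq A by (auto simp: nzideal_iff)
 qed
 thus ?thesis using C eq by (auto simp: nonzero_ideals_def)
qed

text \<open>Nonzero prime ideals, encoded as the nonzero maximal ideals; \<open>pideal_prime\<close>
  recovers the multiplicative property.\<close>

definition pideal :: "complex set => bool" where
 "pideal P \<longleftrightarrow> nzideal P & P~=R & (ALL A. ideal A --> P<=A --> A = P | A = R)"

lemma pideal_nz: "pideal P ==> nzideal P" by (simp add: pideal_def)

lemma pideal_ex:
 assumes J: "nzideal J" and ne: "J~=R"
 shows "EX P. pideal P & J<=P"
proof -
 let ?Q = "%P. nzideal P & P~=R & J<=P"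
 obtain P where P: "?Q P" "!!A. ?Q A ==> inorm P<=inorm A"
  using ex_has_least_nat[of ?Q J inorm] assms by blast
 have "A = P | A = R" if A: "ideal A" "P<=A" for A
 proof (rule disjCI)
  assume ne: "A~=R"
  have nz: "nzideal A" using A P(1) unfolding nzideal_iff by blast
  hence "inorm P<=inorm A" using P A ne by blast
  hence "inorm A = inorm P" using inorm_mono[OF _ nz A(2)] P(1) by simp
  thus "A = P" using inorm_eqD[OF _ nz A(2)] P(1) by blast
 qed
 thus ?thesis unfolding pideal_def using P(1) by blast
qed

text \<open>The quotient of \<open>I\<close> by \<open>I \<star> P\<close> is one-dimensional over
  the residue field: for \<open>x\<close> in \<open>I\<close> outside \<open>I \<star> P\<close>,
  the ideal generated by \<open>x\<close> and \<open>I \<star> P\<close> lies strictly above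
  \<open>I \<star> P\<close>, hence is \<open>I\<close> by maximality of \<open>P\<close>.\<close>

lemma inorm_prod_pideal:
 assumes I: "nzideal I" and P: "pideal P"
 shows "inorm (I \<star> P) = inorm I*inorm P"
proof -
 note id = nz_ideal[OF I] nz_ideal[OF pideal_nz[OF P]]
 have IP: "nzideal (I \<star> P)" using nzideal_prod I pideal_nz[OF P] by blast
 note ag = ideal_add_subgroup[OF nz_ideal[OF IP]] ideal_add_subgroup[OF id(2)]
 have sub: "I \<star> P<=I" by (rule ideal_prod_sub(1)[OF id])
 have "I \<star> P~=I"
 proof
  assume "I \<star> P = I"
  hence "1:P" by (intro nakayama[OF I id(2)]) simp
  thus False using P ideal_eq_R_iff[OF id(2)] by (simp add: pideal_def)
 qed
 then obtain x where x: "x:I" "x~:I \<star> P" using sub by blast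
 have xR: "x:R" using idealD(7)[OF id(1) x(1)] .
 define A where "A = {y. EX r:R. y - r*x:I \<star> P}"
 have A: "ideal A"
 proof (rule idealI)
  show "A<=R"
  proof
   fix y assume "y:A"
   then obtain r where "r:R" "y - r*x:I \<star> P" by (auto simp: A_def)
   hence "(y - r*x) + r*x:R" using idealD(7)[OF nz_ideal[OF IP]] xR R_mult R_add by blast
   thus "y:R" by simp
  qed
  show "0:A" using idealD(2)[OF nz_ideal[OF IP]] by (auto simp: A_def intro!: bexI[of _ 0])
  fix y z assume "y:A" "z:A"
  then obtain r s where rs: "r:R" "s:R" "y - r*x:I \<star> P" "z - s*x:I \<star> P" by (auto simp: A_def)
  hence "(y - r*x) + (z - s*x):I \<star> P" using idealD(3)[OF nz_ideal[OF IP]] by blast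
  hence "(y + z) - (r + s)*x:I \<star> P" by (simp add: algebra_simps)
  thus "y + z:A" unfolding A_def using R_add[OF rs(1,2)] by blast
 next
  fix a y assume a: "a:R" and "y:A"
  then obtain r where r: "r:R" "y - r*x:I \<star> P" by (auto simp: A_def)
  hence "a*(y - r*x):I \<star> P" using idealD(5)[OF nz_ideal[OF IP] a] by blast
  hence "a*y - (a*r)*x:I \<star> P" by (simp add: algebra_simps)
  thus "a*y:A" unfolding A_def using R_mult[OF a r(1)] by blast
 qed
 have "x:A" using idealD(2)[OF nz_ideal[OF IP]] by (auto simp: A_def intro!: bexI[of _ 1])
 have IPA: "I \<star> P<=A" by (auto simp: A_def intro!: bexI[of _ 0])
 have AI: "A<=I"
 proof
  fix y assume "y:A"
  then obtain r where r: "r:R" "y - r*x:I \<star> P" by (auto simp: A_def)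
  hence "(y - r*x) + r*x:I" using sub idealD(3,5)[OF id(1)] x(1) by blast
  thus "y:I" by simp
 qed
 have nzA: "nzideal A" using A IPA IP unfolding nzideal_iff by blast
 obtain C where C: "nzideal C" "A = I \<star> C" using ideal_divides[OF I nzA AI] by blast
 obtain I' omg where i: "nzideal I'" "omg:R" "omg~=0" "I \<star> I' = principal omg" using ideal_invertible[OF I] by blast
 have *: "(*) omg`X = I' \<star> (I \<star> X)" if X: "ideal X" for X
  using principal_prod[OF i(2) X] ideal_prod_assoc[OF nz_ideal[OF i(1)] id(1) X] i(4) ideal_prod_comm[of I I'] by simp
 have "(*) omg`P<=(*) omg`C"
  unfolding *[OF id(2)] *[OF nz_ideal[OF C(1)]]
  by (rule ideal_prod_mono) (use IPA C nz_ideal i A in auto)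
 hence "P<=C" using i(3) by (auto simp: image_iff)
 hence "C = P | C = R" using P nz_ideal[OF C(1)] unfolding pideal_def by blast
 hence "C = R" using C(2) \<open>x : A\<close> x(2) by blast
 hence AeqI: "A = I" using C(2) ideal_prod_R(1)[OF id(1)] by simp
 \<comment> \<open>The annihilator of \<open>x\<close> modulo \<open>I \<star> P\<close> is a proper
   ideal containing \<open>P\<close>, hence equal to \<open>P\<close>.\<close>
 have ker: "r*x:I \<star> P \<longleftrightarrow> r:P" if r: "r:R" for r
 proof
  assume "r:P" thus "r*x:I \<star> P" using ideal_prod_mem[OF x(1), of r P] by (simp add: mult.commute)
 next
  let ?B = "{r:R. r*x:I \<star> P}"
  have B: "ideal ?B"
   by (rule idealI) (auto simp: distrib_right mult.assoc intro: R_add R_mult idealD(3,5)[OF nz_ideal[OF IP]] simp: idealD(2)[OF nz_ideal[OF IP]])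
  have "P<=?B" using idealD(7)[OF id(2)] ideal_prod_mem[OF x(1), of _ P] by (auto simp: mult.commute)
  hence "?B = P | ?B = R" using P B unfolding pideal_def by blast
  moreover have "1~:?B" using x(2) by simp
  ultimately have "?B = P" using R_1 by metis
  moreover assume "r*x:I \<star> P"
  ultimately show "r:P" using r by blast
 qed
 have "index_in I (I \<star> P) = index_in R P"
  unfolding index_in_def
 proof (rule sym, rule bij_betw_same_card[of "%c. coset_of (I \<star> P) ((SOME r. r:R & c = coset_of P r)*x)"])
  let ?g = "%c. coset_of (I \<star> P) ((SOME r. r:R & c = coset_of P r)*x)"
  have g: "?g (coset_of P r) = coset_of (I \<star> P) (r*x)" if r: "r:R" for r
  proof -
   define s where "s = (SOME s. s:R & coset_of P r = coset_of P s)"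
   have "s:R & coset_of P r = coset_of P s" unfolding s_def by (rule someI[of _ r]) (use r in simp)
   hence s: "s:R" "r - s:P" using coset_of_eq_iff[OF ag(2)] by blast+
   hence "(s - r)*x:I \<star> P" using ker[of "s - r"] R_diff r idealD(4)[OF id(2) s(2)] by simp
   hence "s*x - r*x:I \<star> P" by (simp add: algebra_simps)
   thus ?thesis unfolding s_def[symmetric] using coset_of_eq_iff[OF ag(1)] by blast
  qed
  show "bij_betw ?g (coset_of P`R) (coset_of (I \<star> P)`I)"
   unfolding bij_betw_def
  proof
   show "inj_on ?g (coset_of P`R)"
   proof (rule inj_onI)
    fix c d assume "c:coset_of P`R" "d:coset_of P`R" and eq: "?g c = ?g d"
    then obtain r s where rs: "r:R" "s:R" "c = coset_of P r" "d = coset_of P s" by blast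
    have "coset_of (I \<star> P) (r*x) = coset_of (I \<star> P) (s*x)" using eq rs g by simp
    hence "r*x - s*x:I \<star> P" using coset_of_eq_iff[OF ag(1)] by blast
    hence "(r - s)*x:I \<star> P" by (simp add: algebra_simps)
    hence "r - s:P" using ker[of "r - s"] R_diff rs by blast
    thus "c = d" using rs coset_of_eq_iff[OF ag(2)] by blast
   qed
   have "?g`coset_of P`R = (%r. coset_of (I \<star> P) (r*x))`R"
    unfolding image_image by (rule image_cong) (use g in auto)
   also have "... = coset_of (I \<star> P)`I"
   proof
    show "(%r. coset_of (I \<star> P) (r*x))`R<=coset_of (I \<star> P)`I"
     using idealD(5)[OF id(1) _ x(1)] by blast
    show "coset_of (I \<star> P)`I<=(%r. coset_of (I \<star> P) (r*x))`R"
    proof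
     fix c assume "c:coset_of (I \<star> P)`I"
     then obtain y where y: "y:A" "c = coset_of (I \<star> P) y" using AeqI by blast
     then obtain r where "r:R" "y - r*x:I \<star> P" by (auto simp: A_def)
     thus "c:(%r. coset_of (I \<star> P) (r*x))`R"
      using y coset_of_eq_iff[OF ag(1)] by blast
    qed
   qed
   finally show "?g`coset_of P`R = coset_of (I \<star> P)`I" .
  qed
 qed
 thus ?thesis using inorm_tower[OF IP I sub] by simp
qed

lemma inorm_prod:
 assumes "nzideal I" "nzideal J"
 shows "inorm (I \<star> J) = inorm I*inorm J"
 using assms
proof (induction "inorm J" arbitrary: I J rule: less_induct)
 case less
 note id = nz_ideal[OF less.prems(1)]
 show ?case
 proof (cases "J = R")
  case False
  then obtain P where P: "pideal P" "J<=P" using pideal_ex[OF less.prems(2)] by blast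
  note nP = pideal_nz[OF P(1)]
  obtain C where C: "nzideal C" "J = P \<star> C" using ideal_divides[OF nP less.prems(2) P(2)] by blast
  have JCP: "inorm J = inorm C*inorm P" using inorm_prod_pideal[OF C(1) P(1)] C(2) ideal_prod_comm[of P C] by simp
  have "inorm P~=1" using inorm_1D[OF nP] P(1) by (auto simp: pideal_def)
  hence "inorm P > 1" using inorm_pos[OF nP] by linarith
  hence lt: "inorm C < inorm J" using JCP inorm_pos[OF C(1)] by simp
  have "I \<star> J = (I \<star> P) \<star> C" using ideal_prod_assoc[OF id nz_ideal[OF nP] nz_ideal[OF C(1)]] C(2) by simp
  hence "inorm (I \<star> J) = inorm (I \<star> P)*inorm C"
   using less.hyps[OF lt nzideal_prod[OF less.prems(1) nP] C(1)] by simp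
  thus ?thesis using inorm_prod_pideal[OF less.prems(1) P(1)] JCP by simp
 qed (simp add: ideal_prod_R id inorm_R)
qed

lemma inorm_ipow: "nzideal I ==> inorm (ipow I k) = inorm I^k"
 by (induction k) (simp_all add: ipow_Suc inorm_prod ipow_nz inorm_R)

lemma pideal_prime:
 assumes P: "pideal P" and x: "x:R" "y:R" "x*y:P"
 shows "x:P | y:P"
proof (rule disjCI)
 assume y: "y~:P"
 note id = nz_ideal[OF pideal_nz[OF P]]
 let ?B = "{r:R. r*y:P}"
 have B: "ideal ?B"
  using ideal_colon[OF id, of "{y}"] by simp
 have "P<=?B" using idealD(6,7)[OF id] x(2) by blast
 hence "?B = P | ?B = R" using P B unfolding pideal_def by blast
 moreover have "1~:?B" using y by simp
 ultimately have "?B = P" using R_1 by metis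
 thus "x:P" using x by blast
qed

lemma pideal_prod_sub:
 assumes P: "pideal P" and I: "ideal I" and J: "ideal J" and sub: "I \<star> J<=P"
 shows "I<=P | J<=P"
proof (rule ccontr)
 assume "~ ?thesis"
 then obtain x y where xy: "x:I" "x~:P" "y:J" "y~:P" by blast
 thus False using pideal_prime[OF P, of x y] ideal_prod_mem[OF xy(1,3)] sub idealD(7)[OF I] idealD(7)[OF J] by blast
qed

lemma pideal_sub_eq: "pideal P ==> pideal Q ==> P<=Q ==> P = Q"
 using nz_ideal[of Q] by (metis pideal_def)

lemma nat_in_ideal: "nzideal I ==> EX k>0. k<=inorm I & of_nat k:I"
proof -
 assume I: "nzideal I"
 obtain k where "k:{1..inorm I}" "of_nat k*1:I"
  using index_multiple[OF add_subgroup_R ideal_add_subgroup[OF nz_ideal[OF I]] fin_index_ideal[OF I] R_1] by blast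
 thus ?thesis by (intro exI[of _ k]) simp
qed

end

section \<open>Counting ideals and torsion classes\<close>

text \<open>The Riemann zeta value at \<open>s\<close>, for \<open>s > 1\<close>.\<close>

definition zeta_sum :: "real => real" where "zeta_sum s = suminf (%n. 1/real (Suc n) powr s)"

text \<open>Rankin's trick: a tuple whose product is at most \<open>X\<close> has weight at least 1
  when weighted by the \<open>s\<close>-th power of \<open>X\<close> over the product, and the sum
  of these weights factors into zeta values. An exponent slightly above 1 absorbs the logarithms of
  the exact count.\<close>

lemma card_bounded_products:
 assumes s: "s > 1" and X: "X >= 0"
 shows "finite {f:{..<k} \<rightarrow>\<^sub>E {1..}. real (PROD j<k. f j)<=X}"
  and "real (card {f:{..<k} \<rightarrow>\<^sub>E {1..}. real (PROD j<k. f j)<=X})<=zeta_sum s^k*X powr s"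
proof -
 define N where "N = nat \<lfloor>X\<rfloor>"
 let ?T = "{f:{..<k} \<rightarrow>\<^sub>E {1..}. real (PROD j<k. f j)<=X}"
 have T: "?T<={..<k} \<rightarrow>\<^sub>E {1..N}"
 proof
  fix f assume f: "f:?T"
  have "f i<=N" if i: "i < k" for i
  proof -
   have ge: "f j >= 1" if "j < k" for j using f that by (auto simp: PiE_iff)
   have "(PROD j:{..<k} - {i}. f j) >= 1" by (rule prod_ge_1) (use ge in auto)
   hence "f i*1<=f i*(PROD j:{..<k} - {i}. f j)" by (rule mult_left_mono) simp
   also have "... = (PROD j<k. f j)" using i by (subst prod.remove[of _ i]) auto
   finally have "real (f i)<=real (PROD j<k. f j)" by (simp only: mult_1_right of_nat_le_iff)
   also have "...<=X" using f by simp
   finally show ?thesis unfolding N_def by (simp add: le_nat_floor)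
  qed
  thus "f:{..<k} \<rightarrow>\<^sub>E {1..N}" using f by (auto simp: PiE_iff)
 qed
 have finP: "finite ({..<k} \<rightarrow>\<^sub>E {1..N})" by (intro finite_PiE) auto
 thus fin: "finite ?T" using T finite_subset by blast
 have sm: "summable (%n. 1/real (Suc n) powr s)"
  using summable_real_powr_iff[of "- s"] s by (subst summable_Suc_iff) (simp add: powr_minus_divide)
 have Z: "(SUM n:{1..N}. 1/real n powr s)<=zeta_sum s"
 proof -
  have "(SUM n:{1..N}. 1/real n powr s) = (SUM n<N. 1/real (Suc n) powr s)"
   by (rule sum.reindex_bij_witness[of _ Suc "%n. n - 1"]) auto
  also have "...<=zeta_sum s" unfolding zeta_sum_def by (rule sum_le_suminf[OF sm]) auto
  finally show ?thesis .
 qed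
 have "real (card ?T) = (SUM f:?T. 1)" by simp
 also have "...<=(SUM f:?T. X powr s*(PROD j<k. 1/real (f j) powr s))"
 proof (rule sum_mono)
  fix f assume f: "f:?T"
  have ge: "f j >= 1" if "j < k" for j using f that by (auto simp: PiE_iff)
  have "(PROD j<k. real (f j)) > 0"
  proof (rule prod_pos)
   fix j assume "j:{..<k}"
   thus "0 < real (f j)" using ge[of j] by simp
  qed
  moreover have "(PROD j<k. real (f j))<=X" using f by simp
  ultimately have "(PROD j<k. real (f j)) powr s<=X powr s" "(PROD j<k. real (f j)) powr s > 0"
   using powr_mono2[of s "PROD j<k. real (f j)" X] s powr_gt_zero[of "PROD j<k. real (f j)" s] by linarith+
  moreover have "(PROD j<k. 1/real (f j) powr s) = 1/(PROD j<k. real (f j)) powr s"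
   by (simp only: prod_dividef prod_powr_distrib prod.neutral_const)
  ultimately show "1<=X powr s*(PROD j<k. 1/real (f j) powr s)" by simp
 qed
 also have "...<=(SUM f:{..<k} \<rightarrow>\<^sub>E {1..N}. X powr s*(PROD j<k. 1/real (f j) powr s))"
 proof (rule sum_mono2[OF finP T])
  show "0<=X powr s*(PROD j<k. 1/real (f j) powr s)" for f
   by (intro mult_nonneg_nonneg prod_nonneg) auto
 qed
 also have "... = X powr s*(PROD j<k. SUM n:{1..N}. 1/real n powr s)"
  by (subst prod_sum_PiE) (auto simp: sum_distrib_left)
 also have "...<=X powr s*zeta_sum s^k"
  using Z by (intro mult_left_mono) (auto intro!: power_mono sum_nonneg)
 finally show "real (card ?T)<=zeta_sum s^k*X powr s" by (simp add: mult.commute)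
qed

context number_ring
begin

text \<open>For a prime ideal this is the rational prime below it
  (\<open>below_prime\<close>).\<close>

definition below :: "complex set => nat" where "below P = (LEAST k. k > 0 & of_nat k:P)"

lemma below:
 assumes P: "nzideal P"
 shows "below P > 0" "of_nat (below P):P" "below P<=inorm P"
  "k > 0 ==> of_nat k:P ==> below P<=k"
proof -
 obtain k where k: "k > 0" "k<=inorm P" "of_nat k:P" using nat_in_ideal[OF P] by blast
 have "below P > 0 & of_nat (below P):P" unfolding below_def by (rule LeastI[of _ k]) (use k in simp)
 thus "below P > 0" "of_nat (below P):P" by auto
 show le: "below P<=k" if "k > 0" "of_nat k:P" for k unfolding below_def by (rule Least_le) (use that in simp)
 show "below P<=inorm P" using le[OF k(1,3)] k(2) by simp
qed

lemma below_prime: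
 assumes P: "pideal P"
 shows "prime (below P)"
proof (rule prime_natI)
 note nz = pideal_nz[OF P]
 note b = below[OF nz]
 have "below P~=1"
 proof
  assume "below P = 1"
  hence "1:P" using b(2) by simp
  thus False using P ideal_eq_R_iff[OF nz_ideal[OF nz]] by (simp add: pideal_def)
 qed
 thus "below P >= 2" using b(1) by linarith
 fix x y assume "below P dvd x*y"
 show "below P dvd x | below P dvd y"
 proof -
  have dv: "below P dvd x" if x: "of_nat x:P" for x
  proof -
   have "of_nat (below P*(x div below P)):P" using idealD(6)[OF nz_ideal[OF nz] R_of_nat b(2)] by simp
   hence "of_nat x + - of_nat (below P*(x div below P)):P"
    using idealD(3,4)[OF nz_ideal[OF nz]] x by blast
   moreover have "of_nat x = (of_nat (below P*(x div below P)) + of_nat (x mod below P) :: complex)"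
    by (simp only: mult_div_mod_eq flip: of_nat_add)
   ultimately have "of_nat (x mod below P):P" by simp
   hence "x mod below P = 0" using b(4)[of "x mod below P"] mod_less_divisor[OF b(1), of x] by linarith
   thus ?thesis by blast
  qed
  obtain j where "x*y = below P*j" using \<open>below P dvd x * y\<close> by (auto elim: dvdE)
  hence "of_nat x * of_nat y:P" using idealD(6)[OF nz_ideal[OF nz] R_of_nat b(2), of j] by (metis of_nat_mult)
  thus ?thesis using pideal_prime[OF P R_of_nat R_of_nat] dv by blast
 qed
qed

text \<open>Distinct primes are divided out one after another; a prime containing
  \<open>P \<star> C\<close> but different from \<open>P\<close> contains \<open>C\<close>.\<close>

lemma prod_inorm_le:
 assumes "finite S" "ALL P:S. pideal P" "nzideal A" "ALL P:S. A<=P"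
 shows "(PROD P:S. inorm P)<=inorm A"
 using assms
proof (induction S arbitrary: A rule: finite_induct)
 case empty
 thus ?case using inorm_pos[of A] by simp
next
 case (insert P S)
 have P: "pideal P" using insert.prems by blast
 obtain C where C: "nzideal C" "A = P \<star> C"
  using ideal_divides[OF pideal_nz[OF P] insert.prems(2)] insert.prems(3) by blast
 have "C<=Q" if Q: "Q:S" for Q
 proof -
  have pQ: "pideal Q" using insert.prems Q by blast
  have "P \<star> C<=Q" using insert.prems(3) Q C by blast
  hence "P<=Q | C<=Q" using pideal_prod_sub[OF pQ nz_ideal[OF pideal_nz[OF P]] nz_ideal[OF C(1)]] by blast
  moreover have "~ P<=Q" using pideal_sub_eq[OF P pQ] insert.hyps Q by blast
  ultimately show ?thesis by blast
 qed
 hence "(PROD P:S. inorm P)<=inorm C" using insert.IH[of C] insert.prems C by blast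
 thus ?case using insert.hyps inorm_prod[OF pideal_nz[OF P] C(1)] C(2) by simp
qed

lemma inorm_of_nat: "k > 0 ==> inorm (principal (of_nat k)) = k^4"
 using index_principal[of "of_nat k"] nrm_of_int[of "int k"]
 by (simp add: norm_power flip: of_nat_power)

text \<open>Each prime above \<open>p\<close> has norm at least \<open>p\<close>, while the product
  of these norms is at most the norm \<open>p^4\<close> of \<open>p\<close>.\<close>

lemma card_above_le:
 assumes "finite S" "ALL P:S. pideal P & below P = p"
 shows "card S<=4"
proof (cases "S = {}")
 case False
 then obtain Q where "Q:S" by blast
 hence "pideal Q" "below Q = p" using assms(2) by auto
 hence p: "p > 1" using below_prime[of Q] prime_gt_1_nat by auto
 have nz: "nzideal (principal (of_nat p))" using p by (intro principal_nzideal) auto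
 have sub: "principal (of_nat p)<=P" if PS: "P:S" for P
 proof -
  have P: "pideal P" "below P = p" using assms(2) PS by auto
  show ?thesis using below(2)[OF pideal_nz[OF P(1)]] principal_sub[OF nz_ideal[OF pideal_nz[OF P(1)]]] P(2) by simp
 qed
 have "p^card S<=(PROD P:S. inorm P)"
 proof -
  have "(PROD P:S. p)<=(PROD P:S. inorm P)"
  proof (rule prod_mono)
   fix P assume "P:S"
   hence P: "pideal P" "below P = p" using assms(2) by auto
   show "0<=p & p<=inorm P" using below(3)[OF pideal_nz[OF P(1)]] P(2) by simp
  qed
  thus ?thesis by simp
 qed
 also have "...<=inorm (principal (of_nat p))"
  by (rule prod_inorm_le[OF assms(1) _ nz]) (use sub assms(2) in auto)
 also have "... = p^4" using inorm_of_nat[of p] p by simp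
 finally show ?thesis using p power_increasing_iff[of p "card S" 4] by simp
qed simp

lemma labelling:
 "EX lab :: complex set => nat. (ALL P. lab P < 4) & (ALL P Q. pideal P --> pideal Q --> below P = below Q --> lab P = lab Q --> P = Q)"
proof -
 let ?S = "%p. {P. pideal P & below P = p}"
 have "EX f. inj_on f (?S p) & f`?S p<={..<(4::nat)}" for p
 proof -
  have fin: "finite (?S p)"
  proof (rule ccontr)
   assume "infinite (?S p)"
   then obtain T where T: "finite T" "card T = 5" "T<=?S p" using infinite_arbitrarily_large[of "?S p" 5] by metis
   have "ALL P:T. pideal P & below P = p" using T(3) by blast
   hence "card T<=4" by (rule card_above_le[OF T(1)])
   thus False using T(2) by simp
  qed
  have "card (?S p)<=4" by (rule card_above_le[OF fin, of p]) (simp only: mem_Collect_eq Ball_def simp_thms)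
  hence "card (?S p)<=card {..<(4::nat)}" by (simp only: card_lessThan)
  from card_le_inj[OF fin finite_lessThan this]
  obtain f where "f`?S p<={..<(4::nat)}" "inj_on f (?S p)" by (elim exE conjE)
  thus ?thesis by blast
 qed
 then obtain f where f: "!!p. inj_on (f p) (?S p)" "!!p. f p`?S p<={..<(4::nat)}"
  using choice[of "%p f. inj_on f (?S p) & f`?S p<={..<(4::nat)}"] by blast
 define lab where "lab P = (if pideal P then f (below P) P else 0)" for P
 have "lab P < 4" for P
 proof (cases "pideal P")
  case True
  hence "f (below P) P:f (below P)`?S (below P)" by blast
  thus ?thesis using f(2)[of "below P"] True by (auto simp: lab_def)
 qed (simp add: lab_def)
 moreover have "P = Q" if "pideal P" "pideal Q" "below P = below Q" "lab P = lab Q" for P Q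
  using inj_onD[OF f(1)[of "below P"], of P Q] that by (simp add: lab_def)
 ultimately show ?thesis by blast
qed

definition lprod :: "complex set list => complex set" where "lprod Ps = fold (\<star>) Ps R"

lemma factorization:
 assumes "nzideal J"
 shows "EX Ps. (ALL P:set Ps. pideal P) & J = lprod Ps & prod_list (map inorm Ps) = inorm J"
 using assms
proof (induction "inorm J" arbitrary: J rule: less_induct)
 case less
 show ?case
 proof (cases "J = R")
  case True
  thus ?thesis by (intro exI[of _ "[]"]) (simp add: lprod_def inorm_R)
 next
  case False
  then obtain P where P: "pideal P" "J<=P" using pideal_ex[OF less.prems] by blast
  note nP = pideal_nz[OF P(1)]
  obtain C where C: "nzideal C" "J = P \<star> C" using ideal_divides[OF nP less.prems P(2)] by blast
  have "inorm P~=1" using inorm_1D[OF nP] P(1) by (auto simp: pideal_def)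
  hence "inorm P > 1" using inorm_pos[OF nP] by linarith
  moreover have eq: "inorm J = inorm P*inorm C" using inorm_prod[OF nP C(1)] C(2) by simp
  ultimately have "inorm C < inorm J" using inorm_pos[OF C(1)] by simp
  then obtain Ps where Ps: "ALL P:set Ps. pideal P" "C = lprod Ps" "prod_list (map inorm Ps) = inorm C"
   using less.hyps C(1) by blast
  thus ?thesis using P(1) C(2) eq by (intro exI[of _ "Ps @ [P]"]) (simp add: lprod_def)
 qed
qed

lemma lprod_mset:
 assumes "ALL P:set Ps. pideal P" "mset Ps = mset Qs"
 shows "lprod Ps = lprod Qs"
 unfolding lprod_def
proof (rule fold_permuted_eq[where P = ideal])
 have i: "ideal P" if "P:set Ps" for P using assms(1) that nz_ideal pideal_nz by blast
 show "ideal (P \<star> z)" if "P:set Ps" "ideal z" for P z using i that ideal_prod_ideal by blast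
 show "P \<star> (Q \<star> z) = Q \<star> (P \<star> z)" if "P:set Ps" "Q:set Ps" "ideal z" for P Q z
  using that i by (intro ideal_prod_left_commute)
qed (use assms(2) ideal_R in auto)

text \<open>Labelling the at most four primes above each rational prime turns an ideal into four integers
whose product is its norm.\<close>

lemma card_ideals_le:
 assumes s: "s > 1" and X: "X >= 0"
 shows "finite {J. nzideal J & real (inorm J)<=X}"
  "real (card {J. nzideal J & real (inorm J)<=X})<=zeta_sum s^4*X powr s"
proof -
 obtain lab :: "complex set => nat" where lab0: "(ALL P. lab P < 4) & (ALL P Q. pideal P --> pideal Q --> below P = below Q --> lab P = lab Q --> P = Q)"
  using labelling by (rule exE)
 hence lab: "lab P < 4" "pideal P ==> pideal Q ==> below P = below Q ==> lab P = lab Q ==> P = Q" for P Q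
  by simp_all
 define fac where "fac J = (SOME Ps. (ALL P:set Ps. pideal P) & J = lprod Ps & prod_list (map inorm Ps) = inorm J)" for J
 have fac: "(ALL P:set (fac J). pideal P) & J = lprod (fac J) & prod_list (map inorm (fac J)) = inorm J" if J: "nzideal J" for J
  unfolding fac_def by (rule someI_ex[OF factorization[OF J]])
 \<comment> \<open>Component \<open>j\<close> multiplies the rational primes below the factors
   labelled \<open>j\<close>; \<open>restrict\<close> makes it an element of the function space that
   is counted.\<close>
 define tup where "tup J = restrict (%j. prod_list (map below (filter (%P. lab P = j) (fac J)))) {..<4}" for J
 let ?S = "{J. nzideal J & real (inorm J)<=X}"
 let ?T = "{f:{..<4} \<rightarrow>\<^sub>E {1..}. real (PROD j<4. f j)<=X}"
 have "inj_on tup ?S"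
 proof (rule inj_onI)
  fix J L assume J: "J:?S" and L: "L:?S" and eq: "tup J = tup L"
  have pf: "prime_factorization (tup A j) = mset (map below (filter (%P. lab P = j) (fac A)))"
   if "A:?S" "j < 4" for A j
  proof -
   have "tup A j = prod_mset (mset (map below (filter (%P. lab P = j) (fac A))))"
    using that(2) by (simp add: tup_def prod_mset_prod_list[symmetric] del: prod_mset_prod_list mset_map)
   moreover have "p :# mset (map below (filter (%P. lab P = j) (fac A))) ==> prime p" for p
    using fac[of A] that(1) below_prime by auto
   ultimately show ?thesis using prime_factorization_prod_mset_primes by metis
  qed
  \<comment> \<open>Unique factorization of the component returns the primes below, and the prime
    below together with the label determines the ideal.\<close>
  have fl: "mset (filter (%P. lab P = j) (fac J)) = mset (filter (%P. lab P = j) (fac L))" if j: "j < 4" for j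
  proof (rule multiset.inj_map_strong)
   show "image_mset below (mset (filter (%P. lab P = j) (fac J))) = image_mset below (mset (filter (%P. lab P = j) (fac L)))"
    using pf[OF J j] pf[OF L j] eq by simp
   fix P Q assume "P :# mset (filter (%P. lab P = j) (fac J))" "Q :# mset (filter (%P. lab P = j) (fac L))" "below P = below Q"
   thus "P = Q" using fac[of J] fac[of L] J L lab(2)[of P Q] by auto
  qed
  have "count (mset (fac J)) P = count (mset (fac L)) P" for P
  proof -
   have c: "count (mset (filter (%Q. lab Q = lab P) xs)) P = count (mset xs) P" for xs by simp
   show ?thesis using arg_cong[OF fl[OF lab(1)[of P]], of "%M. count M P"] unfolding c .
  qed
  hence "mset (fac J) = mset (fac L)" by (rule multiset_eqI)
  thus "J = L" using lprod_mset[of "fac J" "fac L"] fac[of J] fac[of L] J L by simp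
 qed
 moreover have "tup`?S<=?T"
 proof
  fix f assume "f:tup`?S"
  then obtain J where J: "nzideal J" "real (inorm J)<=X" "f = tup J" by blast
  have ps: "ALL P:set (fac J). pideal P" and pl: "prod_list (map inorm (fac J)) = inorm J" using fac[OF J(1)] by auto
  have pos: "prod_list (map below Ps) > 0" if "ALL P:set Ps. pideal P" for Ps
   using that by (induction Ps) (auto simp: below(1)[OF pideal_nz])
  have "tup J j >= 1" if "j < 4" for j
   using pos[of "filter (%P. lab P = j) (fac J)"] ps that by (simp add: tup_def Suc_le_eq)
  moreover have "(PROD j<4. prod_list (map below (filter (%P. lab P = j) Ps))) = prod_list (map below Ps)" for Ps
  proof (induction Ps)
   case (Cons P Ps)
   have "(PROD j<4. prod_list (map below (filter (%P. lab P = j) (P # Ps)))) =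
     (PROD j<4. (if j = lab P then below P else 1)*prod_list (map below (filter (%P. lab P = j) Ps)))"
    by (intro prod.cong) auto
   thus ?case using Cons lab(1)[of P] by (simp add: prod.distrib)
  qed simp
  hence "(PROD j<4. tup J j) = prod_list (map below (fac J))" by (simp add: tup_def)
  moreover have "prod_list (map below Ps)<=prod_list (map inorm Ps)" if "ALL P:set Ps. pideal P" for Ps
   using that by (induction Ps) (auto intro!: mult_mono below(3) pideal_nz)
  hence "prod_list (map below (fac J))<=inorm J" using ps pl by metis
  ultimately have "(PROD j<4. tup J j)<=inorm J" by simp
  hence "real (PROD j<4. tup J j)<=X" using J(2) by linarith
  moreover have "tup J:{..<4} \<rightarrow>\<^sub>E {1..}"
   using \<open>!!j. j < 4 ==> tup J j >= 1\<close> by (auto simp: PiE_iff tup_def)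
  ultimately show "f:?T" using J(3) by simp
 qed
 ultimately show "finite ?S" "real (card ?S)<=zeta_sum s^4*X powr s"
  using card_bounded_products[OF s X, of 4] inj_on_finite card_inj_on_le[of tup ?S ?T] by auto
qed

end

section \<open>The class group and its torsion\<close>

context number_ring
begin

abbreviation cls :: "complex set => complex set set" where "cls I \<equiv> ideal_equiv R `` {I}"

lemma ideal_equiv_iff: "(I, J):ideal_equiv R \<longleftrightarrow> nzideal I & nzideal J &
  (EX alf:R - {0}. EX bet:R - {0}. (*) alf`I = (*) bet`J)"
 by (simp add: ideal_equiv_def)

lemma ideal_equiv_equiv: "equiv (nonzero_ideals R) (ideal_equiv R)"
proof (rule equivI)
 show "refl_on (nonzero_ideals R) (ideal_equiv R)"
  by (rule refl_onI) (auto simp: ideal_equiv_iff intro!: bexI[of _ 1])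
 show "ideal_equiv R<=nonzero_ideals R \<times> nonzero_ideals R" by (auto simp: ideal_equiv_iff)
 show "sym (ideal_equiv R)"
 proof (rule symI)
  fix I J assume "(I, J):ideal_equiv R"
  then obtain alf bet where "nzideal I" "nzideal J" "alf:R - {0}" "bet:R - {0}" "(*) alf`I = (*) bet`J"
   unfolding ideal_equiv_iff by blast
  thus "(J, I):ideal_equiv R" unfolding ideal_equiv_iff by metis
 qed
 show "trans (ideal_equiv R)"
 proof (rule transI)
  fix I J L assume "(I, J):ideal_equiv R" "(J, L):ideal_equiv R"
  then obtain alf bet gam dlt where h: "nzideal I" "nzideal L" "alf:R - {0}" "bet:R - {0}" "(*) alf`I = (*) bet`J"
   "gam:R - {0}" "dlt:R - {0}" "(*) gam`J = (*) dlt`L"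
   unfolding ideal_equiv_iff by (elim conjE bexE) rule
  have "(*) (gam*alf)`I = (*) gam`((*) bet`J)" by (simp only: scale_scale[symmetric] h(5))
  also have "... = (*) bet`((*) dlt`L)" by (simp only: scale_scale mult.commute[of gam] h(8)[symmetric])
  finally have "(*) (gam*alf)`I = (*) (bet*dlt)`L" by (simp only: scale_scale)
  moreover have "gam*alf:R - {0}" "bet*dlt:R - {0}" using h R_mult by auto
  ultimately show "(I, L):ideal_equiv R" unfolding ideal_equiv_iff using h(1,2) by blast
 qed
qed

lemma cls_eq_iff: "nzideal I ==> nzideal J ==> cls I = cls J \<longleftrightarrow> (I, J):ideal_equiv R"
 using eq_equiv_class_iff[OF ideal_equiv_equiv] .

lemma prod_scale2:
 assumes "nzideal I" "nzideal J" "alf:R" "bet:R"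
 shows "(*) (alf*bet)`(I \<star> J) = ((*) alf`I) \<star> ((*) bet`J)"
proof -
 note id = nz_ideal[OF assms(1)] nz_ideal[OF assms(2)]
 have "((*) alf`I) \<star> ((*) bet`J) = (*) alf`(I \<star> ((*) bet`J))"
  by (intro ideal_prod_scale id ideal_scale assms)
 also have "I \<star> ((*) bet`J) = (*) bet`(J \<star> I)"
  by (subst ideal_prod_comm) (intro ideal_prod_scale id ideal_scale assms)
 finally show ?thesis by (simp only: scale_scale ideal_prod_comm[of I J])
qed

text \<open>The group operation picks representatives by choice; equivalent ideals have equivalent
  products, so any representatives may be used.\<close>

lemma class_mult:
 assumes I: "nzideal I" and J: "nzideal J"
 shows "cls I \<otimes>\<^bsub>class_group K\<^esub> cls J = cls (I \<star> J)"
proof -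
 have some: "(A, SOME X. X:cls A):ideal_equiv R" if "nzideal A" for A
 proof -
  have "A:cls A" using equiv_class_self[OF ideal_equiv_equiv that] .
  hence "(SOME X. X:cls A):cls A" by (rule someI)
  thus ?thesis by (simp only: Image_singleton_iff)
 qed
 define I' where "I' = (SOME X. X:cls I)"
 define J' where "J' = (SOME X. X:cls J)"
 obtain alf bet where a: "nzideal I'" "alf:R - {0}" "bet:R - {0}" "(*) alf`I = (*) bet`I'"
  using some[OF I] unfolding I'_def[symmetric] ideal_equiv_iff by blast
 obtain gam dlt where c: "nzideal J'" "gam:R - {0}" "dlt:R - {0}" "(*) gam`J = (*) dlt`J'"
  using some[OF J] unfolding J'_def[symmetric] ideal_equiv_iff by blast
 have "(*) (alf*gam)`(I \<star> J) = (*) (bet*dlt)`(I' \<star> J')"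
  using prod_scale2[OF I J, of alf gam] prod_scale2[OF a(1) c(1), of bet dlt] a c by simp
 moreover have "alf*gam:R - {0}" "bet*dlt:R - {0}" using a c R_mult by auto
 ultimately have "(I \<star> J, I' \<star> J'):ideal_equiv R"
  unfolding ideal_equiv_iff using nzideal_prod I J a(1) c(1) by blast
 hence "cls (I \<star> J) = cls (I' \<star> J')" using cls_eq_iff[OF nzideal_prod[OF I J] nzideal_prod[OF a(1) c(1)]] by simp
 thus ?thesis by (simp add: class_group_def Let_def I'_def J'_def)
qed

lemma class_pow: "nzideal I ==> cls I [^]\<^bsub>class_group K\<^esub> (l::nat) = cls (ipow I l)"
proof (induction l)
 case 0
 thus ?case by (simp add: nat_pow_def class_group_def Let_def)
next
 case (Suc l)
 have "cls I [^]\<^bsub>class_group K\<^esub> (Suc l) = (cls I [^]\<^bsub>class_group K\<^esub> l) \<otimes>\<^bsub>class_group K\<^esub> cls I"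
  by (simp add: nat_pow_def)
 thus ?case using Suc class_mult[OF ipow_nz[OF Suc.prems] Suc.prems, of l]
  by (simp add: ipow_Suc ideal_prod_comm[of I])
qed

lemma torsion_representative:
 assumes "c:class_torsion K l"
 shows "EX I tau. nzideal I & c = cls I & tau:R & tau~=0 & ipow I l = principal tau"
proof -
 have c: "c:nonzero_ideals R // ideal_equiv R" "c [^]\<^bsub>class_group K\<^esub> l = cls R"
  using assms by (auto simp: class_torsion_def class_group_def Let_def)
 then obtain I where I: "nzideal I" "c = cls I" by (auto elim: quotientE)
 hence "cls (ipow I l) = cls R" using class_pow c(2) by simp
 hence "(ipow I l, R):ideal_equiv R" using cls_eq_iff ipow_nz I(1) nzideal_R by blast
 then obtain alf bet where ab: "alf:R" "alf~=0" "bet:R" "bet~=0" "(*) alf`ipow I l = principal bet"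
  unfolding ideal_equiv_iff by blast
 have "bet:(*) alf`ipow I l" unfolding ab(5) by (rule mem_principal)
 then obtain x where x: "x:ipow I l" "bet = alf*x" by blast
 have "(*) alf`ipow I l = (*) alf`principal x" unfolding ab(5) x(2) by (simp only: scale_scale)
 hence "ipow I l = principal x" by (simp only: scale_inj[OF ab(2)])
 moreover have "x:R" using idealD(7)[OF nz_ideal[OF ipow_nz[OF I(1)]] x(1)] .
 ultimately show ?thesis using I ab(4) x(2) by auto
qed

text \<open>For a torsion class \<open>[I]\<close> with \<open>I\<^sup>l = (tau)\<close> and \<open>A\<close> from the given family, Minkowski yields \<open>alf\<close> in \<open>I A\<close> whose
conjugates are small relative to \<open>|tau|\<^bsup>1/l\<^esup>\<close>. The pair \<open>([I], A)\<close> is recovered from \<open>alf (I A)\<^sup>-\<^sup>1\<close> and the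
logarithmic cell of \<open>alf\<close>.\<close>

lemma torsion_card_bound:
 assumes l: "l >= 1" and A: "finite AA" "!!aa. aa:AA ==> nzideal aa"
  and excl: "!!aa bb x y. aa:AA ==> bb:AA ==> aa~=bb ==> x:R ==> x~=0 ==> y:R ==> y~=0 ==>
   (*) x`ipow aa l = (*) y`ipow bb l ==>
   (!!i. cmod (e i (y/x))<=exp (real l)*(real (inorm aa)/real (inorm bb)) powr (real l/4)) ==> False"
 shows "card (class_torsion K l)*card AA <=
  card {J. nzideal J & real (inorm J)<=2 * sqrt disc} * (nat \<lfloor>ln (2 * sqrt disc)\<rfloor> + 1)^4"
proof -
 define D where "D = 2 * sqrt disc"
 have D1: "D >= 2" unfolding D_def using disc_ge_1 by simp
 define M where "M = nat \<lfloor>ln D\<rfloor>"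
 define Ic where "Ic c = (SOME I. EX tau. nzideal I & c = cls I & tau:R & tau~=0 & ipow I l = principal tau)" for c
 define tau where "tau c = (SOME tau. nzideal (Ic c) & c = cls (Ic c) & tau:R & tau~=0 & ipow (Ic c) l = principal tau)" for c
 have rep: "nzideal (Ic c) & c = cls (Ic c) & tau c:R & tau c~=0 & ipow (Ic c) l = principal (tau c)"
  if c: "c:class_torsion K l" for c
  unfolding tau_def by (rule someI_ex, unfold Ic_def) (rule someI_ex[OF torsion_representative[OF c]])
 \<comment> \<open>These behave like the absolute values of the conjugates of a generator of
   \<open>Ic c\<close>: their product is its norm (\<open>wprod\<close>).\<close>
 define w where "w c i = cmod (e i (tau c)) powr (1/real l)" for c i
 \<comment> \<open>Chosen so that the box with sides \<open>r aa*w c i\<close> has volume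
   \<open>D\<close> times the norm of \<open>Ic c \<star> aa\<close>.\<close>
 define r where "r aa = (D*real (inorm aa)) powr (1/4)" for aa
 have wpos: "w c i > 0" if "c:class_torsion K l" for c i
  using rep[OF that] e_eq_0_iff[of "tau c" i] R_K by (simp add: w_def)
 have wl: "w c i^l = cmod (e i (tau c))" if "c:class_torsion K l" for c i
 proof -
  have "cmod (e i (tau c)) > 0" using rep[OF that] e_eq_0_iff[of "tau c" i] R_K by simp
  thus ?thesis using l by (simp add: w_def powr_powr flip: powr_realpow)
 qed
 have wprod: "(PROD i:UNIV. w c i) = real (inorm (Ic c))" if c: "c:class_torsion K l" for c
 proof -
  have "(PROD i:UNIV. w c i)^l = cmod (nrm (tau c))"
   unfolding nrm_def prod_norm[symmetric] prod_power_distrib by (simp only: wl[OF c])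
  also have "... = real (inorm (ipow (Ic c) l))" using rep[OF c] index_principal[of "tau c"] by simp
  also have "... = real (inorm (Ic c))^l" using rep[OF c] inorm_ipow[of "Ic c" l] by (simp only: of_nat_power)
  finally have "(PROD i:UNIV. w c i)^l = real (inorm (Ic c))^l" .
  moreover have "(PROD i:UNIV. w c i) >= 0" by (rule prod_nonneg) (simp add: w_def)
  ultimately show ?thesis using power_eq_imp_eq_base[of "PROD i:UNIV. w c i" l "real (inorm (Ic c))"] l by simp
 qed
 have rpos: "r aa > 0" if "aa:AA" for aa using D1 inorm_pos[OF A(2)[OF that]] by (simp add: r_def)
 have r4: "r aa^4 = D*real (inorm aa)" if "aa:AA" for aa
 proof -
  have "D*real (inorm aa) > 0" using D1 inorm_pos[OF A(2)[OF that]] by simp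
  moreover have "r aa^4 = (D*real (inorm aa)) powr (real 4*(1/4))" unfolding r_def
   by (rule powr_power) (use \<open>D * real (inorm aa) > 0\<close> in linarith)
  moreover have "real 4*(1/4) = 1" by simp
  ultimately show ?thesis using powr_one[of "D*real (inorm aa)"] by (simp only: less_imp_le)
 qed
 \<comment> \<open>The ratios of \<open>cmod (e i alf)\<close> to the sides of the box are at most 1
   and their product is at least \<open>1/D\<close>, so each lies between \<open>1/D\<close> and 1.
   Their negative logarithms fall into \<open>M + 1\<close> unit cells.\<close>
 have ex: "EX alf J. alf:R & alf~=0 & nzideal J & real (inorm J)<=D & principal alf = (Ic c \<star> aa) \<star> J &
   (ALL i. 0<=- ln (cmod (e i alf)/(r aa*w c i)) & - ln (cmod (e i alf)/(r aa*w c i))<=ln D)"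
  if c: "c:class_torsion K l" and a: "aa:AA" for c aa
 proof -
  have nI: "nzideal (Ic c \<star> aa)" using rep[OF c] A(2)[OF a] nzideal_prod by blast
  define N where "N = inorm (Ic c \<star> aa)"
  have N: "N = inorm (Ic c)*inorm aa" unfolding N_def using inorm_prod rep[OF c] A(2)[OF a] by blast
  have N0: "real N > 0" unfolding N_def using inorm_pos[OF nI] by simp
  have prodt: "(PROD i:UNIV. r aa*w c i) = D*real N"
   by (simp add: prod.distrib wprod[OF c] r4[OF a] N)
  have tcj: "r aa*w c (cj i) = r aa*w c i" for i by (simp add: w_def e_cj)
  have tpos: "r aa*w c i > 0" for i using rpos[OF a] wpos[OF c] by simp
  have vol: "real N * sqrt disc < (PROD i:UNIV. r aa*w c i)"
   unfolding prodt D_def using N0 disc_ge_1 by simp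
  obtain alf where al: "alf:Ic c \<star> aa" "alf~=0" "!!i. cmod (e i alf)<=r aa*w c i"
   using minkowski_ideal[OF ideal_add_subgroup[OF nz_ideal[OF nI]] idealD(1)[OF nz_ideal[OF nI]] fin_index_ideal[OF nI], of "%i. r aa*w c i"]
    tpos tcj vol unfolding N_def by blast
  have aR: "alf:R" using idealD(7)[OF nz_ideal[OF nI] al(1)] .
  obtain J where J: "nzideal J" "principal alf = (Ic c \<star> aa) \<star> J"
   using ideal_divides[OF nI principal_nzideal[OF aR al(2)] principal_sub[OF nz_ideal[OF nI] al(1)]] by blast
  have nrma: "cmod (nrm alf) = real N*real (inorm J)"
   using index_principal[OF aR al(2)] J inorm_prod[OF nI J(1)] by (simp add: N_def)
  have le: "cmod (nrm alf)<=D*real N"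
   unfolding prodt[symmetric] nrm_def prod_norm[symmetric] by (rule prod_mono) (simp add: al)
  hence "real N*real (inorm J)<=real N*D" unfolding nrma by (simp add: mult.commute)
  hence JD: "real (inorm J)<=D" using N0 by simp
  define rho where "rho i = cmod (e i alf)/(r aa*w c i)" for i
  have rho: "rho i > 0" "rho i<=1" for i
   using al(2,3) tpos[of i] e_eq_0_iff[OF R_K[OF aR], of i] by (auto simp: rho_def field_simps)
  have "(PROD i:UNIV. rho i) = cmod (nrm alf)/(D*real N)"
   unfolding rho_def prod_dividef prodt by (simp add: nrm_def prod_norm)
  also have "... >= 1/D"
  proof -
   have "real N*1<=real N*real (inorm J)"
    using inorm_pos[OF J(1)] by (intro mult_left_mono) auto
   thus ?thesis unfolding nrma using D1 N0 by (simp add: field_simps)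
  qed
  finally have prho: "(PROD i:UNIV. rho i) >= 1/D" .
  have "rho i >= 1/D" for i
  proof -
   have "(PROD i:UNIV. rho i) = rho i*(PROD j:UNIV - {i}. rho j)" by (rule prod.remove) auto
   also have "...<=rho i*1" using rho by (intro mult_left_mono prod_le_1) (auto intro: less_imp_le)
   finally show ?thesis using prho by simp
  qed
  hence lnr: "ln (1/D)<=ln (rho i)" for i using D1 by (intro ln_mono) auto
  have "0<=- ln (rho i) & - ln (rho i)<=ln D" for i using rho[of i] D1 lnr[of i] by (simp add: ln_div)
  thus ?thesis using aR al(2) J JD unfolding rho_def by blast
 qed
 define V where "V alf c aa i = - ln (cmod (e i alf)/(r aa*w c i))" for alf c aa i
 have ex': "EX g. fst g:R & fst g~=0 & nzideal (snd g) & real (inorm (snd g))<=D &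
   principal (fst g) = (Ic (fst p) \<star> snd p) \<star> snd g &
   (ALL i. 0<=V (fst g) (fst p) (snd p) i & V (fst g) (fst p) (snd p) i<=ln D)"
  if "p:class_torsion K l \<times> AA" for p
 proof -
  have p: "fst p:class_torsion K l" "snd p:AA" using that by auto
  show ?thesis using ex[OF p] unfolding V_def by (metis fst_conv snd_conv)
 qed
 define G where "G p = (SOME g. fst g:R & fst g~=0 & nzideal (snd g) & real (inorm (snd g))<=D &
   principal (fst g) = (Ic (fst p) \<star> snd p) \<star> snd g &
   (ALL i. 0<=V (fst g) (fst p) (snd p) i & V (fst g) (fst p) (snd p) i<=ln D))" for p
 define al where "al p = fst (G p)" for p
 define Jf where "Jf p = snd (G p)" for p
 have G: "al p:R & al p~=0 & nzideal (Jf p) & real (inorm (Jf p))<=D &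
   principal (al p) = (Ic (fst p) \<star> snd p) \<star> Jf p &
   (ALL i. 0<=V (al p) (fst p) (snd p) i & V (al p) (fst p) (snd p) i<=ln D)"
  if "p:class_torsion K l \<times> AA" for p
  unfolding al_def Jf_def G_def by (rule someI_ex[OF ex'[OF that]])
 define cell where "cell p = (%i::4. nat \<lfloor>V (al p) (fst p) (snd p) i\<rfloor>)" for p
 let ?S = "{J. nzideal J & real (inorm J)<=D}"
 let ?T = "?S \<times> ((UNIV :: 4 set) \<rightarrow>\<^sub>E {..M})"
 have into: "(Jf p, cell p):?T" if p: "p:class_torsion K l \<times> AA" for p
 proof -
  have "cell p i<=M" for i unfolding cell_def M_def using G[OF p] by (intro nat_mono floor_mono) blast
  thus ?thesis using G[OF p] by (simp add: PiE_iff)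
 qed
 have inj: "inj_on (%p. (Jf p, cell p)) (class_torsion K l \<times> AA)"
 proof (rule inj_onI)
  fix p q assume p: "p:class_torsion K l \<times> AA" and q: "q:class_torsion K l \<times> AA"
   and "(Jf p, cell p) = (Jf q, cell q)"
  hence Jeq: "Jf p = Jf q" and celleq: "cell p = cell q" by auto
  obtain c aa where pc: "p = (c, aa)" "c:class_torsion K l" "aa:AA" using p by blast
  obtain d bb where qd: "q = (d, bb)" "d:class_torsion K l" "bb:AA" using q by blast
  define alf where "alf = al p"
  define bet where "bet = al q"
  define J where "J = Jf p"
  have a: "alf:R" "alf~=0" "nzideal J" "principal alf = (Ic c \<star> aa) \<star> J"
   using G[OF p] by (simp_all add: alf_def J_def pc(1))
  have b: "bet:R" "bet~=0" "principal bet = (Ic d \<star> bb) \<star> J"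
   using G[OF q] by (simp_all add: bet_def J_def Jeq qd(1))
  have nzs: "nzideal (Ic c)" "nzideal (Ic d)" "nzideal aa" "nzideal bb" using rep pc qd A(2) by blast+
  note ids = nzs[THEN nz_ideal] nz_ideal[OF a(3)]
  let ?I = "Ic c \<star> aa" and ?I' = "Ic d \<star> bb"
  have nI: "nzideal ?I" "nzideal ?I'" using nzideal_prod nzs by blast+
  have "J \<star> ((*) bet`?I) = J \<star> ((*) alf`?I')"
  proof -
   have "J \<star> ((*) bet`?I) = (*) bet`(?I \<star> J)"
    by (subst ideal_prod_comm) (intro ideal_prod_scale ideal_scale b(1) nz_ideal[OF nI(1)] ids)
   also have "... = (*) alf`(?I' \<star> J)" unfolding a(4)[symmetric] b(3)[symmetric]
    by (simp only: scale_scale mult.commute[of alf])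
   also have "... = J \<star> ((*) alf`?I')"
    by (subst ideal_prod_comm, rule sym) (intro ideal_prod_scale ideal_scale a(1) nz_ideal[OF nI(2)] ids)
   finally show ?thesis .
  qed
  hence eqI: "(*) bet`?I = (*) alf`?I'"
   by (rule ideal_cancel[OF a(3) ideal_scale[OF b(1) nz_ideal[OF nI(1)]] ideal_scale[OF a(1) nz_ideal[OF nI(2)]]])
  have "aa = bb"
  proof (rule ccontr)
   assume ne: "aa~=bb"
   \<comment> \<open>The \<open>l\<close>-th power of \<open>eqI\<close>: the torsion ideals become
     the principal ideals of \<open>tau c\<close> and \<open>tau d\<close>.\<close>
   define x where "x = bet^l*tau c"
   define y where "y = alf^l*tau d"
   have xy: "x:R" "x~=0" "y:R" "y~=0"
    using a b rep[OF pc(2)] rep[OF qd(2)] by (auto simp: x_def y_def intro!: R_mult R_power)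
   have pw: "ipow ((*) bet`(Ic c \<star> aa)) l = (*) (bet^l*tau c)`ipow aa l"
    if bet: "bet:R" "bet~=0" and c: "c:class_torsion K l" and a: "aa:AA" for bet c aa
   proof -
    note nI = nzideal_prod[OF conjunct1[OF rep[OF c]] A(2)[OF a]]
    have "(*) bet`(Ic c \<star> aa) = principal bet \<star> (Ic c \<star> aa)"
     by (rule principal_prod[symmetric, OF bet(1) nz_ideal[OF nI]])
    hence "ipow ((*) bet`(Ic c \<star> aa)) l = principal (bet^l) \<star> (ipow (Ic c) l \<star> ipow aa l)"
     using ipow_prod[OF principal_nzideal[OF bet] nI] ipow_prod[of "Ic c" aa] rep[OF c] A(2)[OF a] ipow_principal[OF bet(1)] by simp
    also have "... = principal (bet^l) \<star> ((*) (tau c)`ipow aa l)"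
     using rep[OF c] principal_prod[of "tau c", OF _ nz_ideal[OF ipow_nz[OF A(2)[OF a]]]] by simp
    also have "... = (*) (bet^l)`((*) (tau c)`ipow aa l)"
     using rep[OF c] by (intro principal_prod R_power bet ideal_scale nz_ideal[OF ipow_nz[OF A(2)[OF a]]]) auto
    finally show ?thesis by (simp only: scale_scale)
   qed
   have eq: "(*) x`ipow aa l = (*) y`ipow bb l"
    unfolding x_def y_def using pw[OF b(1,2) pc(2,3)] pw[OF a(1,2) qd(2,3)] eqI by simp
   \<comment> \<open>The factors \<open>w\<close> cancel against \<open>tau\<close>. What remains is
     the ratio of two \<open>rho\<close> values from the same cell, at most \<open>exp 1\<close>,
     and the ratio \<open>r aa/r bb\<close>, both raised to the power \<open>l\<close>.\<close>
   have "cmod (e i (y/x))<=exp (real l)*(real (inorm aa)/real (inorm bb)) powr (real l/4)" for i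
   proof -
    define rho where "rho = cmod (e i alf)/(r aa*w c i)"
    define rho' where "rho' = cmod (e i bet)/(r bb*w d i)"
    note pos = wpos[OF pc(2), of i] wpos[OF qd(2), of i] rpos[OF pc(3)] rpos[OF qd(3)]
    have rp: "rho > 0" "rho' > 0"
     using pos a b e_eq_0_iff R_K by (auto simp: rho_def rho'_def)
    have "nat \<lfloor>- ln rho\<rfloor> = nat \<lfloor>- ln rho'\<rfloor>" "0<=- ln rho" "0<=- ln rho'"
     using fun_cong[OF celleq, of i] G[OF p] G[OF q]
     by (simp_all add: cell_def V_def rho_def rho'_def alf_def bet_def pc(1) qd(1))
    hence "ln rho - ln rho'<=1" by linarith
    hence "ln (rho/rho')<=1" using rp by (simp add: ln_div)
    hence rr: "rho/rho'<=exp 1" using rp by (metis divide_pos_pos exp_le_cancel_iff exp_ln)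
    have "cmod (e i (y/x)) = (cmod (e i alf)^l*w d i^l)/(cmod (e i bet)^l*w c i^l)"
     using xy a b rep[OF pc(2)] rep[OF qd(2)] wl[OF pc(2), of i] wl[OF qd(2), of i]
     by (simp add: x_def y_def e_divide e_mult e_power R_K K_closed norm_divide norm_mult norm_power)
    also have "... = ((rho/rho')*(r aa/r bb))^l"
     using pos rp by (simp add: rho_def rho'_def field_simps)
    also have "...<=(exp 1*(r aa/r bb))^l"
     using rr pos rp by (intro power_mono mult_right_mono) auto
    also have "... = exp (real l)*(r aa/r bb)^l" using exp_of_nat_mult[of l "1::real"] by (simp only: power_mult_distrib mult_1_right)
    also have "(r aa/r bb)^l = (real (inorm aa)/real (inorm bb)) powr (real l/4)"
    proof -
     have "r aa/r bb = (real (inorm aa)/real (inorm bb)) powr (1/4)"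
      unfolding r_def using D1 by (simp flip: powr_divide)
     thus ?thesis using l inorm_pos[OF nzs(3)] inorm_pos[OF nzs(4)] by (simp only:) (subst powr_power, auto)
    qed
    finally show ?thesis .
   qed
   thus False using excl[OF pc(3) qd(3) ne xy eq] by blast
  qed
  \<comment> \<open>Cancelling the common \<open>aa\<close> leaves two equivalent ideals.\<close>
  moreover have "c = d"
  proof -
   have "aa \<star> ((*) bet`Ic c) = aa \<star> ((*) alf`Ic d)"
   proof -
    have "aa \<star> ((*) bet`Ic c) = (*) bet`?I"
     by (subst ideal_prod_comm) (intro ideal_prod_scale ideal_scale b(1) ids)
    also have "... = (*) alf`(Ic d \<star> aa)" using eqI \<open>aa = bb\<close> by simp
    also have "... = aa \<star> ((*) alf`Ic d)"
     by (subst ideal_prod_comm, rule sym) (intro ideal_prod_scale ideal_scale a(1) ids)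
    finally show ?thesis .
   qed
   hence "(*) bet`Ic c = (*) alf`Ic d"
    by (rule ideal_cancel[OF nzs(3) ideal_scale[OF b(1) ids(1)] ideal_scale[OF a(1) ids(2)]])
   hence "(Ic c, Ic d):ideal_equiv R" unfolding ideal_equiv_iff using nzs a b by blast
   hence "cls (Ic c) = cls (Ic d)" using cls_eq_iff nzs by blast
   thus ?thesis using rep[OF pc(2)] rep[OF qd(2)] by metis
  qed
  ultimately show "p = q" using pc qd by blast
 qed
 have finS: "finite ?S" using card_ideals_le(1)[of 2 D] D1 by simp
 have "card (class_torsion K l \<times> AA)<=card ?T"
  by (rule card_inj_on_le[OF inj]) (use into finS in \<open>auto intro!: finite_PiE\<close>)
 also have "... = card ?S*(M + 1)^4" by (simp add: card_cartesian_product card_PiE)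
 finally show ?thesis unfolding card_cartesian_product D_def M_def .
qed

end

section \<open>Degree one primes in a quartic tower\<close>

text \<open>With \<open>c^2 = d\<close> modulo \<open>p\<close>, \<open>F m\<close> is congruent to
  \<open>(m^2 - A)*(m^2 - B)\<close>, where \<open>A*B\<close> is \<open>t^2\<close> times a
  nonresidue; so one of \<open>A\<close>, \<open>B\<close> is a square. The resulting root
  \<open>m0\<close> is simple, hence if \<open>p^2\<close> divides \<open>F m0\<close> it does not
  divide \<open>F (m0 + p)\<close>.\<close>

lemma exact_root_mod_prime:
 fixes t u v d :: int and p :: nat
 defines "F \<equiv> %m. (m^2 - t*u)^2 - t^2 * v^2*d"
 assumes p: "prime p" "odd p" and d: "Legendre d (int p) = 1" and nu: "Legendre (u^2 - d * v^2) (int p) = -1"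
  and nd: "~ int p dvd t" "~ int p dvd v"
 shows "EX m. ~ int p dvd 2*m & int p dvd F m & ~ int p^2 dvd F m"
proof -
 let ?p = "int p"
 have pp: "prime ?p" "?p > 2"
  using p prime_ge_2_nat[OF p(1)] by (auto simp: le_less)
 obtain c where c: "[c^2 = d] (mod ?p)" "~ ?p dvd d"
  using d unfolding Legendre_def QuadRes_def by (auto split: if_splits simp: cong_0_iff)
 have nu': "~ QuadRes ?p (u^2 - d * v^2)" "~ ?p dvd u^2 - d * v^2"
  using nu unfolding Legendre_def by (auto split: if_splits simp: cong_0_iff)
 have cdv: "?p dvd c^2 - d" using c(1) by (simp add: cong_iff_dvd_diff)
 have nc: "~ ?p dvd c"
 proof
  assume "?p dvd c"
  hence "?p dvd c^2" by (simp add: power2_eq_square)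
  hence "?p dvd c^2 - (c^2 - d)" using cdv by (rule dvd_diff)
  thus False using c(2) by simp
 qed
 define A where "A = t*(u + v * c)"
 define B where "B = t*(u - v * c)"
 have AB: "[A*B = t^2*(u^2 - d * v^2)] (mod ?p)"
 proof -
  have "A*B - t^2*(u^2 - d * v^2) = - (t^2 * v^2)*(c^2 - d)" by (simp add: A_def B_def algebra_simps power2_eq_square)
  thus ?thesis unfolding cong_iff_dvd_diff using cdv by simp
 qed
 have n2: "~ ?p dvd 2" using pp(2) zdvd_imp_le[of ?p 2] by auto
 have nAB: "~ ?p dvd A*B"
 proof -
  have "~ ?p dvd t^2*(u^2 - d * v^2)"
   using nd nu'(2) by (simp add: prime_dvd_mult_iff[OF pp(1)] prime_dvd_power_iff[OF pp(1)])
  thus ?thesis using cong_dvd_iff[OF AB] by blast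
 qed
 have leg: "Legendre (A*B) ?p = -1"
 proof -
  have "Legendre (A*B) ?p = Legendre (t^2*(u^2 - d * v^2)) ?p"
  proof -
   have "[A*B = 0] (mod ?p) \<longleftrightarrow> [t^2*(u^2 - d * v^2) = 0] (mod ?p)" using cong_trans[OF AB] cong_trans[OF cong_sym[OF AB]] by blast
   moreover have "[z^2 = A*B] (mod ?p) \<longleftrightarrow> [z^2 = t^2*(u^2 - d * v^2)] (mod ?p)" for z
    using cong_trans[OF _ AB] cong_trans[OF _ cong_sym[OF AB]] by blast
   ultimately show ?thesis unfolding Legendre_def QuadRes_def by simp
  qed
  moreover have "[(t^2*(u^2 - d * v^2)) = 0] (mod ?p) \<longleftrightarrow> False"
   using nd nu'(2) by (simp add: cong_0_iff prime_dvd_mult_iff[OF pp(1)] prime_dvd_power_iff[OF pp(1)])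
  moreover have "~ QuadRes ?p (t^2*(u^2 - d * v^2))"
  proof
   assume "QuadRes ?p (t^2*(u^2 - d * v^2))"
   then obtain z where z: "[z^2 = t^2*(u^2 - d * v^2)] (mod ?p)" by (auto simp: QuadRes_def)
   have "coprime t ?p" using nd(1) pp(1) by (metis coprime_commute prime_imp_coprime)
   then obtain i where i: "[t*i = 1] (mod ?p)" using cong_solve_coprime_int by blast
   have "[(z*i)^2 = t^2*(u^2 - d * v^2)*i^2] (mod ?p)"
    unfolding power_mult_distrib by (rule cong_mult[OF z cong_refl])
   also have "t^2*(u^2 - d * v^2)*i^2 = (t*i)^2*(u^2 - d * v^2)" by (simp add: power_mult_distrib)
   also have "[(t*i)^2*(u^2 - d * v^2) = 1^2*(u^2 - d * v^2)] (mod ?p)"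
    by (intro cong_mult cong_pow i cong_refl)
   finally show False using nu'(1) by (auto simp: QuadRes_def)
  qed
  ultimately show ?thesis unfolding Legendre_def by simp
 qed
 \<comment> \<open>Two nonresidues would have a product with Legendre symbol 1.\<close>
 have "QuadRes ?p A | QuadRes ?p B"
 proof (rule ccontr)
  assume "~ ?thesis"
  moreover have "~ ?p dvd A" "~ ?p dvd B" using nAB by (auto intro: dvd_mult dvd_mult2)
  ultimately have "Legendre A ?p = -1" "Legendre B ?p = -1" by (auto simp: Legendre_def cong_0_iff)
  moreover have e: "[Legendre X ?p = X^((p - 1) div 2)] (mod ?p)" for X
   using euler_criterion[of p X] p(1) pp(2) by simp
  ultimately have "[(-1)*(-1) = A^((p - 1) div 2)*B^((p - 1) div 2)] (mod ?p)"
   using cong_mult[OF e[of A] e[of B]] by simp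
  hence "[(-1)*(-1) = (A*B)^((p - 1) div 2)] (mod ?p)" by (simp only: power_mult_distrib)
  hence "[(-1)*(-1) = (-1::int)] (mod ?p)" using cong_trans[OF _ cong_sym[OF e[of "A*B"]]] leg by simp
  thus False using n2 by (simp add: cong_iff_dvd_diff)
 qed
 then obtain m0 where m0: "?p dvd m0^2 - A | ?p dvd m0^2 - B"
  by (auto simp: QuadRes_def cong_iff_dvd_diff)
 have nm0: "~ ?p dvd m0"
 proof
  assume "?p dvd m0"
  hence "?p dvd m0^2" by (simp add: power2_eq_square)
  hence "?p dvd A | ?p dvd B" using m0 by (metis dvd_diff_right_iff dvd_diff_commute)
  thus False using nAB by auto
 qed
 have Fm: "F m = (m^2 - A)*(m^2 - B) + t^2 * v^2*(c^2 - d)" for m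
  by (simp add: F_def A_def B_def algebra_simps power2_eq_square)
 have Fp: "?p dvd F m0" unfolding Fm using m0 cdv by auto
 \<comment> \<open>Taylor expansion at \<open>m0\<close>; the bracket multiplied by the first power
   of \<open>p\<close> is the derivative.\<close>
 have der: "F (m0 + ?p) = F m0 + ?p*(4*m0*(m0^2 - t*u)) + ?p^2*(4*m0^2 + 2*(m0^2 - t*u) + 4*m0 * ?p + ?p^2)"
  by (simp add: F_def algebra_simps power2_eq_square)
 have nder: "~ ?p dvd 4*m0*(m0^2 - t*u)"
 proof
  assume "?p dvd 4*m0*(m0^2 - t*u)"
  hence "?p dvd 2*2*m0*(m0^2 - t*u)" by simp
  hence "?p dvd m0^2 - t*u" using n2 nm0 by (simp only: prime_dvd_mult_iff[OF pp(1)]) blast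
  moreover have "m0^2 - A = (m0^2 - t*u) - t * v * c" "m0^2 - B = (m0^2 - t*u) + t * v * c"
   by (simp_all add: A_def B_def algebra_simps)
  ultimately have "?p dvd t * v * c" using m0 by (metis dvd_add_right_iff dvd_diff_right_iff)
  thus False using nd nc by (simp add: prime_dvd_mult_iff[OF pp(1)])
 qed
 show ?thesis
 proof (cases "?p^2 dvd F m0")
  case False
  thus ?thesis using Fp nm0 n2 by (intro exI[of _ m0]) (simp add: prime_dvd_mult_iff[OF pp(1)])
 next
  case True
  have "~ ?p^2 dvd F (m0 + ?p)"
  proof
   assume "?p^2 dvd F (m0 + ?p)"
   hence "?p^2 dvd ?p*(4*m0*(m0^2 - t*u))" unfolding der using True
    by (metis dvd_add_right_iff dvd_add_left_iff dvd_triv_left)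
   thus False using nder pp by (simp add: power2_eq_square)
  qed
  moreover have "?p dvd F (m0 + ?p)" unfolding der using Fp by (simp add: power2_eq_square)
  moreover have "~ ?p dvd 2*(m0 + ?p)" using n2 nm0 by (simp add: prime_dvd_mult_iff[OF pp(1)])
  ultimately show ?thesis by blast
 qed
qed

text \<open>\<open>K\<close> is Q(sqrt d) with a square root of \<open>t*(u + v*dlt)\<close>
  adjoined. The data \<open>d\<close>, \<open>u\<close>, \<open>v\<close> are shared by a whole
  family of fields, while \<open>t\<close> varies.\<close>

locale d4_tower = number_ring K e w for K e w +
 fixes d t u v :: int and dlt s :: complex
 assumes delta_K: "dlt:K" and s_K: "s:K" and delta_sq: "dlt^2 = of_int d"
  and s_sq: "s^2 = of_int t*(of_int u + of_int v * dlt)"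
  and span: "x:K ==> EX a b c c' :: rat. x = of_rat a + of_rat b*dlt + of_rat c * s + of_rat c'*(s*dlt)"
  and nu_nonsq: "\<nexists>r :: rat. r^2 = of_int (u^2 - d * v^2)" and d_nonsq: "\<nexists>r :: rat. r^2 = of_int d"
begin

text \<open>The conjugate square root, in general outside \<open>K\<close>.\<close>

definition s2 :: complex where "s2 = csqrt (of_int t*(of_int u - of_int v * dlt))"

lemma s2_sq: "s2^2 = of_int t*(of_int u - of_int v * dlt)" by (simp add: s2_def)

definition conjs :: "(complex \<times> complex) set" where "conjs = {(dlt, s), (dlt, - s), (- dlt, s2), (- dlt, - s2)}"

lemma e_span: "e i (of_rat a + of_rat b*dlt + of_rat c * s + of_rat c'*(s*dlt)) =
  of_rat a + of_rat b*e i dlt + of_rat c*e i s + of_rat c'*(e i s*e i dlt)"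
 by (simp add: e_add e_mult K_closed delta_K s_K)

lemma e_conjs: "(e i dlt, e i s):conjs"
proof -
 have d2: "(e i dlt)^2 = dlt^2" using e_power[of dlt i 2] delta_K delta_sq by simp
 have s2': "(e i s)^2 = of_int t*(of_int u + of_int v * e i dlt)"
  using e_power[of s i 2] s_K s_sq delta_K by (simp add: e_mult e_add K_closed)
 show ?thesis
 proof (cases "e i dlt = dlt")
  case True
  hence "(e i s)^2 = s^2" using s2' s_sq by simp
  thus ?thesis using True by (auto simp: conjs_def power2_eq_iff)
 next
  case False
  hence dm: "e i dlt = - dlt" using d2 by (simp add: power2_eq_iff)
  hence "(e i s)^2 = s2^2" using s2' s2_sq by simp
  thus ?thesis using dm by (auto simp: conjs_def power2_eq_iff)
 qed
qed

lemma e_determined: "e i dlt = e j dlt ==> e i s = e j s ==> i = j"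
proof -
 assume h: "e i dlt = e j dlt" "e i s = e j s"
 have "e i x = e j x" if xK: "x:K" for x
 proof -
  obtain a b c c' where x: "x = of_rat a + of_rat b*dlt + of_rat c * s + of_rat c'*(s*dlt)" using span[OF xK] by blast
  show ?thesis unfolding x e_span h by simp
 qed
 hence "e i = e j" using emb_eqI[OF e_emb e_emb] by blast
 thus ?thesis by (simp add: e_eq_iff)
qed

text \<open>Four embeddings inject into a list of at most four pairs. So every pair occurs, which
  gives the involution \<open>iot\<close>, and the pairs are distinct, which gives
  \<open>conjs_distinct\<close>.\<close>

lemma conjs_bij: "bij_betw (%i. (e i dlt, e i s)) UNIV conjs" and conjs_card: "card conjs = 4"
proof -
 have inj: "inj (%i. (e i dlt, e i s))" by (rule injI) (auto dest: e_determined)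
 have sub: "range (%i. (e i dlt, e i s))<=conjs" using e_conjs by blast
 have fin: "finite conjs" by (simp add: conjs_def)
 have c4: "card (range (%i. (e i dlt, e i s))) = 4" using card_image[OF inj] by simp
 have "card conjs<=4" unfolding conjs_def by (simp add: card_insert_if)
 thus card: "card conjs = 4" using card_mono[OF fin sub] c4 by linarith
 hence "range (%i. (e i dlt, e i s)) = conjs" using card_subset_eq[OF fin sub] c4 by simp
 thus "bij_betw (%i. (e i dlt, e i s)) UNIV conjs" using inj by (simp add: bij_betw_def)
qed

lemma conjs_distinct: "s~=0" "s2~=0" "dlt~=0"
proof -
 have small: "card {x, y, z}<=3" for x y z :: "complex \<times> complex" by (simp add: card_insert_if)
 show "s~=0"
 proof
  assume "s = 0"
  hence "(dlt, - s) = (dlt, s)" by simp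
  hence "conjs = {(dlt, s), (- dlt, s2), (- dlt, - s2)}" unfolding conjs_def by (simp only: insert_absorb2)
  thus False using conjs_card small[of "(dlt, s)" "(- dlt, s2)" "(- dlt, - s2)"] by simp
 qed
 show "s2~=0"
 proof
  assume "s2 = 0"
  hence "conjs = {(dlt, s), (dlt, - s), (- dlt, s2)}" by (simp add: conjs_def)
  thus False using conjs_card small[of "(dlt, s)" "(dlt, - s)" "(- dlt, s2)"] by simp
 qed
 have "dlt = 0 ==> EX r :: rat. r^2 = of_int d" using delta_sq by (intro exI[of _ 0]) simp
 thus "dlt~=0" using d_nonsq by blast
qed

text \<open>The characteristic polynomial of \<open>s\<close> evaluated at \<open>m\<close>
  (\<open>nrm_s_minus\<close>).\<close>

definition F :: "int => int" where "F m = (m^2 - t*u)^2 - t^2 * v^2*d"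

lemma s_R: "s:R" and delta_R: "dlt:R"
proof -
 have "algebraic_int (dlt^2)" unfolding delta_sq by simp
 hence "algebraic_int dlt" by (rule algebraic_int_if_power) simp
 thus d: "dlt:R" using delta_K by (simp add: R_iff)
 have "algebraic_int (s^2)" unfolding s_sq using d by (intro R_iff[THEN iffD1, THEN conjunct2] R_mult R_add) auto
 hence "algebraic_int s" by (rule algebraic_int_if_power) simp
 thus "s:R" using s_K by (simp add: R_iff)
qed

lemma nrm_s_minus: "nrm (s - of_int m) = of_int (F m)"
proof -
 have "nrm (s - of_int m) = (PROD i:UNIV. e i s - of_int m)" unfolding nrm_def by (simp add: e_diff s_K)
 also have "... = (PROD x:conjs. snd x - of_int m)"
  using prod.reindex_bij_betw[OF conjs_bij, of "%x. snd x - of_int m"] by simp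
 also have "... = (s - of_int m)*(- s - of_int m)*(s2 - of_int m)*(- s2 - of_int m)"
  unfolding conjs_def using conjs_distinct by (simp add: mult.assoc)
 also have "... = ((of_int m)^2 - s^2)*((of_int m)^2 - s2^2)" by (simp add: algebra_simps power2_eq_square)
 also have "... = ((of_int m)^2 - of_int t * of_int u)^2 - (of_int t)^2*(of_int v)^2*dlt^2"
  unfolding s_sq s2_sq by (simp add: algebra_simps power2_eq_square)
 finally show ?thesis unfolding delta_sq by (simp add: F_def)
qed

lemma iot_ex: "EX i. e i dlt = dlt & e i s = - s"
proof -
 have "(dlt, - s):(%i. (e i dlt, e i s))`UNIV" using conjs_bij by (simp add: bij_betw_def conjs_def)
 then obtain i where "(dlt, - s) = (e i dlt, e i s)" by blast
 thus ?thesis by (intro exI[of _ i]) simp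
qed

text \<open>The nontrivial automorphism of \<open>K\<close> over Q(sqrt d).\<close>

definition iot :: "complex => complex" where "iot = e (SOME i. e i dlt = dlt & e i s = - s)"

lemma iot: "iot dlt = dlt" "iot s = - s" "iot:embeddings K"
 using someI_ex[OF iot_ex] by (simp_all add: iot_def)

lemma iot_R: "x:R ==> iot x:R"
proof -
 assume x: "x:R"
 obtain a b c c' where xx: "x = of_rat a + of_rat b*dlt + of_rat c * s + of_rat c'*(s*dlt)"
  using span[OF R_K[OF x]] by blast
 have "iot x = of_rat a + of_rat b*dlt + of_rat c*(- s) + of_rat c'*((- s)*dlt)"
  unfolding xx using someI_ex[OF iot_ex] by (simp add: iot_def e_span)
 hence "iot x:K" using delta_K s_K by (simp add: K_closed)
 moreover have "algebraic_int (iot x)" using x by (simp add: iot_def e_algebraic_int R_iff)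
 ultimately show ?thesis by (simp add: R_iff)
qed

text \<open>Write \<open>gam\<close> as \<open>a + b*dlt + (c + c'*dlt)*s\<close>. If the two
  embeddings agree on \<open>dlt\<close>, they are opposite on \<open>s\<close>, and the last
  coefficient vanishes. Otherwise squaring the equality shows that \<open>c^2 - c'^2*d\<close> times
  \<open>S*S'\<close> is rational; as the square of \<open>S*S'\<close> is
  \<open>t^2*(u^2 - d*v^2)\<close>, not a rational square, that coefficient is 0, and then
  \<open>c\<close> and \<open>c'\<close> vanish since \<open>d\<close> is not a square.\<close>

lemma fixed_if_conjugates_eq:
 assumes g: "gam:K" and ij: "i~=j" and eq: "e i gam = e j gam"
 shows "iot gam = gam"
proof -
 obtain a b c c' where g: "gam = of_rat a + of_rat b*dlt + of_rat c * s + of_rat c'*(s*dlt)" using span[OF g] by blast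
 define D where "D = e i dlt"
 define S where "S = e i s"
 define S' where "S' = e j s"
 have D2: "D^2 = of_int d" using e_power[of dlt i 2] delta_K delta_sq by (simp add: D_def)
 have S2: "S^2 = of_int t*(of_int u + of_int v * D)"
  using e_power[of s i 2] s_K s_sq delta_K by (simp add: e_mult e_add K_closed S_def D_def)
 have eS0: "e k s~=0" for k using e_eq_0_iff[OF s_K] conjs_distinct(1) by simp
 have "of_rat c + of_rat c'*dlt = 0"
 proof (cases "e j dlt = D")
  case True
  hence "S'~=S" using e_determined[of i j] ij by (auto simp: D_def S_def S'_def)
  moreover have "S'^2 = S^2" using e_power[of s j 2] s_K s_sq delta_K True S2 by (simp add: e_mult e_add K_closed S'_def)
  ultimately have "S' = - S" by (simp add: power2_eq_iff)
  hence "2*S*(of_rat c + of_rat c'*D) = 0"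
   using eq True unfolding g e_span D_def[symmetric] S_def[symmetric] S'_def[symmetric] by (simp add: algebra_simps)
  hence "e i (of_rat c + of_rat c'*dlt) = 0" using eS0[of i] delta_K by (simp add: S_def D_def e_add e_mult K_closed)
  thus ?thesis using e_eq_0_iff[of "of_rat c + of_rat c'*dlt" i] delta_K by (simp add: K_closed)
 next
  case False
  have "(e j dlt)^2 = D^2" using e_power[of dlt j 2] delta_K delta_sq D2 by simp
  hence Dm: "e j dlt = - D" using False by (simp add: power2_eq_iff)
  have S2': "S'^2 = of_int t*(of_int u - of_int v * D)"
   using e_power[of s j 2] s_K s_sq delta_K by (simp add: e_mult e_add K_closed S'_def Dm)
  have "2 * of_rat b*D = (of_rat c - of_rat c'*D)*S' - (of_rat c + of_rat c'*D)*S"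
   using eq unfolding g e_span D_def[symmetric] S_def[symmetric] S'_def[symmetric] Dm by (simp add: algebra_simps)
  hence "(2 * of_rat b*D)^2 = ((of_rat c - of_rat c'*D)*S' - (of_rat c + of_rat c'*D)*S)^2" by simp
  also have "... = (of_rat c - of_rat c'*D)^2*S'^2 + (of_rat c + of_rat c'*D)^2*S^2
    - 2*((of_rat c)^2 - (of_rat c')^2*D^2)*(S*S')"
   by (simp add: algebra_simps power2_eq_square)
  also have "(of_rat c - of_rat c'*D)^2*S'^2 + (of_rat c + of_rat c'*D)^2*S^2 =
    of_int t*(2 * of_int u*((of_rat c)^2 + (of_rat c')^2*D^2) + 4 * of_int v * of_rat c * of_rat c'*D^2)"
   unfolding S2 S2' by (simp add: algebra_simps power2_eq_square)
  finally have key: "2 * of_rat (c^2 - c'^2 * of_int d)*(S*S') =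
    of_rat (of_int t*(2 * of_int u*(c^2 + c'^2 * of_int d) + 4 * of_int v * c*c' * of_int d) - 4*b^2 * of_int d)"
   unfolding D2 power_mult_distrib by (simp add: of_rat_add of_rat_diff of_rat_mult of_rat_power algebra_simps)
  have "c^2 - c'^2 * of_int d = 0"
  proof (rule ccontr)
   assume nz: "c^2 - c'^2 * of_int d~=0"
   define q where "q = (of_int t*(2 * of_int u*(c^2 + c'^2 * of_int d) + 4 * of_int v * c*c' * of_int d) - 4*b^2 * of_int d)/(2*(c^2 - c'^2 * of_int d))"
   have "of_rat (2*(c^2 - c'^2 * of_int d))*(S*S') = of_rat (2*(c^2 - c'^2 * of_int d)*q)"
   proof -
    have "2*(c^2 - c'^2 * of_int d)*q = of_int t*(2 * of_int u*(c^2 + c'^2 * of_int d) + 4 * of_int v * c*c' * of_int d) - 4*b^2 * of_int d"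
     unfolding q_def using nz by simp
    moreover have "of_rat (2*(c^2 - c'^2 * of_int d)) = (2 * of_rat (c^2 - c'^2 * of_int d) :: complex)"
     by (simp only: of_rat_mult of_rat_numeral_eq)
    ultimately show ?thesis using key by (simp only:)
   qed
   moreover have "of_rat (2*(c^2 - c'^2 * of_int d))~=(0::complex)" using nz by (simp only: of_rat_eq_0_iff) simp
   ultimately have "S*S' = of_rat q" by (simp add: of_rat_mult)
   hence "of_rat (q^2) = S^2*S'^2" by (simp only: of_rat_power power_mult_distrib[symmetric])
   also have "... = (of_int t)^2*((of_int u)^2 - (of_int v)^2*D^2)" unfolding S2 S2' by (simp add: algebra_simps power2_eq_square)
   also have "... = of_rat ((of_int t)^2 * of_int (u^2 - d * v^2))"
    unfolding D2 by (simp add: of_rat_mult of_rat_power of_rat_diff)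
   finally have "q^2 = (of_int t)^2 * of_int (u^2 - d * v^2)" by (simp only: of_rat_eq_iff)
   moreover have "t~=0" using S2 eS0[of i] by (auto simp: S_def)
   ultimately have "(q/of_int t)^2 = of_int (u^2 - d * v^2)" by (simp add: power_divide field_simps)
   thus False using nu_nonsq by blast
  qed
  hence c2: "c^2 = c'^2 * of_int d" by simp
  have "c' = 0"
  proof (rule ccontr)
   assume "c'~=0"
   hence "(c/c')^2 = of_int d" using c2 by (simp add: power_divide field_simps)
   thus False using d_nonsq by blast
  qed
  thus ?thesis using c2 by simp
 qed
 hence "gam = of_rat a + of_rat b*dlt + of_rat 0 * s + of_rat 0*(s*dlt)"
  unfolding g by (metis (no_types, lifting) add.assoc add.right_neutral distrib_left mult.commute mult.left_commute mult_zero_right of_rat_0)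
 hence "iot gam = of_rat a + of_rat b*dlt" using someI_ex[OF iot_ex] unfolding iot_def by (simp only: e_span) simp
 thus ?thesis using \<open>gam = of_rat a + of_rat b * dlt + of_rat 0 * s + of_rat 0 * (s * dlt)\<close> by simp
qed

definition pid :: "nat => int => complex set" where
 "pid p m = {of_nat p*x + (s - of_int m)*y |x y. x:R & y:R}"

lemma pid_ideal: "ideal (pid p m)"
proof (rule idealI)
 show "pid p m<=R" unfolding pid_def using s_R by (auto intro!: R_add R_mult R_diff)
 show "0:pid p m" unfolding pid_def by (rule CollectI, rule exI[of _ 0], rule exI[of _ 0]) simp
 fix x y assume "x:pid p m" "y:pid p m"
 then obtain a b c c' where h: "x = of_nat p*a + (s - of_int m)*b" "y = of_nat p*c + (s - of_int m)*c'"
  "a:R" "b:R" "c:R" "c':R" unfolding pid_def by blast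
 have "x + y = of_nat p*(a + c) + (s - of_int m)*(b + c')" by (simp add: h algebra_simps)
 thus "x + y:pid p m" unfolding pid_def using R_add h by blast
next
 fix r x assume r: "r:R" and "x:pid p m"
 then obtain a b where h: "x = of_nat p*a + (s - of_int m)*b" "a:R" "b:R" unfolding pid_def by blast
 have "r*x = of_nat p*(r*a) + (s - of_int m)*(r*b)" by (simp add: h algebra_simps)
 thus "r*x:pid p m" unfolding pid_def using R_mult[OF r] h by blast
qed

lemma pid_gens: "of_nat p:pid p m" "s - of_int m:pid p m"
proof -
 show "of_nat p:pid p m" unfolding pid_def by (rule CollectI, rule exI[of _ 1], rule exI[of _ 0]) simp
 show "s - of_int m:pid p m" unfolding pid_def by (rule CollectI, rule exI[of _ 0], rule exI[of _ 1]) simp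
qed

text \<open>Expanded over the conjugates, the norm is 1 plus \<open>p\<close> times an algebraic
  integer, which is rational and so an integer. This serves to show that \<open>pid p m\<close> is a
  proper ideal.\<close>

lemma nrm_1_minus:
 assumes "x:R"
 shows "EX k::int. nrm (1 - of_nat p*x) = of_int (1 + int p*k)"
proof (cases "p = 0")
 case True thus ?thesis by simp
next
 case False
 have ex: "EX y. algebraic_int y & (PROD i:A. 1 - of_nat p*e i x) = 1 + of_nat p*y" if "finite A" for A
  using that
 proof (induction A rule: finite_induct)
  case empty thus ?case by (intro exI[of _ 0]) simp
 next
  case (insert i A)
  then obtain y where y: "algebraic_int y" "(PROD i:A. 1 - of_nat p*e i x) = 1 + of_nat p*y" by blast
  have ai: "algebraic_int (e i x)" using assms e_algebraic_int R_iff by blast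
  have "(PROD i:insert i A. 1 - of_nat p*e i x) = 1 + of_nat p*(y + - e i x + of_nat p*(- e i x*y))"
   using insert.hyps y(2) by (simp add: algebra_simps)
  moreover have "algebraic_int (y + - e i x + of_nat p*(- e i x*y))"
   by (intro algebraic_int_add_mult y(1) algebraic_int_minus ai) simp
  ultimately show ?case by blast
 qed
 have "nrm (1 - of_nat p*x) = (PROD i:UNIV. 1 - of_nat p*e i x)"
  unfolding nrm_def using R_K[OF assms] by (simp add: e_diff e_mult K_closed)
 then obtain y where y: "algebraic_int y" "nrm (1 - of_nat p*x) = 1 + of_nat p*y" using ex[of UNIV] by auto
 have "1 - of_nat p*x:R" using assms by (intro R_diff R_mult) auto
 hence "nrm (1 - of_nat p*x):\<int>" by (rule nrm_Ints)
 then obtain z where z: "nrm (1 - of_nat p*x) = of_int z" using Ints_imp_ex by blast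
 have "y = of_rat ((of_int z - 1)/of_nat p)" using y(2) z False by (simp add: of_rat_divide of_rat_diff field_simps)
 hence "y:\<int>" using y(1) by (intro rational_algebraic_int_is_int) auto
 then obtain k where "y = of_int k" using Ints_imp_ex by blast
 thus ?thesis using y(2) by (intro exI[of _ k]) simp
qed

text \<open>The prime divides the norm of \<open>s - m\<close> exactly once, which makes
  \<open>(p, s - m)\<close> a prime of degree one; the condition on \<open>2*m\<close> separates it
  from \<open>(p, s + m)\<close>.\<close>

definition exact :: "nat => int => bool" where
 "exact p m \<longleftrightarrow> prime p & ~ int p dvd 2*m & int p dvd F m & ~ int p^2 dvd F m"

lemma exact_minus: "exact p m ==> exact p (- m)" by (simp add: exact_def F_def)

lemma pid_nz: "prime p ==> nzideal (pid p m)"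
 unfolding nzideal_iff using pid_ideal pid_gens(1)[of p m] prime_gt_0_nat[of p] by (metis of_nat_0_eq_iff neq0_conv)

text \<open>The norm divides both \<open>p^4\<close> and the norm of \<open>s - m\<close>, so it is
  1 or \<open>p\<close>. In the first case \<open>(s - m)*y = 1 - p*x\<close> for some integral
  \<open>x\<close> and \<open>y\<close>, and taking norms modulo \<open>p\<close> gives a
  contradiction.\<close>

lemma pid_norm:
 assumes ex: "exact p m"
 shows "inorm (pid p m) = p"
proof -
 have p: "prime p" "int p dvd F m" "~ int p^2 dvd F m" using ex by (auto simp: exact_def)
 note nz = pid_nz[OF p(1), of m]
 have p0: "p > 0" using prime_gt_0_nat[OF p(1)] .
 have F0: "F m~=0" using p(3) by auto
 have sR: "s - of_int m:R" using s_R by (intro R_diff) auto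
 have s0: "s - of_int m~=0" using nrm_eq_0_iff[OF R_K[OF sR]] nrm_s_minus F0 by simp
 have "inorm (pid p m) dvd inorm (principal (of_nat p))"
  using inorm_tower[OF principal_nzideal nz principal_sub[OF pid_ideal pid_gens(1)]] p0 by simp
 hence d1: "inorm (pid p m) dvd p^4" using inorm_of_nat[OF p0] by simp
 have "inorm (pid p m) dvd inorm (principal (s - of_int m))"
  using inorm_tower[OF principal_nzideal[OF sR s0] nz principal_sub[OF pid_ideal pid_gens(2)]] by simp
 moreover have "real (inorm (principal (s - of_int m))) = real (nat \<bar>F m\<bar>)"
  using index_principal[OF sR s0] unfolding nrm_s_minus by simp
 hence "inorm (principal (s - of_int m)) = nat \<bar>F m\<bar>" by (simp only: of_nat_eq_iff)
 ultimately have d2: "int (inorm (pid p m)) dvd F m" by (simp add: nat_dvd_iff)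
 obtain k where k: "inorm (pid p m) = p^k" using d1 divides_primepow_nat[OF p(1)] by blast
 have "k < 2"
 proof (rule ccontr)
  assume "~ k < 2"
  hence "int p^2 dvd int (inorm (pid p m))" unfolding k by (simp add: le_imp_power_dvd)
  thus False using d2 p(3) dvd_trans by blast
 qed
 moreover have "k~=0"
 proof
  assume "k = 0"
  hence "pid p m = R" using k inorm_1D[OF nz] by simp
  then obtain x y where xy: "1 = of_nat p*x + (s - of_int m)*y" "x:R" "y:R" unfolding pid_def using R_1 by blast
  hence "(s - of_int m)*y = 1 - of_nat p*x" by (simp add: algebra_simps)
  hence "nrm (s - of_int m)*nrm y = nrm (1 - of_nat p*x)" using nrm_mult[OF R_K[OF sR] R_K[OF xy(3)]] by simp
  moreover obtain z where z: "nrm y = of_int z" using nrm_Ints[OF xy(3)] Ints_imp_ex by blast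
  moreover obtain k' where "nrm (1 - of_nat p*x) = of_int (1 + int p*k')" using nrm_1_minus[OF xy(2)] by blast
  ultimately have "of_int (F m*z) = (of_int (1 + int p*k') :: complex)" unfolding nrm_s_minus by simp
  hence "F m*z = 1 + int p*k'" by (simp only: of_int_eq_iff)
  hence "int p dvd 1" using p(2) by (metis dvd_add_left_iff dvd_mult2 dvd_triv_left)
  thus False using p(1) by simp
 qed
 ultimately have "k = 1" by linarith
 thus ?thesis using k by simp
qed

lemma pid_pideal:
 assumes ex: "exact p m"
 shows "pideal (pid p m)"
proof -
 have p: "prime p" using ex by (simp add: exact_def)
 note nz = pid_nz[OF p, of m]
 have "pid p m~=R" using pid_norm[OF ex] inorm_R p by auto
 moreover have "A = pid p m | A = R" if A: "ideal A" "pid p m<=A" for A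
 proof -
  have nzA: "nzideal A" using A nz unfolding nzideal_iff by blast
  have "p = inorm A*index_in A (pid p m)" using inorm_tower[OF nz nzA A(2)] pid_norm[OF ex] by simp
  hence "inorm A dvd p" by (rule dvdI)
  hence "inorm A = 1 | inorm A = p" using p prime_nat_iff by blast
  thus ?thesis using inorm_1D[OF nzA] inorm_eqD[OF nz nzA A(2)] pid_norm[OF ex] by auto
 qed
 ultimately show ?thesis using nz by (simp add: pideal_def)
qed

lemma iot_pid: "x:pid p m ==> iot x:pid p (- m)"
proof -
 assume "x:pid p m"
 then obtain a b where h: "x = of_nat p*a + (s - of_int m)*b" "a:R" "b:R" unfolding pid_def by blast
 have K: "a:K" "b:K" using h R_K by blast+
 have "iot x = of_nat p*iot a + (iot s - of_int m)*iot b"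
  unfolding h(1) using iot(3) K s_K
  by (simp add: emb_add[OF iot(3)] emb_mult[OF iot(3)] emb_diff[OF iot(3)] emb_of_nat[OF iot(3)] emb_of_int[OF iot(3)] K_closed)
 hence "iot x = of_nat p*iot a + (s - of_int (- m))*(- iot b)" by (simp add: iot(2) algebra_simps)
 thus ?thesis unfolding pid_def using iot_R[OF h(2)] R_uminus[OF iot_R[OF h(3)]] by blast
qed

text \<open>Otherwise the conjugate ideal contains both \<open>s + m\<close> and
  \<open>s - m\<close>, hence \<open>2*m\<close>, which is a unit modulo \<open>p\<close>.\<close>

lemma pid_ne: "exact p m ==> ~ pid p m<=pid p (- m)"
proof
 assume ex: "exact p m" and sub: "pid p m<=pid p (- m)"
 note ex' = exact_minus[OF ex]
 note P = pid_pideal[OF ex'] and id = pid_ideal[of p "- m"]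
 have "s - of_int m:pid p (- m)" "s - of_int (- m):pid p (- m)" using pid_gens(2) sub by blast+
 hence "(s - of_int (- m)) + - (s - of_int m):pid p (- m)" using idealD(3,4)[OF id] by blast
 moreover have "(s - of_int (- m)) + - (s - of_int m) = of_int (2*m)" by simp
 ultimately have m2: "of_int (2*m):pid p (- m)" by (simp only:)
 have "coprime (int p) (2*m)" using ex by (intro prime_imp_coprime) (auto simp: exact_def)
 then obtain a b where "a*int p + b*(2*m) = 1" using bezout_int[of "int p" "2*m"] by (auto simp: coprime_iff_gcd_eq_1)
 hence "of_int a * of_nat p + of_int b * of_int (2*m) = (1 :: complex)"
  by (metis (no_types, lifting) of_int_1 of_int_add of_int_mult of_int_of_nat_eq)
 moreover have "of_int a * of_nat p + of_int b * of_int (2*m):pid p (- m)"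
  by (intro idealD(3)[OF id] idealD(5)[OF id R_of_int] m2 pid_gens(1))
 ultimately have "1:pid p (- m)" by simp
 thus False using P ideal_eq_R_iff[OF id] by (simp add: pideal_def)
qed

lemma ipow_sub: "nzideal I ==> ipow I (Suc k)<=I"
 unfolding ipow_Suc by (intro ideal_prod_sub nz_ideal ipow_nz)

lemma ipow_mem: "nzideal I ==> x:I ==> x^k:ipow I k"
 by (induction k) (auto simp: ipow_Suc intro: ideal_prod_mem)

text \<open>The ideal of \<open>y/x\<close> is the quotient of the \<open>l\<close>-th powers of
  \<open>pid p m\<close> and \<open>pid q n\<close>. If \<open>iot\<close> fixed \<open>y/x\<close>,
  it would fix \<open>piv = (y/x)*q^l\<close>, which lies in the \<open>l\<close>-th power of
  \<open>pid p m\<close>; so \<open>piv\<close> would lie in the conjugate prime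
  \<open>pid p (- m)\<close> as well. Then \<open>p\<close> would divide the norm of
  \<open>piv\<close> at least \<open>l + 1\<close> times, whereas that norm is
  \<open>p^l*q^(3*l)\<close>.\<close>

lemma not_fixed:
 assumes p: "exact p m" and q: "exact q n" and pq: "p~=q" and l: "l >= 1"
  and xy: "x:R" "x~=0" "y:R" "y~=0" and eq: "(*) x`ipow (pid p m) l = (*) y`ipow (pid q n) l"
 shows "iot (y/x)~=y/x"
proof
 assume fx: "iot (y/x) = y/x"
 have pr: "prime p" "prime q" using p q by (auto simp: exact_def)
 note nzp = pid_nz[OF pr(1), of m] and nzq = pid_nz[OF pr(2), of n]
 have "y * of_nat q^l:(*) y`ipow (pid q n) l"
  by (intro imageI ipow_mem[OF nzq] pid_gens(1))
 then obtain piv where pi: "piv:ipow (pid p m) l" "y * of_nat q^l = x*piv" unfolding eq[symmetric] by blast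
 have piR: "piv:R" using idealD(7)[OF nz_ideal[OF ipow_nz[OF nzp]] pi(1)] .
 have q0: "q > 0" using prime_gt_0_nat[OF pr(2)] .
 have pi0: "piv~=0" using pi(2) xy q0 by auto
 have pie: "piv = (y/x) * of_nat (q^l)" using pi(2) xy by (simp add: field_simps)
 have "y/x:K" by (intro K_divide R_K xy)
 hence "iot piv = iot (y/x)*iot (of_nat (q^l))" unfolding pie by (intro emb_mult[OF iot(3)] K_of_nat)
 hence fpi: "iot piv = piv" unfolding fx emb_of_nat[OF iot(3)] pie .
 have "piv:pid p m" using ipow_sub[OF nzp, of "l - 1"] pi(1) l by auto
 hence pi': "piv:pid p (- m)" using iot_pid fpi by metis
 have "principal piv<=ipow (pid p m) l" using principal_sub[OF nz_ideal[OF ipow_nz[OF nzp]] pi(1)] .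
 then obtain C where C: "nzideal C" "principal piv = ipow (pid p m) l \<star> C"
  using ideal_divides[OF ipow_nz[OF nzp] principal_nzideal[OF piR pi0]] by blast
 have P': "pideal (pid p (- m))" using pid_pideal exact_minus p by blast
 have step: "C<=pid p (- m)" if "ipow (pid p m) k \<star> C<=pid p (- m)" for k
  using that
 proof (induction k)
  case 0
  thus ?case using ideal_prod_R(2)[OF nz_ideal[OF C(1)]] by simp
 next
  case (Suc k)
  have ids: "ideal (ipow (pid p m) k)" "ideal C" using nz_ideal ipow_nz nzp C(1) by blast+
  have "pid p m \<star> (ipow (pid p m) k \<star> C)<=pid p (- m)"
   using Suc.prems ideal_prod_assoc[OF pid_ideal ids] by (simp add: ipow_Suc)
  hence "ipow (pid p m) k \<star> C<=pid p (- m)"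
   using pideal_prod_sub[OF P' pid_ideal ideal_prod_ideal[OF ids]] pid_ne[OF p] by blast
  thus ?case by (rule Suc.IH)
 qed
 have "C<=pid p (- m)" using step C(2) principal_sub[OF pid_ideal pi'] by blast
 hence pC: "p dvd inorm C"
  using inorm_tower[OF C(1) pid_nz[OF pr(1)], of "- m"] pid_norm[OF exact_minus[OF p]] by simp
 have Npi: "inorm (principal piv) = p^l*inorm C"
  unfolding C(2) using inorm_prod[OF ipow_nz[OF nzp] C(1)] inorm_ipow[OF nzp] pid_norm[OF p] by simp
 have "inorm (principal x)*p^l = inorm (principal y)*q^l"
  using arg_cong[OF eq, of inorm] inorm_scale[OF xy(1,2) ipow_nz[OF nzp]] inorm_scale[OF xy(3,4) ipow_nz[OF nzq]]
   inorm_ipow[OF nzp] inorm_ipow[OF nzq] pid_norm[OF p] pid_norm[OF q] by simp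
 moreover have "inorm (principal y)*(q^l)^4 = inorm (principal x)*inorm (principal piv)"
  using index_principal_mult[OF xy(3,4), of "of_nat (q^l)"] index_principal_mult[OF xy(1,2) piR pi0]
   pi(2) inorm_of_nat[of "q^l"] q0 R_of_nat[of "q^l"] by simp
 moreover have "inorm (principal x) > 0" using inorm_pos[OF principal_nzideal[OF xy(1,2)]] .
 ultimately have "inorm (principal x)*(inorm (principal piv)*q^l) = inorm (principal x)*(p^l*(q^l)^4)"
  by (simp only: mult_ac)
    (metis (no_types, lifting) mult.assoc mult.commute)
 hence "inorm (principal piv)*q^l = p^l*(q^l)^4" using \<open>inorm (principal x) > 0\<close> by simp
 hence "p^l*(inorm C*q^l) = p^l*(q^l)^4" unfolding Npi by (simp only: mult.assoc)
 hence "inorm C*q^l = (q^l)^4" using prime_gt_0_nat[OF pr(1)] by simp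
 hence "p dvd (q^l)^4" using pC by (metis dvd_mult2)
 hence "p dvd q" using pr(1) prime_dvd_power by blast
 thus False using pr pq primes_dvd_imp_eq by blast
qed

end

section \<open>Vandermonde determinants and the discriminant\<close>

lemma power_4_bij: "EX h :: 4 => nat. bij_betw h UNIV {0..<4}"
 using ex_bij_betw_finite_nat[of "UNIV :: 4 set"] by simp

context number_ring
begin

definition h4 :: "4 => nat" where "h4 = (SOME h. bij_betw h UNIV {0..<4})"

lemma h4: "bij_betw h4 UNIV {0..<4}" unfolding h4_def by (rule someI_ex[OF power_4_bij])

lemma h4_less: "h4 i < 4" using h4 by (auto simp: bij_betw_def)

text \<open>The Vandermonde determinant of the conjugates, with its columns in the order given by
  \<open>h4\<close>.\<close>

definition vdm :: "complex => complex" where "vdm gam = hdet (\<chi> i j. (e i gam)^h4 j)"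

text \<open>A kernel vector would be the coefficients of a polynomial of degree at most 3 with four
  distinct roots.\<close>

lemma vdm_nonzero:
 assumes "!!i j. i~=j ==> e i gam~=e j gam"
 shows "vdm gam~=0"
 unfolding vdm_def hdet_nonzero_iff
proof (intro allI impI)
 fix x :: "complex^4" assume 0: "(\<chi> i j. (e i gam)^h4 j) *v x = 0"
 define P where "P = (SUM j:UNIV. Polynomial.monom (x $ j) (h4 j))"
 have roots: "poly P (e i gam) = 0" for i
 proof -
  have "poly P (e i gam) = (SUM j:UNIV. (e i gam)^h4 j*x $ j)" by (simp add: P_def poly_sum poly_monom mult.commute)
  also have "... = ((\<chi> i j. (e i gam)^h4 j) *v x) $ i" by (simp add: matrix_vector_mult_def)
  finally show ?thesis using 0 by simp
 qed
 have cf: "Polynomial.coeff P (h4 k) = x $ k" for k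
 proof -
  have "Polynomial.coeff P (h4 k) = (SUM j:UNIV. if j = k then x $ j else 0)"
   unfolding P_def coeff_sum coeff_monom using h4 by (intro sum.cong) (auto simp: bij_betw_def inj_def)
  thus ?thesis by simp
 qed
 have "P = 0"
 proof (rule ccontr)
  assume P: "P~=0"
  have "inj (%i. e i gam)" using assms by (auto simp: inj_def)
  hence "4 = card (range (%i. e i gam))" by (simp add: card_image)
  also have "...<=card {z. poly P z = 0}" by (rule card_mono[OF poly_roots_finite[OF P]]) (use roots in auto)
  also have "...<=Polynomial.degree P" by (rule poly_roots_degree[OF P])
  also have "...<=3"
   unfolding P_def
  proof (rule degree_sum_le)
   fix j :: 4
   show "Polynomial.degree (Polynomial.monom (x $ j) (h4 j))<=3"
    using order_trans[OF degree_monom_le[of "x $ j" "h4 j"], of 3] h4_less[of j] by linarith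
  qed simp
  finally show False by simp
 qed
 thus "x = 0" using cf by (simp add: vec_eq_iff)
qed

text \<open>Each of the 24 Leibniz terms has total exponent 0 + 1 + 2 + 3 = 6.\<close>

lemma vdm_bound:
 assumes G: "!!i. cmod (e i gam)<=G"
 shows "cmod (vdm gam)<=24*G^6"
proof -
 have sum6: "(SUM j:UNIV. h4 j) = 6"
  using sum.reindex_bij_betw[OF h4, of "%x. x"] by (simp add: eval_nat_numeral)
 have G0: "G >= 0" using G[of 0] norm_ge_zero order_trans by blast
 have "cmod (vdm gam)<=(SUM p | p permutes (UNIV :: 4 set). cmod (of_int (sign p)*(PROD i:UNIV. (e i gam)^h4 (p i))))"
  unfolding vdm_def Determinants.det_def by (rule order_trans[OF norm_sum]) simp
 also have "...<=(SUM p | p permutes (UNIV :: 4 set). G^6)"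
 proof (rule sum_mono)
  fix p assume "p:{p. p permutes (UNIV :: 4 set)}"
  hence p: "p permutes (UNIV :: 4 set)" by simp
  have "cmod (of_int (sign p)*(PROD i:UNIV. (e i gam)^h4 (p i))) = (PROD i:UNIV. cmod (e i gam)^h4 (p i))"
   by (simp add: norm_mult sign_def prod_norm[symmetric] norm_power)
  also have "...<=(PROD i:UNIV. G^h4 (p i))" by (intro prod_mono) (auto intro!: power_mono G)
  also have "... = (PROD i:UNIV. G^h4 i)"
   using prod.permute[OF p, of "%i. G^h4 i"] by (simp add: comp_def)
  also have "... = G^6" by (simp add: power_sum[symmetric] sum6)
  finally show "cmod (of_int (sign p)*(PROD i:UNIV. (e i gam)^h4 (p i)))<=G^6" .
 qed
 also have "... = 24*G^6"
  using card_permutations[of "UNIV :: 4 set" 4] by (simp add: fact_numeral)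
 finally show ?thesis .
qed

text \<open>The four elements \<open>b*gam^k\<close> are integral, so their embedding matrix is that
  of \<open>w\<close> times an integral matrix.\<close>

lemma scaled_vdm:
 assumes b: "b:R" and g: "gam:K" and bg: "!!k. k < 4 ==> b*gam^k:R"
 shows "EX c::int. nrm b * vdm gam = hdet (embmat e w) * of_int c"
proof -
 have "EX c. b*gam^h4 j = (SUM k:UNIV. of_int (c k)*w k)" for j
  using bg[OF h4_less[of j]] unfolding R_zspan zspan_def by blast
 then obtain c where c: "!!j. b*gam^h4 j = (SUM k:UNIV. of_int (c j k)*w k)" by metis
 define C :: "rat^4^4" where "C = (\<chi> k j. of_int (c j k))"
 have "embmat e (%j. b*gam^h4 j) = embmat e w ** (\<chi> k j. of_rat (C $ k $ j))"
  by (rule cmod_embmat_eqI) (auto simp: b_K c C_def)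
 hence 1: "hdet (embmat e (%j. b*gam^h4 j)) = hdet (embmat e w)*hdet ((\<chi> k j. of_rat (C $ k $ j)) :: complex^4^4)"
  by (simp add: det_mul)
 have "hdet ((\<chi> k j. of_rat (C $ k $ j)) :: complex^4^4):\<int>"
  by (rule hdet_closed) (auto simp: C_def)
 then obtain n where n: "hdet ((\<chi> k j. of_rat (C $ k $ j)) :: complex^4^4) = of_int n" using Ints_imp_ex by blast
 have "embmat e (%j. b*gam^h4 j) = (\<chi> i. e i b *s ((\<chi> i j. (e i gam)^h4 j) $ i))"
  unfolding embmat_def using R_K[OF b] g by (simp add: vec_eq_iff e_mult e_power K_closed)
 hence "hdet (embmat e (%j. b*gam^h4 j)) = nrm b * vdm gam"
  unfolding nrm_def vdm_def by (simp only: det_rows_mul vec_lambda_eta)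
 thus ?thesis using 1 n by metis
qed

text \<open>The powers of \<open>gam\<close> multiplied by \<open>N\<close>, or by \<open>b\<close>, are integral. Since \<open>N\<close> is coprime to the rest of the norm
of \<open>b\<close>, a gcd argument saves three of the four factors \<open>N\<close>.\<close>

lemma disc_le_vdm:
 assumes g: "gam:K" and ne: "!!i j. i~=j ==> e i gam~=e j gam" and N: "N > 0"
  and b1: "!!k. k < 4 ==> of_nat N*gam^k:R" and b2: "b:R" "!!k. k < 4 ==> b*gam^k:R"
  and nb: "nrm b = of_int (int N*m)" "coprime (int N) m"
 shows "disc<=(real N*cmod (vdm gam))^2"
proof -
 let ?E = "hdet (embmat e w)"
 have E0: "?E~=0" by (rule det_embmat)
 obtain c1 where c1: "nrm (of_nat N) * vdm gam = ?E * of_int c1" using scaled_vdm[OF R_of_nat g b1] by blast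
 obtain c2 where c2: "nrm b * vdm gam = ?E * of_int c2" using scaled_vdm[OF b2(1) g b2(2)] by blast
 have nN: "nrm (of_nat N) = of_nat N^4" using nrm_of_int[of "int N"] by simp
 have V0: "vdm gam~=0" by (rule vdm_nonzero[OF ne])
 have "of_nat N*(?E*(of_nat N^3 * of_int c2)) = (of_nat N*(?E*(of_int m * of_int c1) :: complex))"
 proof -
  have "of_nat N*(?E*(of_nat N^3 * of_int c2)) = of_nat N^4*(?E * of_int c2)"
   by (simp add: power4_eq_xxxx power3_eq_cube mult_ac)
  also have "... = (of_int (int N*m))*(of_nat N^4 * vdm gam)" unfolding c2[symmetric] nb(1) by (simp only: mult_ac)
  also have "... = (of_int (int N*m))*(?E * of_int c1)" using c1 unfolding nN by simp
  finally show ?thesis by (simp add: mult_ac)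
 qed
 hence "(of_nat N^3 * of_int c2 :: complex) = of_int m * of_int c1" using E0 N by simp
 hence "of_int (int N^3*c2) = (of_int (m*c1) :: complex)" by simp
 hence "int N^3*c2 = m*c1" by (simp only: of_int_eq_iff)
 hence "int N^3 dvd m*c1" by (metis dvd_triv_left)
 hence "int N^3 dvd c1" using nb(2) by (simp add: coprime_dvd_mult_right_iff)
 moreover have "c1~=0" using c1 V0 N E0 unfolding nN by auto
 ultimately have "int N^3<=\<bar>c1\<bar>" using dvd_imp_le_int[of c1 "int N^3"] by simp
 hence c1N: "real N^3<=\<bar>real_of_int c1\<bar>" by (metis of_int_abs of_int_le_iff of_int_of_nat_eq of_int_power)
 have "real N^4*cmod (vdm gam) = cmod ?E * \<bar>real_of_int c1\<bar>"
  using arg_cong[OF c1, of cmod] unfolding nN by (simp add: norm_mult norm_power)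
 also have "... >= cmod ?E*real N^3" using c1N by (intro mult_left_mono) auto
 finally have "real N^3*cmod ?E<=real N^3*(real N*cmod (vdm gam))" by (simp add: power4_eq_xxxx power3_eq_cube mult_ac)
 hence "cmod ?E<=real N*cmod (vdm gam)" using N by simp
 thus ?thesis unfolding disc_def by (intro power_mono) auto
qed

text \<open>For \<open>p\<close> prime to the discriminant the trace form is nondegenerate modulo
  \<open>p\<close>. The traces of all \<open>w i*x\<close> are divisible by \<open>p\<close> because
  the squares of these elements are, and Cramer's rule then makes the coordinates of
  \<open>x\<close> divisible by \<open>p\<close>.\<close>

lemma divisible_if_square_divisible:
 assumes p: "prime p" and nd: "disc = real Dn" "~ p dvd Dn" and x: "x:R" "z:R" "x^2 = of_nat p*z"
 shows "EX y:R. x = of_nat p*y"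
proof -
 have p0: "p > 0" using prime_gt_0_nat[OF p] .
 \<comment> \<open>With \<open>T\<close> also for the trace itself, \<open>T^2/p\<close> is a sum of
   terms \<open>e a y*e b y/p\<close>, whose squares are algebraic integers; so it is an integer and
   \<open>p\<close> divides the trace.\<close>
 have tr: "EX T. (SUM a:UNIV. e a y) = of_int (int p*T)" if y: "y:R" "z':R" "y^2 = of_nat p*z'" for y z'
 proof -
  obtain T where T: "(SUM a:UNIV. e a y) = of_int T" using trace_Ints[OF y(1)] Ints_imp_ex by blast
  have sq: "(e a y)^2 = of_nat p*e a z'" for a
  proof -
   have "(e a y)^2 = e a (y^2)" using e_power[OF R_K[OF y(1)]] by simp
   thus ?thesis unfolding y(3) using R_K[OF y(2)] by (simp add: e_mult)
  qed
  have ai: "algebraic_int (e a y*e b y/of_nat p)" for a b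
  proof (rule algebraic_int_if_power[where n = 2])
   have "(e a y*e b y/of_nat p)^2 = e a z'*e b z'"
    using p0 sq[of a] sq[of b] by (simp add: power_divide power_mult_distrib) (simp add: power2_eq_square)
   thus "algebraic_int ((e a y*e b y/of_nat p)^2)"
    using y(2) e_algebraic_int by (simp add: R_iff algebraic_int_add_mult)
  qed simp
  have "(of_int T)^2/of_nat p = (SUM a:UNIV. SUM b:UNIV. e a y*e b y/of_nat p)"
   unfolding T[symmetric] power2_eq_square sum_product sum_divide_distrib ..
  hence "algebraic_int ((of_int T)^2/of_nat p :: complex)" using ai by (simp add: algebraic_int_sum)
  hence "((of_int T)^2/of_nat p :: complex):\<int>"
   by (intro rational_algebraic_int_is_int) auto
  then obtain k where "(of_int T)^2/of_nat p = (of_int k :: complex)" using Ints_imp_ex by blast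
  hence "of_int (T^2) = (of_int (k*int p) :: complex)" using p0 by (simp add: field_simps)
  hence "T^2 = k*int p" by (simp only: of_int_eq_iff)
  hence "int p dvd T^2" by simp
  hence "int p dvd T" using p by (intro prime_dvd_power[of "int p" T 2]) auto
  then obtain k' where "T = int p*k'" by (auto elim: dvdE)
  thus ?thesis using T by metis
 qed
 obtain n where n: "x = (SUM k:UNIV. of_int (n k)*w k)" using x(1) unfolding R_zspan zspan_def by blast
 define E where "E = embmat e w"
 define M where "M = transpose E ** E"
 have Mij: "M $ i $ j = (SUM a:UNIV. e a (w i*w j))" for i j
  unfolding M_def E_def by (simp add: matrix_matrix_mult_def transpose_def embmat_def e_mult b_K)
 have MI: "M $ i $ j:\<int>" for i j unfolding Mij by (intro trace_Ints R_mult w_R)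
 have detM: "hdet M = (hdet E)^2" unfolding M_def by (simp add: det_mul power2_eq_square)
 have "hdet M:\<int>" by (rule hdet_closed) (use MI in auto)
 then obtain N0 where N0: "hdet M = of_int N0" using Ints_imp_ex by blast
 have "real_of_int \<bar>N0\<bar> = real Dn"
  using nd(1) unfolding disc_def E_def[symmetric] norm_power[symmetric] detM[symmetric] N0 by simp
 hence N0p: "~ int p dvd N0" using nd(2) by (metis dvd_abs_iff int_dvd_int_iff of_int_eq_iff of_int_of_nat_eq)
 define X :: "complex^4" where "X = (\<chi> k. of_int (n k)/of_nat p)"
 have MX: "(M *v X) $ i:\<int>" for i
 proof -
  have "(w i*x)^2 = of_nat p*((w i)^2*z)" using x(3) by (simp add: power_mult_distrib)
  then obtain T where T: "(SUM a:UNIV. e a (w i*x)) = of_int (int p*T)"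
   using tr[of "w i*x" "(w i)^2*z"] x w_R R_mult R_power by blast
  have "(SUM a:UNIV. e a (w i*x)) = (SUM a:UNIV. SUM j:UNIV. of_int (n j)*e a (w i*w j))"
   unfolding n sum_distrib_left by (intro sum.cong refl) (simp add: e_sum e_mult b_K K_closed mult_ac)
  also have "... = (SUM j:UNIV. M $ i $ j * of_int (n j))"
   unfolding Mij by (subst sum.swap) (simp add: sum_distrib_left sum_distrib_right mult_ac)
  finally have "(M *v X) $ i = of_int (int p*T)/of_nat p"
   unfolding T X_def by (simp add: matrix_vector_mult_def sum_divide_distrib)
  hence "(M *v X) $ i = of_int T" using p0 by simp
  thus ?thesis by simp
 qed
 have "int p dvd n k" for k
 proof -
  have "X $ k*hdet M:\<int>" unfolding cramer_lemma[symmetric]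
   by (rule hdet_closed) (use MI MX in auto)
  then obtain q where "X $ k*hdet M = of_int q" using Ints_imp_ex by blast
  hence "of_int (n k*N0) = (of_int (q*int p) :: complex)" unfolding X_def N0 using p0 by (simp add: field_simps)
  hence "n k*N0 = q*int p" by (simp only: of_int_eq_iff)
  hence "int p dvd n k*N0" by (metis dvd_triv_right)
  hence "int p dvd n k | int p dvd N0" using p by (intro prime_dvd_multD) auto
  thus ?thesis using N0p by blast
 qed
 hence "ALL k. EX m. n k = int p*m" unfolding dvd_def by (rule allI)
 hence "EX n'. ALL k. n k = int p*n' k" by (rule choice)
 then obtain n' where n': "!!k. n k = int p*n' k" by blast
 have "x = of_nat p*(SUM k:UNIV. of_int (n' k)*w k)" unfolding n n' by (simp add: sum_distrib_left mult_ac)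
 moreover have "(SUM k:UNIV. of_int (n' k)*w k):R" by (intro R_sum R_mult w_R R_of_int)
 ultimately show ?thesis by blast
qed

lemma card_prime_divisors_le:
 assumes "finite S" "ALL p:S. prime p & p dvd n" "(n::nat) > 0"
 shows "2^card S<=n"
proof -
 have "(PROD p:S. p) dvd n"
  using assms(1,2)
 proof (induction S rule: finite_induct)
  case (insert p S)
  have "coprime p (PROD p:S. p)" using insert by (intro prod_coprime_right) (metis insert_iff primes_coprime)
  thus ?case using insert by (simp add: divides_mult)
 qed simp
 hence "(PROD p:S. p)<=n" using assms(3) by (rule dvd_imp_le)
 moreover have "(PROD p:S. 2)<=(PROD p:S. p)" by (rule prod_mono) (use assms(2) prime_ge_2_nat in auto)
 ultimately show ?thesis by simp
qed

end

section \<open>The torsion bound for a single field\<close>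

context d4_tower
begin

text \<open>If \<open>p\<close> divided \<open>t\<close>, it would divide \<open>s^2\<close> and,
  being prime to the discriminant, \<open>s\<close> itself; so \<open>p^4\<close> would divide the
  norm \<open>t^2*(u^2 - d*v^2)\<close>, and \<open>p^2\<close> would divide the squarefree
  \<open>t\<close>.\<close>

lemma not_dvd_t:
 assumes p: "prime p" and nd: "disc = real Dn" "~ p dvd Dn" and sf: "squarefree t" and nu: "~ int p dvd u^2 - d * v^2"
 shows "~ int p dvd t"
proof
 assume "int p dvd t"
 then obtain t' where t': "t = int p*t'" by (auto elim: dvdE)
 have "s^2 = of_nat p*(of_int t'*(of_int u + of_int v * dlt))" unfolding s_sq t' by simp
 moreover have "of_int t'*(of_int u + of_int v * dlt):R" by (intro R_mult R_add delta_R R_of_int)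
 ultimately obtain y where y: "y:R" "s = of_nat p*y" using divisible_if_square_divisible[OF p nd s_R] by blast
 have "nrm s = nrm (of_nat p)*nrm y" unfolding y(2) by (rule nrm_mult) (use y(1) R_K in auto)
 moreover have "nrm s = of_int (t^2*(u^2 - d * v^2))"
  using nrm_s_minus[of 0] by (simp add: F_def algebra_simps power2_eq_square)
 moreover have "nrm (of_nat p) = of_nat p^4" using nrm_of_int[of "int p"] by simp
 moreover obtain k where "nrm y = of_int k" using nrm_Ints[OF y(1)] Ints_imp_ex by blast
 ultimately have "of_int (t^2*(u^2 - d * v^2)) = (of_int (int p^4*k) :: complex)" by simp
 hence "t^2*(u^2 - d * v^2) = int p^4*k" by (simp only: of_int_eq_iff)
 hence "int p^4 dvd t^2*(u^2 - d * v^2)" by simp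
 moreover have "coprime (int p^4) (u^2 - d * v^2)" using nu p by (simp add: prime_imp_coprime)
 ultimately have "(int p^2)^2 dvd t^2" by (simp add: coprime_dvd_mult_left_iff flip: power_mult)
 hence "int p^2 dvd t" using pow_divides_pow_iff[of 2 "int p^2" t] by simp
 hence "int p dvd 1" using sf unfolding squarefree_def by blast
 thus False using p by simp
qed

definition good_prime :: "nat => bool" where
 "good_prime p \<longleftrightarrow> prime p & odd p & Legendre d (int p) = 1 & Legendre (u^2 - d * v^2) (int p) = -1 & ~ int p dvd v"

lemma torsion_times_primes_le:
 assumes sf: "squarefree t" and l: "l >= 1" and nd: "disc = real Dn"
  and P: "finite P" "!!p. p:P ==> good_prime p & ~ p dvd Dn & real p<=y"
  and y: "y >= 0" "576*exp (12*real l)*y^(6*l) < disc"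
 shows "card (class_torsion K l)*card P <=
  card {J. nzideal J & real (inorm J)<=2 * sqrt disc} * (nat \<lfloor>ln (2 * sqrt disc)\<rfloor> + 1)^4"
proof -
 have "EX m. exact p m" if pP: "p:P" for p
 proof -
  have g: "prime p" "odd p" "Legendre d (int p) = 1" "Legendre (u^2 - d * v^2) (int p) = -1" "~ int p dvd v" "~ p dvd Dn"
   using P(2)[OF pP] by (auto simp: good_prime_def)
  have "~ int p dvd u^2 - d * v^2" using g(4) by (auto simp: Legendre_def cong_0_iff split: if_splits)
  hence "~ int p dvd t" by (rule not_dvd_t[OF g(1) nd g(6) sf])
  thus ?thesis using exact_root_mod_prime[OF g(1-4) _ g(5)] g(1) unfolding exact_def F_def by blast
 qed
 then obtain m where m: "!!p. p:P ==> exact p (m p)" by metis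
 define A where "A = (%p. pid p (m p))`P"
 have "inj_on (%p. pid p (m p)) P" by (rule inj_onI) (metis m pid_norm)
 hence cA: "card A = card P" unfolding A_def by (rule card_image)
 have "card (class_torsion K l)*card A <=
  card {J. nzideal J & real (inorm J)<=2 * sqrt disc} * (nat \<lfloor>ln (2 * sqrt disc)\<rfloor> + 1)^4"
 proof (rule torsion_card_bound[OF l])
  show "finite A" using P(1) by (simp add: A_def)
  show "nzideal aa" if "aa:A" for aa using that m pid_nz by (auto simp: A_def exact_def)
  fix aa bb x z
  assume ab: "aa:A" "bb:A" "aa~=bb" and x: "x:R" "x~=0" and z: "z:R" "z~=0"
   and eq: "(*) x`ipow aa l = (*) z`ipow bb l"
   and bound: "!!i. cmod (e i (z/x))<=exp (real l)*(real (inorm aa)/real (inorm bb)) powr (real l/4)"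
  obtain p where p: "p:P" "aa = pid p (m p)" using ab(1) A_def by blast
  obtain q where q: "q:P" "bb = pid q (m q)" using ab(2) A_def by blast
  note ep = m[OF p(1)] and eq' = m[OF q(1)]
  have pr: "prime p" "prime q" using ep eq' by (auto simp: exact_def)
  have p0: "real p > 0" "real q > 0" using pr prime_gt_0_nat by auto
  have pq: "p~=q" using ab p q by auto
  define gam where "gam = z/x"
  have gK: "gam:K" unfolding gam_def by (intro K_divide R_K x z)
  have "iot gam~=gam" unfolding gam_def by (rule not_fixed[OF ep eq' pq l x z eq[unfolded p(2) q(2)]])
  hence ne: "e i gam~=e j gam" if "i~=j" for i j using fixed_if_conjugates_eq[OF gK that] by blast
  \<comment> \<open>\<open>b^l*gam\<close> is integral for \<open>b\<close> in \<open>bb\<close>;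
    the exponent \<open>3*l\<close> covers \<open>gam\<close> up to its third power.\<close>
  have lift: "b^(3*l)*gam^k:R" if b: "b:bb" and k: "k < 4" for b k
  proof -
   have bR: "b:R" using b idealD(7)[OF pid_ideal] q(2) by blast
   have "z*b^l:(*) z`ipow bb l" by (intro imageI ipow_mem) (use b q(2) pid_nz pr in auto)
   then obtain piv where pi: "piv:ipow aa l" "z*b^l = x*piv" unfolding eq[symmetric] by blast
   have piR: "piv:R" using idealD(7)[OF nz_ideal[OF ipow_nz[OF pid_nz[OF pr(1)]]]] pi(1) p(2) by blast
   have "b^l*gam = piv" using pi(2) x(2) by (simp add: gam_def field_simps)
   moreover have "b^(3*l)*gam^k = (b^l*gam)^k*(b^l)^(3 - k)"
   proof -
    have "(b^l)^3 = (b^l)^k*(b^l)^(3 - k)" using k by (simp flip: power_add)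
    thus ?thesis by (simp add: power_mult_distrib mult_ac flip: power_mult)
   qed
   ultimately show ?thesis using piR bR by (simp add: R_mult R_power)
  qed
  obtain f where f: "F (m q) = int q*f" using eq' by (auto simp: exact_def elim: dvdE)
  have "~ int q dvd f" using eq' f by (auto simp: exact_def power2_eq_square)
  hence cop: "coprime (int q) f" using pr(2) by (simp add: prime_imp_coprime)
  have sm: "s - of_int (m q):R" by (intro R_diff s_R R_of_int)
  \<comment> \<open>Two denominators are compared: the integer \<open>q^(3*l)\<close>, and a power
    of \<open>s - m q\<close> whose norm contains \<open>q\<close> to the power \<open>3*l\<close>
    exactly.\<close>
  have D: "disc<=(real (q^(3*l))*cmod (vdm gam))^2"
  proof (rule disc_le_vdm[OF gK ne])
   show "0 < q^(3*l)" using pr(2) prime_gt_0_nat by simp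
   show "of_nat (q^(3*l))*gam^k:R" if "k < 4" for k
    using lift[OF _ that, of "of_nat q"] pid_gens(1) q(2) by simp
   show "(s - of_int (m q))^(3*l):R" by (intro R_power sm)
   show "(s - of_int (m q))^(3*l)*gam^k:R" if "k < 4" for k
    using lift[OF _ that, of "s - of_int (m q)"] pid_gens(2) q(2) by simp
   show "nrm ((s - of_int (m q))^(3*l)) = of_int (int (q^(3*l))*f^(3*l))"
    using nrm_power[OF R_K[OF sm], of "3*l"] unfolding nrm_s_minus f by (simp add: power_mult_distrib)
   show "coprime (int (q^(3*l))) (f^(3*l))" using cop by simp
  qed
  define G where "G = exp (real l)*(real p/real q) powr (real l/4)"
  have "cmod (vdm gam)<=24*G^6"
   by (rule vdm_bound) (use bound in \<open>simp add: gam_def G_def p(2) q(2) pid_norm[OF ep] pid_norm[OF eq']\<close>)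
  hence "(real (q^(3*l))*cmod (vdm gam))^2<=(real (q^(3*l))*(24*G^6))^2"
   by (intro power_mono mult_left_mono) auto
  also have "... = 576*((real q^(3*l))^2*G^12)" by (simp add: power_mult_distrib flip: power_mult)
  also have "G^12 = exp (12*real l)*(real p/real q)^(3*l)"
  proof -
   have "((real p/real q) powr (real l/4))^12 = (real p/real q) powr (real 12*(real l/4))"
    by (rule powr_power) (use p0 in simp)
   also have "real 12*(real l/4) = real (3*l)" by simp
   also have "(real p/real q) powr real (3*l) = (real p/real q)^(3*l)" using p0 by (intro powr_realpow) simp
   finally show ?thesis unfolding G_def power_mult_distrib using exp_of_nat_mult[of 12 "real l"] by simp
  qed
  also have "576*((real q^(3*l))^2*(exp (12*real l)*(real p/real q)^(3*l))) =
    576*exp (12*real l)*(real q^(3*l)*real p^(3*l))"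
   using p0 by (simp add: power_divide power2_eq_square)
  also have "...<=576*exp (12*real l)*(y^(3*l)*y^(3*l))"
   using P(2)[OF p(1)] P(2)[OF q(1)] y(1) by (intro mult_left_mono mult_mono power_mono) auto
  also have "y^(3*l)*y^(3*l) = y^(6*l)" by (simp flip: power_add)
  finally show False using D y(2) by linarith
 qed
 thus ?thesis unfolding cA .
qed

text \<open>The family of ideals is \<open>R\<close> alone, so no two members have to be told apart.
  It covers the small discriminants in \<open>torsion_growth\<close>.\<close>

lemma torsion_trivial_bound:
 assumes l: "l >= 1"
 shows "card (class_torsion K l) <=
  card {J. nzideal J & real (inorm J)<=2 * sqrt disc} * (nat \<lfloor>ln (2 * sqrt disc)\<rfloor> + 1)^4"
 using torsion_card_bound[OF l, of "{R}"] nzideal_R by simp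

end

text \<open>Pure analysis: \<open>T\<close> stands for the torsion, \<open>Jb D\<close> for the
  bound of the counting argument, and \<open>c*y powr (1 - \<epsilon> / 4) - log 2 D\<close> for the
  number of available primes. \<open>y\<close> is taken as a constant times the power
  \<open>1/(6*l)\<close> of \<open>D\<close>; the discriminants up to \<open>D1\<close> are absorbed
  by \<open>C\<close>.\<close>

lemma torsion_growth:
 fixes l :: nat and \<epsilon> c y0 Z :: real
 assumes l: "l >= 1" and eps: "0 < \<epsilon>" "\<epsilon> < 1" and c: "c > 0" and Z: "Z >= 0"
 defines "Jb \<equiv> %D. Z*(2 * sqrt D) powr (1 + \<epsilon> / 2)*(ln (2 * sqrt D) + 1)^4"
 shows "EX C. ALL D T. D >= 1 --> T >= 0 --> T<=Jb D -->
  (ALL y. y >= y0 --> y >= 0 --> 576*exp (12*real l)*y^(6*l) < D -->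
    T*(c*y powr (1 - \<epsilon> / 4) - log 2 D)<=Jb D) -->
  T<=C*D powr (1/2 - 1/(6*real l) + \<epsilon>)"
proof -
 \<comment> \<open>The allowance \<open>4*a\<close> pays for the exponent of the ideal count, for
   the logarithms and for the loss in the number of primes, each costing at most
   \<open>a\<close>.\<close>
 define a where "a = \<epsilon> / 4"
 have a: "0 < a" "a < 1/4" using eps by (auto simp: a_def)
 define L where "L = 6*real l"
 have L: "L >= 6" using l by (simp add: L_def)
 \<comment> \<open>577 instead of 576 leaves room for the strict inequality required of
   \<open>y\<close>.\<close>
 define A where "A = (1/(577*exp (12*real l))) powr (1/L)"
 have A: "A > 0" by (simp add: A_def)
 define k where "k = c/2*A powr (1 - a)"
 have k: "k > 0" using c A by (simp add: k_def)
 define b where "b = (1 - a)/L"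
 have b: "b > 0" using a L by (simp add: b_def)
 define r where "r = 1/L"
 have r: "r > 0" using L by (simp add: r_def)
 have "eventually (%D::real. (ln (2 * sqrt D) + 1)^4<=D powr a) at_top"
  using a by real_asymp
 moreover have "eventually (%D::real. log 2 D<=k*D powr b) at_top"
  unfolding log_def using k b by real_asymp
 moreover have "eventually (%D::real. y0<=A*D powr r) at_top"
 proof -
  have "filterlim (%D::real. A*D powr r) at_top at_top" using A r by real_asymp
  thus ?thesis by (simp add: filterlim_at_top)
 qed
 ultimately have "eventually (%D::real. (ln (2 * sqrt D) + 1)^4<=D powr a & log 2 D<=k*D powr b & y0<=A*D powr r) at_top"
  by eventually_elim blast
 then obtain D0 where D0: "!!D. D >= D0 ==> (ln (2 * sqrt D) + 1)^4<=D powr a & log 2 D<=k*D powr b & y0<=A*D powr r"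
  unfolding eventually_at_top_linorder by blast
 define D1 where "D1 = max 1 D0"
 define X where "X = 1/2 - 1/L + \<epsilon>"
 have "1/L<=1/6" using L by (simp add: field_simps)
 hence X0: "X >= 0" using eps by (simp add: X_def)
 define C where "C = max (Jb D1) (Z*2 powr (1 + 2*a)/k)"
 have lnp: "ln (2 * sqrt D) + 1 >= 0" if "D >= 1" for D :: real
  using that by (intro add_nonneg_nonneg ln_ge_zero) (auto intro: order_trans[of 1 "2*1"])
 have "T<=C*D powr X"
  if D: "D >= 1" and T: "T >= 0" "T<=Jb D" and
   y: "!!y. y >= y0 ==> y >= 0 ==> 576*exp (12*real l)*y^(6*l) < D ==> T*(c*y powr (1 - \<epsilon> / 4) - log 2 D)<=Jb D"
  for D T
 proof (cases "D<=D1")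
  case True
  have "Jb D<=Jb D1" unfolding Jb_def using True D Z eps lnp[OF D]
   by (intro mult_mono mult_left_mono powr_mono2 power_mono add_right_mono ln_mono) (auto intro!: mult_nonneg_nonneg)
  hence "T<=C*1" using T(2) by (simp add: C_def)
  also have "...<=C*D powr X"
  proof (rule mult_left_mono)
   show "1<=D powr X" using D X0 by (rule ge_one_powr_ge_zero)
   show "0<=C" using Z k by (simp add: C_def le_max_iff_disj)
  qed
  finally show ?thesis .
 next
  case False
  hence DD: "D >= D0" by (simp add: D1_def)
  note e = D0[OF DD]
  define Y where "Y = A*D powr r"
  have Y0: "Y > 0" using A D by (simp add: Y_def)
  have "Y^(6*l) = Y powr L" using Y0 by (simp add: L_def flip: powr_realpow)
  also have "... = 1/(577*exp (12*real l))*D"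
   unfolding Y_def A_def r_def using D L by (simp add: powr_mult powr_powr powr_divide)
  finally have "576*exp (12*real l)*Y^(6*l) = 576/577*D" by simp
  moreover have "576/577*D < D" using D by simp
  ultimately have "576*exp (12*real l)*Y^(6*l) < D" by linarith
  hence "T*(c*Y powr (1 - \<epsilon> / 4) - log 2 D)<=Jb D" using y[of Y] e Y0 by (simp add: Y_def)
  moreover have "c*Y powr (1 - \<epsilon> / 4) - log 2 D >= k*D powr b"
  proof -
   have "c*Y powr (1 - a) = 2*(k*D powr b)"
    unfolding Y_def k_def b_def r_def using A D by (simp add: powr_mult powr_powr)
   thus ?thesis using e by (simp add: a_def)
  qed
  ultimately have 1: "T*(k*D powr b)<=Jb D" using T(1) by (meson mult_left_mono order_trans)
  have "Jb D = Z*(2 * sqrt D) powr (1 + 2*a)*(ln (2 * sqrt D) + 1)^4" by (simp add: Jb_def a_def)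
  also have "...<=Z*(2 * sqrt D) powr (1 + 2*a)*D powr a"
   using e Z by (intro mult_left_mono) auto
  also have "(2 * sqrt D) powr (1 + 2*a) = 2 powr (1 + 2*a)*D powr (1/2 + a)"
   using D by (simp add: powr_mult powr_half_sqrt[symmetric] powr_powr algebra_simps)
  also have "Z*(2 powr (1 + 2*a)*D powr (1/2 + a))*D powr a = Z*2 powr (1 + 2*a)*D powr (1/2 + 2*a)"
  proof -
   have "D powr (1/2 + a)*D powr a = D powr (1/2 + 2*a)" by (subst powr_add[symmetric]) (simp add: algebra_simps)
   thus ?thesis by (simp only: mult.assoc)
  qed
  finally have "T*(k*D powr b)<=Z*2 powr (1 + 2*a)*D powr (1/2 + 2*a)" using 1 by linarith
  also have "...<=Z*2 powr (1 + 2*a)*D powr (X + b)"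
  proof -
   have "a/L<=a" using a L by (simp add: field_simps)
   moreover have "b = 1/L - a/L" by (simp add: b_def diff_divide_distrib)
   ultimately have "1/2 + 2*a<=X + b" using a unfolding X_def a_def by linarith
   thus ?thesis using D Z by (intro mult_left_mono powr_mono) auto
  qed
  finally have "T*k*D powr b<=(Z*2 powr (1 + 2*a)*D powr X)*D powr b" by (simp add: powr_add mult.assoc)
  hence "T*k<=Z*2 powr (1 + 2*a)*D powr X" using D by simp
  hence "T<=Z*2 powr (1 + 2*a)/k*D powr X" using k by (simp add: field_simps)
  also have "...<=C*D powr X" by (intro mult_right_mono) (auto simp: C_def)
  finally show ?thesis .
 qed
 thus ?thesis unfolding X_def L_def by blast
qed

section \<open>Galois theory of D4-fields\<close>

text \<open>On residues modulo 4, \<open>dih a True\<close> is the rotation taking \<open>i\<close>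
  to \<open>a + i\<close> and \<open>dih a False\<close> the reflection taking \<open>i\<close> to
  \<open>a - i\<close>; \<open>4 - i\<close> keeps the difference within the naturals.\<close>

definition dih :: "nat => bool => nat => nat" where
 "dih a s i = (if i < 4 then (if s then a + i else a + (4 - i)) mod 4 else i)"

lemma less_4_cases: "(i::nat) < 4 \<longleftrightarrow> i = 0 | i = 1 | i = 2 | i = 3"
 by auto

lemma all_less_4: "(ALL i<(4::nat). P i) \<longleftrightarrow> P 0 & P 1 & P 2 & P 3"
 by (auto simp: less_4_cases)

text \<open>Quantification over explicit lists lets the multiplication table be evaluated.\<close>

lemma dih_comp_table:
 "list_all (%a. list_all (%b. list_all (%i. list_all (%s. list_all (%t.
   dih a s (dih b t i) = dih ((if s then a + b else a + (4 - b)) mod 4) (s = t) i)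
   [True, False]) [True, False]) [0..<4]) [0..<4]) [0..<4]"
 by code_simp

lemma dih_comp:
 assumes "a < 4" "b < 4"
 shows "dih a s o dih b t = dih ((if s then a + b else a + (4 - b)) mod 4) (s = t)"
proof
 fix i
 have "dih a s (dih b t i) = dih ((if s then a + b else a + (4 - b)) mod 4) (s = t) i"
 proof (cases "i < 4")
  case True
  have "s:set [True, False]" "t:set [True, False]" by (cases s; cases t; simp)+
  thus ?thesis
   using dih_comp_table assms True unfolding list_all_iff set_upt atLeast0LessThan by blast
 next
  case False
  thus ?thesis by (simp only: dih_def if_False)
 qed
 thus "(dih a s o dih b t) i = dih ((if s then a + b else a + (4 - b)) mod 4) (s = t) i"
  by (simp only: comp_apply)
qed

lemma dih_eq_iff: "a < 4 ==> b < 4 ==> dih a s = dih b t \<longleftrightarrow> a = b & s = t"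
proof
 assume ab: "a < 4" "b < 4" and e: "dih a s = dih b t"
 have "dih a s 0 = dih b t 0" "dih a s 1 = dih b t 1" using e by auto
 moreover have "ALL a<4. ALL b<4. dih a s 0 = dih b t 0 & dih a s 1 = dih b t 1 --> a = b & s = t"
  unfolding all_less_4 dih_def by (cases s; cases t) simp_all
 ultimately show "a = b & s = t" using ab by blast
qed simp

lemma dih_id: "dih 0 True = id"
 by (auto simp: dih_def fun_eq_iff)

text \<open>Adjacency forces the images of 2 and 3 to be opposite to those of 0 and 1, and leaves
  two neighbours of the image of 0 for the image of 1. These are the rotation and the
  reflection.\<close>

lemma D4_carrier: "carrier D4_group = (%(a,s). dih a s)`({..<4} \<times> UNIV)"
proof (intro equalityI subsetI)
 fix p assume p: "p:carrier D4_group"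
 hence bij: "bij_betw p {..<4} {..<4}" and fix4: "!!i. i >= 4 ==> p i = i"
  and adj: "!!i j. i < 4 ==> j < 4 ==> sq_adj i j ==> sq_adj (p i) (p j)"
  by (auto simp: D4_group_def)
 have lt: "p 0 < 4" "p 1 < 4" "p 2 < 4" "p 3 < 4" using bij_betwE[OF bij] by (simp_all add: Ball_def)
 have ne: "p 0~=p 2" "p 1~=p 3"
  using inj_on_eq_iff[OF bij_betw_imp_inj_on[OF bij], of 0 2] inj_on_eq_iff[OF bij_betw_imp_inj_on[OF bij], of 1 3] by simp_all
 have ad: "sq_adj (p 0) (p 1)" "sq_adj (p 1) (p 2)" "sq_adj (p 2) (p 3)"
  by (rule adj; simp add: sq_adj_def)+
 have "EX a s. a < 4 & p 0 = dih a s 0 & p 1 = dih a s 1 & p 2 = dih a s 2 & p 3 = dih a s 3"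
 proof -
  have adj2: "ALL a<4. ALL b<4. ALL c<4. a~=c --> sq_adj a b --> sq_adj b c --> c = (a + 2) mod 4"
   unfolding all_less_4 sq_adj_def by simp
  have adj1: "ALL a<4. ALL b<4. sq_adj a b --> b = (a + 1) mod 4 | b = (a + 3) mod 4"
   unfolding all_less_4 sq_adj_def by simp
  have "p 2 = (p 0 + 2) mod 4" "p 3 = (p 1 + 2) mod 4" "p 1 = (p 0 + 1) mod 4 | p 1 = (p 0 + 3) mod 4"
   using adj2 adj1 lt ne ad by blast+
  hence "EX s. p 0 = dih (p 0) s 0 & p 1 = dih (p 0) s 1 & p 2 = dih (p 0) s 2 & p 3 = dih (p 0) s 3"
  proof (elim disjE)
   assume q: "p 2 = (p 0 + 2) mod 4" "p 3 = (p 1 + 2) mod 4" "p 1 = (p 0 + 1) mod 4"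
   have "p 3 = (p 0 + 3) mod 4" unfolding q(2,3) by presburger
   thus ?thesis using q lt by (intro exI[of _ True]) (simp add: dih_def)
  next
   assume q: "p 2 = (p 0 + 2) mod 4" "p 3 = (p 1 + 2) mod 4" "p 1 = (p 0 + 3) mod 4"
   have "p 3 = (p 0 + 5) mod 4" unfolding q(2,3) by presburger
   moreover have "... = (p 0 + 1) mod 4" by presburger
   ultimately have "p 3 = (p 0 + 1) mod 4" by (rule trans)
   thus ?thesis using q lt by (intro exI[of _ False]) (simp add: dih_def)
  qed
  thus ?thesis using lt by blast
 qed
 then obtain a s where as: "a < 4" "p 0 = dih a s 0" "p 1 = dih a s 1" "p 2 = dih a s 2" "p 3 = dih a s 3" by blast
 have "p i = dih a s i" for i
 proof (cases "i < 4")
  case True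
  thus ?thesis using as unfolding less_4_cases by auto
 next
  case False
  thus ?thesis using fix4 by (simp add: dih_def)
 qed
 hence "p = dih a s" by auto
 thus "p:(%(a,s). dih a s)`({..<4} \<times> UNIV)" using as(1) by auto
next
 fix p assume "p:(%(a,s). dih a s)`({..<4} \<times> (UNIV :: bool set))"
 then obtain a s where p: "p = dih a s" "a < 4" by auto
 have inj: "inj_on p {..<4}"
  using p(2) unfolding p(1) inj_on_def less_4_cases lessThan_iff dih_def by (cases s) auto
 have sub: "p`{..<4}<={..<4}" using p by (auto simp: dih_def)
 have "bij_betw p {..<4} {..<4}"
  unfolding bij_betw_def using inj sub endo_inj_surj by blast
 moreover have "sq_adj (p i) (p j)" if "i < 4" "j < 4" "sq_adj i j" for i j
 proof -
  have "ALL a<4. ALL i<4. ALL j<4. sq_adj i j --> sq_adj (dih a s i) (dih a s j)"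
   unfolding all_less_4 sq_adj_def dih_def by (cases s) simp_all
  thus ?thesis using that p by blast
 qed
 ultimately show "p:carrier D4_group" using p by (auto simp: D4_group_def dih_def)
qed

lemma D4_mult: "mult D4_group p q = p o q" and D4_one: "one D4_group = id"
 by (simp_all add: D4_group_def)

lemma D4_card: "card (carrier D4_group) = 8"
proof -
 have "inj_on (%(a,s). dih a s) ({..<4} \<times> (UNIV :: bool set))"
  by (auto simp: inj_on_def dih_eq_iff)
 thus ?thesis unfolding D4_carrier by (simp add: card_image card_cartesian_product)
qed

text \<open>The structure is phrased by equations between elements so that it passes through an
  isomorphism. \<open>z\<close> is the half turn; for a reflection \<open>h\<close> the witness
  \<open>g\<close> is the quarter turn, which conjugates \<open>h\<close> to \<open>z\<close> times
  \<open>h\<close>.\<close>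

lemma D4_structure:
 "EX z:carrier D4_group. z~=\<one>\<^bsub>D4_group\<^esub> & z \<otimes>\<^bsub>D4_group\<^esub> z = \<one>\<^bsub>D4_group\<^esub> &
   (ALL x:carrier D4_group. z \<otimes>\<^bsub>D4_group\<^esub> x = x \<otimes>\<^bsub>D4_group\<^esub> z) &
   (ALL h:carrier D4_group. h = \<one>\<^bsub>D4_group\<^esub> | h = z | h \<otimes>\<^bsub>D4_group\<^esub> h = z |
    (h \<otimes>\<^bsub>D4_group\<^esub> h = \<one>\<^bsub>D4_group\<^esub> & (EX g:carrier D4_group.
     h \<otimes>\<^bsub>D4_group\<^esub> g = g \<otimes>\<^bsub>D4_group\<^esub> (z \<otimes>\<^bsub>D4_group\<^esub> h) & g \<otimes>\<^bsub>D4_group\<^esub> g = z &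
     (ALL x:carrier D4_group. EX y:{\<one>\<^bsub>D4_group\<^esub>, z, h, z \<otimes>\<^bsub>D4_group\<^esub> h}. x = y | x = g \<otimes>\<^bsub>D4_group\<^esub> y))))"
proof -
 let ?z = "dih 2 True"
 have mem: "dih a s:carrier D4_group" if "a < 4" for a s using that by (auto simp: D4_carrier)
 have elim: "EX a s. a < 4 & x = dih a s" if "x:carrier D4_group" for x using that by (auto simp: D4_carrier)
 have central: "?z o x = x o ?z" if xC: "x:carrier D4_group" for x
 proof -
  obtain a s where as: "a < 4" "x = dih a s" using elim xC by blast
  have "ALL a<4. ?z o dih a s = dih a s o ?z"
   unfolding all_less_4 by (cases s) (simp_all add: dih_comp flip: numeral_2_eq_2)
  thus ?thesis using as by blast
 qed
 have hh: "h = id | h = ?z | h o h = ?z | (h o h = id & (EX g:carrier D4_group.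
     h o g = g o (?z o h) & g o g = ?z &
     (ALL x:carrier D4_group. EX y:{id, ?z, h, ?z o h}. x = y | x = g o y)))"
  if hC: "h:carrier D4_group" for h
 proof -
  obtain a s where h: "a < 4" "h = dih a s" using elim hC by blast
  show ?thesis
  proof (cases s)
   case True
   have "ALL a<4. dih a True = id | dih a True = ?z | dih a True o dih a True = ?z"
    unfolding all_less_4 by (simp add: dih_comp dih_id flip: numeral_2_eq_2)
   thus ?thesis using h True by auto
  next
   case False
   have c1: "ALL a<4. dih a False o dih a False = id"
    unfolding all_less_4 by (simp add: dih_comp dih_id)
   have c2: "ALL a<4. dih a False o dih 1 True = dih 1 True o (?z o dih a False)"
    unfolding all_less_4 by (simp add: dih_comp flip: numeral_2_eq_2)
   have c3: "dih 1 True o dih 1 True = ?z" by (simp add: dih_comp flip: numeral_2_eq_2)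
   have "ALL a<4. ALL b<4. ALL t. dih b t:{dih 0 True, ?z, dih a False, ?z o dih a False} |
     dih b t:(o) (dih 1 True)`{dih 0 True, ?z, dih a False, ?z o dih a False}"
    unfolding all_less_4 all_bool_eq by (simp add: dih_comp dih_eq_iff flip: numeral_2_eq_2)
   note H = this
   have "EX y:{id, ?z, h, ?z o h}. x = y | x = dih 1 True o y" if xC: "x:carrier D4_group" for x
   proof -
    have sF: "s = False" using False by simp
    obtain b t where x: "b < 4" "x = dih b t" using elim xC by blast
    have "x:{id, ?z, h, ?z o h} | x:(o) (dih 1 True)`{id, ?z, h, ?z o h}"
     using H[rule_format, OF h(1) x(1), of t] by (simp only: h(2) x(2) sF dih_id)
    thus ?thesis by (elim disjE imageE) blast+
   qed
   moreover have "dih 1 True:carrier D4_group" by (rule mem) simp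
   moreover have "h o h = id" "h o dih 1 True = dih 1 True o (?z o h)" using c1 c2 h False by auto
   ultimately show ?thesis using c3 by blast
  qed
 qed
 have "?z~=id" by (simp add: dih_id[symmetric] dih_eq_iff)
 moreover have "?z o ?z = id" by (simp add: dih_comp dih_id)
 moreover have "?z:carrier D4_group" by (rule mem) simp
 ultimately show ?thesis unfolding D4_mult D4_one using central hh
  by (intro bexI[where x = ?z] conjI ballI)
qed

section \<open>Minimal polynomials and extension of embeddings\<close>

definition coeffs_in :: "complex set => complex poly => bool" where
 "coeffs_in F p \<longleftrightarrow> (ALL i. Polynomial.coeff p i:F)"

context number_subfield
begin

lemma coeffs_in_closed:
 "coeffs_in K 0" "coeffs_in K 1" "coeffs_in K p ==> coeffs_in K q ==> coeffs_in K (p + q)"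
 "coeffs_in K p ==> coeffs_in K q ==> coeffs_in K (p - q)"
 "coeffs_in K p ==> coeffs_in K q ==> coeffs_in K (p*q)"
 "c:K ==> coeffs_in K (Polynomial.monom c n)"
 unfolding coeffs_in_def
 by (auto simp: coeff_mult coeff_1 intro!: K_add K_diff K_mult K_sum)

lemma coeffs_in_division:
 assumes q: "q~=0" "coeffs_in K q" and "coeffs_in K g"
 shows "EX s r. coeffs_in K s & coeffs_in K r & g = s*q + r & (r = 0 | Polynomial.degree r < Polynomial.degree q)"
 using assms(3)
proof (induction "Polynomial.degree g" arbitrary: g rule: less_induct)
 case (less g)
 show ?case
 proof (cases "g = 0 | Polynomial.degree g < Polynomial.degree q")
  case True
  thus ?thesis using less.prems coeffs_in_closed(1) by (intro exI[of _ 0] exI[of _ g]) auto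
 next
  case False
  define c where "c = lead_coeff g/lead_coeff q"
  have cK: "c:K" using less.prems q(2) unfolding c_def coeffs_in_def by (intro K_divide) auto
  define t where "t = Polynomial.monom c (Polynomial.degree g - Polynomial.degree q)"
  have t: "coeffs_in K t" unfolding t_def by (rule coeffs_in_closed(6)[OF cK])
  have cz: "c~=0" using False q by (auto simp: c_def)
  define g' where "g' = g - t*q"
  have "Polynomial.degree (t*q) = Polynomial.degree t + Polynomial.degree q"
   using cz q by (intro degree_mult_eq) (auto simp: t_def)
  hence tq: "Polynomial.degree (t*q) = Polynomial.degree g"
   using cz False by (simp add: t_def degree_monom_eq)
  hence le: "Polynomial.degree g'<=Polynomial.degree g" unfolding g'_def by (metis degree_diff_le order_refl)
  have "Polynomial.coeff (t*q) (Polynomial.degree g) = lead_coeff t*lead_coeff q"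
   using lead_coeff_mult[of t q] unfolding tq .
  hence "Polynomial.coeff g' (Polynomial.degree g) = 0"
   using q cz by (simp add: g'_def t_def degree_monom_eq c_def)
  hence lt: "g' = 0 | Polynomial.degree g' < Polynomial.degree g" using le by (metis eq_zero_or_degree_less)
  have g'K: "coeffs_in K g'" unfolding g'_def by (intro coeffs_in_closed less.prems t q)
  have "EX s r. coeffs_in K s & coeffs_in K r & g' = s*q + r & (r = 0 | Polynomial.degree r < Polynomial.degree q)"
  proof (cases "g' = 0")
   case True
   thus ?thesis using coeffs_in_closed(1) by (intro exI[of _ 0]) auto
  next
   case False
   thus ?thesis using less.hyps[of g'] lt g'K by blast
  qed
  then obtain s r where sr: "coeffs_in K s" "coeffs_in K r" "g' = s*q + r" "r = 0 | Polynomial.degree r < Polynomial.degree q"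
   by blast
  have "g = (s + t)*q + r" using sr(3) unfolding g'_def by (simp add: algebra_simps)
  thus ?thesis using sr coeffs_in_closed(3)[OF sr(1) t] by blast
 qed
qed

lemma min_polynomial_ex:
 assumes "p~=0" "coeffs_in K p" "poly p x = 0"
 shows "EX m. m~=0 & lead_coeff m = 1 & coeffs_in K m & poly m x = 0 &
   (ALL q. q~=0 --> coeffs_in K q --> poly q x = 0 --> Polynomial.degree m<=Polynomial.degree q)"
proof -
 let ?P = "%n. EX q. q~=0 & coeffs_in K q & poly q x = 0 & Polynomial.degree q = n"
 have "?P (Polynomial.degree p)" using assms by blast
 hence "?P (LEAST n. ?P n)" by (rule LeastI)
 then obtain q where q: "q~=0" "coeffs_in K q" "poly q x = 0" "Polynomial.degree q = (LEAST n. ?P n)" by blast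
 define m where "m = Polynomial.smult (inverse (lead_coeff q)) q"
 have lc: "lead_coeff q~=0" using q(1) by (rule leading_coeff_neq_0)
 have "lead_coeff q:K" using q(2) by (simp add: coeffs_in_def)
 hence "coeffs_in K m" using q(2) unfolding m_def coeffs_in_def by (auto intro!: K_mult K_inverse)
 moreover have "Polynomial.degree m = Polynomial.degree q" "poly m x = 0" "m~=0" "lead_coeff m = 1"
  using lc q by (auto simp: m_def)
 moreover have "Polynomial.degree q<=Polynomial.degree r" if "r~=0" "coeffs_in K r" "poly r x = 0" for r
  unfolding q(4) by (rule Least_le) (use that in blast)
 ultimately show ?thesis by metis
qed

end

lemma map_poly_hom_closed:
 assumes F: "subfield_C F" and sig: "sig:embeddings F" and p: "coeffs_in F p" and q: "coeffs_in F q"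
 shows "map_poly sig (p + q) = map_poly sig p + map_poly sig q"
  "map_poly sig (p - q) = map_poly sig p - map_poly sig q"
  "map_poly sig (p*q) = map_poly sig p*map_poly sig q"
proof -
 interpret number_subfield F by unfold_locales (rule F)
 have z: "sig 0 = 0" by (rule emb_0[OF sig])
 have pq: "Polynomial.coeff p i:F" "Polynomial.coeff q i:F" for i using p q by (auto simp: coeffs_in_def)
 show "map_poly sig (p + q) = map_poly sig p + map_poly sig q"
  by (rule poly_eqI) (simp add: coeff_map_poly z emb_add[OF sig] pq)
 show "map_poly sig (p - q) = map_poly sig p - map_poly sig q"
  by (rule poly_eqI) (simp add: coeff_map_poly z emb_diff[OF sig] pq)
 show "map_poly sig (p*q) = map_poly sig p*map_poly sig q"
  by (rule poly_eqI) (simp add: coeff_map_poly z coeff_mult emb_sum[OF sig] emb_mult[OF sig] pq K_mult)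
qed

text \<open>The ring \<open>F[x]\<close>, which is a field when \<open>x\<close> is algebraic over
  \<open>F\<close>.\<close>

definition adjoin :: "complex set => complex => complex set" where
 "adjoin F x = {poly p x | p. coeffs_in F p}"

lemma adjoin_mem: "subfield_C F ==> x:adjoin F x" and adjoin_sub: "subfield_C F ==> F<=adjoin F x"
proof -
 assume F: "subfield_C F"
 interpret number_subfield F by unfold_locales (rule F)
 have "coeffs_in F [:0,1:]" by (auto simp: coeffs_in_def coeff_pCons split: nat.splits)
 moreover have "poly [:0,1:] x = x" by simp
 ultimately show "x:adjoin F x" unfolding adjoin_def by (intro CollectI exI[of _ "[:0,1:]"]) simp
 show "F<=adjoin F x"
 proof
  fix c assume "c:F"
  hence "coeffs_in F [:c:]" by (auto simp: coeffs_in_def coeff_pCons split: nat.splits)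
  moreover have "poly [:c:] x = c" by simp
  ultimately show "c:adjoin F x" unfolding adjoin_def by (intro CollectI exI[of _ "[:c:]"]) simp
 qed
qed

text \<open>One-step extension of embeddings: a root of the conjugated minimal polynomial is chosen
 as the image of \<open>x\<close>.\<close>

lemma embedding_adjoin:
 assumes F: "subfield_C F" and sig: "sig:embeddings F"
  and x: "p~=0" "coeffs_in F p" "poly p x = 0"
 obtains m where "lead_coeff m = 1" "coeffs_in F m" "poly m x = 0"
  "!!q. q~=0 ==> coeffs_in F q ==> poly q x = 0 ==> Polynomial.degree m<=Polynomial.degree q"
  "subfield_C (adjoin F x)"
  "!!y. poly (map_poly sig m) y = 0 ==> EX tau:embeddings (adjoin F x). tau x = y & (ALL c:F. tau c = sig c)"
proof -
 interpret number_subfield F by unfold_locales (rule F)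
 obtain m where m: "m~=0" "lead_coeff m = 1" "coeffs_in F m" "poly m x = 0"
  "!!q. q~=0 ==> coeffs_in F q ==> poly q x = 0 ==> Polynomial.degree m<=Polynomial.degree q"
  using min_polynomial_ex[OF x] by blast
 have div: "EX r. coeffs_in F r & q = r*m" if q: "coeffs_in F q" "poly q x = 0" for q
 proof -
  obtain s r where sr: "coeffs_in F s" "coeffs_in F r" "q = s*m + r" "r = 0 | Polynomial.degree r < Polynomial.degree m"
   using coeffs_in_division[OF m(1,3) q(1)] by blast
  have "poly r x = 0" using sr(3) q(2) m(4) by simp
  hence "r = 0" using m(5)[of r] sr by linarith
  thus ?thesis using sr by auto
 qed
 \<comment> \<open>Inverses by the Euclidean algorithm, with induction on the degree: the remainder
   of \<open>m\<close> by \<open>q\<close> has smaller degree than \<open>q\<close>.\<close>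
 have inv0: "EX r. coeffs_in F r & poly r x*poly q x = 1"
  if "coeffs_in F q" "poly q x~=0" "Polynomial.degree q < Polynomial.degree m" for q
  using that
 proof (induction "Polynomial.degree q" arbitrary: q rule: less_induct)
  case less
  have qn: "q~=0" using less.prems by auto
  show ?case
  proof (cases "Polynomial.degree q = 0")
   case True
   then obtain c where c: "q = [:c:]" using degree_eq_zeroE by blast
   have "c:F" using less.prems(1) unfolding c coeffs_in_def by (metis coeff_pCons_0)
   hence "coeffs_in F [:inverse c:]" by (auto simp: coeffs_in_def coeff_pCons K_inverse split: nat.splits)
   thus ?thesis using less.prems c by (intro exI[of _ "[:inverse c:]"]) simp
  next
   case False
   obtain s r where sr: "coeffs_in F s" "coeffs_in F r" "m = s*q + r" "r = 0 | Polynomial.degree r < Polynomial.degree q"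
    using coeffs_in_division[OF qn less.prems(1) m(3)] by blast
   have rx: "poly s x*poly q x = - poly r x" using m(4) sr(3) by (simp add: eq_neg_iff_add_eq_0)
   show ?thesis
   proof (cases "poly r x = 0")
    case True
    have "r = 0"
    proof (rule ccontr)
     assume "r~=0"
     hence "Polynomial.degree m<=Polynomial.degree r" using m(5) sr(2) True by blast
     thus False using sr(4) \<open>r ~= 0\<close> less.prems(3) by linarith
    qed
    hence msq: "m = s*q" using sr by simp
    hence sn: "s~=0" using m(1) by auto
    have "poly s x = 0" using rx True less.prems(2) by simp
    hence "Polynomial.degree m<=Polynomial.degree s" using m(5) sn sr(1) by blast
    moreover have "Polynomial.degree m = Polynomial.degree s + Polynomial.degree q"
     unfolding msq by (rule degree_mult_eq[OF sn qn])
    ultimately show ?thesis using False by simp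
   next
    case rF: False
    hence lt: "Polynomial.degree r < Polynomial.degree q" using sr(4) by auto
    then obtain r' where r': "coeffs_in F r'" "poly r' x*poly r x = 1"
     using less.hyps[OF lt sr(2) rF] less.prems(3) by auto
    have "poly (0 - r' * s) x*poly q x = 1" using rx r' by (simp add: mult.assoc)
    moreover have "coeffs_in F (0 - r' * s)" by (intro coeffs_in_closed r' sr)
    ultimately show ?thesis by blast
   qed
  qed
 qed
 have inv: "EX r. coeffs_in F r & poly r x*poly q x = 1" if q: "coeffs_in F q" "poly q x~=0" for q
 proof -
  obtain s r where sr: "coeffs_in F s" "coeffs_in F r" "q = s*m + r" "r = 0 | Polynomial.degree r < Polynomial.degree m"
   using coeffs_in_division[OF m(1,3) q(1)] by blast
  have qr: "poly q x = poly r x" using sr(3) m(4) by simp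
  hence "r~=0" using q by auto
  thus ?thesis using inv0[OF sr(2)] sr(4) q(2) qr by auto
 qed
 have sf: "subfield_C (adjoin F x)"
  unfolding subfield_C_def
 proof (intro conjI ballI impI)
  show "0:adjoin F x" using adjoin_sub[OF F] K_0 by blast
  show "1:adjoin F x" using adjoin_sub[OF F] K_1 by blast
  fix a assume a: "a:adjoin F x"
  then obtain q where q: "coeffs_in F q" "a = poly q x" by (auto simp: adjoin_def)
  have "coeffs_in F (0 - q)" using coeffs_in_closed q by blast
  thus "- a:adjoin F x" unfolding adjoin_def using q by (intro CollectI exI[of _ "0 - q"]) simp
  show "inverse a:adjoin F x" if anz: "a~=0"
  proof -
   obtain r where r: "coeffs_in F r" "poly r x*poly q x = 1" using inv[OF q(1)] q(2) anz by blast
   have "inverse a = poly r x" unfolding q(2)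
    by (rule inverse_unique) (subst mult.commute, rule r(2))
   thus ?thesis unfolding adjoin_def using r(1) by blast
  qed
  fix b assume b: "b:adjoin F x"
  then obtain r where r: "coeffs_in F r" "b = poly r x" by (auto simp: adjoin_def)
  show "a + b:adjoin F x" unfolding adjoin_def using q r coeffs_in_closed by (intro CollectI exI[of _ "q + r"]) simp
  show "a*b:adjoin F x" unfolding adjoin_def using q r coeffs_in_closed by (intro CollectI exI[of _ "q*r"]) simp
 qed
 have ext: "EX tau:embeddings (adjoin F x). tau x = y & (ALL c:F. tau c = sig c)" if y: "poly (map_poly sig m) y = 0" for y
 proof -
  have wd: "poly (map_poly sig p) y = poly (map_poly sig q) y"
   if pq: "coeffs_in F p" "coeffs_in F q" "poly p x = poly q x" for p q
  proof -
   have "poly (p - q) x = 0" using pq by simp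
   then obtain r where r: "coeffs_in F r" "p - q = r*m"
    using div[OF coeffs_in_closed(4)[OF pq(1,2)]] by blast
   have "map_poly sig p - map_poly sig q = map_poly sig r*map_poly sig m"
    using map_poly_hom_closed(2)[OF F sig pq(1,2)] map_poly_hom_closed(3)[OF F sig r(1) m(3)] r(2) by simp
   hence "poly (map_poly sig p) y - poly (map_poly sig q) y = 0" using y by (metis mult_zero_right poly_diff poly_mult)
   thus ?thesis by simp
  qed
  \<comment> \<open>Evaluation at \<open>y\<close> of a chosen polynomial representing
    \<open>z\<close>; by \<open>wd\<close> all representing polynomials give the same value. The
    value 0 elsewhere is the convention of \<open>embeddings\<close>.\<close>
  define tau where "tau z = (if z:adjoin F x then poly (map_poly sig (SOME p. coeffs_in F p & poly p x = z)) y else 0)" for z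
  have tau: "tau (poly p x) = poly (map_poly sig p) y" if "coeffs_in F p" for p
  proof -
   have "EX q. coeffs_in F q & poly q x = poly p x" using that by blast
   from someI_ex[OF this] have "poly (map_poly sig (SOME q. coeffs_in F q & poly q x = poly p x)) y = poly (map_poly sig p) y"
    using wd that by blast
   moreover have "poly p x:adjoin F x" using that by (auto simp: adjoin_def)
   ultimately show ?thesis by (simp add: tau_def)
  qed
  have c: "tau c = sig c" if cF: "c:F" for c
  proof -
   have "coeffs_in F [:c:]" using cF by (auto simp: coeffs_in_def coeff_pCons split: nat.splits)
   moreover have "map_poly sig [:c:] = [:sig c:]"
    by (rule poly_eqI) (simp add: coeff_map_poly emb_0[OF sig] coeff_pCons split: nat.splits)
   ultimately show ?thesis using tau[of "[:c:]"] by simp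
  qed
  have "tau x = y"
  proof -
   have "coeffs_in F [:0,1:]" by (auto simp: coeffs_in_def coeff_pCons split: nat.splits)
   from tau[OF this] show ?thesis by (simp add: map_poly_pCons emb_0[OF sig] emb_1[OF sig])
  qed
  moreover have "tau:embeddings (adjoin F x)"
   unfolding embeddings_def
  proof (intro CollectI conjI ballI allI impI)
   fix a b assume "a:adjoin F x" "b:adjoin F x"
   then obtain p q where pq: "coeffs_in F p" "a = poly p x" "coeffs_in F q" "b = poly q x" by (auto simp: adjoin_def)
   have "tau (poly (p + q) x) = tau (poly p x) + tau (poly q x)"
    using tau[OF coeffs_in_closed(3)[OF pq(1,3)]] tau[OF pq(1)] tau[OF pq(3)] map_poly_hom_closed(1)[OF F sig pq(1,3)] by simp
   thus "tau (a + b) = tau a + tau b" by (simp add: pq)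
   have "tau (poly (p*q) x) = tau (poly p x)*tau (poly q x)"
    using tau[OF coeffs_in_closed(5)[OF pq(1,3)]] tau[OF pq(1)] tau[OF pq(3)] map_poly_hom_closed(3)[OF F sig pq(1,3)] by simp
   thus "tau (a*b) = tau a*tau b" by (simp add: pq)
  next
   show "tau 1 = 1" using c[of 1] emb_1[OF sig] by simp
  qed (simp add: tau_def)
  ultimately show ?thesis using c by blast
 qed
 show ?thesis using that[OF m(2,3,4,5) sf ext] by blast
qed

text \<open>The complex numbers as a rational vector space, to have dimensions and the exchange
  argument at hand.\<close>

interpretation QV: vector_space "%(q::rat) (x::complex). of_rat q*x"
 by unfold_locales (simp_all add: algebra_simps of_rat_add of_rat_mult)

lemma Q_basis_vector_space:
 assumes b: "is_Q_basis K n omg"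
 shows "inj_on omg {..<n}" "QV.independent (omg`{..<n})" "K<=QV.span (omg`{..<n})" "omg`{..<n}<=K"
proof -
 have ind: "!!c. (SUM i<n. of_rat (c i) * omg i) = 0 ==> ALL i<n. c i = 0" and inK: "!!i. i < n ==> omg i:K"
  and sp: "!!x. x:K ==> EX c. x = (SUM i<n. of_rat (c i) * omg i)"
  using b unfolding is_Q_basis_def by blast+
 show inj: "inj_on omg {..<n}"
 proof (rule inj_onI, rule ccontr)
  fix i j assume h: "i:{..<n}" "j:{..<n}" "omg i = omg j" "i~=j"
  define c where "c k = (if k = i then 1 else if k = j then -1 else 0 :: rat)" for k
  have "(SUM k<n. of_rat (c k) * omg k) = (SUM k:{i, j}. of_rat (c k) * omg k)"
   using h by (intro sum.mono_neutral_right) (auto simp: c_def)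
  also have "... = 0" using h by (simp add: c_def)
  finally have "c i = 0" using ind h by blast
  thus False by (simp add: c_def)
 qed
 let ?B = "omg`{..<n}"
 show "QV.independent ?B"
 proof
  assume "QV.dependent ?B"
  then obtain u v where u: "v:?B" "u v~=0" "(SUM v:?B. of_rat (u v) * v) = 0"
   by (auto simp: QV.dependent_finite)
  hence "(SUM i<n. of_rat (u (omg i)) * omg i) = 0" by (simp add: sum.reindex[OF inj])
  thus False using ind[of "%i. u (omg i)"] u(1,2) by auto
 qed
 show "K<=QV.span ?B"
 proof
  fix x assume "x:K"
  then obtain c where "x = (SUM i<n. of_rat (c i) * omg i)" using sp by blast
  thus "x:QV.span ?B" by (simp only:) (rule QV.span_sum, rule QV.span_scale, rule QV.span_base, simp)
 qed
 show "?B<=K" using inK by auto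
qed

lemma Q_basis_dim: "is_Q_basis K n omg ==> QV.dim K = n"
 using QV.basis_card_eq_dim[OF Q_basis_vector_space(4,3,2)] card_image[OF Q_basis_vector_space(1)] by fastforce

lemma Q_basis_degree:
 assumes "number_field K"
 shows "EX omg. is_Q_basis K (field_degree K) omg"
proof -
 obtain n omg where b: "is_Q_basis K n omg" using assms unfolding number_field_def by blast
 have "field_degree K = n" unfolding field_degree_def
  by (rule the_equality) (use b Q_basis_dim in blast)+
 thus ?thesis using b by blast
qed

text \<open>Four equations in five unknowns, padded by a zero row to a singular square matrix. It
  serves both the algebraicity of \<open>K\<close> and the bound on its embeddings.\<close>

lemma underdetermined_5:
 fixes A :: "nat => 5 => 'a::field"
 shows "EX c. c~=(%_. 0) & (ALL i<4. (SUM j:UNIV. A i j*c j) = 0)"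
proof -
 obtain h :: "5 => nat" where h: "bij_betw h UNIV {0..<5}" using ex_bij_betw_finite_nat[of "UNIV :: 5 set"] by auto
 define M :: "'a^5^5" where "M = (\<chi> i j. if h i < 4 then A (h i) j else 0)"
 have "4:h`UNIV" using h by (simp add: bij_betw_def)
 then obtain k where k: "h k = 4" by auto
 have "row k M = 0" using k by (simp add: M_def row_def vec_eq_iff)
 hence "hdet M = 0" by (rule Determinants.det_zero_row(2))
 then obtain x where x: "M *v x = 0" "x~=0" using hdet_nonzero_iff[of M] by blast
 have "(SUM j:UNIV. A i j*x $ j) = 0" if "i < 4" for i
 proof -
  have "i:h`UNIV" using h that by (simp add: bij_betw_def)
  then obtain i' where i': "h i' = i" by auto
  have "(M *v x) $ i' = 0" using x(1) by simp
  thus ?thesis using i' that by (simp add: M_def matrix_vector_mult_def)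
 qed
 moreover have "(%j. x $ j)~=(%_. 0)" using x(2) by (auto simp: vec_eq_iff fun_eq_iff)
 ultimately show ?thesis by (intro exI[of _ "%j. x $ j"]) simp
qed

lemma subfield_Rats: "subfield_C \<rat>"
 unfolding subfield_C_def by (auto intro: Rats_add Rats_mult)

definition algebraic_Q :: "complex => bool" where
 "algebraic_Q x \<longleftrightarrow> (EX p. p~=0 & coeffs_in \<rat> p & poly p x = 0)"

lemma coeffs_in_mono: "coeffs_in F p ==> F<=F' ==> coeffs_in F' p"
 by (auto simp: coeffs_in_def)

lemma Rats_subfield: "subfield_C F ==> \<rat><=F"
 using number_subfield.K_Rats[OF number_subfield.intro] by blast

lemma adjoin_least:
 assumes "subfield_C E" "F<=E" "x:E"
 shows "adjoin F x<=E"
proof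
 interpret E: number_subfield E by unfold_locales (rule assms(1))
 fix y assume "y:adjoin F x"
 then obtain p where "y = poly p x" "coeffs_in F p" by (auto simp: adjoin_def)
 thus "y:E" using assms by (auto simp: poly_altdef coeffs_in_def intro!: E.K_sum E.K_mult E.K_power)
qed

lemma extend_adjoin:
 assumes F: "subfield_C F" and sig: "sig:embeddings F" and x: "algebraic_Q x"
 shows "subfield_C (adjoin F x)" "EX tau:embeddings (adjoin F x). ALL c:F. tau c = sig c"
proof -
 interpret F: number_subfield F by unfold_locales (rule F)
 obtain p where p: "p~=0" "coeffs_in F p" "poly p x = 0"
  using x coeffs_in_mono Rats_subfield[OF F] unfolding algebraic_Q_def by blast
 obtain m where m: "lead_coeff m = 1" "coeffs_in F m" "poly m x = 0" "subfield_C (adjoin F x)"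
  "!!y. poly (map_poly sig m) y = 0 ==> EX tau:embeddings (adjoin F x). tau x = y & (ALL c:F. tau c = sig c)"
  using embedding_adjoin[OF F sig p] by metis
 show "subfield_C (adjoin F x)" by (rule m(4))
 have "Polynomial.degree m > 0"
 proof (rule ccontr)
  assume "~ ?thesis"
  then obtain c where "m = [:c:]" using degree_eq_zeroE by blast
  thus False using m(1,3) by simp
 qed
 moreover have "Polynomial.degree (map_poly sig m) = Polynomial.degree m"
  using m(1) F.emb_1[OF sig] by (intro degree_map_poly) auto
 ultimately have "~ constant (poly (map_poly sig m))" by (simp add: constant_degree)
 then obtain y where "poly (map_poly sig m) y = 0" using fundamental_theorem_of_algebra by blast
 thus "EX tau:embeddings (adjoin F x). ALL c:F. tau c = sig c" using m(5) by blast
qed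

fun adjoin_list :: "complex set => complex list => complex set" where
 "adjoin_list F [] = F" | "adjoin_list F (x # xs) = adjoin (adjoin_list F xs) x"

lemma extend_adjoin_list:
 assumes F: "subfield_C F" and sig: "sig:embeddings F" and "ALL x:set xs. algebraic_Q x"
 shows "subfield_C (adjoin_list F xs) & F<=adjoin_list F xs & set xs<=adjoin_list F xs &
  (EX tau:embeddings (adjoin_list F xs). ALL c:F. tau c = sig c)"
 using assms(3)
proof (induction xs)
 case Nil
 thus ?case using F sig by auto
next
 case (Cons x xs)
 then obtain tau where t: "subfield_C (adjoin_list F xs)" "F<=adjoin_list F xs" "set xs<=adjoin_list F xs"
  "tau:embeddings (adjoin_list F xs)" "ALL c:F. tau c = sig c" by auto
 have x: "algebraic_Q x" using Cons.prems by simp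
 obtain tau' where t': "tau':embeddings (adjoin (adjoin_list F xs) x)" "ALL c:adjoin_list F xs. tau' c = tau c"
  using extend_adjoin(2)[OF t(1,4) x] by blast
 have sub: "adjoin_list F xs<=adjoin (adjoin_list F xs) x" "x:adjoin (adjoin_list F xs) x"
  using adjoin_sub[OF t(1)] adjoin_mem[OF t(1)] by blast+
 have "ALL c:F. tau' c = sig c" using t' t by auto
 thus ?case using extend_adjoin(1)[OF t(1,4) x] sub t(2,3) t'(1) by auto
qed

lemma adjoin_list_least:
 "subfield_C E ==> F<=E ==> set xs<=E ==> adjoin_list F xs<=E"
proof (induction xs)
 case (Cons x xs)
 have "x:E" using Cons.prems(3) by simp
 moreover have "adjoin_list F xs<=E" using Cons by simp
 ultimately show ?case using adjoin_least[OF Cons.prems(1)] by simp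
qed simp

lemma id_embedding: "subfield_C F ==> (%x. if x:F then x else 0):embeddings F"
 by (auto simp: embeddings_def subfield_C_def)

text \<open>The minimal polynomial of an irrational \<open>x\<close> has degree at least 2 and, by
  minimality against its derivative, a root other than \<open>x\<close>.\<close>

lemma embedding_moves_irrational:
 assumes x: "algebraic_Q x" "x~:\<rat>"
 shows "subfield_C (adjoin \<rat> x)" "EX tau:embeddings (adjoin \<rat> x). tau x~=x"
proof -
 let ?i = "%x. if x:\<rat> then x else (0::complex)"
 have i: "?i:embeddings \<rat>" by (rule id_embedding[OF subfield_Rats])
 obtain p where p: "p~=0" "coeffs_in \<rat> p" "poly p x = 0" using x(1) by (auto simp: algebraic_Q_def)
 obtain m where m: "lead_coeff m = 1" "coeffs_in \<rat> m" "poly m x = 0"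
  "!!q. q~=0 ==> coeffs_in \<rat> q ==> poly q x = 0 ==> Polynomial.degree m<=Polynomial.degree q" "subfield_C (adjoin \<rat> x)"
  "!!y. poly (map_poly ?i m) y = 0 ==> EX tau:embeddings (adjoin \<rat> x). tau x = y & (ALL c:\<rat>. tau c = ?i c)"
  by (rule embedding_adjoin[OF subfield_Rats i p], rule that)
 show "subfield_C (adjoin \<rat> x)" by (rule m(5))
 have mi: "map_poly ?i m = m" using m(2) by (intro poly_eqI) (simp add: coeff_map_poly coeffs_in_def)
 have m0: "m~=0" using m(1) by auto
 obtain q where q: "m = [:- x, 1:] * q" using m(3) poly_eq_0_iff_dvd by (metis dvdE)
 have q0: "q~=0" using m0 q by auto
 have dm: "Polynomial.degree m = Suc (Polynomial.degree q)"
 proof -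
  have "Polynomial.degree ([:- x, 1:] * q) = Polynomial.degree [:- x, 1:] + Polynomial.degree q"
   by (rule degree_mult_eq) (use q0 in auto)
  thus ?thesis unfolding q by simp
 qed
 have "Polynomial.degree q~=0"
 proof
  assume "Polynomial.degree q = 0"
  then obtain c where c: "q = [:c:]" using degree_eq_zeroE by blast
  have "lead_coeff q = 1" using m(1) lead_coeff_mult[of "[:- x, 1:]" q] unfolding q by simp
  hence "q = 1" using c by (simp add: one_pCons)
  hence "m = [:- x, 1:]" using q by simp
  hence "Polynomial.coeff m 0 = - x" by simp
  hence "- x:\<rat>" using m(2) unfolding coeffs_in_def by metis
  thus False using x(2) by (simp add: Rats_minus_iff)
 qed
 hence "~ constant (poly q)" by (simp add: constant_degree)
 then obtain y where y: "poly q y = 0" using fundamental_theorem_of_algebra by blast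
 have "y~=x"
 proof
  assume "y = x"
  hence "poly (pderiv m) x = 0" unfolding q pderiv_mult using y by (simp add: pderiv_pCons)
  moreover have "coeffs_in \<rat> (pderiv m)" using m(2) by (auto simp: coeffs_in_def coeff_pderiv intro!: Rats_mult)
  moreover have "Polynomial.degree (pderiv m) < Polynomial.degree m" using dm by (simp add: degree_pderiv)
  moreover have "pderiv m~=0" using dm by (simp add: pderiv_eq_0_iff)
  ultimately show False using m(4)[of "pderiv m"] by simp
 qed
 moreover have "poly m y = 0" unfolding q using y by simp
 ultimately show "EX tau:embeddings (adjoin \<rat> x). tau x~=x" using m(6)[of y] mi by metis
qed

section \<open>The Galois closure and its automorphisms\<close>

locale d4_quartic_field =
 fixes K assumes D4: "D4_quartic K"
begin

sublocale number_subfield K using D4 by unfold_locales (simp add: D4_quartic_def number_field_def)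

lemma basis_ex: "EX omg. is_Q_basis K 4 omg"
 using D4 Q_basis_degree[of K] by (simp add: D4_quartic_def)

definition omg :: "nat => complex" where "omg = (SOME omg. is_Q_basis K 4 omg)"

lemma omg_basis: "is_Q_basis K 4 omg" unfolding omg_def by (rule someI_ex[OF basis_ex])

lemma omg: "i < 4 ==> omg i:K" "x:K ==> EX c :: nat => rat. x = (SUM i<4. of_rat (c i) * omg i)"
 "(SUM i<4. of_rat (c i) * omg i) = 0 ==> i < 4 ==> c i = 0"
proof -
 show "i < 4 ==> omg i:K" "x:K ==> EX c :: nat => rat. x = (SUM i<4. of_rat (c i) * omg i)"
  "(SUM i<4. of_rat (c i) * omg i) = 0 ==> i < 4 ==> c i = 0"
  using omg_basis unfolding is_Q_basis_def by blast+
qed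

text \<open>Five powers of \<open>x\<close> in a four-dimensional space are dependent.\<close>

lemma algebraic_K: "x:K ==> algebraic_Q x"
proof -
 assume x: "x:K"
 obtain h :: "5 => nat" where h: "bij_betw h UNIV {0..<5}" using ex_bij_betw_finite_nat[of "UNIV :: 5 set"] by auto
 have "EX c. x^h j = (SUM i<4. of_rat (c i) * omg i)" for j by (rule omg(2)[OF K_power[OF x]])
 then obtain c where c: "!!j. x^h j = (SUM i<4. of_rat (c j i) * omg i)" by metis
 obtain a where a: "a~=(%_. 0)" "!!i. i < 4 ==> (SUM j:UNIV. c j i*a j) = 0"
  using underdetermined_5[of "%i j. c j i"] by blast
 define p where "p = (SUM j:UNIV. Polynomial.monom (of_rat (a j) :: complex) (h j))"
 have cf: "Polynomial.coeff p (h k) = of_rat (a k)" for k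
 proof -
  have "Polynomial.coeff p (h k) = (SUM j:UNIV. if j = k then of_rat (a j) else 0)"
   unfolding p_def coeff_sum coeff_monom using h by (intro sum.cong) (auto simp: bij_betw_def inj_def)
  thus ?thesis by simp
 qed
 have "p~=0"
 proof
  assume "p = 0"
  hence "of_rat (a k) = (0::complex)" for k using cf[of k] by simp
  thus False using a(1) by auto
 qed
 moreover have "coeffs_in \<rat> p" by (auto simp: coeffs_in_def p_def coeff_sum intro!: Rats_sum)
 moreover have "poly p x = 0"
 proof -
  have "poly p x = (SUM j:UNIV. of_rat (a j)*(SUM i<4. of_rat (c j i) * omg i))"
   by (simp add: p_def poly_sum poly_monom c)
  also have "... = (SUM i<4. of_rat (SUM j:UNIV. c j i*a j) * omg i)"
   unfolding sum_distrib_left of_rat_sum sum_distrib_right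
   by (subst sum.swap) (simp add: of_rat_mult mult_ac)
  finally show ?thesis using a(2) by simp
 qed
 ultimately show ?thesis unfolding algebraic_Q_def by blast
qed

text \<open>Five embeddings would satisfy a linear relation on the four basis elements, against
  their independence. Equality is obtained in \<open>tower_structure\<close> by exhibiting
  four.\<close>

lemma emb_card_le: "finite (embeddings K)" "card (embeddings K)<=4"
proof -
 have no: "~ (EX A. A<=embeddings K & finite A & card A = 5)"
 proof
  assume "EX A. A<=embeddings K & finite A & card A = 5"
  then obtain A where A: "A<=embeddings K" "finite A" "card A = 5" by blast
  then obtain f :: "5 => complex => complex" where f: "bij_betw f UNIV A"
   using finite_same_card_bij[of "UNIV :: 5 set" A] by auto
  obtain c where c: "c~=(%_. 0)" "!!i. i < 4 ==> (SUM j:UNIV. f j (omg i)*c j) = 0"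
   using underdetermined_5[of "%i j. f j (omg i)"] by blast
  have fe: "f j:embeddings K" for j using f A(1) by (auto simp: bij_betw_def)
  define C where "C sig = c (inv_into UNIV f sig)" for sig
  have "C sig = 0" if "sig:A" for sig
  proof (rule embeddings_independent[OF A(2,1) _ that, of C])
   fix x assume "x:K"
   then obtain q where q: "x = (SUM i<4. of_rat (q i) * omg i)" using omg(2) by blast
   have fx: "f j x = (SUM i<4. of_rat (q i)*f j (omg i))" for j
    unfolding q by (subst emb_sum[OF fe]) (auto simp: emb_mult[OF fe] emb_of_rat[OF fe] omg(1) intro!: sum.cong K_mult)
   have "(SUM sig:A. C sig * sig x) = (SUM j:UNIV. c j*f j x)"
    using f by (subst sum.reindex_bij_betw[OF f, symmetric]) (simp add: C_def bij_betw_def)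
   also have "... = (SUM i<4. of_rat (q i)*(SUM j:UNIV. f j (omg i)*c j))"
    unfolding fx sum_distrib_left by (subst sum.swap) (simp add: mult_ac)
   finally show "(SUM sig:A. C sig * sig x) = 0" using c(2) by simp
  qed
  moreover have "f j:A" "inv_into UNIV f (f j) = j" for j using f by (auto simp: bij_betw_def)
  ultimately have "c j = 0" for j unfolding C_def by metis
  thus False using c(1) by auto
 qed
 show fin: "finite (embeddings K)"
  using no infinite_arbitrarily_large[of "embeddings K" 5] by blast
 show "card (embeddings K)<=4"
 proof (rule ccontr)
  assume "~ ?thesis"
  hence "5<=card (embeddings K)" by simp
  then obtain A where "A<=embeddings K" "card A = 5" by (rule obtain_subset_with_card_n)
  thus False using no finite_subset[OF _ fin] by blast
 qed
qed

definition L where "L = galois_closure K"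

lemma L_sub: "sig:embeddings K ==> x:K ==> sig x:L"
 and L_least: "subfield_C F ==> (!!sig x. sig:embeddings K ==> x:K ==> sig x:F) ==> L<=F"
 by (auto simp: L_def galois_closure_def)

lemma L_subfield: "subfield_C L"
 unfolding L_def galois_closure_def subfield_C_def by blast

sublocale L: number_subfield L by unfold_locales (rule L_subfield)

lemma K_sub_L: "K<=L"
 using L_sub[OF id_embedding[OF subfield]] by auto

lemma conjugate_algebraic: "sig:embeddings K ==> x:K ==> algebraic_Q (sig x)"
proof -
 assume s: "sig:embeddings K" and x: "x:K"
 obtain p where p: "p~=0" "coeffs_in \<rat> p" "poly p x = 0" using algebraic_K[OF x] by (auto simp: algebraic_Q_def)
 have "poly p (sig x) = sig (poly p x)"
  using p(2) x by (simp add: poly_altdef coeffs_in_def emb_sum[OF s] emb_mult[OF s] emb_power[OF s] emb_Rats[OF s] K_closed K_Rats)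
 hence "poly p (sig x) = 0" using p(3) emb_0[OF s] by simp
 thus ?thesis using p unfolding algebraic_Q_def by blast
qed

text \<open>These finitely many algebraic numbers generate \<open>L\<close> over any of its
  subfields (\<open>L_eq_adjoin_list\<close>), which is why embeddings extend to \<open>L\<close>
  step by step.\<close>

definition gens :: "complex list" where
 "gens = (SOME xs. set xs = (%(sig, i). sig (omg i))`(embeddings K \<times> {..<4}))"

lemma set_gens: "set gens = (%(sig, i). sig (omg i))`(embeddings K \<times> {..<4})"
proof -
 have "finite ((%(sig, i). sig (omg i))`(embeddings K \<times> {..<4}))" using emb_card_le(1) by (intro finite_imageI finite_cartesian_product) auto
 thus ?thesis unfolding gens_def by (rule someI_ex[OF finite_list])
qed

lemma gens_alg: "ALL x:set gens. algebraic_Q x" and gens_L: "set gens<=L"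
 unfolding set_gens using conjugate_algebraic L_sub omg(1) by auto

lemma L_eq_adjoin_list:
 assumes F: "subfield_C F" "F<=L"
 shows "adjoin_list F gens = L"
proof
 note e = extend_adjoin_list[OF F(1) id_embedding[OF F(1)] gens_alg]
 show "adjoin_list F gens<=L" by (rule adjoin_list_least[OF L_subfield F(2) gens_L])
 interpret E: number_subfield "adjoin_list F gens" by unfold_locales (use e in blast)
 show "L<=adjoin_list F gens"
 proof (rule L_least[OF E.subfield])
  fix sig x assume s: "sig:embeddings K" and "x:K"
  then obtain q where q: "x = (SUM i<4. of_rat (q i) * omg i)" using omg(2) by blast
  have "sig x = (SUM i<4. of_rat (q i) * sig (omg i))"
   unfolding q by (subst emb_sum[OF s]) (auto simp: emb_mult[OF s] emb_of_rat[OF s] omg(1) intro!: sum.cong K_mult)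
  moreover have "sig (omg i):adjoin_list F gens" if "i < 4" for i
  proof -
   have "sig (omg i):set gens" unfolding set_gens using s that by force
   thus ?thesis using e by blast
  qed
  ultimately show "sig x:adjoin_list F gens" by (auto intro!: E.K_sum E.K_mult)
 qed
qed

lemma extend_to_L: "subfield_C F ==> F<=L ==> sig:embeddings F ==> EX tau:embeddings L. ALL c:F. tau c = sig c"
 using extend_adjoin_list[OF _ _ gens_alg, of F sig] L_eq_adjoin_list[of F] by simp

abbreviation G where "G \<equiv> carrier (aut_group L)"

lemma G_iff: "g:G \<longleftrightarrow> bij_betw g L L & (ALL x:L. ALL y:L. g (x + y) = g x + g y & g (x*y) = g x*g y) & (ALL x. x~:L --> g x = x)"
 by (simp add: aut_group_def)

text \<open>Normality: composing with \<open>tau\<close> permutes the finitely many embeddings of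
  \<open>K\<close>, and \<open>L\<close> is generated by their images.\<close>

lemma embedding_onto:
 assumes t: "tau:embeddings L"
 shows "tau`L = L"
proof
 have comp: "(%x. if x:K then tau (sig x) else 0):embeddings K" if s: "sig:embeddings K" for sig
  using emb_add[OF s] emb_mult[OF s] emb_1[OF s] L.emb_add[OF t] L.emb_mult[OF t] L.emb_1[OF t] L_sub[OF s]
  by (auto simp: embeddings_def K_add K_mult)
 let ?S = "{x:L. tau x:L}"
 have S: "subfield_C ?S"
  unfolding subfield_C_def
  by (auto simp: L.emb_0[OF t] L.emb_1[OF t] L.emb_add[OF t] L.emb_mult[OF t] L.emb_uminus[OF t] L.emb_inverse[OF t] intro: L.K_closed)
 have "L<=?S"
 proof (rule L_least[OF S])
  fix sig x assume s: "sig:embeddings K" and x: "x:K"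
  show "sig x:?S" using L_sub[OF s x] L_sub[OF comp[OF s] x] x by simp
 qed
 thus "tau`L<=L" by auto
 let ?f = "%sig x. if x:K then tau (sig x) else 0"
 have "inj_on ?f (embeddings K)"
 proof (rule inj_onI)
  fix sig sig' assume s: "sig:embeddings K" "sig':embeddings K" and eq: "?f sig = ?f sig'"
  show "sig = sig'"
  proof (rule emb_eqI[OF s])
   fix x assume x: "x:K"
   have "tau (sig x) = tau (sig' x)" using fun_cong[OF eq, of x] x by simp
   thus "sig x = sig' x" using L.emb_inj[OF t L_sub[OF s(1) x] L_sub[OF s(2) x]] by blast
  qed
 qed
 moreover have "?f`embeddings K<=embeddings K" using comp by blast
 ultimately have surj: "?f`embeddings K = embeddings K" using emb_card_le(1) by (simp add: endo_inj_surj)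
 have T: "subfield_C (tau`L)"
  unfolding subfield_C_def
 proof (intro conjI ballI impI)
  show "0:tau`L" using L.emb_0[OF t] by (metis L.K_0 image_eqI)
  show "1:tau`L" using L.emb_1[OF t] by (metis L.K_1 image_eqI)
  fix x assume "x:tau`L"
  then obtain x' where x': "x = tau x'" "x':L" by blast
  show "- x:tau`L" using L.emb_uminus[OF t x'(2)] L.K_uminus[OF x'(2)] x'(1) by (metis image_eqI)
  show "inverse x:tau`L" using L.emb_inverse[OF t x'(2)] L.K_inverse[OF x'(2)] x'(1) by (metis image_eqI)
  fix y assume "y:tau`L"
  then obtain y' where y': "y = tau y'" "y':L" by blast
  show "x + y:tau`L" using L.emb_add[OF t x'(2) y'(2)] L.K_add[OF x'(2) y'(2)] x'(1) y'(1) by (metis image_eqI)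
  show "x*y:tau`L" using L.emb_mult[OF t x'(2) y'(2)] L.K_mult[OF x'(2) y'(2)] x'(1) y'(1) by (metis image_eqI)
 qed
 show "L<=tau`L"
 proof (rule L_least[OF T])
  fix sig x assume s: "sig:embeddings K" and x: "x:K"
  then obtain sig' where s': "sig':embeddings K" "sig = ?f sig'" using surj by blast
  thus "sig x:tau`L" using x L_sub[OF s'(1) x] by simp
 qed
qed

text \<open>Members of \<open>embeddings\<close> vanish outside their field, whereas members of
  \<open>aut_group\<close> are the identity there; this passes from one convention to the
  other.\<close>

lemma embedding_to_G: "tau:embeddings L ==> (%x. if x:L then tau x else x):G"
proof -
 assume t: "tau:embeddings L"
 have "bij_betw tau L L" using embedding_onto[OF t] L.emb_inj[OF t] by (auto simp: bij_betw_def inj_on_def)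
 hence "bij_betw (%x. if x:L then tau x else x) L L" by (subst bij_betw_cong[of L _ tau]) auto
 thus ?thesis unfolding G_iff using L.emb_add[OF t] L.emb_mult[OF t] by (simp add: L.K_add L.K_mult)
qed

lemma embedding_is_restriction:
 assumes "sig:embeddings K"
 shows "EX g:G. ALL x:K. sig x = g x"
proof -
 obtain tau where t: "tau:embeddings L" "ALL c:K. tau c = sig c" using extend_to_L[OF subfield K_sub_L assms] by blast
 show ?thesis using t(2) K_sub_L by (intro bexI[OF _ embedding_to_G[OF t(1)]]) auto
qed

text \<open>An irrational element would be moved by an embedding of the field it generates, and that
  embedding extends to \<open>L\<close>.\<close>

lemma fixed_rational:
 assumes x: "x:L" "algebraic_Q x" and fx: "!!g. g:G ==> g x = x"
 shows "x:\<rat>"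
proof (rule ccontr)
 assume "x~:\<rat>"
 note m = embedding_moves_irrational[OF x(2) this]
 obtain sig where s: "sig:embeddings (adjoin \<rat> x)" "sig x~=x" using m(2) by blast
 have "adjoin \<rat> x<=L" by (rule adjoin_least[OF L_subfield Rats_subfield[OF L_subfield] x(1)])
 then obtain tau where t: "tau:embeddings L" "ALL c:adjoin \<rat> x. tau c = sig c" using extend_to_L[OF m(1) _ s(1)] by blast
 have "tau x = sig x" using t(2) adjoin_mem[OF subfield_Rats] by blast
 thus False using fx[OF embedding_to_G[OF t(1)]] x(1) s(2) by simp
qed

lemma G_emb: "g:G ==> (%x. if x:L then g x else 0):embeddings L"
proof -
 assume g: "g:G"
 hence h: "bij_betw g L L" "!!x y. x:L ==> y:L ==> g (x + y) = g x + g y & g (x*y) = g x*g y" by (auto simp: G_iff)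
 have "g 0 = 0" using h(2)[of 0 0] by simp
 moreover have "g 1~=g 0" using h(1) inj_onD[of g L 1 0] by (auto simp: bij_betw_def)
 moreover have "g 1*g 1 = g 1" using h(2)[of 1 1] by simp
 ultimately have "g 1 = 1" by simp
 thus ?thesis using h(2) by (auto simp: embeddings_def L.K_add L.K_mult)
qed

context
 fixes g assumes g: "g:G"
begin

lemma g_L: "x:L ==> g x:L" using g by (auto simp: G_iff bij_betw_def)
lemma g_add: "x:L ==> y:L ==> g (x + y) = g x + g y" and g_mult: "x:L ==> y:L ==> g (x*y) = g x*g y"
 using g by (auto simp: G_iff)
lemma g_uminus: "x:L ==> g (- x) = - g x" using L.emb_uminus[OF G_emb[OF g], of x] by (simp add: L.K_uminus)
lemma g_diff: "x:L ==> y:L ==> g (x - y) = g x - g y" using L.emb_diff[OF G_emb[OF g], of x y] by (simp add: L.K_diff)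
lemma g_Rats: "x:\<rat> ==> g x = x" using L.emb_Rats[OF G_emb[OF g], of x] L.K_Rats[of x] by simp
lemma g_eq_0_iff: "x:L ==> g x = 0 \<longleftrightarrow> x = 0" using L.emb_eq_0_iff[OF G_emb[OF g], of x] by simp
lemma g_power: "x:L ==> g (x^n) = g x^n" using L.emb_power[OF G_emb[OF g], of x n] by (simp add: L.K_power)
lemma g_restrict: "(%x. if x:K then g x else 0):embeddings K"
proof -
 have "g 1 = 1" using g_Rats[of 1] by simp
 thus ?thesis using g_add g_mult K_sub_L by (auto simp: embeddings_def K_add K_mult subset_iff)
qed
end

lemma G_comp: "g:G ==> g':G ==> g o g':G"
proof -
 assume h: "g:G" "g':G"
 have "bij_betw (g o g') L L" using h bij_betw_trans unfolding G_iff by blast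
 moreover have "g' x:L" if "x:L" for x using h(2) that by (auto simp: G_iff bij_betw_def)
 ultimately show ?thesis using h unfolding G_iff by simp
qed

lemma G_id: "id:G" by (auto simp: G_iff)

lemma G_ext: "g:G ==> g':G ==> (!!x. x:L ==> g x = g' x) ==> g = g'"
 by (rule ext) (metis G_iff)

text \<open>The set on which \<open>g\<close> and \<open>g'\<close> agree is a subfield containing
  all conjugates of \<open>K\<close>, hence all of \<open>L\<close>.\<close>

lemma G_ext_K:
 assumes g: "g:G" "g':G" and eq: "!!k x. k:G ==> x:K ==> g (k x) = g' (k x)"
 shows "g = g'"
proof (rule G_ext[OF g])
 let ?S = "{x:L. g x = g' x}"
 have S: "subfield_C ?S"
  unfolding subfield_C_def
 proof (intro conjI ballI impI)
  show "0:?S" "1:?S" using g_Rats[OF g(1)] g_Rats[OF g(2)] by simp_all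
  fix x assume x: "x:?S"
  show "- x:?S" using x by (simp add: g_uminus[OF g(1)] g_uminus[OF g(2)] L.K_uminus)
  show "inverse x:?S" using x L.emb_inverse[OF G_emb[OF g(1)], of x] L.emb_inverse[OF G_emb[OF g(2)], of x] by (simp add: L.K_inverse)
  fix y assume y: "y:?S"
  show "x + y:?S" "x*y:?S" using x y by (simp_all add: g_add[OF g(1)] g_add[OF g(2)] g_mult[OF g(1)] g_mult[OF g(2)] L.K_add L.K_mult)
 qed
 have "L<=?S"
 proof (rule L_least[OF S])
  fix sig x assume s: "sig:embeddings K" and x: "x:K"
  obtain k where "k:G" "sig x = k x" using embedding_is_restriction[OF s] x by blast
  thus "sig x:?S" using eq[of k x] L_sub[OF s x] x by simp
 qed
 thus "!!x. x:L ==> g x = g' x" by blast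
qed

lemma aut_structure:
 "card G = 8 & (EX z:G. z~=id & z o z = id & (ALL x:G. z o x = x o z) &
   (ALL h:G. h = id | h = z | h o h = z | (h o h = id & (EX g:G.
    h o g = g o (z o h) & g o g = z & (ALL x:G. EX y:{id, z, h, z o h}. x = y | x = g o y)))))"
proof -
 have "aut_group L \<cong> D4_group" using D4 by (simp add: D4_quartic_def L_def)
 then obtain phi where ph: "phi:iso (aut_group L) D4_group" by (auto simp: is_iso_def)
 have bij: "bij_betw phi G (carrier D4_group)" and hom: "!!x y. x:G ==> y:G ==> phi (x o y) = phi x o phi y"
  using ph by (auto simp: iso_def hom_def D4_mult) (simp add: aut_group_def)
 have inj: "x:G ==> y:G ==> phi x = phi y \<longleftrightarrow> x = y" for x y using bij by (auto simp: bij_betw_def inj_on_def)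
 have surj: "EX x:G. y = phi x" if "y:carrier D4_group" for y
 proof -
  have "y:phi`G" using bij that by (simp add: bij_betw_def)
  thus ?thesis by blast
 qed
 have idD: "id:carrier D4_group" by (simp add: D4_group_def)
 obtain e where e: "e:G" "id = phi e" using surj[OF idD] by blast
 have "phi e o phi id = phi e" using hom[OF e(1) G_id] by simp
 hence ph1: "phi id = id" unfolding e(2)[symmetric] by simp
 have card: "card G = 8" using bij_betw_same_card[OF bij] D4_card by simp
 obtain Z where Z: "Z:carrier D4_group" "Z~=id" "Z o Z = id" "ALL x:carrier D4_group. Z o x = x o Z"
   "ALL h:carrier D4_group. h = id | h = Z | h o h = Z | (h o h = id & (EX g:carrier D4_group.
     h o g = g o (Z o h) & g o g = Z &
     (ALL x:carrier D4_group. EX y:{id, Z, h, Z o h}. x = y | x = g o y)))"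
  using D4_structure unfolding D4_mult D4_one by blast
 obtain z where z: "z:G" "Z = phi z" using surj[OF Z(1)] by blast
 have phG: "phi x:carrier D4_group" if "x:G" for x using bij that by (auto simp: bij_betw_def)
 have tr: "x o y = u" if "x:G" "y:G" "u:G" "phi x o phi y = phi u" for x y u
  using inj[OF G_comp[OF that(1,2)] that(3)] hom[OF that(1,2)] that(4) by simp
 have 1: "z~=id" using Z(2) z(2) ph1 by auto
 have 2: "z o z = id" by (rule tr) (use z G_id Z(3) ph1 in auto)
 have 3: "z o x = x o z" if x: "x:G" for x
  by (rule tr[OF z(1) x G_comp[OF x z(1)]]) (use Z(4) phG[OF x] hom[OF x z(1)] z(2) in auto)
 have 4: "h = id | h = z | h o h = z | (h o h = id & (EX g:G.
    h o g = g o (z o h) & g o g = z & (ALL x:G. EX y:{id, z, h, z o h}. x = y | x = g o y)))" if h: "h:G" for h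
 proof -
  consider "phi h = id" | "phi h = Z" | "phi h o phi h = Z" | "phi h o phi h = id & (EX g:carrier D4_group.
     phi h o g = g o (Z o phi h) & g o g = Z &
     (ALL x:carrier D4_group. EX y:{id, Z, phi h, Z o phi h}. x = y | x = g o y))"
   using bspec[OF Z(5) phG[OF h]] by blast
  thus ?thesis
  proof cases
   case 1
   thus ?thesis using inj[OF h G_id] ph1 by simp
  next
   case 2
   thus ?thesis using inj[OF h z(1)] z(2) by simp
  next
   case 3
   thus ?thesis using tr[OF h h z(1)] z(2) by simp
  next
   case 4
   then obtain g' where g': "g':carrier D4_group" "phi h o g' = g' o (Z o phi h)" "g' o g' = Z"
    "ALL x:carrier D4_group. EX y:{id, Z, phi h, Z o phi h}. x = y | x = g' o y" by blast
   obtain g where g: "g:G" "g' = phi g" using surj[OF g'(1)] by blast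
   have zh: "z o h:G" by (rule G_comp[OF z(1) h])
   have phzh: "phi (z o h) = Z o phi h" using hom[OF z(1) h] z(2) by simp
   have "h o h = id" using tr[OF h h G_id] 4 ph1 by simp
   moreover have "h o g = g o (z o h)"
    by (rule tr[OF h g(1) G_comp[OF g(1) zh]]) (use g' g hom[OF g(1) zh] phzh in simp)
   moreover have "g o g = z" by (rule tr[OF g(1) g(1) z(1)]) (use g' g z in simp)
   moreover have "EX y:{id, z, h, z o h}. x = y | x = g o y" if x: "x:G" for x
   proof -
    obtain y' where y': "y':{id, Z, phi h, Z o phi h}" "phi x = y' | phi x = g' o y'" using g'(4) phG[OF x] by blast
    have "y':phi`{id, z, h, z o h}" using y'(1) ph1 z(2) phzh by auto
    then obtain y where y: "y:{id, z, h, z o h}" "y' = phi y" by blast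
    have yG: "y:G" using y(1) G_id z(1) h zh by blast
    have "x = y | x = g o y"
     using y'(2) unfolding y(2) g(2) hom[OF g(1) yG, symmetric] inj[OF x yG] inj[OF x G_comp[OF g(1) yG]] .
    thus ?thesis using y(1) by blast
   qed
   ultimately show ?thesis using g(1) by blast
  qed
 qed
 show ?thesis using card z(1) 1 2 3 4 by blast
qed

end

text \<open>Equivalent to being algebraic (\<open>algebraic_Q_scaled\<close>,
  \<open>scaled_algebraic_Q\<close>), but in this form closure under sums and products is inherited
  from algebraic integers.\<close>

definition scaled_integral :: "complex => bool" where
 "scaled_integral x \<longleftrightarrow> (EX m::int. m > 0 & algebraic_int (of_int m*x))"

lemma scaled_integral_add_mult:
 assumes "scaled_integral x" "scaled_integral y"
 shows "scaled_integral (x + y)" "scaled_integral (x*y)"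
proof -
 obtain m where m: "m > 0" "algebraic_int (of_int m*x)" using assms(1) by (auto simp: scaled_integral_def)
 obtain k where k: "k > 0" "algebraic_int (of_int k*y)" using assms(2) by (auto simp: scaled_integral_def)
 have "of_int (m*k)*(x + y) = of_int k*(of_int m*x) + of_int m*(of_int k*y)" by (simp add: algebra_simps)
 moreover have "algebraic_int (of_int k*(of_int m*x) + of_int m*(of_int k*y))"
  by (intro algebraic_int_add_mult m k) auto
 ultimately have "algebraic_int (of_int (m*k)*(x + y))" by (simp only:)
 thus "scaled_integral (x + y)" unfolding scaled_integral_def using m(1) k(1) by (intro exI[of _ "m*k"] conjI) auto
 have "of_int (m*k)*(x*y) = (of_int m*x)*(of_int k*y)" by simp
 moreover have "algebraic_int ((of_int m*x)*(of_int k*y))" by (intro algebraic_int_add_mult m k)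
 ultimately have "algebraic_int (of_int (m*k)*(x*y))" by (simp only:)
 thus "scaled_integral (x*y)" unfolding scaled_integral_def using m(1) k(1) by (intro exI[of _ "m*k"] conjI) auto
qed

lemma scaled_integral_poly:
 assumes "!!i. scaled_integral (Polynomial.coeff p i)" "scaled_integral x"
 shows "scaled_integral (poly p x)"
 using assms(1)
proof (induction p)
 case 0
 thus ?case using 0[of 0] by simp
next
 case (pCons a p)
 have "scaled_integral a" using pCons.prems[of 0] by simp
 moreover have "scaled_integral (Polynomial.coeff p i)" for i using pCons.prems[of "Suc i"] by simp
 ultimately show ?case using pCons.IH assms(2) by (simp add: scaled_integral_add_mult)
qed

lemma scaled_integral_Rats: "x:\<rat> ==> scaled_integral x"
proof -
 assume "x:\<rat>"
 then obtain q where q: "x = of_rat q" by (auto elim: Rats_cases)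
 obtain m :: int where m: "m > 0" "of_int m*q:\<int>" using rat_common_denominator[of "{q}"] by auto
 then obtain k where k: "of_int m*q = of_int k" using Ints_cases by blast
 have "of_int m*x = of_rat (of_int m*q)" by (simp add: q of_rat_mult)
 hence "of_int m*x = of_int k" unfolding k by simp
 thus ?thesis using m(1) unfolding scaled_integral_def by (intro exI[of _ m]) simp
qed

text \<open>If \<open>m\<close> clears the denominators of the monic equation of \<open>x\<close>,
  then \<open>of_int m*x\<close> satisfies a monic equation whose coefficients are, up to sign, the
  integers \<open>m^(n - Suc i)*k i\<close>.\<close>

lemma algebraic_Q_scaled: "algebraic_Q x ==> scaled_integral x"
proof -
 assume "algebraic_Q x"
 then obtain p where p: "p~=0" "!!i. Polynomial.coeff p i:\<rat>" "poly p x = 0" by (auto simp: algebraic_Q_def coeffs_in_def)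
 define n where "n = Polynomial.degree p"
 have lc: "lead_coeff p~=0" using p(1) by simp
 have "n~=0"
 proof
  assume "n = 0"
  then obtain c where "p = [:c:]" unfolding n_def using degree_eq_zeroE by blast
  thus False using p by simp
 qed
 have "EX q. Polynomial.coeff p i/lead_coeff p = of_rat q" for i
  using Rats_divide[OF p(2)[of i] p(2)[of "Polynomial.degree p"]] by (auto elim: Rats_cases)
 then obtain c where c: "!!i. Polynomial.coeff p i/lead_coeff p = of_rat (c i)" by metis
 obtain m :: int where m: "m > 0" "!!i. i < n ==> of_int m*c i:\<int>"
  using rat_common_denominator[of "c`{..<n}"] by auto
 have "ALL i. EX j. i < n --> of_int m*c i = of_int j" using m(2) by (auto elim: Ints_cases)
 hence "EX k. ALL i. i < n --> of_int m*c i = of_int (k i)" by (rule choice)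
 then obtain k where k: "!!i. i < n ==> of_int m*c i = of_int (k i)" by blast
 define y where "y = of_int m*x"
 have "0 = poly p x/lead_coeff p" using p(3) by simp
 also have "... = (SUM i<=n. of_rat (c i)*x^i)" unfolding poly_altdef n_def[symmetric] sum_divide_distrib by (simp add: c[symmetric] n_def)
 also have "... = (SUM i<n. of_rat (c i)*x^i) + x^n"
  using c[of n] lc by (simp add: lessThan_Suc_atMost[symmetric] n_def)
 finally have xn: "x^n = - (SUM i<n. of_rat (c i)*x^i)" by (simp add: eq_neg_iff_add_eq_0 add.commute)
 have yn: "y^n = (SUM i<n. of_int (- (m^(n - Suc i)*k i))*y^i)"
 proof -
  have "y^n = of_int m^n*x^n" by (simp add: y_def power_mult_distrib)
  also have "... = (SUM i<n. - (of_int m^n * of_rat (c i)*x^i))" unfolding xn by (simp add: sum_distrib_left sum_negf mult.assoc)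
  also have "... = (SUM i<n. of_int (- (m^(n - Suc i)*k i))*y^i)"
  proof (rule sum.cong[OF refl])
   fix i assume "i:{..<n}"
   hence i: "i < n" by simp
   have kc: "(of_int m * of_rat (c i) :: complex) = of_int (k i)"
    using arg_cong[OF k[OF i], of "of_rat :: rat => complex"] by (simp add: of_rat_mult)
   have "(of_int m :: complex)^n = of_int m^(n - Suc i) * of_int m * of_int m^i"
    using i by (metis Suc_diff_Suc add.commute diff_Suc_Suc le_add_diff_inverse less_imp_le_nat mult.commute power_Suc power_add)
   hence "of_int m^n * of_rat (c i)*x^i = of_int m^(n - Suc i)*(of_int m * of_rat (c i))*(of_int m^i*x^i)"
    by (simp only: mult_ac)
   thus "- (of_int m^n * of_rat (c i)*x^i) = of_int (- (m^(n - Suc i)*k i))*y^i"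
    unfolding kc by (simp add: y_def power_mult_distrib)
  qed
  finally show ?thesis .
 qed
 have "algebraic_int y"
 proof (rule algebraic_int_if_zspan_stable[of "{..<n}" 0 "%i. y^i"])
  show "0:{..<n}" using \<open>n ~= 0\<close> by simp
  fix i assume i: "i:{..<n}"
  show "y*y^i:zspan {..<n} (%i. y^i)"
  proof (cases "Suc i = n")
   case True
   hence "y*y^i = y^n" by auto
   thus ?thesis using yn by (intro zspanI[where c = "%i. - (m^(n - Suc i)*k i)"]) simp
  next
   case False
   thus ?thesis using zspan_gen[of "{..<n}" "Suc i" "%i. y^i"] i by simp
  qed
 qed auto
 thus ?thesis unfolding scaled_integral_def y_def using m(1) by blast
qed

lemma scaled_algebraic_Q: "scaled_integral x ==> algebraic_Q x"
proof -
 assume "scaled_integral x"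
 then obtain m :: int where m: "m > 0" "algebraic_int (of_int m*x)" by (auto simp: scaled_integral_def)
 obtain p where p: "lead_coeff p = 1" "!!i. Polynomial.coeff p i:\<int>" "poly p (of_int m*x) = 0"
  using m(2) by (auto elim: algebraic_int.cases)
 define q where "q = pcompose p [:0, of_int m:]"
 have "q~=0" unfolding q_def using p(1) m(1) by (subst pcompose_eq_0_iff) auto
 moreover have "coeffs_in \<rat> q" unfolding coeffs_in_def q_def
 proof
  fix i
  have "Polynomial.coeff p j:\<rat>" for j using p(2)[of j] Ints_subset_Rats by blast
  thus "Polynomial.coeff (pcompose p [:0, of_int m:]) i:\<rat>"
   by (intro coeff_pcompose_semiring_closed) (auto simp: coeff_pCons split: nat.splits intro: Rats_add Rats_mult)
 qed
 moreover have "poly q x = 0" using p(3) by (simp add: q_def poly_pcompose mult.commute)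
 ultimately show ?thesis unfolding algebraic_Q_def by blast
qed

text \<open>Hilbert 90 made explicit. The quotient \<open>rho\<close> of \<open>s^2\<close> by
  \<open>bet = u + v*dlt\<close> has norm \<open>R^2\<close>, a rational square. Then
  \<open>kap = rho + R\<close> satisfies \<open>kap^2 = T*rho\<close> with \<open>T\<close>
  rational, so \<open>s^2\<close> and \<open>T*bet\<close> differ by a square of Q(sqrt d). Finally
  \<open>T\<close> is replaced by the squarefree integer in its square class.\<close>

lemma (in number_subfield) quadratic_twist:
 fixes d d' u v z :: int and A B r :: rat
 assumes dl: "dlt:K" "dlt^2 = of_int d" and s: "s:K" "s~=0" "s^2 = of_rat A + of_rat B*dlt"
  and n: "A^2 - of_int d*B^2 = of_int d'*r^2" "r~=0" and n0: "u^2 - d * v^2 = d'*z^2" "d'~=0" "z~=0"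
 shows "EX t s' e f. squarefree (t::int) & s':K & s'^2 = of_int t*(of_int u + of_int v * dlt) &
  s = (of_rat e + of_rat f*dlt) * s'"
proof -
 define N where "N = (of_int d'*(of_int z)^2 :: rat)"
 have N0: "N~=0" using n0 by (simp add: N_def)
 have N: "N = (of_int u)^2 - of_int d*(of_int v)^2"
  using arg_cong[OF n0(1), of "of_int :: int => rat"] by (simp add: N_def)
 define P where "P = (A * of_int u - of_int d*B * of_int v)/N"
 define Q where "Q = (B * of_int u - A * of_int v)/N"
 have "(A * of_int u - of_int d*B * of_int v)^2 - of_int d*(B * of_int u - A * of_int v)^2 = (A^2 - of_int d*B^2)*N"
  unfolding N by (simp add: algebra_simps power2_eq_square)
 note num = this
 have "P^2 - of_int d*Q^2 = ((A * of_int u - of_int d*B * of_int v)^2 - of_int d*(B * of_int u - A * of_int v)^2)/N^2"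
  unfolding P_def Q_def power_divide by (simp only: times_divide_eq_right diff_divide_distrib)
 also have "... = (A^2 - of_int d*B^2)*N/N^2" by (simp only: num)
 also have "... = (r/of_int z)^2" unfolding n(1) using N0 n0 by (simp add: N_def power_divide power2_eq_square)
 finally have PQ: "P^2 - of_int d*Q^2 = (r/of_int z)^2" .
 have "r/of_int z~=0" using n(2) n0(3) by simp
 \<comment> \<open>The sign of the square root is chosen so that \<open>P + R\<close> is
   nonzero.\<close>
 then obtain R where R: "R^2 = P^2 - of_int d*Q^2" "P + R~=0"
 proof (cases "P + r/of_int z = 0")
  case True
  hence "P + - (r/of_int z)~=0" using \<open>r / of_int z ~= 0\<close> by (simp add: add_eq_0_iff)
  thus ?thesis using that[of "- (r/of_int z)"] PQ by simp
 next
  case False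
  thus ?thesis using that[of "r/of_int z"] PQ by simp
 qed
 define W where "W = P + R"
 define T where "T = 2*W"
 have T0: "T~=0" using R(2) by (simp add: T_def W_def)
 define bet where "bet = of_int u + of_int v * dlt"
 define rho where "rho = of_rat P + of_rat Q*dlt"
 define kap where "kap = of_rat W + of_rat Q*dlt"
 have br: "bet*rho = s^2"
 proof -
  have "bet*rho = of_rat (of_int u*P + of_int d * of_int v * Q) + of_rat (of_int u*Q + of_int v * P)*dlt"
   using dl(2) unfolding bet_def rho_def by (simp add: algebra_simps of_rat_add of_rat_mult power2_eq_square)
  also have "of_int u*P + of_int d * of_int v * Q = A"
  proof -
   have "of_int u*P + of_int d * of_int v * Q = A*((of_int u)^2 - of_int d*(of_int v)^2)/N"
    unfolding P_def Q_def by (simp add: add_divide_distrib[symmetric] algebra_simps power2_eq_square)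
   thus ?thesis using N0 N by simp
  qed
  also have "of_int u*Q + of_int v * P = B"
  proof -
   have "of_int u*Q + of_int v * P = B*((of_int u)^2 - of_int d*(of_int v)^2)/N"
    unfolding P_def Q_def by (simp add: add_divide_distrib[symmetric] algebra_simps power2_eq_square)
   thus ?thesis using N0 N by simp
  qed
  finally show ?thesis using s(3) by simp
 qed
 have kk: "kap^2 = of_rat T*rho"
 proof -
  have "kap^2 = (of_rat W)^2 + (of_rat Q)^2*dlt^2 + 2 * of_rat W * of_rat Q*dlt"
   unfolding kap_def by (simp add: algebra_simps power2_eq_square)
  also have "... = of_rat (W^2 + of_int d*Q^2) + of_rat (T*Q)*dlt"
   unfolding dl(2) by (simp add: T_def of_rat_add of_rat_mult of_rat_power)
  also have "W^2 + of_int d*Q^2 = T*P"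
  proof -
   have "W^2 + of_int d*Q^2 = P^2 + 2*P*R + R^2 + of_int d*Q^2" unfolding W_def by (simp add: power2_sum)
   also have "... = 2*P^2 + 2*P*R" unfolding R(1) by simp
   finally show ?thesis by (simp add: T_def W_def power2_eq_square algebra_simps)
  qed
  finally show ?thesis unfolding rho_def by (simp only: of_rat_mult distrib_left mult.assoc)
 qed
 have k0: "kap~=0"
 proof
  assume "kap = 0"
  hence "rho = 0" using kk T0 by simp
  thus False using br s(2) by simp
 qed
 obtain p q where pq: "T = of_int p/of_int q" "q > 0" by (cases T) (auto simp: Fract_of_int_quotient)
 have p0: "p~=0" using T0 pq by auto
 \<comment> \<open>\<open>T\<close> is \<open>p/q\<close>, so its square class is that of
   \<open>q*p\<close>.\<close>
 define t where "t = squarefree_part (q*p)"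
 define f where "f = square_part (q*p)"
 have tf: "q*p = t*f^2" unfolding t_def f_def by (rule squarefree_decompose)
 have f0: "f~=0" using tf p0 pq(2) by auto
 define s' where "s' = s/kap*(of_int p/of_int f)"
 have "kap:K" unfolding kap_def using dl(1) by (intro K_add K_mult) auto
 hence sK: "s':K" unfolding s'_def using s(1) by (intro K_mult K_divide) auto
 have "s'^2 = of_int t*bet"
 proof -
  have "s'^2*(kap^2*(of_int f)^2) = s^2*(of_int p)^2"
   unfolding s'_def using k0 f0 by (simp add: power_mult_distrib power_divide)
  also have "... = bet*rho*(of_int p)^2" unfolding br ..
  also have "... = of_int t*bet*(kap^2*(of_int f)^2)"
  proof -
   have tq: "(of_int t*(of_int f)^2 :: complex) = of_int q * of_int p"
    using arg_cong[OF tf, of "of_int :: int => complex"] by simp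
   have "(of_rat T :: complex) = of_int p/of_int q" unfolding pq(1) by (simp add: of_rat_divide)
   hence "of_rat T*(of_int q * of_int p) = (of_int p)^2*(1::complex)" using pq(2) by (simp add: power2_eq_square)
   thus ?thesis unfolding kk using tq by (simp add: mult_ac)
  qed
  finally show ?thesis using k0 f0 by simp
 qed
 moreover have "s = (of_rat (W*(of_int f/of_int p)) + of_rat (Q*(of_int f/of_int p))*dlt) * s'"
 proof -
  have "(of_rat (W*(of_int f/of_int p)) + of_rat (Q*(of_int f/of_int p))*dlt) = kap*(of_int f/of_int p)"
   unfolding kap_def by (simp add: of_rat_mult of_rat_divide algebra_simps)
  thus ?thesis unfolding s'_def using k0 f0 p0 by simp
 qed
 moreover have "squarefree t" unfolding t_def by simp
 ultimately show ?thesis using sK unfolding bet_def by blast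
qed

text \<open>First the square class of the quadratic subfield of \<open>K\<close>, then that of the
  relative norm of the radicand: two different ones among the three classes \<open>a\<close>,
  \<open>b\<close>, \<open>a*b\<close> of the biquadratic field.\<close>

definition class_pairs :: "int => int => (int \<times> int) set" where
 "class_pairs a b = {(a, b), (b, a), (a, a*b), (b, a*b), (a*b, a), (a*b, b)}"

section \<open>The quadratic tower inside a D4-field\<close>

context d4_quartic_field
begin

lemma L_algebraic: "x:L ==> algebraic_Q x"
proof -
 have "ALL x:adjoin_list \<rat> xs. scaled_integral x" if "ALL x:set xs. algebraic_Q x" for xs
  using that
 proof (induction xs)
  case (Cons a xs)
  have "scaled_integral a" using Cons.prems algebraic_Q_scaled by simp
  moreover have "ALL x:adjoin_list \<rat> xs. scaled_integral x" using Cons by simp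
  ultimately show ?case by (auto simp: adjoin_def coeffs_in_def intro!: scaled_integral_poly)
 qed (simp add: scaled_integral_Rats)
 hence "ALL x:L. scaled_integral x"
  using L_eq_adjoin_list[OF subfield_Rats Rats_subfield[OF L_subfield]] gens_alg by metis
 thus "x:L ==> algebraic_Q x" using scaled_algebraic_Q by blast
qed

text \<open>There are 8 automorphisms but at most 4 embeddings of \<open>K\<close>, so some
  \<open>h\<close> other than the identity fixes \<open>K\<close>. It is neither \<open>z\<close>
  nor a square root of \<open>z\<close>, because the central \<open>z\<close>, if it fixed
  \<open>K\<close>, would fix all conjugates of \<open>K\<close>. Hence \<open>h\<close> is a
  reflection, and \<open>z\<close>, \<open>h\<close>, \<open>g\<close> generate the group.\<close>

lemma stabilizer_structure:
 "EX z h g. z:G & h:G & g:G & (ALL x. z (h x) = h (z x)) & (ALL x. z (g x) = g (z x)) & (ALL x. z (z x) = x) &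
   (ALL x. h (g x) = g (z (h x))) & (ALL x. g (g x) = z x) & (ALL x:K. h x = x) & (EX x:K. z x~=x) &
   (ALL k:G. ALL x. h x = x --> z x = x --> g x = x --> k x = x)"
proof -
 obtain z where z0: "z:G" and z1: "z~=id & z o z = id & (ALL x:G. z o x = x o z) &
   (ALL h:G. h = id | h = z | h o h = z | (h o h = id & (EX g:G.
    h o g = g o (z o h) & g o g = z & (ALL x:G. EX y:{id, z, h, z o h}. x = y | x = g o y))))"
  using aut_structure[THEN conjunct2] by (rule bexE)
 have z: "z:G" "z~=id" "z o z = id" "x:G ==> z o x = x o z" "card G = 8" for x
  using z0 z1 aut_structure by simp_all
 note z6 = z1[THEN conjunct2, THEN conjunct2, THEN conjunct2, THEN bspec]
 have zz: "z (z x) = x" for x using fun_cong[OF z(3), of x] by simp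
 \<comment> \<open>The fourth power of every element is trivial, so \<open>k'\<close> applied three
   times is its inverse; in this form it enters \<open>h\<close>.\<close>
 have p4: "k (k (k (k x))) = x" if kG: "k:G" for k x
 proof -
  consider "k = id" | "k = z" | "k o k = z" | "k o k = id" using z6[OF kG] by blast
  thus ?thesis
  proof cases
   case 3
   hence "k (k y) = z y" for y by (metis comp_apply)
   thus ?thesis using zz by simp
  next
   case 4
   hence "k (k y) = y" for y by (metis comp_apply id_apply)
   thus ?thesis by simp
  qed (simp_all add: zz)
 qed
 let ?r = "%g x. if x:K then g x else 0"
 have "~ inj_on ?r G"
 proof
  assume "inj_on ?r G"
  hence "card G<=card (embeddings K)"
   by (rule card_inj_on_le) (use g_restrict emb_card_le(1) in auto)
  thus False using z(5) emb_card_le(2) by simp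
 qed
 then obtain k k' where k: "k:G" "k':G" "k~=k'" "?r k = ?r k'" unfolding inj_on_def by blast
 have kk: "k x = k' x" if "x:K" for x using fun_cong[OF k(4), of x] that by simp
 define h where "h = k' o (k' o (k' o k))"
 have hG: "h:G" unfolding h_def by (intro G_comp k)
 have hK: "h x = x" if "x:K" for x using kk[OF that] p4[OF k(2), of x] by (simp add: h_def)
 have "h~=id"
 proof
  assume "h = id"
  hence "k' (k' (k' (k x))) = x" for x unfolding h_def by (metis comp_apply id_apply)
  hence "k' x = k x" for x using p4[OF k(2), of "k x"] by metis
  thus False using k(3) by auto
 qed
 have zK: "EX x:K. z x~=x"
 proof (rule ccontr)
  assume "~ ?thesis"
  hence fz: "z x = x" if "x:K" for x using that by blast
  have "z (k x) = id (k x)" if "k:G" "x:K" for k x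
   using fun_cong[OF z(4)[OF that(1)], of x] fz[OF that(2)] by simp
  hence "z = id" by (rule G_ext_K[OF z(1) G_id])
  thus False using z(2) by simp
 qed
 hence hz: "h~=z" using hK by auto
 have hhz: "h o h~=z"
 proof
  assume "h o h = z"
  hence "z x = x" if "x:K" for x using hK[OF that] by (metis comp_apply)
  thus False using zK by blast
 qed
 obtain g where g: "g:G" "h o g = g o (z o h)" "g o g = z" "!!x. x:G ==> EX y:{id, z, h, z o h}. x = y | x = g o y"
  using z6[OF hG] \<open>h ~= id\<close> hz hhz by blast
 have "k x = x" if "k:G" "h x = x" "z x = x" "g x = x" for k x
  using g(4)[OF that(1)] that(2-4) by auto
 moreover have "z (h x) = h (z x)" "z (g x) = g (z x)" "h (g x) = g (z (h x))" "g (g x) = z x" for x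
  using fun_cong[OF z(4)[OF hG], of x] fun_cong[OF z(4)[OF g(1)], of x] fun_cong[OF g(2), of x] fun_cong[OF g(3), of x] by simp_all
 ultimately show ?thesis using z(1) hG g(1) zz hK zK by blast
qed

text \<open>\<open>s\<close> is fixed by \<open>h\<close> and negated by \<open>z\<close>,
  \<open>s1\<close> is a square root generating the quadratic subfield, and the square of
  \<open>xi = s*g s\<close> is the relative norm of \<open>s^2\<close>. A square root of an integer
  in \<open>L\<close> is fixed by \<open>z\<close>, the square of \<open>g\<close>, and changed at
  most in sign by \<open>h\<close> and \<open>g\<close>; so, if irrational, it is a rational
  multiple of \<open>s1\<close>, \<open>xi\<close> or their product. This places \<open>a\<close>
  and \<open>b\<close> in the square classes of \<open>d0\<close>, \<open>n0\<close> or
  \<open>d0*n0\<close>.\<close>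

lemma tower_structure:
 fixes a b :: int
 assumes ab: "alf:L" "alf^2 = of_int a" "bet:L" "bet^2 = of_int b"
  and nsq: "\<nexists>r::rat. r^2 = of_int a" "\<nexists>r::rat. r^2 = of_int b" "\<nexists>r::rat. r^2 = of_int (a*b)"
 shows "EX d d' dlt s A B r. (d, d'):class_pairs a b & dlt:K & s:K & s~=0 & dlt^2 = of_int d &
   s^2 = of_rat A + of_rat B*dlt & A^2 - of_int d*B^2 = of_int d'*r^2 & r~=0 &
   (ALL x:K. EX p q p' q'. x = of_rat p + of_rat q*dlt + of_rat p' * s + of_rat q'*(s*dlt)) &
   finite (embeddings K) & card (embeddings K) = 4"
proof -
 obtain z h g where G: "z:G" "h:G" "g:G" and zh: "!!x. z (h x) = h (z x)" and zg: "!!x. z (g x) = g (z x)"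
  and zz: "!!x. z (z x) = x" and hg: "!!x. h (g x) = g (z (h x))" and gg: "!!x. g (g x) = z x"
  and hK: "!!x. x:K ==> h x = x" and zK: "EX x:K. z x~=x"
  and gen: "!!k x. k:G ==> h x = x ==> z x = x ==> g x = x ==> k x = x"
  using stabilizer_structure by blast
 note gL = g_L[OF G(1)] g_L[OF G(2)] g_L[OF G(3)]
 note ga = g_add[OF G(1)] g_add[OF G(2)] g_add[OF G(3)]
 note gm = g_mult[OF G(1)] g_mult[OF G(2)] g_mult[OF G(3)]
 note gu = g_uminus[OF G(1)] g_uminus[OF G(2)] g_uminus[OF G(3)]
 note gd = g_diff[OF G(1)] g_diff[OF G(2)] g_diff[OF G(3)]
 note gQ = g_Rats[OF G(1)] g_Rats[OF G(2)] g_Rats[OF G(3)]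
 note g0 = g_eq_0_iff[OF G(1)] g_eq_0_iff[OF G(2)] g_eq_0_iff[OF G(3)]
 have rat: "EX q. x = of_rat q" if x: "x:L" "h x = x" "z x = x" "g x = x" for x
 proof -
  have "x:\<rat>" by (rule fixed_rational[OF x(1) L_algebraic[OF x(1)]]) (rule gen[OF _ x(2-4)])
  thus ?thesis by (auto elim: Rats_cases)
 qed
 obtain x0 where x0: "x0:K" "z x0~=x0" using zK by blast
 have x0L: "x0:L" using x0(1) K_sub_L by blast
 \<comment> \<open>Antisymmetrised under \<open>z\<close>, and nonzero since \<open>z\<close> moves
   \<open>x0\<close>.\<close>
 define s where "s = x0 - z x0"
 have sL: "s:L" unfolding s_def by (intro L.K_diff x0L gL)
 have s0: "s~=0" using x0(2) by (simp add: s_def)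
 have zs: "z s = - s" unfolding s_def using gd(1)[OF x0L gL(1)[OF x0L]] zz by simp
 have hs: "h s = s" unfolding s_def using gd(2)[OF x0L gL(1)[OF x0L]] hK[OF x0(1)] zh[of x0] by simp
 have gsL: "g s:L" by (rule gL(3)[OF sL])
 have gs0: "g s~=0" using g0(3)[OF sL] s0 by simp
 have zgs: "z (g s) = - g s" unfolding zg zs by (rule gu(3)[OF sL])
 have hgs: "h (g s) = - g s" unfolding hg hs zs by (rule gu(3)[OF sL])
 have ggs: "g (g s) = - s" unfolding gg zs ..
 define S where "S = s * s"
 define S' where "S' = g s*g s"
 have SL: "S:L" "S':L" unfolding S_def S'_def by (intro L.K_mult sL gsL)+
 have S: "z S = S" "h S = S" "g S = S'" "z S' = S'" "h S' = S'" "g S' = S"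
  unfolding S_def S'_def by (simp_all add: gm sL gsL zs hs zgs hgs ggs)
 define s1 where "s1 = S - S'"
 have s1L: "s1:L" unfolding s1_def by (intro L.K_diff SL)
 have s1: "z s1 = s1" "h s1 = s1" "g s1 = - s1" unfolding s1_def by (simp_all add: gd SL S)
 have s10: "s1~=0"
 proof
  assume "s1 = 0"
  hence "(g s)^2 = s^2" by (simp add: s1_def S_def S'_def power2_eq_square)
  hence "g s = s | g s = - s" by (simp add: power2_eq_iff)
  hence "h (g s) = g s" using hs gu(2)[OF sL] by auto
  thus False using hgs gs0 by simp
 qed
 define xi where "xi = s*g s"
 have xiL: "xi:L" unfolding xi_def by (intro L.K_mult sL gsL)
 have xi: "z xi = xi" "h xi = - xi" "g xi = - xi"
  unfolding xi_def by (simp_all add: gm sL gsL zs hs zgs hgs ggs)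
 have xi0: "xi~=0" using s0 gs0 by (simp add: xi_def)
 obtain d0 where d0: "s1 * s1 = of_rat d0" using rat[of "s1 * s1"] s1 s1L by (auto simp: gm L.K_mult)
 obtain A2 where A2: "S + S' = of_rat A2" using rat[of "S + S'"] S SL by (auto simp: ga L.K_add add.commute)
 define A where "A = A2/2"
 have SA: "S = of_rat A + of_rat (1/2) * s1" "S' = of_rat A - of_rat (1/2) * s1"
  using A2 by (simp_all add: A_def of_rat_divide s1_def field_simps)
 have d00: "d0~=0" using d0 s10 by auto
 define n0 where "n0 = A^2 - d0/4"
 have xx: "xi*xi = of_rat n0"
 proof -
  have "xi*xi = S*S'" by (simp add: xi_def S_def S'_def)
  also have "... = (of_rat A)^2 - of_rat (1/4)*(s1 * s1)" unfolding SA by (simp add: of_rat_divide algebra_simps power2_eq_square)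
  also have "... = of_rat n0" unfolding d0 n0_def by (simp add: of_rat_diff of_rat_power of_rat_mult of_rat_divide)
  finally show ?thesis .
 qed
 have n00: "n0~=0" using xx xi0 by auto
 \<comment> \<open>Elements fixed by \<open>z\<close> and \<open>h\<close> are split into the parts
   on which \<open>g\<close> acts by 1 and by -1; multiplication by \<open>s1\<close> exchanges the
   two.\<close>
 have F1: "EX p q. y = of_rat p + of_rat q * s1" if y: "y:L" "h y = y" "z y = y" for y
 proof -
  have gy: "g y:L" "h (g y) = g y" "z (g y) = g y" "g (g y) = y"
   using gL(3)[OF y(1)] hg[of y] zg[of y] gg[of y] y by simp_all
  obtain p where p: "y + g y = of_rat p" using rat[of "y + g y"] y gy by (auto simp: ga L.K_add add.commute)
  have "EX q. (y - g y) * s1 = of_rat q"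
   by (rule rat) (use y gy s1 s1L in \<open>simp_all add: gm gd L.K_mult L.K_diff algebra_simps\<close>)
  then obtain q where q: "(y - g y) * s1 = of_rat q" by blast
  have "(y - g y)*(s1 * s1) = of_rat q * s1" unfolding mult.assoc[symmetric] q ..
  hence "y - g y = of_rat (q/d0) * s1" unfolding d0 using d00 by (simp add: of_rat_divide field_simps)
  then obtain q1 where "y - g y = of_rat q1 * s1" by blast
  moreover have "2*y = (y + g y) + (y - g y)" by simp
  ultimately have "2*y = of_rat p + of_rat q1 * s1" unfolding p by simp
  hence "y = of_rat (p/2) + of_rat (q1/2) * s1" by (simp add: of_rat_divide field_simps)
  thus ?thesis by blast
 qed
 \<comment> \<open>Elements fixed by \<open>h\<close> are split in the same way by \<open>z\<close>;
   the odd part becomes even after multiplication by \<open>s\<close>.\<close>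
 have W: "EX p q p' q'. x = of_rat p + of_rat q * s1 + of_rat p' * s + of_rat q'*(s * s1)" if x: "x:L" "h x = x" for x
 proof -
  have zx: "z x:L" "h (z x) = z x" using gL(1)[OF x(1)] zh[of x] x(2) by simp_all
  obtain p q where pq: "x + z x = of_rat p + of_rat q * s1"
   using F1[of "x + z x"] x zx zz[of x] by (auto simp: ga L.K_add add.commute)
  have "EX p q. (x - z x) * s = of_rat p + of_rat q * s1"
   by (rule F1) (use x zx zz[of x] zs hs sL in \<open>simp_all add: gm gd L.K_mult L.K_diff algebra_simps\<close>)
  then obtain m k where mk: "(x - z x) * s = of_rat m + of_rat k * s1" by blast
  have "(x - z x)*(S*S') = ((x - z x) * s) * s*S'" by (simp add: S_def)
  also have "... = (of_rat m + of_rat k * s1)*(of_rat A - of_rat (1/2) * s1) * s" unfolding mk SA by (simp only: mult_ac)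
  also have "... = (of_rat (m*A - k/2*d0) + of_rat (k*A - m/2) * s1) * s"
  proof -
   have "(of_rat m + of_rat k * s1)*(of_rat A - of_rat (1/2) * s1) =
     of_rat m * of_rat A - of_rat (k/2)*(s1 * s1) + (of_rat k * of_rat A - of_rat (m/2)) * s1"
    by (simp add: of_rat_divide algebra_simps)
   thus ?thesis unfolding d0 by (simp add: of_rat_diff of_rat_mult of_rat_divide)
  qed
  also have "S*S' = of_rat n0" using xx by (simp add: xi_def S_def S'_def mult_ac)
  finally obtain m2 k2 where "(x - z x) * of_rat n0 = (of_rat m2 + of_rat k2 * s1) * s" by blast
  hence "x - z x = (of_rat (m2/n0) + of_rat (k2/n0) * s1) * s"
   using n00 by (simp add: of_rat_divide field_simps)
  then obtain m3 k3 where "x - z x = (of_rat m3 + of_rat k3 * s1) * s" by blast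
  moreover have "2*x = (x + z x) + (x - z x)" by simp
  ultimately have "2*x = (of_rat p + of_rat q * s1) + (of_rat m3 + of_rat k3 * s1) * s" unfolding pq by simp
  hence "x = of_rat (p/2) + of_rat (q/2) * s1 + of_rat (m3/2) * s + of_rat (k3/2)*(s * s1)"
   by (simp add: of_rat_divide field_simps)
  thus ?thesis by blast
 qed
 let ?T = "{1, s1, s, s * s1}"
 note bs = Q_basis_vector_space[OF omg_basis]
 have KT: "K<=QV.span ?T"
 proof
  fix x assume x: "x:K"
  have xL: "x:L" using x K_sub_L by blast
  obtain p q p' q' where "x = of_rat p + of_rat q * s1 + of_rat p' * s + of_rat q'*(s * s1)"
   using W[OF xL hK[OF x]] by blast
  hence xe: "x = of_rat p*1 + of_rat q * s1 + of_rat p' * s + of_rat q'*(s * s1)" by simp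
  show "x:QV.span ?T" unfolding xe by (intro QV.span_add QV.span_scale QV.span_base) auto
 qed
 have cB: "card (omg`{..<4}) = 4" using card_image[OF bs(1)] by simp
 \<comment> \<open>\<open>K\<close> has dimension 4 and lies in the span of the at most four
   elements of \<open>?T\<close>, so the two spaces agree. This is how \<open>s\<close> and
   \<open>s1\<close> are found to lie in \<open>K\<close>.\<close>
 have "?T<=QV.span (omg`{..<4})"
 proof (rule subsetI, rule ccontr)
  fix x assume x: "x:?T" and nx: "x~:QV.span (omg`{..<4})"
  have ind: "QV.independent (insert x (omg`{..<4}))" by (rule QV.independent_insertI[OF nx bs(2)])
  have sub: "insert x (omg`{..<4})<=QV.span ?T" using subset_trans[OF bs(4) KT] QV.span_base[OF x] by simp
  have "card (insert x (omg`{..<4}))<=card ?T" using QV.independent_span_bound[OF _ ind sub] by simp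
  moreover have "card ?T<=4" by (simp add: card_insert_if)
  moreover have "x~:omg`{..<4}" using nx QV.span_base[of x "omg`{..<4}"] by (rule contrapos_nn)
  ultimately show False using cB by simp
 qed
 moreover have "QV.span (omg`{..<4})<=K"
  by (rule QV.span_minimal[OF bs(4)]) (auto simp: QV.subspace_def intro: K_add K_mult)
 ultimately have sK: "s:K" "s1:K" by blast+
 have card4: "card (embeddings K) = 4"
 proof -
  let ?r = "%g x. if x:K then g x else (0::complex)"
  have zgG: "g o z:G" by (rule G_comp[OF G(3,1)])
  \<comment> \<open>Their values at \<open>s1\<close> and \<open>s\<close> tell these four
    restrictions apart.\<close>
  let ?E = "{?r id, ?r z, ?r g, ?r (g o z)}"
  have sub: "?E<=embeddings K" using g_restrict[OF G_id] g_restrict[OF G(1)] g_restrict[OF G(3)] g_restrict[OF zgG] by blast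
  have ev: "(k = k') ==> k s1 = k' s1 & k s = k' s" for k k' :: "complex => complex" by simp
  have sm: "- s~=s" "- s1~=s1" "- g s~=g s" "s~=- s" "s1~=- s1" "g s~=- g s" using s0 s10 gs0 by auto
  have gzs: "g (z s) = - g s" using gu(3)[OF sL] zs by simp
  have "?r id~=?r z" "?r g~=?r (g o z)"
   using ev[of "?r id" "?r z"] ev[of "?r g" "?r (g o z)"] sK zs gzs sm by auto
  moreover have "?r id~=?r g" "?r id~=?r (g o z)" "?r z~=?r g" "?r z~=?r (g o z)"
   using ev[of "?r id" "?r g"] ev[of "?r id" "?r (g o z)"] ev[of "?r z" "?r g"] ev[of "?r z" "?r (g o z)"] sK s1 sm by auto
  ultimately have "card ?E = 4" by (simp only: card_insert_if finite.intros insert_iff empty_iff) simp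
  thus ?thesis using card_mono[OF emb_card_le(1) sub] emb_card_le(2) by simp
 qed
 have sign: "(h x = x | h x = - x) & (g x = x | g x = - x) & z x = x" if x: "x:L" "x^2 = of_int m" for x m
 proof -
  have e: "k x = x | k x = - x" if "k:G" for k
  proof -
   have "(k x)^2 = x^2" using g_power[OF that x(1), of 2] g_Rats[OF that, of "of_int m"] x(2) by simp
   thus ?thesis by (simp add: power2_eq_iff)
  qed
  have "z x = x" unfolding gg[symmetric] using e[OF G(3)] gu(3)[OF x(1)] by auto
  thus ?thesis using e G by blast
 qed
 have relate: "EX r. r~=0 & (d0 = of_int m*r^2 | n0 = of_int m*r^2 | d0*n0 = of_int m*r^2)"
  if x: "x:L" "x^2 = of_int m" and ns: "\<nexists>r::rat. r^2 = of_int m" for x m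
 proof -
  note sg = sign[OF x]
  have x0: "x~=0"
  proof
   assume "x = 0"
   hence "(0::rat)^2 = of_int m" using x(2) by simp
   thus False using ns by blast
  qed
  have m0: "m~=0" using x(2) x0 by auto
  have key: "EX r. r~=0 & D = of_int m*r^2"
   if y: "y:L" "y~=0" "y*y = of_rat D" "h (x*y) = x*y" "g (x*y) = x*y" "z y = y" for y D
  proof -
   have "z (x*y) = x*y" using gm(1)[OF x(1) y(1)] sg y(6) by simp
   then obtain r where r: "x*y = of_rat r" using rat[OF L.K_mult[OF x(1) y(1)] y(4) _ y(5)] by blast
   have "of_rat (r^2) = (x*y)^2" by (simp add: r of_rat_power)
   also have "... = of_int m * of_rat D" unfolding power_mult_distrib x(2) y(3)[symmetric] by (simp add: power2_eq_square)
   also have "... = of_rat (of_int m*D)" by (simp add: of_rat_mult)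
   finally have rD: "r^2 = of_int m*D" by (simp only: of_rat_eq_iff)
   have "r~=0" using r x0 y(2) by auto
   moreover have "D = of_int m*(r/of_int m)^2" using rD m0 by (simp add: power_divide power2_eq_square)
   ultimately show ?thesis using m0 by (intro exI[of _ "r/of_int m"]) simp
  qed
  have prods: "h (x*y) = h x*h y" "g (x*y) = g x*g y" if "y:L" for y using gm that x(1) by blast+
  consider "h x = x" "g x = x" | "h x = x" "g x = - x" | "h x = - x" "g x = - x" | "h x = - x" "g x = x" using sg by blast
  thus ?thesis
  proof cases
   case 1
   then obtain r where "x = of_rat r" using rat[OF x(1)] sg by blast
   hence "of_rat (r^2) = (of_rat (of_int m) :: complex)" using x(2) by (simp add: of_rat_power)
   hence "r^2 = of_int m" by (simp only: of_rat_eq_iff)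
   thus ?thesis using ns by blast
  next
   case 2
   thus ?thesis using key[OF s1L s10 d0] prods[OF s1L] s1 by auto
  next
   case 3
   thus ?thesis using key[OF xiL xi0 xx] prods[OF xiL] xi by auto
  next
   case 4
   have y: "s1*xi:L" "s1*xi~=0" using s1L xiL s10 xi0 by (auto intro: L.K_mult)
   have "(s1*xi)*(s1*xi) = (s1 * s1)*(xi*xi)" by (simp only: mult_ac)
   also have "... = of_rat (d0*n0)" unfolding d0 xx by (simp add: of_rat_mult)
   finally show ?thesis using key[OF y] prods[OF y(1)] 4 gm[OF s1L xiL] s1 xi by auto
  qed
 qed
 \<comment> \<open>Of the nine combinations, the three that put \<open>a\<close> and
   \<open>b\<close> in one class contradict that \<open>a*b\<close> is not a square; the other six
   are the members of \<open>class_pairs\<close>.\<close>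
 have fin: "EX d d' r r'. (d, d'):class_pairs a b & r~=0 & r'~=0 & d0 = of_int d*r^2 & n0 = of_int d'*r'^2"
 proof -
  have a0: "a~=0" "b~=0" using nsq(1,2) by (metis of_int_0 zero_power2)+
  have same: False if "X = of_int a*r^2" "X = of_int b*r'^2" "r~=0" "r'~=0" for X r r' :: rat
  proof -
   have "of_int a*r^2 = of_int b*r'^2" using that by simp
   hence "of_int (a*b) = (of_int b*r'/r)^2" using that(3) by (simp add: power_divide power_mult_distrib field_simps power2_eq_square)
   thus False using nsq(3) by metis
  qed
  have quot: "EX k. k~=0 & Y = of_int (m*m')*k^2"
   if "X = of_int m*r^2" "X*Y = of_int m'*r'^2" "r~=0" "r'~=0" "m~=0" for X Y r r' :: rat and m m' :: int
   using that by (intro exI[of _ "r'/(r * of_int m)"]) (simp add: power_divide power_mult_distrib field_simps power2_eq_square)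
  obtain r where r: "r~=0" "d0 = of_int a*r^2 | n0 = of_int a*r^2 | d0*n0 = of_int a*r^2"
   using relate[OF ab(1,2) nsq(1)] by blast
  obtain r' where r': "r'~=0" "d0 = of_int b*r'^2 | n0 = of_int b*r'^2 | d0*n0 = of_int b*r'^2"
   using relate[OF ab(3,4) nsq(2)] by blast
  have cp: "(a, b):class_pairs a b" "(b, a):class_pairs a b" "(a, a*b):class_pairs a b"
   "(b, a*b):class_pairs a b" "(a*b, a):class_pairs a b" "(a*b, b):class_pairs a b" by (simp_all add: class_pairs_def)
  have comm: "n0*d0 = d0*n0" "b*a = a*b" by simp_all
  from r(2) r'(2) show ?thesis
  proof (elim disjE)
   assume h: "d0 = of_int a*r^2" "d0 = of_int b*r'^2" thus ?thesis using same r(1) r'(1) by blast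
  next
   assume h: "d0 = of_int a*r^2" "n0 = of_int b*r'^2" thus ?thesis using cp(1) r(1) r'(1) by blast
  next
   assume h: "d0 = of_int a*r^2" "d0*n0 = of_int b*r'^2"
   thus ?thesis using quot[OF h r(1) r'(1) a0(1)] cp(3) r(1) by blast
  next
   assume h: "n0 = of_int a*r^2" "d0 = of_int b*r'^2" thus ?thesis using cp(2) r(1) r'(1) by blast
  next
   assume h: "n0 = of_int a*r^2" "n0 = of_int b*r'^2" thus ?thesis using same r(1) r'(1) by blast
  next
   assume h: "n0 = of_int a*r^2" "d0*n0 = of_int b*r'^2"
   have h2: "n0*d0 = of_int b*r'^2" unfolding comm(1) by (rule h(2))
   show ?thesis using quot[OF h(1) h2 r(1) r'(1) a0(1)] cp(5) r(1) h(1) by blast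
  next
   assume h: "d0*n0 = of_int a*r^2" "d0 = of_int b*r'^2"
   show ?thesis using quot[OF h(2,1) r'(1) r(1) a0(2)] cp(4) r'(1) h(2) unfolding comm(2) by blast
  next
   assume h: "d0*n0 = of_int a*r^2" "n0 = of_int b*r'^2"
   have h2: "n0*d0 = of_int a*r^2" unfolding comm(1) by (rule h(1))
   show ?thesis using quot[OF h(2) h2 r'(1) r(1) a0(2)] cp(6) r'(1) h(2) unfolding comm(2) by blast
  next
   assume h: "d0*n0 = of_int a*r^2" "d0*n0 = of_int b*r'^2" thus ?thesis using same r(1) r'(1) by blast
  qed
 qed
 then obtain d d' r r' where dd: "(d, d'):class_pairs a b" "r~=0" "r'~=0" "d0 = of_int d*r^2" "n0 = of_int d'*r'^2" by blast
 define dlt where "dlt = s1/of_rat r"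
 have s1d: "s1 = of_rat r*dlt" using dd(2) by (simp add: dlt_def)
 have "dlt:K" unfolding dlt_def using sK by (intro K_divide) auto
 moreover have "dlt^2 = of_int d"
 proof -
  have "dlt^2 = of_rat d0/of_rat (r^2)" unfolding dlt_def power_divide power2_eq_square[of s1] d0 by (simp add: of_rat_power)
  also have "... = of_rat (of_int d)" unfolding dd(4) using dd(2) by (simp add: of_rat_mult of_rat_power)
  finally show ?thesis by simp
 qed
 moreover have "s^2 = of_rat A + of_rat (r/2)*dlt"
  using SA(1) unfolding s1d by (simp add: S_def power2_eq_square of_rat_divide)
 moreover have "A^2 - of_int d*(r/2)^2 = of_int d'*r'^2"
  using dd(4,5) unfolding n0_def by (simp add: power_divide)
 moreover have "EX p q p' q'. x = of_rat p + of_rat q*dlt + of_rat p' * s + of_rat q'*(s*dlt)" if x: "x:K" for x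
 proof -
  obtain p q p' q' where xe: "x = of_rat p + of_rat q * s1 + of_rat p' * s + of_rat q'*(s * s1)"
   using W[OF subsetD[OF K_sub_L x] hK[OF x]] by blast
  have "x = of_rat p + of_rat (q*r)*dlt + of_rat p' * s + of_rat (q'*r)*(s*dlt)"
   unfolding xe s1d by (simp add: of_rat_mult mult_ac)
  thus ?thesis by blast
 qed
 ultimately show ?thesis using dd(1,3) sK(1) s0 emb_card_le(1) card4 by blast
qed

end

section \<open>Mertens estimates for real characters\<close>

abbreviation Lam :: "nat => real" where "Lam \<equiv> mangoldt"

definition chebyshev_psi :: "nat => real" where "chebyshev_psi n = (SUM d=1..n. Lam d)"

lemma sum_divisors_swap:
 fixes f :: "nat => nat => real"
 shows "(SUM m=1..n. SUM d | d dvd m. f d (m div d)) = (SUM d=1..n. SUM j=1..n div d. f d j)"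
proof -
 have fin: "finite {d. d dvd m}" if "m:{1..n}" for m using that by (auto intro: finite_divisors_nat)
 have "(SUM m=1..n. SUM d | d dvd m. f d (m div d)) = (SUM (m,d):Sigma {1..n} (%m. {d. d dvd m}). f d (m div d))"
  using fin by (subst sum.Sigma) auto
 also have "... = (SUM (d,j):Sigma {1..n} (%d. {1..n div d}). f d j)"
 proof (rule sum.reindex_bij_witness[of _ "%(d,j). (d*j,d)" "%(m,d). (d, m div d)"])
  fix a assume "a:Sigma {1..n} (%m. {d. d dvd m})"
  then obtain m d where a: "a = (m,d)" "m:{1..n}" "d dvd m" by auto
  then obtain k where k: "m = d*k" by auto
  hence kd: "k >= 1" "d >= 1" using a by (auto intro!: Suc_leI Nat.gr0I)
  thus "(case a of (m,d) => (d, m div d)):Sigma {1..n} (%d. {1..n div d})"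
   using a k by (auto simp: less_eq_div_iff_mult_less_eq mult.commute intro: order_trans[of d "d*k"])
 next
  fix b assume "b:Sigma {1..n} (%d. {1..n div d})"
  then obtain d j where b: "b = (d,j)" "1<=d" "d<=n" "1<=j" "j<=n div d" by auto
  hence "d*j<=n" by (simp add: less_eq_div_iff_mult_less_eq mult.commute)
  thus "(case b of (d,j) => (d*j,d)):Sigma {1..n} (%m. {d. d dvd m})" using b by auto
 qed auto
 also have "... = (SUM d=1..n. SUM j=1..n div d. f d j)" by (subst sum.Sigma) auto
 finally show ?thesis .
qed

lemma ln_fact_mangoldt: "ln (fact n) = (SUM d=1..n. Lam d*real (n div d))"
proof -
 have "ln (fact n :: real) = (SUM m=1..n. ln (real m))"
  unfolding fact_prod of_nat_prod by (subst ln_prod) auto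
 also have "... = (SUM m=1..n. SUM d | d dvd m. Lam d)"
  by (intro sum.cong refl) (simp add: mangoldt_sum)
 also have "... = (SUM d=1..n. SUM j=1..n div d. Lam d)" by (rule sum_divisors_swap[of "%d j. Lam d"])
 finally show ?thesis by (simp add: mult.commute)
qed

text \<open>Chebyshev's argument: the terms with \<open>n < d\<close> have weight 1 in
  \<open>ln (fact (2*n)) - 2*ln (fact n)\<close>, the others a nonnegative weight, and the total is
  the logarithm of the central binomial coefficient.\<close>

lemma psi_double: "chebyshev_psi (2*n) - chebyshev_psi n<=2*real n*ln 2"
proof -
 have "chebyshev_psi (2*n) - chebyshev_psi n = (SUM d=n+1..2*n. Lam d)"
 proof -
  have "{1..2*n} = {1..n} \<union> {n+1..2*n}" by auto
  moreover have "sum Lam ({1..n} \<union> {n+1..2*n}) = sum Lam {1..n} + sum Lam {n+1..2*n}"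
   by (rule sum.union_disjoint) auto
  ultimately show ?thesis unfolding chebyshev_psi_def by (simp only: add_diff_cancel_left')
 qed
 also have "... = (SUM d=n+1..2*n. Lam d*(real (2*n div d) - 2*real (n div d)))"
 proof (intro sum.cong refl)
  fix d assume d: "d:{n+1..2*n}"
  hence "n div d = 0" "2*n div d = 1" by (auto intro!: div_nat_eqI)
  thus "Lam d = Lam d*(real (2*n div d) - 2*real (n div d))" by simp
 qed
 also have "...<=(SUM d=1..2*n. Lam d*(real (2*n div d) - 2*real (n div d)))"
 proof (intro sum_mono2)
  fix d
  have "2*(n div d)<=2*n div d" by (cases "d = 0") (auto simp: less_eq_div_iff_mult_less_eq)
  hence "2*real (n div d)<=real (2*n div d)" by linarith
  thus "0<=Lam d*(real (2*n div d) - 2*real (n div d))" by (simp add: mangoldt_nonneg)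
 qed auto
 also have "... = (SUM d=1..2*n. Lam d*real (2*n div d)) - 2*(SUM d=1..2*n. Lam d*real (n div d))"
  by (simp add: right_diff_distrib sum_subtractf sum_distrib_left mult_ac)
 also have "(SUM d=1..2*n. Lam d*real (n div d)) = (SUM d=1..n. Lam d*real (n div d))"
  by (intro sum.mono_neutral_right) auto
 also have "(SUM d=1..2*n. Lam d*real (2*n div d)) - 2 * ... = ln (fact (2*n)) - 2*ln (fact n)"
  by (simp add: ln_fact_mangoldt)
 also have "... = ln (fact (2*n)/(fact n*fact n))"
  by (subst ln_div) (auto simp: ln_mult)
 also have "fact (2*n)/(fact n*fact n) = real (2*n choose n)"
  by (subst binomial_fact) (auto simp: mult_2)
 also have "ln (real (2*n choose n))<=ln (2^(2*n))"
 proof (subst ln_le_cancel_iff)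
  have "(2*n choose n)<=2^(2*n)" by (rule binomial_le_pow2)
  thus "real (2*n choose n)<=2^(2*n)" by (metis of_nat_le_iff of_nat_numeral of_nat_power)
 qed auto
 also have "... = 2*real n*ln 2" by (simp add: ln_realpow)
 finally show ?thesis .
qed

lemma psi_mono: "m<=n ==> chebyshev_psi m<=chebyshev_psi n"
 unfolding chebyshev_psi_def by (intro sum_mono2) (auto simp: mangoldt_nonneg)

lemma psi_le: "chebyshev_psi n<=4*real n"
proof (induction n rule: less_induct)
 case (less n)
 have l2: "ln 2<=(1::real)" using ln_le_minus_one[of 2] by simp
 show ?case
 proof (cases "n<=1")
  case True
  hence "n = 0 | n = 1" by auto
  thus ?thesis by (auto simp: chebyshev_psi_def)
 next
  case False
  define k where "k = (n + 1) div 2"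
  have k: "k < n" "n<=2*k" "2*k<=n + 1" using False by (auto simp: k_def)
  have "chebyshev_psi n<=chebyshev_psi (2*k)" using psi_mono k by blast
  also have "...<=chebyshev_psi k + 2*real k*ln 2" using psi_double[of k] by simp
  also have "...<=4*real k + 2*real k*1" using less.IH[OF k(1)] l2
   by (intro add_mono mult_left_mono) auto
  also have "...<=4*real n"
  proof -
   have "2*real k<=real n + 1" using k(3) by linarith
   moreover have "real n >= 2" using False by linarith
   ultimately show ?thesis using k by linarith
  qed
  finally show ?thesis .
 qed
qed

lemma ln_fact_bounds:
 assumes "n >= 1"
 shows "ln (fact n)<=real n*ln n" "real n*ln n - real n<=ln (fact n)"
proof -
 have "(fact n :: real)<=real n^n" by (metis fact_le_power of_nat_power)
 hence "ln (fact n :: real)<=ln (real n^n)" using assms by (subst ln_le_cancel_iff) auto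
 thus "ln (fact n)<=real n*ln n" by (simp add: ln_realpow assms)
 show "real n*ln n - real n<=ln (fact n)" using assms
 proof (induction n rule: dec_induct)
  case (step n)
  hence n: "real n >= 1" by simp
  have "ln (real (Suc n)) - ln (real n) = ln (1 + 1/real n)"
  proof -
   have "real (Suc n) = real n*(1 + 1/real n)" using n by (simp add: field_simps)
   hence "ln (real (Suc n)) = ln (real n) + ln (1 + 1/real n)" using n by (simp only:) (subst ln_mult, auto intro: add_pos_nonneg)
   thus ?thesis by simp
  qed
  also have "...<=1/real n" using n by (intro ln_add_one_self_le_self) auto
  finally have "real n*(ln (real (Suc n)) - ln (real n))<=1"
   using n by (simp add: field_simps)
  moreover have "ln (fact (Suc n) :: real) = ln (real (Suc n)) + ln (fact n)"
   using n by (simp add: ln_mult del: of_nat_Suc)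
  moreover have "real (Suc n)*ln (real (Suc n)) = real n*ln (real (Suc n)) + ln (real (Suc n))"
   by (simp add: distrib_right)
  ultimately show ?case using step.IH by (simp add: right_diff_distrib del: fact_Suc)
 qed auto
qed

text \<open>Replacing the floors \<open>n div d\<close> of \<open>ln_fact_mangoldt\<close> by
  \<open>n/d\<close> can only increase the sum, and by at most
  \<open>chebyshev_psi n\<close>.\<close>

lemma mertens:
 assumes "n >= 1"
 shows "\<bar>(SUM d=1..n. Lam d/real d) - ln n\<bar><=4"
proof -
 let ?S = "SUM d=1..n. Lam d/real d"
 have n: "real n > 0" using assms by simp
 have nS: "real n * ?S = (SUM d=1..n. Lam d*(real n/real d))"
  by (simp add: sum_distrib_left mult_ac)
 have div: "real (n div d)<=real n/real d" "real n/real d - real (n div d)<=1" if "d >= 1" for d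
 proof -
  have "real n/real d = real (n div d) + real (n mod d)/real d"
   using that by (simp add: field_simps) (metis add.commute div_mult_mod_eq mult.commute of_nat_add of_nat_mult)
  moreover have "real (n mod d)/real d<=1" "real (n mod d)/real d >= 0" using that by auto
  ultimately show "real (n div d)<=real n/real d" "real n/real d - real (n div d)<=1" by linarith+
 qed
 have "ln (fact n)<=real n * ?S" unfolding nS ln_fact_mangoldt
  by (intro sum_mono mult_left_mono div) (auto simp: mangoldt_nonneg)
 hence "real n*ln n - real n<=real n * ?S" using ln_fact_bounds(2)[OF assms] by linarith
 hence "real n*(ln n - ?S)<=real n*1" by (simp add: right_diff_distrib)
 hence 1: "ln n - ?S<=1" using n by (simp only: mult_le_cancel_left_pos)
 have "real n * ?S - ln (fact n) = (SUM d=1..n. Lam d*(real n/real d - real (n div d)))"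
  unfolding nS ln_fact_mangoldt by (simp add: right_diff_distrib sum_subtractf)
 also have "...<=(SUM d=1..n. Lam d*1)"
  by (intro sum_mono mult_left_mono div) (auto simp: mangoldt_nonneg)
 also have "...<=4*real n" using psi_le[of n] by (simp add: chebyshev_psi_def)
 finally have "real n * ?S - real n*ln n<=4*real n" using ln_fact_bounds(1)[OF assms] by linarith
 hence "real n*(?S - ln n)<=real n*4" by (simp add: right_diff_distrib)
 hence "?S - ln n<=4" using n by (simp only: mult_le_cancel_left_pos)
 with 1 show ?thesis by linarith
qed

text \<open>Summation by parts; the differences of the decreasing \<open>g\<close>
  telescope.\<close>

lemma abel_bound:
 fixes c g :: "nat => real"
 assumes C: "!!m. m >= a ==> \<bar>SUM k=a..m. c k\<bar><=B"
  and g: "!!k. k >= a ==> g (Suc k)<=g k" "!!k. k >= a ==> g k >= 0"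
 shows "\<bar>SUM k=a..b. c k*g k\<bar><=B*g a"
proof (cases "a<=b")
 case False
 have "B >= 0" using C[of a] by linarith
 thus ?thesis using False g(2)[of a] by simp
next
 case True
 define D where "D m = (SUM k=a..m. c k)" for m
 have eq: "(SUM k=a..b. c k*g k) = D b*g b + (SUM k=a..<b. D k*(g k - g (Suc k)))"
  using True
 proof (induction b rule: dec_induct)
  case base
  thus ?case by (simp add: D_def)
 next
  case (step n)
  have "D (Suc n) = D n + c (Suc n)" using step by (simp add: D_def)
  thus ?case using step by (simp add: algebra_simps)
 qed
 have B0: "B >= 0" using C[of a] by linarith
 have "\<bar>SUM k=a..b. c k*g k\<bar><=\<bar>D b*g b\<bar> + (SUM k=a..<b. \<bar>D k*(g k - g (Suc k))\<bar>)"
  unfolding eq by (rule order_trans[OF abs_triangle_ineq]) (intro add_left_mono sum_abs)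
 also have "...<=B*g b + (SUM k=a..<b. B*(g k - g (Suc k)))"
  using True C g B0 by (intro add_mono sum_mono) (auto simp: abs_mult D_def intro!: mult_mono)
 also have "(SUM k=a..<b. B*(g k - g (Suc k))) = B*(g a - g b)"
  using True sum_Suc_diff'[of a b g] by (simp add: sum_distrib_left[symmetric] sum_subtractf)
 finally show ?thesis by (simp add: algebra_simps)
qed

definition inv_sqrt_sum :: "nat => real" where "inv_sqrt_sum m = (SUM b=1..m. 1/sqrt (real b))"

lemma inv_sqrt_step:
 assumes "m >= 1"
 shows "1/sqrt (real (Suc m))<=2*(sqrt (real (Suc m)) - sqrt (real m))"
  "2*(sqrt (real (Suc m)) - sqrt (real m))<=1/sqrt (real m)"
proof -
 define a b where "a = sqrt (real m)" and "b = sqrt (real (Suc m))"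
 have ab: "a > 0" "b > a" "b^2 - a^2 = 1" using assms by (auto simp: a_def b_def)
 have "(b - a)*(b + a) = 1" using ab(3) by (simp add: power2_eq_square algebra_simps)
 hence d: "b - a = 1/(b + a)" using ab by (simp add: eq_divide_eq)
 have "1/b<=2/(b + a)" using ab by (simp add: divide_simps)
 thus "1/sqrt (real (Suc m))<=2*(sqrt (real (Suc m)) - sqrt (real m))"
  using d by (simp add: a_def b_def)
 have "2/(b + a)<=1/a" using ab by (simp add: divide_simps)
 thus "2*(sqrt (real (Suc m)) - sqrt (real m))<=1/sqrt (real m)"
  using d by (simp add: a_def b_def)
qed

lemma inv_sqrt_sum_le: "inv_sqrt_sum m<=2 * sqrt (real m)"
proof (induction m)
 case (Suc m)
 show ?case
 proof (cases "m = 0")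
  case False
  thus ?thesis using Suc inv_sqrt_step(1)[of m] by (simp add: inv_sqrt_sum_def)
 qed (simp add: inv_sqrt_sum_def)
qed (simp add: inv_sqrt_sum_def)

text \<open>The difference decreases, by steps that are dominated by a telescoping sum. Its limit
  \<open>c\<close> is the value of the zeta function at 1/2.\<close>

lemma inv_sqrt_sum_asymp: "EX c. ALL m>=1. \<bar>inv_sqrt_sum m - 2 * sqrt (real m) - c\<bar><=1/sqrt (real m)"
proof -
 define h where "h m = inv_sqrt_sum (Suc m) - 2 * sqrt (real (Suc m))" for m
 have st: "h (Suc m)<=h m" "h m - h (Suc m)<=1/sqrt (real (Suc m)) - 1/sqrt (real (Suc (Suc m)))" for m
  using inv_sqrt_step[of "Suc m"] unfolding h_def inv_sqrt_sum_def by simp_all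
 have dec: "h (m + k)<=h m" for m k by (induction k) (use st in \<open>auto intro: order_trans\<close>)
 have d: "h m - h (m + k)<=1/sqrt (real (Suc m)) - 1/sqrt (real (Suc (m + k)))" for m k
 proof (induction k)
  case (Suc k)
  thus ?case using st(2)[of "m + k"] by simp
 qed simp
 have d': "h m - h (m + k)<=1/sqrt (real (Suc m))" for m k
 proof -
  have "0<=1/sqrt (real (Suc (m + k)))" by simp
  thus ?thesis using d[of m k] by linarith
 qed
 have "decseq h" unfolding decseq_def using dec by (metis le_Suc_ex)
 moreover have "h m >= h 0 - 1" for m using d'[of 0 m] by simp
 ultimately obtain c where c: "h \<longlonglongrightarrow> c" using decseq_convergent by metis
 have "\<bar>h m - c\<bar><=1/sqrt (real (Suc m))" for m
 proof -
  have c': "(%k. h (m + k)) \<longlonglongrightarrow> c" using LIMSEQ_ignore_initial_segment[OF c, of m] by (simp add: add.commute)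
  have "c<=h m" by (rule LIMSEQ_le_const2[OF c']) (use dec in auto)
  moreover have "h m - 1/sqrt (real (Suc m))<=c"
  proof (rule LIMSEQ_le_const[OF c'], intro exI[of _ 0] allI impI)
   fix k show "h m - 1/sqrt (real (Suc m))<=h (m + k)" using d'[of m k] by linarith
  qed
  ultimately show ?thesis by linarith
 qed
 hence "\<bar>inv_sqrt_sum m - 2 * sqrt (real m) - c\<bar><=1/sqrt (real m)" if "m >= 1" for m
  using that unfolding h_def by (metis Suc_diff_1 less_eq_Suc_le One_nat_def)
 thus ?thesis by blast
qed

section \<open>Real characters: non-vanishing at 1 and a Mertens estimate\<close>

locale real_character =
 fixes ch :: "nat => real" and q :: nat
 assumes q_pos: "q > 0" and ch_1: "ch 1 = 1" and ch_mult: "ch (m*n) = ch m*ch n"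
  and ch_period: "ch (n + q) = ch n" and ch_val: "ch n:{-1, 0, 1}" and ch_sum: "(SUM n<q. ch n) = 0"
begin

lemma abs_ch: "\<bar>ch n\<bar><=1" using ch_val[of n] by auto

lemma ch_power: "ch (n^k) = ch n^k"
 using ch_1 by (induction k) (auto simp: ch_mult)

lemma psum_bound: "\<bar>SUM k<n. ch k\<bar><=real q"
proof -
 have per: "(SUM k<n+q. ch k) = (SUM k<n. ch k)" for n
  by (induction n) (auto simp: ch_sum ch_period)
 show ?thesis
 proof (induction n rule: less_induct)
  case (less n)
  show ?case
  proof (cases "n < q")
   case True
   have "\<bar>SUM k<n. ch k\<bar><=(SUM k<n. 1)" by (rule order_trans[OF sum_abs]) (intro sum_mono abs_ch)
   thus ?thesis using True by simp
  next
   case False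
   thus ?thesis using less.IH[of "n - q"] per[of "n - q"] q_pos by simp
  qed
 qed
qed

lemma interval_bound: "\<bar>SUM k=a..b. ch k\<bar><=2*real q"
proof (cases "a<=b")
 case True
 have "{..<Suc b} = {..<a} \<union> {a..b}" using True by auto
 moreover have "sum ch ({..<a} \<union> {a..b}) = sum ch {..<a} + sum ch {a..b}"
  by (rule sum.union_disjoint) auto
 ultimately have "(SUM k<Suc b. ch k) = (SUM k<a. ch k) + (SUM k=a..b. ch k)" by metis
 thus ?thesis using psum_bound[of "Suc b"] psum_bound[of a] by linarith
qed simp

lemma weighted_bound:
 assumes "!!k. k >= a ==> g (Suc k)<=g k" "!!k. k >= a ==> g k >= 0"
 shows "\<bar>SUM k=a..b. ch k*g k\<bar><=2*real q*g a"
 by (rule abel_bound) (use interval_bound assms in auto)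

definition L_part :: "nat => real" where "L_part n = (SUM k=1..n. ch k/real k)"

lemma L_part_diff: "m >= n ==> \<bar>L_part m - L_part n\<bar><=2*real q/real (Suc n)"
proof -
 assume mn: "m >= n"
 have "{1..m} = {1..n} \<union> {Suc n..m}" using mn by auto
 hence "L_part m = L_part n + (SUM k=Suc n..m. ch k/real k)"
  unfolding L_part_def by (simp only:) (rule sum.union_disjoint, auto)
 moreover have "\<bar>SUM k=Suc n..m. ch k*(1/real k)\<bar><=2*real q*(1/real (Suc n))"
  by (rule weighted_bound) (auto simp: divide_simps)
 ultimately show ?thesis by simp
qed

lemma L_part_limit: "EX L. ALL n. \<bar>L - L_part n\<bar><=2*real q/real (Suc n)"
proof -
 have "Cauchy L_part"
 proof (rule metric_CauchyI)
  fix e :: real assume e: "e > 0"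
  obtain N where N: "4*real q/e < real N" using reals_Archimedean2 by blast
  have "dist (L_part m) (L_part n) < e" if "m >= N" "n >= N" for m n
  proof -
   have "\<bar>L_part m - L_part N\<bar><=2*real q/real (Suc N)" "\<bar>L_part n - L_part N\<bar><=2*real q/real (Suc N)"
    using L_part_diff that by auto
   moreover have "2*real q/real (Suc N) < e/2"
    using N e by (simp add: divide_simps mult.commute) (simp add: algebra_simps)
   ultimately show ?thesis unfolding dist_real_def by linarith
  qed
  thus "EX M. ALL m>=M. ALL n>=M. dist (L_part m) (L_part n) < e" by blast
 qed
 then obtain L where L: "L_part \<longlonglongrightarrow> L" using Cauchy_convergent_iff convergent_def by blast
 have "\<bar>L - L_part n\<bar><=2*real q/real (Suc n)" for n
 proof (rule LIMSEQ_le_const2)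
  show "(%m. \<bar>L_part m - L_part n\<bar>) \<longlonglongrightarrow> \<bar>L - L_part n\<bar>"
   by (intro tendsto_rabs tendsto_diff L tendsto_const)
  show "EX N. ALL m>=N. \<bar>L_part m - L_part n\<bar><=2*real q/real (Suc n)"
   using L_part_diff by blast
 qed
 thus ?thesis by blast
qed

definition L1 :: real where "L1 = (SOME L. ALL n. \<bar>L - L_part n\<bar><=2*real q/real (Suc n))"

lemma L1: "\<bar>L1 - L_part n\<bar><=2*real q/real (Suc n)"
 using someI_ex[OF L_part_limit] unfolding L1_def by blast

text \<open>The Dirichlet coefficients of the zeta function times the L-function of
  \<open>ch\<close>.\<close>

definition divsum :: "nat => real" where "divsum n = (SUM d | d dvd n. ch d)"

lemma divsum_prime_power_mult:
 assumes p: "prime p" and m: "~ p dvd m" "m > 0"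
 shows "divsum (p^e*m) = (SUM i<=e. ch p^i)*divsum m"
proof -
 have p0: "p > 1" using p prime_gt_1_nat by blast
 have bij: "bij_betw (%(i,d). p^i*d) ({..e} \<times> {d. d dvd m}) {d. d dvd p^e*m}"
   unfolding bij_betw_def
  proof (intro conjI inj_onI equalityI subsetI)
   fix a b assume a: "a:{..e} \<times> {d. d dvd m}" and b: "b:{..e} \<times> {d. d dvd m}"
    and e: "(case a of (i,d) => p^i*d) = (case b of (i,d) => p^i*d)"
   obtain i d j d' where ab: "a = (i,d)" "b = (j,d')" "d dvd m" "d' dvd m" using a b by auto
   have nd: "~ p dvd d" "~ p dvd d'" using ab m dvd_trans by blast+
   have d0: "d~=0" "d'~=0" using ab m by (auto intro!: Nat.gr0I)
   have "multiplicity p (p^i*d) = i" "multiplicity p (p^j*d') = j"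
    using p nd d0 p0 by (simp_all add: prime_elem_multiplicity_mult_distrib multiplicity_same_power not_dvd_imp_multiplicity_0)
   hence "i = j" using e ab by simp
   thus "a = b" using e ab p0 by simp
  next
   fix x assume "x:{d. d dvd p^e*m}"
   then obtain u v where "x = u * v" "u dvd p^e" "v dvd m" using division_decomp by blast
   thus "x:(%(i,d). p^i*d)`({..e} \<times> {d. d dvd m})"
    using divides_primepow_nat[OF p] by force
  next
   fix x assume "x:(%(i,d). p^i*d)`({..e} \<times> {d. d dvd m})"
   then obtain i d where "i<=e" "d dvd m" "x = p^i*d" by auto
   thus "x:{d. d dvd p^e*m}" by (simp add: le_imp_power_dvd mult_dvd_mono)
  qed
 have "divsum (p^e*m) = (SUM x:{..e} \<times> {d. d dvd m}. ch (case x of (i, d) => p^i*d))"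
  unfolding divsum_def by (rule sum.reindex_bij_betw[OF bij, symmetric])
 also have "... = (SUM (i,d):{..e} \<times> {d. d dvd m}. ch (p^i*d))"
  by (rule sum.cong) auto
 also have "... = (SUM i<=e. SUM d | d dvd m. ch p^i*ch d)"
  by (subst sum.cartesian_product) (simp add: ch_mult ch_power)
 also have "... = (SUM i<=e. ch p^i)*divsum m"
  unfolding divsum_def by (rule sum_product[symmetric])
 finally show ?thesis .
qed

lemma geom_bounds: "(SUM i<=e. ch p^i) >= 0" "even e ==> (SUM i<=e. ch p^i) >= 1"
proof -
 have "(SUM i<=e. ch p^i) >= 0 & (even e --> (SUM i<=e. ch p^i) >= 1)"
 proof -
  consider "ch p = -1" | "ch p = 0" | "ch p = 1" using ch_val[of p] by auto
  thus ?thesis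
  proof cases
   case 1
   have "(SUM i<=e. (-1::real)^i) = (if even e then 1 else 0)" by (induction e) auto
   thus ?thesis using 1 by simp
  next
   case 2
   have "(SUM i<=e. (0::real)^i) = 1" by (induction e) auto
   thus ?thesis using 2 by simp
  qed simp
 qed
 thus "(SUM i<=e. ch p^i) >= 0" "even e ==> (SUM i<=e. ch p^i) >= 1" by auto
qed

text \<open>Multiplicativity reduces this to prime powers, where the sum of the powers of
  \<open>ch p\<close> is nonnegative, and at least 1 for an even exponent.\<close>

lemma divsum_nonneg_square: "n > 0 ==> divsum n >= 0 & (ALL k. n = k^2 --> divsum n >= 1)"
proof (induction n rule: less_induct)
 case (less n)
 show ?case
 proof (cases "n = 1")
  case True
  have "divsum 1 = 1" using ch_1 by (simp add: divsum_def)
  thus ?thesis using True by (metis order_refl zero_le_one)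
 next
  case False
  then obtain p where p: "prime p" "p dvd n" using prime_factor_nat by blast
  define e where "e = multiplicity p n"
  obtain m where m: "n = p^e*m" "~ p dvd m"
   using multiplicity_decompose'[of n p] less.prems p unfolding e_def by (metis not_prime_unit neq0_conv)
  have m0: "m > 0" using m less.prems by (auto intro!: Nat.gr0I)
  have e0: "e > 0" unfolding e_def using p less.prems by (simp add: prime_multiplicity_gt_zero_iff)
  have p1: "p > 1" using p prime_gt_1_nat by blast
  have "p^e > 1" using p1 e0 by (rule one_less_power)
  hence "m < n" using m m0 by simp
  note IH = less.IH[OF this m0]
  have ds: "divsum n = (SUM i<=e. ch p^i)*divsum m"
   using divsum_prime_power_mult[OF p(1) m(2) m0] m(1) by simp
  have "divsum n >= 0" unfolding ds using geom_bounds(1) IH by simp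
  moreover have "divsum n >= 1" if k: "n = k^2" for k
  proof -
   have k0: "k > 0" using k less.prems by (auto intro!: Nat.gr0I)
   have ek: "e = 2*multiplicity p k" unfolding e_def k using p k0
    by (simp add: prime_elem_multiplicity_power_distrib)
   have "p^multiplicity p k dvd k" by (rule multiplicity_dvd)
   then obtain l where l: "k = p^multiplicity p k*l" by auto
   have "p^e*m = p^e*l^2" using m(1) k l ek
    by (metis power_even_eq power_mult_distrib)
   hence "m = l^2" using p1 by simp
   hence "divsum m >= 1" using IH by blast
   moreover have "(SUM i<=e. ch p^i) >= 1" using geom_bounds(2) ek by simp
   ultimately have "1*1<=(SUM i<=e. ch p^i)*divsum m" by (intro mult_mono) auto
   thus ?thesis unfolding ds by simp
  qed
  ultimately show ?thesis by blast
 qed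
qed

text \<open>Dirichlet's hyperbola method: pairs with first factor at most \<open>u\<close>, and
  pairs with first factor beyond \<open>u\<close>, whose second factor is then at most
  \<open>u\<close>.\<close>

lemma sqrt_sum_split:
 "(SUM m=1..u^2. divsum m/sqrt (real m)) =
   (SUM a=1..u. ch a/sqrt (real a)*inv_sqrt_sum (u^2 div a)) +
   (SUM b=1..u. 1/sqrt (real b)*(SUM a=Suc u..u^2 div b. ch a/sqrt (real a)))"
proof -
 let ?f = "%d j. ch d/sqrt (real d)*(1/sqrt (real j))"
 have "(SUM m=1..u^2. divsum m/sqrt (real m)) = (SUM m=1..u^2. SUM d | d dvd m. ?f d (m div d))"
  unfolding divsum_def sum_divide_distrib
 proof (intro sum.cong refl)
  fix m d assume "m:{1..u^2}" "d:{d. d dvd m}"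
  hence "real m = real d*real (m div d)" by (metis mem_Collect_eq dvd_mult_div_cancel of_nat_mult)
  thus "ch d/sqrt (real m) = ?f d (m div d)" by (simp add: real_sqrt_mult)
 qed
 also have "... = (SUM d=1..u^2. SUM j=1..u^2 div d. ?f d j)" by (rule sum_divisors_swap)
 also have "... = (SUM d=1..u. SUM j=1..u^2 div d. ?f d j) + (SUM d=Suc u..u^2. SUM j=1..u^2 div d. ?f d j)"
 proof -
  have "u<=u^2" by (simp add: power2_eq_square)
  hence "{1..u^2} = {1..u} \<union> {Suc u..u^2}" by auto
  thus ?thesis by (simp only:) (rule sum.union_disjoint, auto)
 qed
 also have "(SUM d=1..u. SUM j=1..u^2 div d. ?f d j) = (SUM a=1..u. ch a/sqrt (real a)*inv_sqrt_sum (u^2 div a))"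
  by (simp add: inv_sqrt_sum_def sum_distrib_left)
 also have "(SUM d=Suc u..u^2. SUM j=1..u^2 div d. ?f d j) = (SUM b=1..u. SUM a=Suc u..u^2 div b. ?f a b)"
 proof -
  have "(SUM d=Suc u..u^2. SUM j=1..u^2 div d. ?f d j) = (SUM (d,j):Sigma {Suc u..u^2} (%d. {1..u^2 div d}). ?f d j)"
   by (subst sum.Sigma) auto
  also have "... = (SUM (j,d):Sigma {1..u} (%j. {Suc u..u^2 div j}). ?f d j)"
  proof (rule sum.reindex_bij_witness[of _ "%(j,d). (d,j)" "%(d,j). (j,d)"])
   fix a assume "a:Sigma {Suc u..u^2} (%d. {1..u^2 div d})"
   then obtain d j where a: "a = (d,j)" "Suc u<=d" "d<=u^2" "1<=j" "j<=u^2 div d" by auto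
   hence dj: "j*d<=u^2" by (simp add: less_eq_div_iff_mult_less_eq)
   have "j<=u"
   proof (rule ccontr)
    assume "~ j<=u"
    hence "u*u < j*d" using a(2) by (intro mult_strict_mono) auto
    thus False using dj by (simp add: power2_eq_square)
   qed
   thus "(case a of (d,j) => (j,d)):Sigma {1..u} (%j. {Suc u..u^2 div j})"
    using a dj by (auto simp: less_eq_div_iff_mult_less_eq mult.commute)
  next
   fix b assume "b:Sigma {1..u} (%j. {Suc u..u^2 div j})"
   then obtain j d where b: "b = (j,d)" "1<=j" "j<=u" "Suc u<=d" "d<=u^2 div j" by auto
   hence dj: "d*j<=u^2" by (simp add: less_eq_div_iff_mult_less_eq)
   have "d<=u^2" using b(5) div_le_dividend order_trans by blast
   thus "(case b of (j,d) => (d,j)):Sigma {Suc u..u^2} (%d. {1..u^2 div d})"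
    using b dj by (auto simp: less_eq_div_iff_mult_less_eq mult.commute)
  qed auto
  also have "... = (SUM b=1..u. SUM a=Suc u..u^2 div b. ?f a b)" by (subst sum.Sigma) auto
  finally show ?thesis .
 qed
 finally show ?thesis by (simp add: sum_distrib_left mult.commute)
qed

text \<open>The squares alone make the sum of \<open>divsum m/sqrt m\<close> diverge. In the
  hyperbola method its main term is \<open>2*u*L_part u\<close>, which would be bounded if
  \<open>L1\<close> were 0, and the remaining terms are bounded by partial summation.\<close>

lemma L1_nonzero: "L1~=0"
proof
 assume L0: "L1 = 0"
 obtain c where c: "!!m. m >= 1 ==> \<bar>inv_sqrt_sum m - 2 * sqrt (real m) - c\<bar><=1/sqrt (real m)"
  using inv_sqrt_sum_asymp by blast
 have sqb: "\<bar>SUM a=b..b'. ch a/sqrt (real a)\<bar><=2*real q/sqrt (real b)" if "b >= 1" for b b'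
 proof -
  have "\<bar>SUM a=b..b'. ch a*(1/sqrt (real a))\<bar><=2*real q*(1/sqrt (real b))"
   by (rule weighted_bound) (use that in \<open>auto simp: frac_le\<close>)
  thus ?thesis by simp
 qed
 have bd: "(SUM m=1..u^2. divsum m/sqrt (real m))<=8*real q + 2*real q * \<bar>c\<bar> + 6" if u: "u >= 1" for u
 proof -
  have ur: "real u > 0" using u by simp
  \<comment> \<open>\<open>sqrt (u^2 div a)\<close> is replaced by \<open>u/sqrt a\<close>; as
    \<open>a\<close> is at most \<open>u\<close>, the floor is at least \<open>u\<close> and
    rounding costs little.\<close>
  have ap: "\<bar>inv_sqrt_sum (u^2 div a) - (2*real u/sqrt (real a) + c)\<bar><=6 * sqrt (real a)/real u*(1/2)"
   if a: "a:{1..u}" for a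
  proof -
   define M where "M = u^2 div a"
   define x where "x = (real u)^2/real a"
   have a0: "real a > 0" using a by simp
   have "u*a<=u^2" using a by (simp add: power2_eq_square)
   hence "u<=M" using a by (simp add: M_def less_eq_div_iff_mult_less_eq)
   hence M1: "M >= 1" using u by simp
   have x: "x = real M + real (u^2 mod a)/real a"
    unfolding x_def M_def using a0
    by (simp add: field_simps) (metis (no_types, opaque_lifting) add.commute div_mult_mod_eq mult.commute of_nat_add of_nat_mult of_nat_power)
   have r: "real (u^2 mod a)/real a >= 0" "real (u^2 mod a)/real a<=1" using a by auto
   have xM: "real M<=x" "x<=real M + 1" using x r by linarith+
   have sx: "sqrt x = real u/sqrt (real a)" unfolding x_def using ur by (simp add: real_sqrt_divide)
   have "2*(sqrt x - sqrt (real M))<=2*(sqrt (real (Suc M)) - sqrt (real M))" using xM by simp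
   also have "...<=1/sqrt (real M)" by (rule inv_sqrt_step(2)[OF M1])
   finally have e1: "2 * sqrt x - 2 * sqrt (real M)<=1/sqrt (real M)" by simp
   have e2: "2 * sqrt (real M)<=2 * sqrt x" using xM by simp
   have e4: "2/sqrt (real M) = 1/sqrt (real M) + 1/sqrt (real M)" by simp
   have e3: "\<bar>inv_sqrt_sum M - (2 * sqrt x + c)\<bar><=2/sqrt (real M)"
    unfolding abs_le_iff e4 using c[OF M1, unfolded abs_le_iff] e1 e2 by (intro conjI; linarith)
   have "x<=2*real M" using xM M1 by linarith
   hence "sqrt x<=sqrt 2 * sqrt (real M)" by (metis real_sqrt_le_iff real_sqrt_mult)
   also have "...<=(3/2) * sqrt (real M)"
   proof (rule mult_right_mono)
    show "sqrt 2<=3/2" by (rule real_le_lsqrt) (auto simp: power2_eq_square)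
   qed simp
   finally have le: "sqrt x<=3/2 * sqrt (real M)" .
   have sp: "sqrt (real M) > 0" "sqrt x > 0" using M1 xM by auto
   have "sqrt x/sqrt (real M)<=3/2" using le sp by (simp add: pos_divide_le_eq)
   hence "(sqrt x/sqrt (real M))/sqrt x<=(3/2)/sqrt x" using sp by (intro divide_right_mono) auto
   hence "1/sqrt (real M)<=(3/2)/sqrt x" using sp by simp
   hence "2/sqrt (real M)<=3/sqrt x" by simp
   also have "3/sqrt x = 6 * sqrt (real a)/real u*(1/2)" unfolding sx by simp
   finally show ?thesis using e3 unfolding M_def[symmetric] sx by simp
  qed
  define E where "E a = inv_sqrt_sum (u^2 div a) - (2*real u/sqrt (real a) + c)" for a
  have "(SUM a=1..u. ch a/sqrt (real a)*inv_sqrt_sum (u^2 div a)) =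
   (SUM a=1..u. ch a/sqrt (real a)*(2*real u/sqrt (real a))) + (SUM a=1..u. ch a/sqrt (real a)*c)
    + (SUM a=1..u. ch a/sqrt (real a)*E a)"
   by (simp add: sum.distrib[symmetric] E_def algebra_simps)
  also have "(SUM a=1..u. ch a/sqrt (real a)*(2*real u/sqrt (real a))) = 2*real u*L_part u"
   unfolding L_part_def sum_distrib_left by (intro sum.cong refl) (simp add: field_simps)
  also have "(SUM a=1..u. ch a/sqrt (real a)*c) = (SUM a=1..u. ch a/sqrt (real a))*c"
   by (simp add: sum_distrib_right)
  also have "2*real u*L_part u + (SUM a=1..u. ch a/sqrt (real a))*c + (SUM a=1..u. ch a/sqrt (real a)*E a)
   <=4*real q + 2*real q * \<bar>c\<bar> + 3"
  proof (intro add_mono)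
   have "\<bar>L_part u\<bar><=2*real q/real (Suc u)" using L1[of u] L0 by simp
   hence "real u * \<bar>L_part u\<bar><=real u*(2*real q/real (Suc u))" by (intro mult_left_mono) auto
   also have "...<=2*real q" by (simp add: divide_simps) (simp add: algebra_simps)
   finally have "real u * \<bar>L_part u\<bar><=2*real q" .
   moreover have "real u*L_part u<=real u * \<bar>L_part u\<bar>" by (intro mult_left_mono) auto
   ultimately show "2*real u*L_part u<=4*real q" by linarith
   have "\<bar>(SUM a=1..u. ch a/sqrt (real a))*c\<bar><=2*real q * \<bar>c\<bar>"
    unfolding abs_mult using sqb[of 1 u] by (intro mult_right_mono) auto
   thus "(SUM a=1..u. ch a/sqrt (real a))*c<=2*real q * \<bar>c\<bar>" by linarith
   have "(SUM a=1..u. ch a/sqrt (real a)*E a)<=(SUM a=1..u. 3/real u)"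
   proof (intro sum_mono)
    fix a assume a: "a:{1..u}"
    have "ch a/sqrt (real a)*E a<=\<bar>ch a\<bar> / sqrt (real a) * \<bar>E a\<bar>"
     by (rule order_trans[OF abs_ge_self]) (simp add: abs_mult)
    also have "...<=1/sqrt (real a)*(6 * sqrt (real a)/real u*(1/2))"
     using ap[OF a] abs_ch[of a] unfolding E_def by (intro mult_mono divide_right_mono) auto
    also have "... = 3/real u" using a by simp
    finally show "ch a/sqrt (real a)*E a<=3/real u" .
   qed
   also have "... = 3" using ur by simp
   finally show "(SUM a=1..u. ch a/sqrt (real a)*E a)<=3" .
  qed
  finally have p1: "(SUM a=1..u. ch a/sqrt (real a)*inv_sqrt_sum (u^2 div a))<=4*real q + 2*real q * \<bar>c\<bar> + 3" .
  have "(SUM b=1..u. 1/sqrt (real b)*(SUM a=Suc u..u^2 div b. ch a/sqrt (real a)))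
   <=(SUM b=1..u. 1/sqrt (real b)*(2*real q/sqrt (real (Suc u))))"
   using sqb[of "Suc u"] by (intro sum_mono mult_left_mono) (auto simp: abs_le_iff)
  also have "... = inv_sqrt_sum u*(2*real q/sqrt (real (Suc u)))"
   unfolding inv_sqrt_sum_def sum_distrib_right by (rule refl)
  also have "...<=2 * sqrt (real (Suc u))*(2*real q/sqrt (real (Suc u)))"
  proof (intro mult_right_mono)
   have "2 * sqrt (real u)<=2 * sqrt (real (Suc u))" by simp
   thus "inv_sqrt_sum u<=2 * sqrt (real (Suc u))" using inv_sqrt_sum_le[of u] by linarith
  qed simp
  also have "... = 4*real q" by (simp add: field_simps)
  finally have p2: "(SUM b=1..u. 1/sqrt (real b)*(SUM a=Suc u..u^2 div b. ch a/sqrt (real a)))<=4*real q" .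
  show ?thesis unfolding sqrt_sum_split using p1 p2 by linarith
 qed
 \<comment> \<open>Only the squares are kept, and \<open>1/sqrt (k^2)\<close> is
   \<open>1/k\<close>.\<close>
 have low: "(SUM m=1..u^2. divsum m/sqrt (real m)) >= harm u" for u
 proof -
  have "harm u = (SUM m:(%k. k^2)`{1..u}. 1/sqrt (real m))"
   unfolding harm_def by (subst sum.reindex) (auto simp: inj_on_def inverse_eq_divide)
  also have "...<=(SUM m:(%k. k^2)`{1..u}. divsum m/sqrt (real m))"
  proof (intro sum_mono divide_right_mono)
   fix m assume "m:(%k. k^2)`{1..u}"
   then obtain k where "m = k^2" "k >= 1" by auto
   thus "1<=divsum m" using divsum_nonneg_square[of m] by simp
  qed simp
  also have "...<=(SUM m=1..u^2. divsum m/sqrt (real m))"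
   using divsum_nonneg_square by (intro sum_mono2) auto
  finally show ?thesis .
 qed
 obtain u where u: "exp (8*real q + 2*real q * \<bar>c\<bar> + 6) < real u" using reals_Archimedean2 by blast
 have "real u > 0" using u by (meson exp_gt_zero less_trans)
 hence "8*real q + 2*real q * \<bar>c\<bar> + 6 < ln (real u)" using u by (metis exp_less_cancel_iff exp_ln)
 also have "...<=ln (real u + 1)" using \<open>real u > 0\<close> by simp
 also have "...<=harm u" using ln_le_harm[of u] by simp
 finally show False using bd[of u] low[of u] \<open>real u > 0\<close> by force
qed

text \<open>The sum of \<open>ch m*ln m/m\<close> is evaluated twice. It is bounded by partial
  summation; with \<open>ln\<close> written as a divisor sum of \<open>Lam\<close> it becomes
  \<open>L1\<close> times the wanted sum, up to an error controlled by \<open>psi_le\<close>.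
  Division by \<open>L1\<close> is possible by \<open>L1_nonzero\<close>.\<close>

theorem mertens_character: "EX C. ALL n. \<bar>SUM d=1..n. ch d*Lam d/real d\<bar><=C"
proof -
 define C where "C = (10*real q + 1) / \<bar>L1\<bar>"
 have "\<bar>SUM d=1..n. ch d*Lam d/real d\<bar><=C" for n
 proof (cases "n = 0")
  case True
  thus ?thesis by (simp add: C_def)
 next
  case False
  define S where "S = (SUM d=1..n. ch d*Lam d/real d)"
  define T where "T = (SUM m=1..n. ch m*(ln (real m)/real m))"
  have "T = (SUM m=1..n. SUM d | d dvd m. ch d*Lam d/real d*(ch (m div d)/real (m div d)))"
   unfolding T_def
  proof (intro sum.cong refl)
   fix m assume m: "m:{1..n}"
   have "ch m*(ln (real m)/real m) = (SUM d | d dvd m. Lam d*(ch m/real m))"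
   proof -
    have "(SUM d | d dvd m. Lam d) = ln (real m)" using m mangoldt_sum[of m, where ?'a = real] by simp
    hence "ch m*(ln (real m)/real m) = (SUM d | d dvd m. Lam d)*(ch m/real m)" by simp
    thus ?thesis by (simp only: sum_distrib_right)
   qed
   also have "... = (SUM d | d dvd m. ch d*Lam d/real d*(ch (m div d)/real (m div d)))"
   proof (intro sum.cong refl)
    fix d assume "d:{d. d dvd m}"
    hence md: "m = d*(m div d)" by simp
    hence "ch m = ch d*ch (m div d)" "real m = real d*real (m div d)"
     by (metis ch_mult, metis of_nat_mult)
    thus "Lam d*(ch m/real m) = ch d*Lam d/real d*(ch (m div d)/real (m div d))" by simp
   qed
   finally show "ch m*(ln (real m)/real m) = ..." .
  qed
  also have "... = (SUM d=1..n. SUM j=1..n div d. ch d*Lam d/real d*(ch j/real j))" by (rule sum_divisors_swap)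
  also have "... = (SUM d=1..n. ch d*Lam d/real d*L_part (n div d))" by (simp add: L_part_def sum_distrib_left)
  also have "... = L1*S - (SUM d=1..n. ch d*Lam d/real d*(L1 - L_part (n div d)))"
   by (simp add: S_def sum_distrib_left sum_subtractf[symmetric] algebra_simps)
  finally have LS: "L1*S = T + (SUM d=1..n. ch d*Lam d/real d*(L1 - L_part (n div d)))" by simp
  have err: "\<bar>SUM d=1..n. ch d*Lam d/real d*(L1 - L_part (n div d))\<bar><=8*real q"
  proof -
   have "\<bar>SUM d=1..n. ch d*Lam d/real d*(L1 - L_part (n div d))\<bar><=(SUM d=1..n. \<bar>ch d*Lam d/real d*(L1 - L_part (n div d))\<bar>)"
    by (rule sum_abs)
   also have "...<=(SUM d=1..n. Lam d*(2*real q/real n))"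
   proof (intro sum_mono)
    fix d assume d: "d:{1..n}"
    have "n < d*Suc (n div d)" using d dividend_less_times_div[of d n] by simp
    hence "real n < real d*real (Suc (n div d))" by (metis of_nat_less_iff of_nat_mult)
    hence k: "2*real q/real (Suc (n div d))<=2*real q*real d/real n"
     using False q_pos by (simp add: divide_simps)
    have "\<bar>ch d*Lam d/real d*(L1 - L_part (n div d))\<bar> = \<bar>ch d\<bar> * (Lam d/real d * \<bar>L1 - L_part (n div d)\<bar>)"
     by (simp add: abs_mult mangoldt_nonneg)
    also have "...<=1*(Lam d/real d*(2*real q*real d/real n))"
     using L1[of "n div d"] k abs_ch[of d]
     by (intro mult_mono mult_left_mono) (auto simp: mangoldt_nonneg)
    also have "... = Lam d*(2*real q/real n)" using d by simp
    finally show "\<bar>ch d*Lam d/real d*(L1 - L_part (n div d))\<bar><=Lam d*(2*real q/real n)" .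
   qed
   also have "... = chebyshev_psi n*(2*real q/real n)"
    unfolding chebyshev_psi_def by (rule sum_distrib_right[symmetric])
   also have "...<=4*real n*(2*real q/real n)" by (intro mult_right_mono psi_le) simp
   also have "... = 8*real q" using False by simp
   finally show ?thesis .
  qed
  have "\<bar>T\<bar><=2*real q + 1"
  proof -
   \<comment> \<open>The function decreases only beyond \<open>exp 1\<close>, so the terms at 1 and
     2 are treated apart.\<close>
   let ?g = "%m. ln (real m)/real m"
   have g3: "\<bar>SUM m=3..n. ch m * ?g m\<bar><=2*real q * ?g 3"
   proof (rule weighted_bound)
    fix k :: nat assume k: "k >= 3"
    have "exp 1<=real k" using k exp_le by linarith
    thus "?g (Suc k)<=?g k" using ln_x_over_x_mono[of "real k" "real (Suc k)"] by simp
    show "?g k >= 0" using k by simp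
   qed
   have "ln (3::real)<=3 - 1" by (rule ln_le_minus_one) simp
   hence "2*real q * ?g 3<=2*real q*1" by (intro mult_left_mono) auto
   with g3 have g4: "\<bar>SUM m=3..n. ch m * ?g m\<bar><=2*real q" by linarith
   have g2: "\<bar>ch 2 * ?g 2\<bar><=1"
   proof -
    have "ln (2::real)<=2 - 1" by (rule ln_le_minus_one) simp
    hence "\<bar>?g 2\<bar><=1" by simp
    thus ?thesis using abs_ch[of 2] mult_mono[of "\<bar>ch 2\<bar>" 1 "\<bar>?g 2\<bar>" 1] by (simp only: abs_mult) simp
   qed
   consider "n = 1" | "n >= 2" using False by linarith
   thus ?thesis
   proof cases
    case 1
    thus ?thesis by (simp add: T_def)
   next
    case 2
    hence "{1..n} = {1} \<union> ({2} \<union> {3..n})" by auto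
    hence "T = ch 2 * ?g 2 + (SUM m=3..n. ch m * ?g m)" unfolding T_def by (simp only:) simp
    thus ?thesis using g2 g4 by linarith
   qed
  qed
  hence "\<bar>L1*S\<bar><=10*real q + 1" unfolding LS using err by linarith
  hence "\<bar>S\<bar><=C" unfolding C_def using L1_nonzero by (simp add: abs_mult pos_le_divide_eq mult.commute)
  thus ?thesis by (simp add: S_def)
 qed
 thus ?thesis by blast
qed

end

section \<open>Legendre symbols as characters\<close>

lemma Legendre_cong: "[a = b] (mod p) ==> Legendre a p = Legendre b p"
proof -
 assume ab: "[a = b] (mod p)"
 have "[a = 0] (mod p) \<longleftrightarrow> [b = 0] (mod p)" using cong_trans[OF ab] cong_trans[OF cong_sym[OF ab]] by blast
 moreover have "[z^2 = a] (mod p) \<longleftrightarrow> [z^2 = b] (mod p)" for z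
  using cong_trans[OF _ ab] cong_trans[OF _ cong_sym[OF ab]] by blast
 ultimately show ?thesis unfolding Legendre_def QuadRes_def by simp
qed

text \<open>Euler's criterion gives the congruence modulo \<open>p\<close>; the two sides differ by
  at most 2, which is less than \<open>p\<close>.\<close>

lemma Legendre_mult:
 assumes p: "prime p" "2 < p"
 shows "Legendre (a*b) (int p) = Legendre a (int p)*Legendre b (int p)"
proof -
 note e = euler_criterion[OF p]
 have "[Legendre a (int p)*Legendre b (int p) = a^((p - 1) div 2)*b^((p - 1) div 2)] (mod int p)"
  by (rule cong_mult[OF e[of a] e[of b]])
 hence "[Legendre a (int p)*Legendre b (int p) = (a*b)^((p - 1) div 2)] (mod int p)" by (simp only: power_mult_distrib)
 hence "[Legendre a (int p)*Legendre b (int p) = Legendre (a*b) (int p)] (mod int p)"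
  using cong_trans[OF _ cong_sym[OF e[of "a*b"]]] by blast
 hence d: "int p dvd Legendre a (int p)*Legendre b (int p) - Legendre (a*b) (int p)" by (simp only: cong_iff_dvd_diff)
 have v: "Legendre x (int p):{-1, 0, 1}" for x by (simp add: Legendre_def)
 have "\<bar>Legendre a (int p)*Legendre b (int p) - Legendre (a*b) (int p)\<bar><=2"
  using v[of a] v[of b] v[of "a*b"] by auto
 thus ?thesis using d p(2) dvd_imp_le_int[of "Legendre a (int p)*Legendre b (int p) - Legendre (a*b) (int p)" "int p"] by linarith
qed

lemma Legendre_unit: "~ int p dvd a ==> Legendre a (int p):{-1, 1}"
 by (simp add: Legendre_def cong_0_iff)

lemma minus_1_power_sign: "((-1)::int)^k = (if even k then 1 else -1)" by simp

lemma Legendre_minus_1: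
 assumes p: "prime p" "2 < p"
 shows "Legendre (-1) (int p) = (if p mod 4 = 1 then 1 else -1)"
proof -
 have odd: "odd p" using p prime_odd_nat by auto
 have "int p dvd Legendre (-1) (int p) - (-1)^((p - 1) div 2)"
  using euler_criterion[OF p, of "-1"] by (simp only: cong_iff_dvd_diff)
 moreover have "\<bar>Legendre (-1) (int p) - (-1)^((p - 1) div 2)\<bar><=2" by (auto simp: Legendre_def minus_1_power_sign)
 ultimately have "Legendre (-1) (int p) = (-1)^((p - 1) div 2)"
  using p(2) dvd_imp_le_int[of "Legendre (-1) (int p) - (-1)^((p - 1) div 2)" "int p"] by linarith
 moreover have "even ((p - 1) div 2) \<longleftrightarrow> p mod 4 = 1" using odd by presburger
 ultimately show ?thesis by (simp add: minus_1_power_sign)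
qed

text \<open>Gauss's lemma: \<open>G.E\<close> consists of the doubles of the \<open>x\<close> with
  \<open>h div 2 < x\<close> and \<open>x <= h\<close>, and the parity of their number depends on
  \<open>p mod 8\<close>.\<close>

lemma Legendre_2:
 assumes p: "prime p" "2 < p"
 shows "Legendre 2 (int p) = (if p mod 8:{1, 7} then 1 else -1)"
proof -
 have odd: "odd p" using p prime_odd_nat by auto
 interpret G: GAUSS p 2
  by unfold_locales (use p zdvd_imp_le[of "int p" 2] in \<open>auto simp: cong_0_iff\<close>)
 define h where "h = (int p - 1) div 2"
 have h: "int p = 2*h + 1" using odd by (simp add: h_def)
 have C: "G.C = (%x. x*2)`{0<..h}"
  unfolding G.C_def G.B_def G.A_def h_def[symmetric] image_image by (rule image_cong) (use h in auto)
 have "G.E = (%x. x*2)`{h div 2<..h}"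
  unfolding G.E_def C h_def[symmetric] using h p(2) by (auto simp: image_iff)
 hence "card G.E = card {h div 2<..h}" by (simp add: card_image inj_on_def)
 hence "card G.E = nat (h - h div 2)" by simp
 moreover have "even (nat (h - h div 2)) \<longleftrightarrow> p mod 8:{1, 7}"
 proof -
  have "h >= 0" using h p(2) by simp
  hence "even (nat (h - h div 2)) \<longleftrightarrow> even (h - h div 2)" by (simp add: even_nat_iff)
  also have "... \<longleftrightarrow> (2*h + 1) mod 8 = 1 | (2*h + 1) mod 8 = 7" by presburger
  also have "... \<longleftrightarrow> int (p mod 8) = 1 | int (p mod 8) = 7" unfolding h[symmetric] by (simp add: zmod_int)
  also have "... \<longleftrightarrow> p mod 8:{1, 7}" by auto
  finally show ?thesis .
 qed
 ultimately show ?thesis using G.gauss_lemma by (simp add: minus_1_power_sign)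
qed

text \<open>A real character modulo \<open>q\<close>, constrained only on arguments prime to
  \<open>q\<close>.\<close>

definition is_char :: "nat => (nat => int) => bool" where
 "is_char q f \<longleftrightarrow> (ALL m n. coprime m q --> coprime n q --> f (m*n) = f m*f n) &
   (ALL n. coprime n q --> f n:{-1, 1}) & (ALL m n. coprime m q --> [m = n] (mod q) --> f m = f n)"

lemma is_char_mono: "is_char q f ==> q dvd q' ==> is_char q' f"
proof -
 assume f: "is_char q f" and d: "q dvd q'"
 have c: "coprime n q' ==> coprime n q" for n using d coprime_divisors[OF dvd_refl d] by blast
 have "[m = n] (mod q') ==> [m = n] (mod q)" for m n using d cong_dvd_modulus_nat by blast
 note c' = this
 show ?thesis unfolding is_char_def
 proof (intro conjI allI impI)
  show "f (m*n) = f m*f n" if "coprime m q'" "coprime n q'" for m n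
   using f c[OF that(1)] c[OF that(2)] unfolding is_char_def by blast
  show "f n:{-1, 1}" if "coprime n q'" for n using f c[OF that] unfolding is_char_def by blast
  show "f m = f n" if "coprime m q'" "[m = n] (mod q')" for m n
   using f c[OF that(1)] c'[OF that(2)] unfolding is_char_def by blast
 qed
qed

lemma is_char_mult: "is_char q f ==> is_char q g ==> is_char q (%n. f n*g n)"
proof -
 assume f: "is_char q f" and g: "is_char q g"
 have "f (m*n)*g (m*n) = (f m*g m)*(f n*g n)" if "coprime m q" "coprime n q" for m n
  using f g that unfolding is_char_def by (simp add: mult_ac)
 moreover have "f n*g n:{-1, 1}" if "coprime n q" for n
 proof -
  have "f n:{-1, 1}" "g n:{-1, 1}" using f g that unfolding is_char_def by blast+
  thus ?thesis by auto
 qed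
 moreover have "f m*g m = f n*g n" if "coprime m q" "[m = n] (mod q)" for m n
 proof -
  have "f m = f n" "g m = g n" using f g that unfolding is_char_def by blast+
  thus ?thesis by simp
 qed
 ultimately show ?thesis unfolding is_char_def by blast
qed

lemma is_char_1: "is_char q f ==> f 1 = 1"
proof -
 assume f: "is_char q f"
 have "f (1*1) = f 1*f 1" using f unfolding is_char_def by (metis coprime_1_left)
 moreover have "f 1:{-1, 1}" using f unfolding is_char_def by (metis coprime_1_left)
 ultimately show ?thesis by auto
qed

text \<open>On odd arguments \<open>chi4\<close> and \<open>chi8\<close> are the characters attached
  to -1 and 2; the values at even arguments are a default.\<close>

definition chi4 :: "nat => int" where "chi4 n = (if n mod 4 = 1 then 1 else -1)"
definition chi8 :: "nat => int" where "chi8 n = (if n mod 8:{1, 7} then 1 else -1)"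

lemma odd_mod_8: "odd (n::nat) ==> n mod 8 = 1 | n mod 8 = 3 | n mod 8 = 5 | n mod 8 = 7" by presburger

lemma chi4_mod: "chi4 (n mod 8) = chi4 n" and chi8_mod: "chi8 (n mod 8) = chi8 n"
 by (simp_all add: chi4_def chi8_def mod_mod_cancel)

lemma chi_mult: "odd m ==> odd n ==> chi4 (m*n) = chi4 m*chi4 n & chi8 (m*n) = chi8 m*chi8 n"
proof -
 assume o: "odd m" "odd n"
 have "ALL a:{1,3,5,7}. ALL b:{1,3,5,7}. chi4 ((a*b) mod 8) = chi4 a*chi4 b & chi8 ((a*b) mod 8) = chi8 a*chi8 b"
  by (simp add: chi4_def chi8_def)
 moreover have "m mod 8:{1,3,5,7}" "n mod 8:{1,3,5,7}" using odd_mod_8[OF o(1)] odd_mod_8[OF o(2)] by auto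
 ultimately have "chi4 ((m mod 8)*(n mod 8) mod 8) = chi4 (m mod 8)*chi4 (n mod 8) &
  chi8 ((m mod 8)*(n mod 8) mod 8) = chi8 (m mod 8)*chi8 (n mod 8)" by blast
 thus ?thesis by (simp only: mod_mult_eq chi4_mod chi8_mod)
qed

lemma coprime_8_odd: "coprime n (8*q) ==> odd (n::nat)"
 by (metis coprime_divisors coprime_right_2_iff_odd dvd_mult2 dvd_refl dvd_triv_left numeral_Bit0 mult_2 coprime_mult_right_iff even_numeral)

lemma is_char_chi: "is_char 8 chi4" "is_char 8 chi8"
proof -
 have o: "odd n" if "coprime n 8" for n :: nat using coprime_8_odd[of n 1] that by simp
 have "chi4 m = chi4 n & chi8 m = chi8 n" if "[m = n] (mod 8)" for m n
  using that chi4_mod chi8_mod unfolding cong_def by metis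
 thus "is_char 8 chi4" "is_char 8 chi8"
  unfolding is_char_def using o chi_mult by (auto simp: chi4_def chi8_def)
qed

text \<open>That such an \<open>f\<close> exists (\<open>char_for_ex\<close>) is quadratic
  reciprocity: as a function of \<open>p\<close> the symbol of \<open>d\<close> at \<open>p\<close>
  depends only on \<open>p\<close> modulo \<open>8*nat \<bar>d\<bar>\<close>.\<close>

definition char_for :: "int => (nat => int) => bool" where
 "char_for d f \<longleftrightarrow> is_char (8*nat \<bar>d\<bar>) f & (ALL p. prime p --> coprime p (8*nat \<bar>d\<bar>) --> f p = Legendre d (int p))"

lemma prime_gt_2: "prime p ==> coprime p (8*q) ==> p > (2::nat)"
 using coprime_8_odd[of p q] prime_ge_2_nat[of p] by (metis even_numeral le_neq_implies_less)

lemma char_for_mult: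
 assumes "char_for a f" "char_for b g"
 shows "char_for (a*b) (%n. f n*g n)"
proof -
 have "8*nat \<bar>a\<bar> dvd 8*nat \<bar>a*b\<bar>" "8*nat \<bar>b\<bar> dvd 8*nat \<bar>a*b\<bar>" by (simp_all add: abs_mult nat_mult_distrib)
 hence c: "is_char (8*nat \<bar>a*b\<bar>) f" "is_char (8*nat \<bar>a*b\<bar>) g"
  using assms is_char_mono unfolding char_for_def by blast+
 have "f p*g p = Legendre (a*b) (int p)" if p: "prime p" "coprime p (8*nat \<bar>a*b\<bar>)" for p
 proof -
  have "coprime p (8*nat \<bar>a\<bar>)" "coprime p (8*nat \<bar>b\<bar>)" using p(2) by (auto simp: abs_mult nat_mult_distrib)
  hence "f p = Legendre a (int p)" "g p = Legendre b (int p)" using assms p unfolding char_for_def by blast+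
  thus ?thesis using Legendre_mult[OF p(1) prime_gt_2[OF p]] by simp
 qed
 thus ?thesis using is_char_mult[OF c] unfolding char_for_def by blast
qed

lemma char_for_basic: "char_for 1 (%_. 1)" "char_for (-1) chi4" "char_for 2 chi8"
proof -
 have "Legendre 1 (int p) = 1" if "p > 1" for p
  using that by (auto simp: Legendre_def QuadRes_def cong_0_iff intro!: exI[of _ 1])
 thus "char_for 1 (%_. 1)" unfolding char_for_def is_char_def using prime_gt_1_nat by auto
 show "char_for (-1) chi4" unfolding char_for_def
  using is_char_chi(1) Legendre_minus_1 prime_gt_2[of _ 1] by (auto simp: chi4_def)
 show "char_for 2 chi8" unfolding char_for_def
  using is_char_mono[OF is_char_chi(2)] Legendre_2 prime_gt_2[of _ 2] by (auto simp: chi8_def)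
qed

text \<open>Reciprocity exchanges \<open>r\<close> and \<open>n\<close> at the cost of a sign, which
  is \<open>chi4 n\<close> if \<open>r mod 4 = 3\<close> and 1 otherwise.\<close>

definition psi_char :: "nat => nat => int" where
 "psi_char r n = Legendre (int n) (int r)*(if r mod 4 = 3 then chi4 n else 1)"

lemma char_for_odd_prime:
 assumes r: "prime r" "2 < r"
 shows "char_for (int r) (psi_char r)"
proof -
 have ro: "odd r" using r prime_odd_nat by auto
 let ?q = "8*r"
 have "is_char ?q (%n. Legendre (int n) (int r))"
  unfolding is_char_def
 proof (intro conjI allI impI)
  fix m n assume "coprime m ?q" "coprime n ?q"
  thus "Legendre (int (m*n)) (int r) = Legendre (int m) (int r)*Legendre (int n) (int r)"
   using Legendre_mult[OF r] by simp
 next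
  fix n assume "coprime n ?q"
  hence "coprime n r" by simp
  hence "~ r dvd n" using r(1) coprime_common_divisor[of n r r] by auto
  thus "Legendre (int n) (int r):{-1, 1}" by (intro Legendre_unit) simp
 next
  fix m n assume "[m = n] (mod ?q)"
  hence "[m = n] (mod r)" using cong_dvd_modulus_nat dvd_triv_right by blast
  thus "Legendre (int m) (int r) = Legendre (int n) (int r)" by (intro Legendre_cong) (simp add: cong_int_iff)
 qed
 moreover have "is_char ?q (%n. if r mod 4 = 3 then chi4 n else 1)"
  using is_char_mono[OF is_char_chi(1), of ?q] by (cases "r mod 4 = 3") (simp_all add: is_char_def)
 ultimately have "is_char ?q (psi_char r)" unfolding psi_char_def[abs_def] by (rule is_char_mult)
 moreover have "psi_char r p = Legendre (int r) (int p)" if p: "prime p" "coprime p ?q" for p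
 proof -
  have p2: "p > 2" using prime_gt_2[OF p] .
  have po: "odd p" using coprime_8_odd[OF p(2)] .
  have ne: "p~=r" using p r by auto
  have QR: "Legendre (int r) (int p)*Legendre (int p) (int r) = (-1)^((r - 1) div 2*((p - 1) div 2))"
   by (rule Quadratic_Reciprocity) (use r p p2 ne in auto)
  have "~ r dvd p" using p r ne primes_dvd_imp_eq by blast
  hence u: "Legendre (int p) (int r):{-1, 1}" by (intro Legendre_unit) simp
  have "even ((r - 1) div 2) \<longleftrightarrow> r mod 4~=3" using ro by presburger
  moreover have "even ((p - 1) div 2) \<longleftrightarrow> p mod 4 = 1" using po by presburger
  ultimately have "(-1)^((r - 1) div 2*((p - 1) div 2)) = (if r mod 4 = 3 then chi4 p else 1)"
   by (simp add: minus_1_power_sign chi4_def)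
  thus ?thesis unfolding psi_char_def using QR u by auto
 qed
 ultimately show ?thesis by (simp add: char_for_def)
qed

lemma char_for_nat: "n > 0 ==> EX f. char_for (int n) f"
proof (induction n rule: prime_divisors_induct)
 case (factor p n)
 hence "EX f. char_for (int n) f" by simp
 moreover have "EX g. char_for (int p) g"
 proof (cases "p = 2")
  case True
  thus ?thesis using char_for_basic(3) by auto
 next
  case False
  hence "2 < p" using factor(1) prime_ge_2_nat[of p] by linarith
  thus ?thesis using char_for_odd_prime factor(1) by blast
 qed
 ultimately show ?case using char_for_mult by (metis of_nat_mult)
qed (use char_for_basic(1) in auto)

lemma char_for_ex: "d~=0 ==> EX f. char_for d f"
proof -
 assume d: "d~=0"
 then obtain f where f: "char_for \<bar>d\<bar> f" using char_for_nat[of "nat \<bar>d\<bar>"] by auto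
 show ?thesis
 proof (cases "d > 0")
  case True
  thus ?thesis using f by auto
 next
  case False
  hence "d = -1 * \<bar>d\<bar>" by simp
  thus ?thesis using char_for_mult[OF char_for_basic(2) f] by metis
 qed
qed

text \<open>Squaring modulo \<open>r\<close> identifies 1 and \<open>r - 1\<close>, so it is not
  injective and hence not surjective.\<close>

lemma nonresidue_ex:
 assumes r: "prime r" "2 < r"
 shows "EX n. Legendre (int n) (int r) = -1"
proof -
 have "EX a. Legendre a (int r) = -1"
 proof (rule ccontr)
  assume no: "~ ?thesis"
  let ?sq = "%x::nat. x^2 mod r"
  have "x:?sq`{..<r}" if x: "x < r" for x
  proof -
   have "Legendre (int x) (int r)~=-1" using no by blast
   hence "[int x = 0] (mod int r) | QuadRes (int r) (int x)" by (auto simp: Legendre_def split: if_splits)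
   hence "EX y. [y^2 = int x] (mod int r)"
   proof
    assume "[int x = 0] (mod int r)"
    thus ?thesis by (intro exI[of _ 0]) (simp add: cong_sym)
   qed (simp add: QuadRes_def)
   then obtain y where y: "[y^2 = int x] (mod int r)" by blast
   define z where "z = nat (y mod int r)"
   have zy: "int z = y mod int r" using r by (simp add: z_def)
   have "[int (z^2) = int x] (mod int r)" using y unfolding of_nat_power zy by (simp add: cong_def power_mod)
   hence "z^2 mod r = x" using x by (simp only: cong_int_iff) (simp add: cong_def)
   moreover have "z < r" using zy r by (metis of_nat_0_less_iff of_nat_less_iff pos_mod_bound prime_gt_0_nat)
   ultimately show ?thesis by blast
  qed
  hence "{..<r}<=?sq`{..<r}" by auto
  hence "card {..<r}<=card (?sq`{..<r})" by (intro card_mono) auto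
  moreover have "card (?sq`{..<r})<=card {..<r}" by (rule card_image_le) simp
  ultimately have "inj_on ?sq {..<r}" by (intro eq_card_imp_inj_on) auto
  moreover have "?sq 1 = ?sq (r - 1)"
  proof -
   obtain k where k: "r = k + 2" using r by (metis less_imp_le_nat le_add_diff_inverse add.commute)
   have "(r - 1)^2 = 1 + r*k" unfolding k by (simp add: power2_eq_square algebra_simps)
   moreover have "(1 + r*k) mod r = 1 mod r" by (rule mod_mult_self2)
   ultimately show ?thesis by (simp only: power_one)
  qed
  ultimately have "1 = r - 1" using inj_onD[of ?sq "{..<r}" 1 "r - 1"] r(2) by simp
  thus False using r by simp
 qed
 then obtain a where a: "Legendre a (int r) = -1" by blast
 have "[int (nat (a mod int r)) = a] (mod int r)" using r by (simp add: cong_def)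
 thus ?thesis using a Legendre_cong by metis
qed

text \<open>The character is that of the squarefree part \<open>e\<close>, which is not 1. If an odd
  prime \<open>r\<close> divides \<open>e\<close>, take \<open>n\<close> a nonresidue modulo
  \<open>r\<close> and congruent to 1 modulo the rest of \<open>q\<close>; otherwise
  \<open>e\<close> is -1, 2 or -2 and \<open>n\<close> is chosen modulo 8. Letting \<open>q\<close>
  be any multiple allows several characters to share a modulus.\<close>

lemma nonprincipal_char:
 assumes d: "d~=0" and nsq: "!!m. d~=m^2" and q: "q > 0" "8*nat \<bar>d\<bar> dvd q"
 shows "EX f. is_char q f & (ALL p. prime p --> coprime p q --> f p = Legendre d (int p)) & (EX n. coprime n q & f n = -1)"
proof -
 define e where "e = squarefree_part d"
 define m where "m = square_part d"
 have dem: "d = e*m^2" unfolding e_def m_def by (rule squarefree_decompose)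
 have e0: "e~=0" "m~=0" using d dem by auto
 have sf: "squarefree e" unfolding e_def by simp
 have e1: "e~=1" using nsq[of m] dem by auto
 have edq: "8*nat \<bar>e\<bar> dvd q"
  by (rule dvd_trans[OF _ q(2)]) (simp add: dem abs_mult nat_mult_distrib)
 have main: "EX f. char_for e f & (EX n. coprime n q & f n = -1)"
 proof (cases "EX r. prime r & 2 < r & int r dvd e")
  case True
  then obtain r where r: "prime r" "2 < r" "int r dvd e" by blast
  then obtain e1 where e1: "e = int r*e1" by (auto elim: dvdE)
  have re1: "~ int r dvd e1"
  proof
   assume "int r dvd e1"
   hence "int r^2 dvd e" by (simp add: e1 power2_eq_square)
   hence "int r dvd 1" using sf unfolding squarefree_def by blast
   thus False using r(1) by simp
  qed
  obtain g where g: "char_for e1 g" using char_for_ex[of e1] e1 e0 by auto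
  \<comment> \<open>The full power of \<open>r\<close> is removed from \<open>q\<close>; the modulus
    of \<open>g\<close> still divides \<open>q1\<close>.\<close>
  obtain k q1 where q1: "q = r^k*q1" "~ r dvd q1" using prime_power_canonical[OF r(1) q(1)] by (metis mult.commute)
  have "8*nat \<bar>e1\<bar> dvd q" by (rule dvd_trans[OF _ edq]) (simp add: e1 abs_mult nat_mult_distrib)
  moreover have "coprime (8*nat \<bar>e1\<bar>) (r^k)"
  proof -
   have "~ r dvd nat \<bar>e1\<bar>" using re1 by (simp add: int_dvd_int_iff[symmetric])
   moreover have "~ r dvd 8"
   proof
    assume "r dvd 8"
    hence "r dvd 2^3" by simp
    hence "r dvd 2" using r(1) prime_dvd_power by blast
    thus False using r(2) dvd_imp_le[of r 2] by simp
   qed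
   ultimately have "~ r dvd 8*nat \<bar>e1\<bar>" using r(1) prime_dvd_mult_iff by blast
   hence "coprime r (8*nat \<bar>e1\<bar>)" by (rule prime_imp_coprime[OF r(1)])
   thus ?thesis by (simp only: coprime_commute[of r] coprime_power_right_iff simp_thms)
  qed
  ultimately have e1q: "8*nat \<bar>e1\<bar> dvd q1" unfolding q1(1) by (simp add: coprime_dvd_mult_right_iff)
  obtain a where a: "Legendre (int a) (int r) = -1" using nonresidue_ex[OF r(1,2)] by blast
  have cop: "coprime r q1" using q1(2) r(1) by (simp add: prime_imp_coprime)
  obtain n where n: "[n = a] (mod r)" "[n = 1] (mod q1)" using binary_chinese_remainder_nat[OF cop] by blast
  have Ln: "Legendre (int n) (int r) = -1" using n(1) a Legendre_cong[of "int n" "int a" "int r"] by (simp add: cong_int_iff)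
  have "~ int r dvd int n"
  proof
   assume "int r dvd int n"
   hence "Legendre (int n) (int r) = 0" by (simp add: Legendre_def cong_0_iff)
   thus False using Ln by simp
  qed
  hence "coprime r n" using r(1) by (simp add: prime_imp_coprime)
  moreover have cq1: "coprime n q1" using n(2) cong_imp_coprime[OF cong_sym[OF n(2)]] by simp
  ultimately have cn: "coprime n q" unfolding q1(1) by (simp add: coprime_commute)
  have "[n = 1] (mod 8*nat \<bar>e1\<bar>)" using n(2) e1q cong_dvd_modulus_nat by blast
  hence g1: "g n = 1" using g is_char_1[of _ g] cong_imp_coprime[OF cong_sym, of n 1 "8*nat \<bar>e1\<bar>"]
   unfolding char_for_def is_char_def by (metis coprime_1_left)
  have "[n = 1] (mod 8)" using \<open>[n = 1] (mod 8 * nat \<bar>e1\<bar>)\<close> cong_dvd_modulus_nat dvd_triv_left by blast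
  hence "n mod 8 = 1" by (simp add: cong_def)
  hence "chi4 n = 1" using chi4_mod[of n] by (simp add: chi4_def)
  hence "psi_char r n*g n = -1" using Ln g1 by (simp add: psi_char_def)
  moreover have "char_for e (%n. psi_char r n*g n)" unfolding e1 by (rule char_for_mult[OF char_for_odd_prime[OF r(1,2)] g])
  ultimately show ?thesis using cn by blast
 next
  case False
  have pr2: "p = 2" if "prime p" "p dvd nat \<bar>e\<bar>" for p
  proof -
   have "int p dvd e" using that(2) by (metis dvd_abs_iff int_dvd_int_iff int_nat_eq abs_ge_zero)
   hence "~ 2 < p" using False that(1) by blast
   thus ?thesis using prime_ge_2_nat[OF that(1)] by simp
  qed
  have "~ 4 dvd nat \<bar>e\<bar>"
  proof
   assume "4 dvd nat \<bar>e\<bar>"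
   hence "int 4 dvd e" by (metis dvd_abs_iff int_dvd_int_iff int_nat_eq abs_ge_zero)
   hence "2^2 dvd e" by simp
   hence "(2::int) dvd 1" using sf unfolding squarefree_def by blast
   thus False by simp
  qed
  have "nat \<bar>e\<bar> = 1 | nat \<bar>e\<bar> = 2"
  proof (rule ccontr)
   assume ne: "~ ?thesis"
   then obtain p where p: "prime p" "p dvd nat \<bar>e\<bar>" using prime_factor_nat by blast
   hence "2 dvd nat \<bar>e\<bar>" using pr2[OF p] by simp
   then obtain k where k: "nat \<bar>e\<bar> = 2*k" by (rule dvdE)
   hence "k~=1" using ne by auto
   then obtain p' where p': "prime p'" "p' dvd k" using prime_factor_nat by blast
   hence "p' = 2" using pr2 k by simp
   thus False using p' k \<open>~ 4 dvd nat \<bar>e\<bar>\<close> by (auto elim!: dvdE)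
  qed
  hence "e = -1 | e = 2 | e = -2" using e1 by auto
  moreover have "char_for (-2) (%n. chi4 n*chi8 n)" using char_for_mult[OF char_for_basic(2,3)] by simp
  \<comment> \<open>Residues modulo 8 with value -1: 3 for \<open>chi4\<close> and for
    \<open>chi8\<close>, 5 for their product.\<close>
  ultimately obtain f where f: "char_for e f" "(EX a. odd a & (ALL n. n mod 8 = a mod 8 --> f n = -1))"
  proof (elim disjE)
   assume "e = -1"
   moreover have "chi4 n = -1" if "n mod 8 = 3" for n using that chi4_mod[of n] by (simp add: chi4_def)
   ultimately show ?thesis using char_for_basic(2) by (intro that[of chi4]) (auto intro!: exI[of _ 3])
  next
   assume "e = 2"
   thus ?thesis using char_for_basic(3) by (intro that[of chi8]) (auto simp: chi8_def intro!: exI[of _ 3])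
  next
   assume "e = -2" and c: "char_for (-2) (%n. chi4 n*chi8 n)"
   have "chi4 n*chi8 n = -1" if "n mod 8 = 5" for n
   proof -
    have "chi4 n = 1" "chi8 n = -1" using that chi4_mod[of n] by (simp_all add: chi8_def chi4_def)
    thus ?thesis by simp
   qed
   thus ?thesis using c \<open>e = -2\<close> by (intro that[of "%n. chi4 n*chi8 n"]) (auto intro!: exI[of _ 5])
  qed
  obtain a where a: "odd a" "!!n. n mod 8 = a mod 8 ==> f n = -1" using f(2) by blast
  obtain k q1 where q1: "q = 2^k*q1" "~ 2 dvd q1" using prime_power_canonical[OF two_is_prime_nat q(1)] by (metis mult.commute)
  have "coprime 2 q1" using q1(2) by simp
  hence "coprime (2^3) q1" by (simp only: coprime_power_left_iff) simp
  hence "coprime 8 q1" by simp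
  then obtain n where n: "[n = a] (mod 8)" "[n = 1] (mod q1)" using binary_chinese_remainder_nat by blast
  have "odd n" using n(1) a(1) unfolding cong_def by presburger
  moreover have "coprime n q1" using n(2) cong_imp_coprime[OF cong_sym[OF n(2)]] by simp
  ultimately have "coprime n q" unfolding q1(1) by simp
  moreover have "f n = -1" using a(2) n(1) by (simp add: cong_def)
  ultimately show ?thesis using f(1) by blast
 qed
 then obtain f n where f: "char_for e f" "coprime n q" "f n = -1" by blast
 have "f p = Legendre d (int p)" if p: "prime p" "coprime p q" for p
 proof -
  have cp: "coprime p (8*nat \<bar>e\<bar>)" "coprime p (8*nat \<bar>d\<bar>)" using p(2) edq q(2) coprime_divisors[OF dvd_refl] by blast+
  have fp: "f p = Legendre e (int p)" using f(1) p cp unfolding char_for_def by blast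
  have p2: "p > 2" using prime_gt_2[OF p(1) cp(1)] .
  have "~ int p dvd m"
  proof
   assume "int p dvd m"
   hence "int p dvd d" unfolding dem by (simp add: power2_eq_square)
   hence "p dvd nat \<bar>d\<bar>" by (simp add: int_dvd_int_iff[symmetric])
   hence "p dvd 1" using cp(2) by (metis coprime_common_divisor dvd_mult dvd_refl)
   thus False using p(1) by simp
  qed
  hence "Legendre m (int p):{-1, 1}" by (rule Legendre_unit)
  hence "Legendre m (int p)*Legendre m (int p) = 1" by auto
  thus ?thesis unfolding fp dem power2_eq_square Legendre_mult[OF p(1) p2] by simp
 qed
 thus ?thesis using f is_char_mono[OF _ edq] unfolding char_for_def by blast
qed

text \<open>The sum over a period vanishes because multiplication by \<open>n0\<close> permutes the
  residues and flips the sign of the sum.\<close>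

lemma real_character_of:
 assumes f: "is_char q f" "coprime n0 q" "f n0 = -1" and q: "q > 0"
 shows "real_character (%n. if coprime n q then of_int (f n) else 0) q"
proof
 let ?ch = "%n. if coprime n q then real_of_int (f n) else 0"
 have v: "f n = -1 | f n = 1" if "coprime n q" for n using f(1) that unfolding is_char_def by blast
 show "0 < q" by (rule q)
 show "?ch 1 = 1" using is_char_1[OF f(1)] by simp
 show mult: "?ch (m*n) = ?ch m * ?ch n" for m n using f(1) unfolding is_char_def by simp
 have per: "?ch m = ?ch n" if "[m = n] (mod q)" for m n
 proof (cases "coprime m q")
  case True
  hence "coprime n q" using cong_imp_coprime[OF that] by blast
  thus ?thesis using f(1) True that unfolding is_char_def by simp
 next
  case False
  hence "~ coprime n q" using cong_imp_coprime[OF cong_sym[OF that]] by blast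
  thus ?thesis using False by simp
 qed
 show "?ch (n + q) = ?ch n" for n by (rule per) (simp add: cong_def)
 show "?ch n:{-1, 0, 1}" for n using v[of n] by auto
 have "bij_betw (%n. (n0*n) mod q) {..<q} {..<q}"
 proof -
  have "inj_on (%n. (n0*n) mod q) {..<q}"
  proof (rule inj_onI)
   fix m n assume m: "m:{..<q}" "n:{..<q}" "(n0*m) mod q = (n0*n) mod q"
   hence "[m = n] (mod q)" using cong_mult_lcancel_nat[OF f(2), of m n] by (simp add: cong_def)
   thus "m = n" using m by (simp add: cong_def)
  qed
  moreover have "(%n. (n0*n) mod q)`{..<q}<={..<q}" using q by auto
  ultimately show ?thesis by (simp add: bij_betw_def endo_inj_surj)
 qed
 hence "(SUM n<q. ?ch n) = (SUM n<q. ?ch ((n0*n) mod q))" by (rule sum.reindex_bij_betw[symmetric])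
 also have "... = (SUM n<q. ?ch (n0*n))" by (intro sum.cong refl per) (simp add: cong_def)
 also have "... = (SUM n<q. ?ch n0 * ?ch n)" by (intro sum.cong refl mult)
 also have "... = - (SUM n<q. ?ch n)" using f(2,3) by (simp add: sum_negf)
 finally show "(SUM n<q. ?ch n) = 0" by linarith
qed

section \<open>Counting the primes used\<close>

definition inert_split :: "int => int => int => nat => bool" where
 "inert_split d nuv v p \<longleftrightarrow> prime p & odd p & Legendre d (int p) = 1 & Legendre nuv (int p) = -1 & ~ int p dvd v"

lemma mangoldt_le_ln: "n > 0 ==> Lam n<=ln (real n)"
proof (cases "primepow n")
 case True
 assume n: "n > 0"
 have "aprimedivisor n dvd n" using n primepow_gt_Suc_0[OF True] by (intro aprimedivisor_dvd') auto
 hence "aprimedivisor n<=n" using n by (rule dvd_imp_le)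
 moreover have "aprimedivisor n > 0" using primepow_gt_Suc_0[OF True] by (simp add: aprimedivisor_pos_nat)
 ultimately show ?thesis using True by (simp add: mangoldt_def)
qed (simp add: mangoldt_def)

text \<open>The weight \<open>(1 + ch1 m)*(1 - ch2 m)\<close> selects the wanted primes and expands
  to \<open>1 + ch1 m - ch2 m - ch3 m\<close> on prime powers. By the Mertens estimates its sum
  against \<open>Lam m/m\<close> is \<open>ln n\<close> up to a constant. Restricted to
  \<open>m\<close> beyond about \<open>n powr (1 - eta/2)\<close> the sum is still at least 1, while
  each term is at most \<open>4*ln n/n powr (1 - eta/2)\<close>; so there are many terms.\<close>

lemma many_inert_split_primes:
 fixes d nuv v :: int and eta :: real
 assumes nz: "d~=0" "nuv~=0" "v~=0" and nsq: "!!m. d~=m^2" "!!m. nuv~=m^2" "!!m. d*nuv~=m^2"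
  and eta: "0 < eta" "eta < 1"
 shows "EX y0. ALL y>=y0. 1/2*y powr (1 - eta)<=real (card {p. inert_split d nuv v p & real p<=y})"
proof -
 define q where "q = 8*nat \<bar>d*nuv * v\<bar>"
 have q0: "q > 0" using nz by (simp add: q_def)
 have dq: "8*nat \<bar>d\<bar> dvd q" "8*nat \<bar>nuv\<bar> dvd q" "8*nat \<bar>d*nuv\<bar> dvd q"
  by (simp_all add: q_def abs_mult nat_mult_distrib)
 obtain f1 n1 where f1: "is_char q f1" "!!p. prime p ==> coprime p q ==> f1 p = Legendre d (int p)" "coprime n1 q" "f1 n1 = -1"
  using nonprincipal_char[OF nz(1) nsq(1) q0 dq(1)] by blast
 obtain f2 n2 where f2: "is_char q f2" "!!p. prime p ==> coprime p q ==> f2 p = Legendre nuv (int p)" "coprime n2 q" "f2 n2 = -1"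
  using nonprincipal_char[OF nz(2) nsq(2) q0 dq(2)] by blast
 have dnu: "d*nuv~=0" using nz by simp
 obtain f3 n3 where f3: "is_char q f3" "!!p. prime p ==> coprime p q ==> f3 p = Legendre (d*nuv) (int p)" "coprime n3 q" "f3 n3 = -1"
  using nonprincipal_char[OF dnu nsq(3) q0 dq(3)] by blast
 define ch1 where "ch1 n = (if coprime n q then real_of_int (f1 n) else 0)" for n
 define ch2 where "ch2 n = (if coprime n q then real_of_int (f2 n) else 0)" for n
 define ch3 where "ch3 n = (if coprime n q then real_of_int (f3 n) else 0)" for n
 interpret X1: real_character ch1 q unfolding ch1_def[abs_def] by (rule real_character_of[OF f1(1,3,4) q0])
 interpret X2: real_character ch2 q unfolding ch2_def[abs_def] by (rule real_character_of[OF f2(1,3,4) q0])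
 interpret X3: real_character ch3 q unfolding ch3_def[abs_def] by (rule real_character_of[OF f3(1,3,4) q0])
 obtain C1 where C1: "!!n. \<bar>SUM m=1..n. ch1 m*Lam m/real m\<bar><=C1" using X1.mertens_character by blast
 obtain C2 where C2: "!!n. \<bar>SUM m=1..n. ch2 m*Lam m/real m\<bar><=C2" using X2.mertens_character by blast
 obtain C3 where C3: "!!n. \<bar>SUM m=1..n. ch3 m*Lam m/real m\<bar><=C3" using X3.mertens_character by blast
 define C where "C = 4 + C1 + C2 + C3"
 have pow: "EX p j. prime p & j > 0 & m = p^j" if "Lam m~=0" for m
  using that by (auto simp: mangoldt_def primepow_def split: if_splits)
 have ch12: "ch1 p*ch2 p = ch3 p" if p: "prime p" for p
 proof (cases "coprime p q")
  case True
  have "p > 2" using prime_gt_2[OF p] True unfolding q_def by blast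
  thus ?thesis using True f1(2) f2(2) f3(2) p Legendre_mult[OF p, of d nuv] by (simp add: ch1_def ch2_def ch3_def flip: of_int_mult)
 qed (simp add: ch1_def ch2_def ch3_def)
 \<comment> \<open>\<open>Lam\<close> is supported on prime powers, so the product of the two
   characters has to be known at primes only.\<close>
 have L12: "ch1 m*ch2 m*Lam m = ch3 m*Lam m" for m
 proof (cases "Lam m = 0")
  case False
  then obtain p j where p: "prime p" "m = p^j" using pow by blast
  have "ch1 m*ch2 m = ch3 m" unfolding p(2) X1.ch_power X2.ch_power X3.ch_power using ch12[OF p(1)] by (simp flip: power_mult_distrib)
  thus ?thesis by simp
 qed simp
 define wt where "wt m = (1 + ch1 m)*(1 - ch2 m)*(Lam m/real m)" for m
 have wt: "wt m = Lam m/real m + ch1 m*Lam m/real m - ch2 m*Lam m/real m - ch3 m*Lam m/real m" for m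
 proof -
  have "wt m = Lam m/real m + ch1 m*Lam m/real m - ch2 m*Lam m/real m - (ch1 m*ch2 m*Lam m)/real m"
   by (simp add: wt_def algebra_simps add_divide_distrib diff_divide_distrib)
  thus ?thesis unfolding L12 .
 qed
 define S where "S n = (SUM m=1..n. wt m)" for n
 have Sb: "\<bar>S n - ln (real n)\<bar><=C" if n: "n >= 1" for n
 proof -
  have "S n = (SUM m=1..n. Lam m/real m) + (SUM m=1..n. ch1 m*Lam m/real m) - (SUM m=1..n. ch2 m*Lam m/real m) - (SUM m=1..n. ch3 m*Lam m/real m)"
   unfolding S_def wt by (simp add: sum.distrib sum_subtractf)
  thus ?thesis using mertens[OF n] C1[of n] C2[of n] C3[of n] unfolding C_def by linarith
 qed
 define Good where "Good n = {p. inert_split d nuv v p & p<=n}" for n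
 have finG: "finite (Good n)" for n unfolding Good_def by simp
 have b1: "0<=1 + ch1 m" "1 + ch1 m<=2" "0<=1 - ch2 m" "1 - ch2 m<=2" for m
  using X1.abs_ch[of m] X2.abs_ch[of m] by linarith+
 \<comment> \<open>For \<open>p\<close> prime to \<open>q\<close> a nonzero weight forces an odd
   exponent, \<open>ch1 p = 1\<close> and \<open>ch2 p = -1\<close>. The primes dividing
   \<open>q\<close> are covered by \<open>{..q}\<close>, and the exponent is at most
   \<open>log 2 n\<close>.\<close>
 have supp: "m:(%(p, j). p^j)`((Good n \<union> {..q}) \<times> {1..nat \<lfloor>log 2 (real n)\<rfloor>})"
  if m: "wt m~=0" "m<=n" for m n
 proof -
  have L0: "Lam m~=0" using m(1) by (auto simp: wt_def)
  then obtain p j where p: "prime p" "j > 0" "m = p^j" using pow by blast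
  have "p<=m" using p by (simp add: self_le_power Suc_le_eq prime_gt_0_nat)
  hence pn: "p<=n" using m(2) by simp
  have "2^j<=p^j" using prime_ge_2_nat[OF p(1)] by (rule power_mono) simp
  hence "2^j<=n" using m(2) p(3) by linarith
  hence "2^j<=real n" by (metis of_nat_le_iff of_nat_numeral of_nat_power)
  hence "real j<=log 2 (real n)" by (rule le_log_of_power) simp
  hence j: "j:{1..nat \<lfloor>log 2 (real n)\<rfloor>}" using p(2) by (simp add: le_nat_floor)
  have "p:Good n \<union> {..q}"
  proof (cases "coprime p q")
   case False
   hence "p dvd q" using p(1) prime_imp_coprime by blast
   hence "p<=q" using q0 by (rule dvd_imp_le)
   thus ?thesis by simp
  next
   case True
   have p2: "p > 2" using prime_gt_2[OF p(1)] True unfolding q_def by blast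
   have "1 + ch1 p^j~=0" "1 - ch2 p^j~=0"
    using m(1) unfolding wt_def p(3) X1.ch_power X2.ch_power by auto
   moreover have f2v: "f2 p = -1 | f2 p = 1" "f1 p = -1 | f1 p = 1" using f1(1) f2(1) True unfolding is_char_def by blast+
   ultimately have c2: "ch2 p = -1" and "odd j" using True by (auto simp: ch2_def minus_one_power_iff split: if_splits)
   hence c1: "ch1 p = 1" using f2v \<open>1 + ch1 p ^ j ~= 0\<close> True by (auto simp: ch1_def minus_one_power_iff)
   have "Legendre d (int p) = 1" "Legendre nuv (int p) = -1"
    using c1 c2 f1(2)[OF p(1) True] f2(2)[OF p(1) True] True by (simp_all add: ch1_def ch2_def)
   moreover have "odd p" using p2 p(1) prime_odd_nat by auto
   moreover have "~ int p dvd v"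
   proof
    assume "int p dvd v"
    hence "int p dvd d*nuv * v" by simp
    hence "p dvd nat \<bar>d*nuv * v\<bar>" by (simp add: int_dvd_int_iff[symmetric])
    hence "p dvd q" unfolding q_def by simp
    thus False using True p(1) coprime_common_divisor[of p q p] by auto
   qed
   ultimately show ?thesis using p(1) pn by (simp add: Good_def inert_split_def)
  qed
  thus ?thesis using j p(3) by (intro image_eqI[of _ _ "(p, j)"]) auto
 qed
 have "eventually (%x::real. x powr (1 - eta/2)/(4*ln x*log 2 x) >= x powr (1 - eta) + real q + 1) at_top"
  unfolding log_def using eta by real_asymp
 moreover have "eventually (%x::real. eta/2*ln x - 2*C >= 1) at_top" using eta by real_asymp
 ultimately have "eventually (%x::real. x powr (1 - eta/2)/(4*ln x*log 2 x) >= x powr (1 - eta) + real q + 1 & eta/2*ln x - 2*C >= 1) at_top"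
  by eventually_elim blast
 then obtain x0 where x0: "!!x. x >= x0 ==> x powr (1 - eta/2)/(4*ln x*log 2 x) >= x powr (1 - eta) + real q + 1 & eta/2*ln x - 2*C >= 1"
  unfolding eventually_at_top_linorder by blast
 have main: "real n powr (1 - eta)<=real (card (Good n))" if n: "real n >= x0" "n >= 2" for n
 proof -
  \<comment> \<open>Cutting off the small \<open>m\<close> bounds every \<open>Lam m/m\<close>; the
    part cut off accounts for \<open>(1 - eta/2)*ln n\<close> out of \<open>ln n\<close>.\<close>
  define k where "k = nat \<lfloor>real n powr (1 - eta/2)\<rfloor>"
  have n1: "real n >= 1" using n by simp
  have kle: "real k<=real n powr (1 - eta/2)" unfolding k_def using n1 by simp
  have kge: "real n powr (1 - eta/2)<=real k + 1" unfolding k_def using n1 by linarith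
  have "real n powr (1 - eta/2) >= 1" using n1 eta by (intro ge_one_powr_ge_zero) auto
  hence k1: "k >= 1" unfolding k_def by (simp add: le_nat_floor)
  have "real n powr (1 - eta/2)<=real n powr 1" using n1 eta by (intro powr_mono) auto
  hence kn: "k<=n" using kle n1 by simp
  have "ln (real k)<=ln (real n powr (1 - eta/2))" using kle k1 by (intro ln_mono) auto
  hence "ln (real k)<=(1 - eta/2)*ln (real n)" using n1 by (simp add: ln_powr)
  hence "S n - S k >= eta/2*ln (real n) - 2*C"
   using Sb[of n] Sb[OF k1] n by (simp add: algebra_simps abs_le_iff)
  hence ge1: "S n - S k >= 1" using x0[OF n(1)] by linarith
  have "S n = S k + (SUM m=Suc k..n. wt m)" unfolding S_def using kn sum.ub_add_nat[of 1 k wt "n - k"] by simp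
  hence "1<=(SUM m:{Suc k..n}. wt m)" using ge1 by simp
  also have "... = (SUM m:{m:{Suc k..n}. wt m~=0}. wt m)" by (rule sum.mono_neutral_right) auto
  also have "...<=(SUM m:{m:{Suc k..n}. wt m~=0}. 4*ln (real n)/real n powr (1 - eta/2))"
  proof (rule sum_mono)
   fix m assume "m:{m:{Suc k..n}. wt m~=0}"
   hence m: "Suc k<=m" "m<=n" by auto
   have "Lam m<=ln (real m)" using m by (intro mangoldt_le_ln) simp
   also have "...<=ln (real n)" using m by (intro ln_mono) auto
   finally have "Lam m/real m<=ln (real n)/real n powr (1 - eta/2)"
    using m kge n1 by (intro frac_le) auto
   moreover have "(1 + ch1 m)*(1 - ch2 m)<=2*2" using b1 by (intro mult_mono) auto
   moreover have "0<=Lam m/real m" by (simp add: mangoldt_nonneg)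
   ultimately have "wt m<=2*2*(ln (real n)/real n powr (1 - eta/2))"
    unfolding wt_def by (intro mult_mono) (use b1[of m] n1 in simp_all)
   thus "wt m<=4*ln (real n)/real n powr (1 - eta/2)" by simp
  qed
  also have "... = real (card {m:{Suc k..n}. wt m~=0})*(4*ln (real n)/real n powr (1 - eta/2))" by simp
  also have "...<=((real (card (Good n)) + real q + 1)*log 2 (real n))*(4*ln (real n)/real n powr (1 - eta/2))"
  proof (rule mult_right_mono)
   have "{m:{Suc k..n}. wt m~=0}<=(%(p, j). p^j)`((Good n \<union> {..q}) \<times> {1..nat \<lfloor>log 2 (real n)\<rfloor>})"
    using supp by auto
   hence "card {m:{Suc k..n}. wt m~=0}<=card ((%(p, j). p^j)`((Good n \<union> {..q}) \<times> {1..nat \<lfloor>log 2 (real n)\<rfloor>}))"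
    using finG by (intro card_mono) auto
   also have "...<=card ((Good n \<union> {..q}) \<times> {1..nat \<lfloor>log 2 (real n)\<rfloor>})" using finG by (intro card_image_le) auto
   also have "... = card (Good n \<union> {..q})*nat \<lfloor>log 2 (real n)\<rfloor>" by (simp add: card_cartesian_product)
   also have "...<=(card (Good n) + Suc q)*nat \<lfloor>log 2 (real n)\<rfloor>"
    using card_Un_le[of "Good n" "{..q}"] by (intro mult_right_mono) auto
   finally have "real (card {m:{Suc k..n}. wt m~=0})<=real ((card (Good n) + Suc q)*nat \<lfloor>log 2 (real n)\<rfloor>)"
    by (simp only: of_nat_le_iff)
   also have "... = (real (card (Good n)) + real q + 1)*real (nat \<lfloor>log 2 (real n)\<rfloor>)" by (simp add: algebra_simps)
   also have "...<=(real (card (Good n)) + real q + 1)*log 2 (real n)"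
    using n1 by (intro mult_left_mono) auto
   finally show "real (card {m:{Suc k..n}. wt m~=0})<=(real (card (Good n)) + real q + 1)*log 2 (real n)" .
   show "0<=4*ln (real n)/real n powr (1 - eta/2)" using n1 by simp
  qed
  finally have 1: "1<=(real (card (Good n)) + real q + 1)*(4*ln (real n)*log 2 (real n))/real n powr (1 - eta/2)"
   by (simp only: mult_ac times_divide_eq_right times_divide_eq_left)
  have pos: "4*ln (real n)*log 2 (real n) > 0" "real n powr (1 - eta/2) > 0" using n by auto
  have "real n powr (1 - eta/2)/(4*ln (real n)*log 2 (real n))<=real (card (Good n)) + real q + 1"
   using 1 pos by (simp add: field_simps)
  thus ?thesis using x0[OF n(1)] by linarith
 qed
 have "1/2*y powr (1 - eta)<=real (card {p. inert_split d nuv v p & real p<=y})" if y: "y >= max (x0 + 1) 3" for y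
 proof -
  define n where "n = nat \<lfloor>y\<rfloor>"
  have n: "real n<=y" "y < real n + 1" "n >= 2" unfolding n_def using y by linarith+
  have "y/2<=real n" using n by linarith
  hence "(y/2) powr (1 - eta)<=real n powr (1 - eta)" using y eta by (intro powr_mono2) auto
  also have "...<=real (card (Good n))" by (rule main) (use n y in auto)
  also have "Good n = {p. inert_split d nuv v p & real p<=y}" proof -
   have "p<=n \<longleftrightarrow> real p<=y" for p
   proof
    assume "p<=n" hence "real p<=real n" by simp
    thus "real p<=y" using n(1) by linarith
   next
    assume "real p<=y" hence "real p < real (n + 1)" using n(2) by simp
    thus "p<=n" by simp
   qed
   thus ?thesis unfolding Good_def by simp
  qed
  finally have "(y/2) powr (1 - eta)<=real (card {p. inert_split d nuv v p & real p<=y})" .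
  moreover have "1/2*y powr (1 - eta)<=(y/2) powr (1 - eta)"
  proof -
   have "(2::real) powr (1 - eta)<=2 powr 1" using eta by (intro powr_mono) auto
   hence "y powr (1 - eta)/2<=y powr (1 - eta)/2 powr (1 - eta)" by (intro divide_left_mono) auto
   thus ?thesis using y by (simp add: powr_divide)
  qed
  ultimately show ?thesis by linarith
 qed
 thus ?thesis by blast
qed

section \<open>Uniformity over the family\<close>

lemma rational_square_Ints:
 assumes "(r :: rat)^2 = of_int m"
 shows "EX k::int. k^2 = m"
proof -
 have sq: "(of_rat r)^2 = (of_int m :: complex)" using arg_cong[OF assms, of "of_rat :: rat => complex"] by (simp add: of_rat_power)
 have "algebraic_int ((of_rat r :: complex)^2)" unfolding sq by simp
 hence "algebraic_int (of_rat r :: complex)" by (rule algebraic_int_if_power) simp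
 hence "(of_rat r :: complex):\<int>" by (intro rational_algebraic_int_is_int) auto
 then obtain k where "of_rat r = (of_int k :: complex)" using Ints_imp_ex by blast
 hence "of_int (k^2) = (of_int m :: complex)" using sq by simp
 thus ?thesis by (metis of_int_eq_iff)
qed

lemma squarefree_not_square: "squarefree (a::int) ==> a~=1 ==> \<nexists>r::rat. r^2 = of_int a"
proof
 assume a: "squarefree a" "a~=1" and "EX r::rat. r^2 = of_int a"
 then obtain k where k: "k^2 = a" using rational_square_Ints by blast
 hence "k dvd 1" using a(1) unfolding squarefree_def by (metis dvd_refl)
 hence "k = 1 | k = -1" by auto
 thus False using k a(2) by auto
qed

lemma squarefree_dvd_square_imp_dvd:
 assumes "squarefree (a::int)" "a dvd k^2"
 shows "a dvd k"
proof -
 define g where "g = gcd a k"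
 have "a~=0" using assms(1) by auto
 hence g0: "g~=0" by (simp add: g_def)
 obtain a' k' where ak: "a = a'*g" "k = k'*g" "coprime a' k'"
  using gcd_coprime_exists[of a k] g0 unfolding g_def by blast
 have "g*a' dvd g*(g*k'^2)" using assms(2) unfolding ak(1,2) by (simp add: power2_eq_square mult_ac)
 hence "a' dvd g*k'^2" using g0 by simp
 hence "a' dvd g" using ak(3) by (simp add: coprime_dvd_mult_left_iff)
 hence "a'^2 dvd a" unfolding ak(1) by (simp add: power2_eq_square mult_dvd_mono)
 hence "a' dvd 1" using assms(1) unfolding squarefree_def by blast
 hence "a dvd g" unfolding ak(1) by (simp add: mult_dvd_mono[of a' 1 g g, simplified])
 thus ?thesis unfolding g_def by simp
qed

lemma squarefree_prod_not_square:
 assumes "squarefree (a::int)" "squarefree b" "a~=b"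
 shows "\<nexists>r::rat. r^2 = of_int (a*b)"
proof
 assume "EX r::rat. r^2 = of_int (a*b)"
 then obtain k where k: "k^2 = a*b" using rational_square_Ints by blast
 have a0: "a~=0" using assms(1) by auto
 have "a dvd k^2" using k by simp
 hence "a dvd k" by (rule squarefree_dvd_square_imp_dvd[OF assms(1)])
 then obtain j where j: "k = a*j" by (auto elim: dvdE)
 hence "b = a*j^2" using k a0 by (auto simp: power2_eq_square mult_ac)
 moreover from this have "j dvd 1" using assms(2) unfolding squarefree_def by (metis dvd_triv_right)
 hence "j = 1 | j = -1" by auto
 ultimately show False using assms(3) by auto
qed

text \<open>\<open>C\<close> is quantified before the field and before \<open>t\<close>. This is
  possible because \<open>many_inert_split_primes\<close> involves only \<open>d\<close>,
  \<open>u\<close>, \<open>v\<close>, and the primes to be avoided for a given field are those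
  dividing its discriminant.\<close>

lemma tower_family_bound:
 fixes d u v :: int and l :: nat and \<epsilon> :: real
 assumes l: "l >= 1" and eps: "0 < \<epsilon>" "\<epsilon> < 1" and v: "v~=0"
  and nsq: "\<nexists>r::rat. r^2 = of_int d" "\<nexists>r::rat. r^2 = of_int (u^2 - d * v^2)" "\<nexists>r::rat. r^2 = of_int (d*(u^2 - d * v^2))"
 shows "EX C. ALL K e w t dlt s. d4_tower K e w d t u v dlt s --> squarefree t -->
  real (card (class_torsion K l))<=C*((cmod (hdet (embmat e w)))^2) powr (1/2 - 1/(6*real l) + \<epsilon>)"
proof -
 define nuv where "nuv = u^2 - d * v^2"
 have int_nsq: "x~=m^2" if "\<nexists>r::rat. r^2 = of_int x" for x m :: int
  using that by (metis of_int_power)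
 have nz: "x~=0" if "\<nexists>r::rat. r^2 = of_int x" for x :: int using int_nsq[OF that, of 0] by simp
 have eta: "0 < \<epsilon> / 4" "\<epsilon> / 4 < 1" using eps by auto
 obtain y0 where y0: "!!y. y >= y0 ==> 1/2*y powr (1 - \<epsilon> / 4)<=real (card {p. inert_split d nuv v p & real p<=y})"
  using many_inert_split_primes[OF nz[OF nsq(1)] nz[OF nsq(2)] v int_nsq[OF nsq(1)] int_nsq[OF nsq(2)] int_nsq[OF nsq(3)] eta]
  unfolding nuv_def by blast
 define Z where "Z = zeta_sum (1 + \<epsilon> / 2)^4"
 have Z0: "Z >= 0" unfolding Z_def by (simp add: zero_le_power_eq)
 define Jb where "Jb D = Z*(2 * sqrt D) powr (1 + \<epsilon> / 2)*(ln (2 * sqrt D) + 1)^4" for D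
 have half: "(1/2 :: real) > 0" by simp
 obtain C where C: "!!D T. D >= 1 ==> T >= 0 ==> T<=Jb D ==>
  (!!y. y >= y0 ==> y >= 0 ==> 576*exp (12*real l)*y^(6*l) < D ==>
    T*(1/2*y powr (1 - \<epsilon> / 4) - log 2 D)<=Jb D) ==>
  T<=C*D powr (1/2 - 1/(6*real l) + \<epsilon>)"
  using torsion_growth[OF l eps half Z0, of y0] unfolding Jb_def by blast
 have "real (card (class_torsion K l))<=C*((cmod (hdet (embmat e w)))^2) powr (1/2 - 1/(6*real l) + \<epsilon>)"
  if tw: "d4_tower K e w d t u v dlt s" and sf: "squarefree t" for K e w t dlt s
 proof -
  interpret d4_tower K e w d t u v dlt s by (rule tw)
  define T where "T = real (card (class_torsion K l))"
  obtain Dn where Dn: "Dn > 0" "disc = real Dn" using disc_Nats by blast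
  have D1: "disc >= 1" by (rule disc_ge_1)
  let ?J = "{J. nzideal J & real (inorm J)<=2 * sqrt disc}"
  have ln0: "ln (2 * sqrt disc) >= 0" using D1 by (intro ln_ge_zero) (auto intro: order_trans[of 1 "2*1"])
  have Jb: "real (card ?J*(nat \<lfloor>ln (2 * sqrt disc)\<rfloor> + 1)^4)<=Jb disc"
  proof -
   have "real (card ?J)<=Z*(2 * sqrt disc) powr (1 + \<epsilon> / 2)"
    unfolding Z_def by (rule card_ideals_le(2)) (use eps D1 in auto)
   moreover have "real (nat \<lfloor>ln (2 * sqrt disc)\<rfloor> + 1)^4<=(ln (2 * sqrt disc) + 1)^4"
    by (rule power_mono) (use ln0 in \<open>simp_all\<close>)
   ultimately have "real (card ?J)*real (nat \<lfloor>ln (2 * sqrt disc)\<rfloor> + 1)^4<=Jb disc"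
    unfolding Jb_def using Z0 by (intro mult_mono) auto
   thus ?thesis by simp
  qed
  have "T<=C*disc powr (1/2 - 1/(6*real l) + \<epsilon>)"
  proof (rule C[OF D1])
   show "T >= 0" by (simp add: T_def)
   show "T<=Jb disc" using torsion_trivial_bound[OF l] Jb unfolding T_def by (meson of_nat_le_iff order_trans)
   fix y assume y: "y >= y0" "y >= 0" "576*exp (12*real l)*y^(6*l) < disc"
   define A where "A = {p. inert_split d nuv v p & real p<=y}"
   \<comment> \<open>At most \<open>log 2 disc\<close> primes divide the discriminant, since their
     product does and each is at least 2.\<close>
   define B where "B = {p. prime p & p dvd Dn}"
   have "A<={..nat \<lfloor>y\<rfloor>}" unfolding A_def by (auto simp: le_nat_floor)
   hence fA: "finite A" using finite_subset by blast
   have "B<={..Dn}"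
   proof
    fix p assume "p:B"
    hence "p dvd Dn" by (simp add: B_def)
    thus "p:{..Dn}" using dvd_imp_le[OF _ Dn(1)] by simp
   qed
   hence fB: "finite B" by (rule finite_subset) simp
   have "2^card B<=Dn" by (rule card_prime_divisors_le[OF fB _ Dn(1)]) (simp add: B_def)
   hence "2^card B<=real Dn" by (metis of_nat_le_iff of_nat_numeral of_nat_power)
   hence cB: "real (card B)<=log 2 disc" unfolding Dn(2) by (rule le_log_of_power) simp
   have "card A - card B<=card (A - B)" by (rule diff_card_le_card_Diff[OF fB])
   hence cAB: "real (card A) - real (card B)<=real (card (A - B))" by linarith
   have "card (class_torsion K l)*card (A - B)<=card ?J*(nat \<lfloor>ln (2 * sqrt disc)\<rfloor> + 1)^4"
   proof (rule torsion_times_primes_le[OF sf l Dn(2) _ _ y(2,3)])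
    show "finite (A - B)" using fA by simp
    fix p assume "p:A - B"
    thus "good_prime p & ~ p dvd Dn & real p<=y"
     by (auto simp: A_def B_def inert_split_def good_prime_def nuv_def)
   qed
   hence "T*real (card (A - B))<=Jb disc" using Jb unfolding T_def by (metis (no_types, lifting) of_nat_le_iff of_nat_mult order_trans)
   moreover have "1/2*y powr (1 - \<epsilon> / 4) - log 2 disc<=real (card (A - B))"
    using y0[OF y(1)] cB cAB unfolding A_def[symmetric] by linarith
   hence "T*(1/2*y powr (1 - \<epsilon> / 4) - log 2 disc)<=T*real (card (A - B))" by (rule mult_left_mono) (simp add: T_def)
   ultimately show "T*(1/2*y powr (1 - \<epsilon> / 4) - log 2 disc)<=Jb disc" by linarith
  qed
  thus ?thesis unfolding T_def disc_def .
 qed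
 thus ?thesis by blast
qed

section \<open>The chosen integral basis and the conclusion\<close>

context d4_quartic_field
begin

text \<open>\<open>field_disc\<close> fixes an integral basis by choice. Some integral basis is
  first shown to exist, and the ring structure is then set up over the chosen one, so that
  \<open>abs_disc K\<close> is the squared determinant of its embedding matrix.\<close>

lemma number_ring_exists:
 assumes fin: "finite (embeddings K)" "card (embeddings K) = 4"
 shows "EX e w. number_ring K e w & abs_disc K = (cmod (hdet (embmat e w)))^2"
proof -
 obtain e :: "4 => complex => complex" where e: "bij_betw e UNIV (embeddings K)"
  using finite_same_card_bij[of "UNIV :: 4 set" "embeddings K"] fin by auto
 obtain h :: "4 => nat" where h: "bij_betw h UNIV {0..<4}" using power_4_bij by blast
 have h4: "h i < 4" for i using h by (auto simp: bij_betw_def)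
 have reind: "(SUM i<4. f i) = (SUM i:UNIV. f (h i))" for f :: "nat => complex"
  using sum.reindex_bij_betw[OF h, of f] by (simp add: lessThan_atLeast0)
 interpret E: number_field_emb K e by unfold_locales (rule e)
 interpret B: number_field_basis K e "%i. omg (h i)"
 proof
  show "omg (h i):K" for i by (rule omg(1)[OF h4])
  fix x assume "x:K"
  then obtain c :: "nat => rat" where "x = (SUM i<4. of_rat (c i) * omg i)" using omg(2) by blast
  hence "x = (SUM i:UNIV. of_rat (c (h i)) * omg (h i))" by (simp only: reind)
  thus "EX c. x = (SUM i:UNIV. of_rat (c i) * omg (h i))" by (intro exI[of _ "%i. c (h i)"])
 qed
 obtain w0 :: "4 => complex" where w0: "!!i. w0 i:E.R" "E.R = zspan UNIV w0" "!!x. x:K ==> EX c. x = (SUM i:UNIV. of_rat (c i)*w0 i)"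
  using B.integral_basis_exists by blast
 interpret W0: number_field_basis K e w0
  by unfold_locales (use w0 E.R_K in blast)+
 have ind0: "c = (%_. 0)" if "(SUM i:UNIV. of_int (c i)*w0 i) = 0" for c :: "4 => int"
 proof -
  define X :: "complex^4" where "X = (\<chi> i. of_int (c i))"
  have "(embmat e w0 *v X) $ j = 0" for j
  proof -
   have "(embmat e w0 *v X) $ j = e j (SUM i:UNIV. of_int (c i)*w0 i)"
    by (simp add: X_def embmat_def matrix_vector_mult_def E.e_sum E.e_mult W0.b_K K_closed mult.commute)
   thus ?thesis using that by simp
  qed
  hence "embmat e w0 *v X = 0" by (simp add: vec_eq_iff)
  hence "X = 0" using W0.det_embmat hdet_nonzero_iff by blast
  thus ?thesis by (simp add: X_def vec_eq_iff fun_eq_iff)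
 qed
 \<comment> \<open>Integral bases are indexed by the numbers below 4, the locales by the type
   \<open>4\<close>; \<open>h\<close> and its inverse translate.\<close>
 let ?hi = "inv_into UNIV h"
 have hi: "?hi (h i) = i" for i using h by (auto simp: bij_betw_def)
 have "is_integral_basis K 4 (%i. w0 (?hi i))"
  unfolding is_integral_basis_def
 proof (intro conjI allI impI ballI)
  show "w0 (?hi i):E.R" for i by (rule w0(1))
  fix x assume "x:E.R"
  then obtain c where c: "x = (SUM i:UNIV. of_int (c i)*w0 i)" unfolding w0(2) zspan_def by blast
  show "EX c. x = (SUM i<4. of_int (c i)*w0 (?hi i))"
   by (rule exI[of _ "%i. c (?hi i)"]) (simp only: reind hi c)
 next
  fix c :: "nat => int" and i :: nat assume "(SUM i<4. of_int (c i)*w0 (?hi i)) = 0" "i < 4"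
  hence "(%i. c (h i)) = (%_. 0)" by (intro ind0) (simp only: reind hi)
  moreover obtain j where "h j = i" using h \<open>i < 4\<close> by (auto simp: bij_betw_def) (metis atLeast0LessThan image_iff lessThan_iff)
  ultimately show "c i = 0" by (metis fun_cong)
 qed
 hence ib: "is_integral_basis K 4 (SOME omg. is_integral_basis K 4 omg)"
  by (rule someI[where P = "%omg. is_integral_basis K 4 omg"])
 define eta where "eta = (SOME omg. is_integral_basis K 4 omg)"
 have et: "!!i. i < 4 ==> eta i:E.R" "!!x. x:E.R ==> EX c :: nat => int. x = (SUM i<4. of_int (c i)*eta i)"
 proof -
  have "is_integral_basis K 4 eta" unfolding eta_def by (rule ib)
  thus "!!i. i < 4 ==> eta i:E.R" "!!x. x:E.R ==> EX c :: nat => int. x = (SUM i<4. of_int (c i)*eta i)"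
   unfolding is_integral_basis_def by blast+
 qed
 define w where "w i = eta (h i)" for i
 have wR: "w i:E.R" for i unfolding w_def by (rule et(1)[OF h4])
 have Rw: "EX c :: 4 => int. x = (SUM i:UNIV. of_int (c i)*w i)" if xR: "x:E.R" for x
 proof -
  obtain c :: "nat => int" where "x = (SUM i<4. of_int (c i)*eta i)" using et(2)[OF xR] by blast
  thus ?thesis by (intro exI[of _ "%i. c (h i)"]) (simp only: reind w_def)
 qed
 have span: "EX c. x = (SUM i:UNIV. of_rat (c i)*w i)" if x: "x:K" for x
 proof -
  obtain c where c: "x = (SUM i:UNIV. of_rat (c i)*w0 i)" using w0(3)[OF x] by blast
  obtain a where a: "!!i. w0 i = (SUM j:UNIV. of_int (a i j)*w j)" using Rw[OF w0(1)] by metis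
  have "x = (SUM i:UNIV. SUM j:UNIV. of_rat (c i * of_int (a i j))*w j)"
   unfolding c by (subst a) (simp add: sum_distrib_left of_rat_mult mult.assoc)
  also have "... = (SUM j:UNIV. of_rat (SUM i:UNIV. c i * of_int (a i j))*w j)"
   by (subst sum.swap) (simp only: of_rat_sum sum_distrib_right)
  finally show ?thesis by (intro exI[of _ "%j. SUM i:UNIV. c i * of_int (a i j)"])
 qed
 have RZ: "E.R = zspan UNIV w"
 proof
  show "E.R<=zspan UNIV w" using Rw by (auto simp: zspan_def)
  show "zspan UNIV w<=E.R" unfolding zspan_def by (auto intro!: E.R_sum E.R_mult wR)
 qed
 have nr: "number_ring K e w"
  by unfold_locales (use wR E.R_K span RZ in blast)+
 interpret N: number_ring K e w by (rule nr)
 have fd: "field_degree K = 4" using D4 by (simp add: D4_quartic_def)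
 have "field_disc K = Determinant.det (Matrix.mat 4 4 (%(i, j). field_trace K (eta i*eta j)))"
  unfolding field_disc_def fd Let_def eta_def ..
 also have "... = hdet ((\<chi> i j. field_trace K (eta (h i)*eta (h j))) :: complex^4^4)"
  by (rule det_mat_eq_hdet[OF h])
 also have "((\<chi> i j. field_trace K (eta (h i)*eta (h j))) :: complex^4^4) = transpose (embmat e w) ** embmat e w"
  unfolding E.field_trace_eq by (simp add: vec_eq_iff matrix_matrix_mult_def transpose_def embmat_def E.e_mult N.b_K flip: w_def)
 also have "hdet ... = (hdet (embmat e w))^2" by (simp add: det_mul power2_eq_square)
 finally have "abs_disc K = (cmod (hdet (embmat e w)))^2" by (simp add: abs_disc_def norm_power)
 thus ?thesis using nr by blast
qed

end

text \<open>Up to squares the product of any two of \<open>a\<close>, \<open>b\<close>,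
  \<open>a*b\<close> is the third.\<close>

lemma class_pairs_nonsquare:
 fixes a b :: int
 assumes nsq: "\<nexists>r::rat. r^2 = of_int a" "\<nexists>r::rat. r^2 = of_int b" "\<nexists>r::rat. r^2 = of_int (a*b)"
  and "(d, d'):class_pairs a b"
 shows "\<nexists>r::rat. r^2 = of_int d" "\<nexists>r::rat. r^2 = of_int d'" "\<nexists>r::rat. r^2 = of_int (d*d')"
proof -
 have a0: "a~=0" "b~=0" using nsq(1,2) by (metis of_int_0 zero_power2)+
 have q: "\<nexists>r::rat. r^2 = of_int (x*(x*y))" if "x~=0" "\<nexists>r::rat. r^2 = of_int y" for x y :: int
 proof
  assume "EX r::rat. r^2 = of_int (x*(x*y))"
  then obtain r :: rat where "r^2 = of_int (x*(x*y))" by blast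
  hence "(r/of_int x)^2 = of_int y" using that(1) by (simp add: power_divide power2_eq_square)
  thus False using that(2) by blast
 qed
 have q1: "\<nexists>r::rat. r^2 = of_int (a*(a*b))" by (rule q[OF a0(1) nsq(2)])
 have q2: "\<nexists>r::rat. r^2 = of_int (b*(b*a))" by (rule q[OF a0(2) nsq(1)])
 have e: "b*(a*b) = b*(b*a)" "a*b*a = a*(a*b)" "a*b*b = b*(b*a)" by simp_all
 have ba: "\<nexists>r::rat. r^2 = of_int (b*a)" unfolding mult.commute[of b a] by (rule nsq(3))
 have bab: "\<nexists>r::rat. r^2 = of_int (b*(a*b))" unfolding e(1) by (rule q2)
 have aba: "\<nexists>r::rat. r^2 = of_int (a*b*a)" unfolding e(2) by (rule q1)
 have abb: "\<nexists>r::rat. r^2 = of_int (a*b*b)" unfolding e(3) by (rule q2)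
 consider "d = a" "d' = b" | "d = b" "d' = a" | "d = a" "d' = a*b" | "d = b" "d' = a*b" | "d = a*b" "d' = a" | "d = a*b" "d' = b"
  using assms(4) unfolding class_pairs_def by blast
 hence "(\<nexists>r::rat. r^2 = of_int d) & (\<nexists>r::rat. r^2 = of_int d') & (\<nexists>r::rat. r^2 = of_int (d*d'))"
 proof cases
  case 1 show ?thesis unfolding 1 by (intro conjI nsq)
 next
  case 2 show ?thesis unfolding 2 by (intro conjI nsq ba)
 next
  case 3 show ?thesis unfolding 3 by (intro conjI nsq q1)
 next
  case 4 show ?thesis unfolding 4 by (intro conjI nsq bab)
 next
  case 5 show ?thesis unfolding 5 by (intro conjI nsq aba)
 next
  case 6 show ?thesis unfolding 6 by (intro conjI nsq abb)
 qed
 thus "\<nexists>r::rat. r^2 = of_int d" "\<nexists>r::rat. r^2 = of_int d'" "\<nexists>r::rat. r^2 = of_int (d*d')" by blast+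
qed

theorem theorem1p1:
  fixes a b :: int
  assumes "squarefree a" and "squarefree b" and "a \<noteq> b"
    and "a \<notin> {0, 1}" and "b \<notin> {0, 1}"
    and "F4 (biquad a b) \<noteq> {}"
  shows "\<exists>\<epsilon>\<^sub>0 > 0. \<forall>\<epsilon> :: real. 0 < \<epsilon> \<and> \<epsilon> < 1/4 \<and> \<epsilon> < \<epsilon>\<^sub>0 \<longrightarrow>
     (\<forall>l :: nat. l \<ge> 1 \<longrightarrow>
       (\<exists>B\<^sub>1 C :: real. \<forall>X :: real. X \<ge> 1 \<longrightarrow>
          real (card {K \<in> F4_le (biquad a b) X.
             \<not> (real (card (class_torsion K l))
                  \<le> C * abs_disc K powr (1/2 - 1 / (6 * real l) + \<epsilon>))})
          \<le> B\<^sub>1 * X powr \<epsilon>))"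
proof -
 have nsq: "\<nexists>r::rat. r^2 = of_int a" "\<nexists>r::rat. r^2 = of_int b" "\<nexists>r::rat. r^2 = of_int (a*b)"
  using squarefree_not_square assms squarefree_prod_not_square by auto
 have main: "EX C. ALL K:F4 (biquad a b). real (card (class_torsion K l))<=C*abs_disc K powr (1/2 - 1/(6*real l) + \<epsilon>)"
  if eps: "0 < \<epsilon>" "\<epsilon> < 1" and l: "l >= 1" for \<epsilon> :: real and l :: nat
 proof -
  let ?X = "1/2 - 1/(6*real l) + \<epsilon>"
  let ?N = "%d d' u v. EX z::int. z~=0 & u^2 - d * v^2 = d'*z^2"
  \<comment> \<open>One solution of the norm equation is fixed for each pair, so that
    \<open>u\<close> and \<open>v\<close> depend only on \<open>d\<close> and \<open>d'\<close>.
    Where no solution exists the value is arbitrary.\<close>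
  define uv where "uv d d' = (SOME p. ?N d d' (fst p) (snd p))" for d d' :: int
  have ex: "EX C. ALL K e w t dlt s. (d, d'):class_pairs a b --> ?N d d' (fst (uv d d')) (snd (uv d d')) -->
    d4_tower K e w d t (fst (uv d d')) (snd (uv d d')) dlt s --> squarefree t -->
    real (card (class_torsion K l))<=C*((cmod (hdet (embmat e w)))^2) powr ?X" for d d'
  proof (cases "(d, d'):class_pairs a b & ?N d d' (fst (uv d d')) (snd (uv d d'))")
   case True
   define u where "u = fst (uv d d')"
   define v where "v = snd (uv d d')"
   obtain z where z: "z~=0" "u^2 - d * v^2 = d'*z^2" using True u_def v_def by blast
   note cn = class_pairs_nonsquare[OF nsq, of d d']
   have sc: "\<nexists>r::rat. r^2 = of_int (m*z^2)" if "\<nexists>r::rat. r^2 = of_int m" for m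
   proof
    assume "EX r::rat. r^2 = of_int (m*z^2)"
    then obtain r :: rat where "r^2 = of_int (m*z^2)" by blast
    hence "(r/of_int z)^2 = of_int m" using z(1) by (simp add: power_divide)
    thus False using that by blast
   qed
   have v0: "v~=0"
   proof
    assume "v = 0"
    hence "(of_int u :: rat)^2 = of_int (d'*z^2)" using z(2) by (metis diff_zero mult_zero_right of_int_power zero_power2)
    thus False using sc cn(2) True by blast
   qed
   have n1: "\<nexists>r::rat. r^2 = of_int (u^2 - d * v^2)" unfolding z(2) using sc cn(2) True by blast
   have n2: "\<nexists>r::rat. r^2 = of_int (d*(u^2 - d * v^2))"
    unfolding z(2) mult.assoc[symmetric] using sc cn(3) True by blast
   show ?thesis using tower_family_bound[OF l eps v0 _ n1 n2] cn(1) True unfolding u_def v_def by blast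
  qed blast
  obtain Cf where Cf: "!!d d' K e w t dlt s. (d, d'):class_pairs a b ==> ?N d d' (fst (uv d d')) (snd (uv d d')) ==>
    d4_tower K e w d t (fst (uv d d')) (snd (uv d d')) dlt s ==> squarefree t ==>
    real (card (class_torsion K l))<=Cf d d'*((cmod (hdet (embmat e w)))^2) powr ?X"
   using ex by metis
  \<comment> \<open>Positive parts, so that the sum dominates each \<open>Cf d d'\<close>.\<close>
  define C where "C = (SUM (d, d'):class_pairs a b. max 0 (Cf d d'))"
  have CC: "Cf d d'<=C" if "(d, d'):class_pairs a b" for d d'
  proof -
   have "(%(d, d'). max 0 (Cf d d')) (d, d')<=C"
    unfolding C_def by (rule member_le_sum[OF that]) (auto simp: class_pairs_def)
   thus ?thesis by simp
  qed
  have "real (card (class_torsion K l))<=C*abs_disc K powr ?X" if KF: "K:F4 (biquad a b)" for K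
  proof -
   interpret d4_quartic_field K by unfold_locales (use KF in \<open>simp add: F4_def\<close>)
   have "csqrt (of_int a):biquad a b" "csqrt (of_int b):biquad a b" by (auto simp: biquad_def)
   hence inL: "csqrt (of_int a):L" "csqrt (of_int b):L" using KF by (auto simp: F4_def L_def)
   obtain d d' dlt s A B r where h: "(d, d'):class_pairs a b" "dlt:K" "s:K" "s~=0" "dlt^2 = of_int d"
    "s^2 = of_rat A + of_rat B*dlt" "A^2 - of_int d*B^2 = of_int d'*r^2" "r~=0"
    "!!x. x:K ==> EX p q p' q'. x = of_rat p + of_rat q*dlt + of_rat p' * s + of_rat q'*(s*dlt)"
    "finite (embeddings K)" "card (embeddings K) = 4"
    using tower_structure[OF inL(1) power2_csqrt inL(2) power2_csqrt nsq] by blast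
   note cn = class_pairs_nonsquare[OF nsq h(1)]
   have d'0: "d'~=0" using cn(2) by (metis of_int_0 zero_power2)
   \<comment> \<open>Clearing the denominators in the norm equation coming from \<open>K\<close>
     gives an integral solution, so the pair chosen in \<open>uv\<close> is one as well.\<close>
   obtain m :: int where m: "m > 0" "of_int m*A:\<int>" "of_int m*B:\<int>" "of_int m*r:\<int>"
    using rat_common_denominator[of "{A, B, r}"] by auto
   obtain u' v' z' where uvz: "of_int m*A = of_int u'" "of_int m*B = of_int v'" "of_int m*r = of_int z'"
    using m by (auto elim!: Ints_cases)
   have "of_int (u'^2 - d * v'^2) = (of_int m)^2*(A^2 - of_int d*B^2)"
    by (simp add: uvz[symmetric] power_mult_distrib algebra_simps)
   also have "... = of_int (d'*z'^2)" unfolding h(7) by (simp add: uvz[symmetric] power_mult_distrib algebra_simps)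
   finally have "u'^2 - d * v'^2 = d'*z'^2" by (simp only: of_int_eq_iff)
   moreover have "z'~=0" using uvz(3) m(1) h(8) by auto
   ultimately have "?N d d' (fst (u', v')) (snd (u', v'))" by auto
   hence N: "?N d d' (fst (uv d d')) (snd (uv d d'))" unfolding uv_def by (rule someI)
   define u where "u = fst (uv d d')"
   define v where "v = snd (uv d d')"
   obtain z where z: "z~=0" "u^2 - d * v^2 = d'*z^2" using N u_def v_def by blast
   \<comment> \<open>\<open>K\<close> is rewritten with the fixed \<open>u\<close> and
     \<open>v\<close>; among the integer parameters only the twist \<open>t\<close> still varies
     within a pair.\<close>
   obtain t s' e' f' where t: "squarefree t" "s':K" "s'^2 = of_int t*(of_int u + of_int v * dlt)"
    "s = (of_rat e' + of_rat f'*dlt) * s'"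
    using quadratic_twist[OF h(2,5,3,4,6,7,8) z(2) d'0 z(1)] by blast
   obtain e w where ew: "number_ring K e w" "abs_disc K = (cmod (hdet (embmat e w)))^2"
    using number_ring_exists[OF h(10,11)] by blast
   interpret N: number_ring K e w by (rule ew(1))
   have tw: "d4_tower K e w d t u v dlt s'"
   proof
    show "dlt:K" "s':K" "dlt^2 = of_int d" "s'^2 = of_int t*(of_int u + of_int v * dlt)" by (fact h(2) t(2) h(5) t(3))+
    show "\<nexists>r :: rat. r^2 = of_int d" by (rule cn(1))
    show "\<nexists>r :: rat. r^2 = of_int (u^2 - d * v^2)"
    proof
     assume "EX r :: rat. r^2 = of_int (u^2 - d * v^2)"
     then obtain r :: rat where "r^2 = of_int (d'*z^2)" unfolding z(2) by blast
     hence "(r/of_int z)^2 = of_int d'" using z(1) by (simp add: power_divide)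
     thus False using cn(2) by blast
    qed
    fix x assume "x:K"
    then obtain p q p' q' where x: "x = of_rat p + of_rat q*dlt + of_rat p' * s + of_rat q'*(s*dlt)" using h(9) by blast
    have "of_rat p' * s + of_rat q'*(s*dlt) = (of_rat p' * of_rat e' + of_rat q' * of_rat f'*dlt^2) * s' + (of_rat p' * of_rat f' + of_rat q' * of_rat e')*(s'*dlt)"
     unfolding t(4) by (simp add: algebra_simps power2_eq_square)
    also have "... = of_rat (p'*e' + q'*f' * of_int d) * s' + of_rat (p'*f' + q'*e')*(s'*dlt)"
     unfolding h(5) by (simp add: of_rat_add of_rat_mult)
    finally have "x = of_rat p + of_rat q*dlt + of_rat (p'*e' + q'*f' * of_int d) * s' + of_rat (p'*f' + q'*e')*(s'*dlt)"
     unfolding x by (simp add: add.assoc)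
    thus "EX a b c c'. x = of_rat a + of_rat b*dlt + of_rat c * s' + of_rat c'*(s'*dlt)" by blast
   qed
   have "real (card (class_torsion K l))<=Cf d d'*abs_disc K powr ?X"
    unfolding ew(2) by (rule Cf[OF h(1) N tw[unfolded u_def v_def] t(1)])
   also have "...<=C*abs_disc K powr ?X" by (rule mult_right_mono[OF CC[OF h(1)]]) simp
   finally show ?thesis .
  qed
  thus ?thesis by blast
 qed
 show ?thesis
 proof (rule exI[of _ 1], intro conjI allI impI)
  fix \<epsilon> :: real and l :: nat
  assume e: "0 < \<epsilon> & \<epsilon> < 1/4 & \<epsilon> < 1" and l: "l >= 1"
  then obtain C where C: "!!K. K:F4 (biquad a b) ==> real (card (class_torsion K l))<=C*abs_disc K powr (1/2 - 1/(6*real l) + \<epsilon>)"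
   using main[of \<epsilon> l] by blast
  have "{K:F4_le (biquad a b) X. ~ (real (card (class_torsion K l))<=C*abs_disc K powr (1/2 - 1/(6*real l) + \<epsilon>))} = {}" for X
   using C by (auto simp: F4_le_def)
  note empty = this
  show "EX B\<^sub>1 C :: real. ALL X :: real. X >= 1 -->
     real (card {K:F4_le (biquad a b) X.
       ~ (real (card (class_torsion K l))
        <=C*abs_disc K powr (1/2 - 1/(6*real l) + \<epsilon>))})
    <=B\<^sub>1*X powr \<epsilon>"
   by (rule exI[of _ 0], rule exI[of _ C]) (simp only: empty card.empty of_nat_0 mult_zero_left order_refl simp_thms)
 qed simp
qed

end
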